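(* Let $u$ and $v$ be the analytic coordinates corresponding to two values $t_1$ and $t_2$ of the arithmetic local parameter $t$, i.e. $u=\int_0^{t_1}\omega_1$, $v=\int_0^{t_2}\omega_1$. Then the function $\sigma(u-v)^2$ is written as a product of formal power series $$\sigma(u-v)^2=(t_2-t_1)^2\,q(t_1)\,q(t_2)\,p(t_1,t_2)\,p(t_2,t_1)\,r(t_1,t_2),$$ where $$p(t_1,t_2)=-\frac{x\langle t_2\rangle^{-1}-x\langle t_1\rangle^{-1}}{(t_2'-t_1)(t_2-t_1)}=1+\mu_1t_1+\mu_2t_2^2+(\mu_2+\mu_1^2)t_1^2+\cdots\ \in\ 1+(t_1,t_2)\,\mathbb{Z}[\boldsymbol{\mu}][[t_1,t_2]],$$ $$q(t)=-x\langle t\rangle\,t\,t'=1-\mu_2t^2-\mu_2\mu_1t^3-(\mu_2\mu_1^2+\mu_4)t^4-(\mu_2\mu_1^3+2\mu_4\mu_1+\mu_2\mu_3)t^5+\cdots\ \in\ 1+t\,\mathbb{Z}[\boldsymbol{\mu}][[t]],$$ $$r(t_1,t_2)=\exp\bigg[\int_{t_1'}^{t_2'}\!\int_{t_1}^{t_2}\Big(\xi\langle T_1,T_2\rangle-\frac{1}{(T_2-T_1)^2}\Big)\,dT_1\,dT_2\bigg]$$ $$\begin{aligned} &=1-\big(\tfrac1{12}\mu_1\mu_3+\tfrac16\mu_4\big)(t_1-t_2)^4-\big(\tfrac16\mu_1^2\mu_3+\tfrac13\mu_4\mu_1\big)(t_1-t_2)^4(t_1+t_2)\\ &\ +\Big(-\big(\tfrac1{30}\mu_3^2+(\tfrac{43}{180}\mu_1^3+\tfrac{11}{90}\mu_2\mu_1)\mu_3+\tfrac{43}{90}\mu_4\mu_1^2+\tfrac{11}{45}\mu_2\mu_4+\tfrac2{15}\mu_6\big)(t_1^4+t_2^4)\\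 &\quad+\big(\tfrac2{15}\mu_3^2+(\tfrac{11}{90}\mu_1^3+\tfrac7{45}\mu_2\mu_1)\mu_3+\tfrac{11}{45}\mu_4\mu_1^2+\tfrac{14}{45}\mu_2\mu_4+\tfrac8{15}\mu_6\big)t_1t_2(t_1^2+t_2^2)\\ &\quad+\big(-\tfrac15\mu_3^2+(\tfrac7{30}\mu_1^3-\tfrac1{15}\mu_2\mu_1)\mu_3+\tfrac7{15}\mu_4\mu_1^2-\tfrac2{15}\mu_2\mu_4+\tfrac15\mu_6\big)t_1^2t_2^2\Big)(t_1-t_2)^2+\cdots\\ &\in\ 1+(t_1-t_2)^2\,(t_1,t_2)^2\,\mathbb{Z}[\boldsymbol{\mu}]\langle\langle t_1,t_2\rangle\rangle. \end{aligned}$$ Since $t_1=u+\cdots\in\mathbb{Z}[\boldsymbol{\mu}]\langle\langle u\rangle\rangle$ and $t_2=v+\cdots\in\mathbb{Z}[\boldsymbol{\mu}]\langle\langle v\rangle\rangle$, one has $$\sigma(u-v)^2\in(u-v)^2\,\big(\text{a series of the form }1+\cdots\text{ in }\mathbb{Z}[\boldsymbol{\mu}]\langle\langle u,v\rangle\rangle\big).$$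
   Context: Let $\mathscr{E}: y^2+(\mu_1x+\mu_3)y=x^3+\mu_2x^2+\mu_4x+\mu_6$ be a (nonsingular) elliptic curve over $\mathbb{C}$; in power series expansions the $\mu_j$ are treated as indeterminates, and $\mathbb{Z}[\boldsymbol{\mu}]=\mathbb{Z}[\mu_1,\mu_2,\mu_3,\mu_4,\mu_6]$. Arithmetic local parameter: $t=-x/y$ at the point $\infty$. With $s=1/x$, the curve equation becomes $s=(1+\mu_2s+\mu_4s^2+\mu_6s^3)t^2+(\mu_1s+\mu_3s^2)t$, with solution $s=t^2+\mu_1t^3+(\mu_1^2+\mu_2)t^4+\cdots\in\mathbb{Z}[\boldsymbol{\mu}][[t]]$; put $x\langle t\rangle=1/s$, $y\langle t\rangle=-x\langle t\rangle/t$. Let $t'=\frac{x\langle t\rangle}{y\langle t\rangle+\mu_1x\langle t\rangle+\mu_3}=-t-\mu_1t^2-\cdots\in t\,\mathbb{Z}[\mu_1,\mu_3][[t]]$, the other parameter value with $x\langle t'\rangle=x\langle t\rangle$; $t_i'$ denotes this series evaluated at $t_i$. Differentials: $\omega_1=\frac{dx}{2y+\mu_1x+\mu_3}=(1+\mu_1t+\cdots)dt\in(1+t\,\mathbb{Z}[\boldsymbol{\mu}][[t]])dt$ and $\eta_1=\frac{-x\,dx}{2y+\mu_1x+\mu_3}$. The 2-form is $$\boldsymbol{\xi}(x,y;z,w)=\frac{F(x,y;z,w)\,dx\,dz}{(x-z)^2(2y+\mu_1x+\mu_3)(2w+\mu_1z+\mu_3)},$$ $$F=xz(x+z)+(\mu_1^2+2\mu_2)xz+\mu_1(zy+xw)+(\mu_3\mu_1+\mu_4)(x+z)+2yw+\mu_3(y+w)+\mu_3^2+2\mu_6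 ,$$ and $\xi\langle T_1,T_2\rangle$ is defined by $\boldsymbol{\xi}(x\langle T_1\rangle,y\langle T_1\rangle;x\langle T_2\rangle,y\langle T_2\rangle)=\xi\langle T_1,T_2\rangle\,dT_1dT_2$; the difference $\xi\langle T_1,T_2\rangle-(T_1-T_2)^{-2}$ is a power series in $T_1,T_2$ over $\mathbb{Z}[\boldsymbol{\mu}]$, and in the definition of $r$ this series is integrated termwise, $T_1$ from $t_1$ to $t_2$ and $T_2$ from $t_1'$ to $t_2'$. Sigma function: let $\alpha,\beta$ be closed paths generating the fundamental group of $\mathscr{E}$ with intersection number $\alpha\cdot\beta=1$, $\omega'=\int_\alpha\omega_1$, $\omega''=\int_\beta\omega_1$, $\eta'=\int_\alpha\eta_1$, $\operatorname{Im}(\omega''/\omega')>0$. Then $$\sigma(u)=c\,\exp\!\big(\tfrac12u^2\eta'/\omega'\big)\sum_{n\in\mathbb{Z}}\exp\!\big(\pi i\tfrac{\omega''}{\omega'}(n+\tfrac12)^2+2\pi i(n+\tfrac12)(\tfrac{u}{\omega'}+\tfrac12)\big),$$ with the nonzero constant $c$ fixed by $\sigma(u)=u+O(u^2)$. Its Taylor coefficients at $0$ are regarded as polynomials in the $\mu_j$. For an integral domain $A$ of characteristic $0$: $A\langle\langle u\rangle\rangle$ is the ring of Hurwitz integral series $\sum_jC_ju^j/j!$ with $C_j\in A$, and $A\langle\langle u,v\rangle\rangle$ is the ring of series $\sum_{j,k}C_{jk}\frac{u^jv^k}{j!\,k!}$ with $C_{jk}\in A$. $(t_1,t_2)$ denotes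 the ideal generated by $t_1,t_2$, and "$\cdots$" denotes terms of higher degree.
   Formalization: The memberships of r and σ(u−v)² fail for the cofactors (e.g. μ4/6 in r; (μ1²+4μ2)u²/12 in σ²). Instead: the whole series r and σ(u−v)² are Hurwitz integral over Z[μ], and the factors (t1−t2)²(t1,t2)² and (u−v)²(1+⋯) are split off over Q[μ]. *)

theory Defs
  imports
    "HOL-Complex_Analysis.Complex_Analysis"
    "HOL-Computational_Algebra.Computational_Algebra"
    "HOL-Library.Poly_Mapping"
    "HOL-Library.Landau_Symbols"
begin

section \<open>The coefficient ring\<close>

text \<open>
  Polynomials over the rationals in variables indexed by natural numbers (a monomial maps each
  variable to its exponent).  The indeterminate \<open>\<mu>\<^sub>j\<close> is the variable with index \<open>j\<close>, and only
  the indices 1, 2, 3, 4, 6 are used.  Power series in which the \<open>\<mu>\<^sub>j\<close> are indeterminates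
  are taken over the fraction field.
\<close>

type_synonym mupoly = "(nat \<Rightarrow>\<^sub>0 nat) \<Rightarrow>\<^sub>0 rat"
type_synonym mufield = "mupoly fract"

instance fract :: ("{idom, ring_char_0}") field_char_0
proof
  show "inj (of_nat :: nat \<Rightarrow> 'a fract)"
  proof (rule injI)
    fix m n :: nat
    assume "(of_nat m :: 'a fract) = of_nat n"
    then have "Fract (of_nat m :: 'a) 1 = Fract (of_nat n) 1"
      by (simp add: of_nat_fract)
    then show "m = n"
      by (simp add: eq_fract)
  qed
qed

definition mu :: "nat \<Rightarrow> mufield" where
  "mu j = to_fract (Poly_Mapping.single (Poly_Mapping.single j 1) 1)"

definition mupolys :: "mupoly set" where
  "mupolys = {P. \<forall>m \<in> Poly_Mapping.keys P. Poly_Mapping.keys m \<subseteq> {1, 2, 3, 4, 6}}"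

definition Q_mu :: "mufield set" where
  "Q_mu = to_fract ` mupolys"

definition Z_mu :: "mufield set" where
  "Z_mu = to_fract ` {P \<in> mupolys. \<forall>m. Poly_Mapping.lookup P m \<in> \<int>}"

definition mupoly_eval :: "(nat \<Rightarrow> complex) \<Rightarrow> mupoly \<Rightarrow> complex" where
  "mupoly_eval \<mu> P =
     (\<Sum>m \<in> Poly_Mapping.keys P. of_rat (Poly_Mapping.lookup P m) *
        (\<Prod>j \<in> Poly_Mapping.keys m. \<mu> j ^ Poly_Mapping.lookup m j))"


section \<open>Power series in one and in two variables\<close>

text \<open>
  All two-variable series live in the field of iterated Laurent series with outer variable \<open>t\<^sub>1\<close>
  and inner variable \<open>t\<^sub>2\<close>; it contains the power series ring in \<open>t\<^sub>1, t\<^sub>2\<close>, hence also its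
  fraction field, and quotients are formed there.  The coefficient of \<open>t\<^sub>1\<^sup>i t\<^sub>2\<^sup>j\<close> in \<open>F\<close>
  is the coefficient of \<open>t\<^sub>2\<^sup>j\<close> in \<open>fls_nth F i\<close>.
\<close>

type_synonym 'a fls2 = "'a fls fls"

lift_definition at1 :: "'a::zero fls \<Rightarrow> 'a fls2" is "\<lambda>f n. fls_const (f n)"
  by (erule MOST_mono) simp

definition at2 :: "'a::zero fls \<Rightarrow> 'a fls2" where
  "at2 f = fls_const f"

definition t1 :: "'a::{zero,one} fls2" where "t1 = at1 fls_X"
definition t2 :: "'a::{zero,one} fls2" where "t2 = at2 fls_X"

definition const2 :: "'a::zero \<Rightarrow> 'a fls2" where
  "const2 c = fls_const (fls_const c)"

definition coeff2 :: "'a::zero fls2 \<Rightarrow> nat \<Rightarrow> nat \<Rightarrow> 'a" where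
  "coeff2 F i j = fls_nth (fls_nth F (int i)) (int j)"

definition series1 :: "(nat \<Rightarrow> 'a::zero) \<Rightarrow> 'a fls" where
  "series1 c = fps_to_fls (Abs_fps c)"

definition series2 :: "(nat \<Rightarrow> nat \<Rightarrow> 'a::zero) \<Rightarrow> 'a fls2" where
  "series2 c = series1 (\<lambda>i. series1 (c i))"

definition power_series1 :: "'a::zero set \<Rightarrow> 'a fls set" where
  "power_series1 A = {series1 c |c. \<forall>n. c n \<in> A}"

definition power_series2 :: "'a::zero set \<Rightarrow> 'a fls2 set" where
  "power_series2 A = {series2 c |c. \<forall>i j. c i j \<in> A}"

definition hurwitz_series1 :: "'a::field_char_0 set \<Rightarrow> 'a fls set" where
  "hurwitz_series1 A = {series1 (\<lambda>n. c n / fact n) |c. \<forall>n. c n \<in> A}"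

definition hurwitz_series2 :: "'a::field_char_0 set \<Rightarrow> 'a fls2 set" where
  "hurwitz_series2 A = {series2 (\<lambda>i j. c i j / (fact i * fact j)) |c. \<forall>i j. c i j \<in> A}"

definition terms_from1 :: "nat \<Rightarrow> 'a::zero fls set" where
  "terms_from1 d = {series1 c |c. \<forall>n. n < d \<longrightarrow> c n = 0}"

text \<open>Here the degree is the total degree in \<open>t\<^sub>1, t\<^sub>2\<close>.\<close>
definition terms_from2 :: "nat \<Rightarrow> 'a::zero fls2 set" where
  "terms_from2 d = {series2 c |c. \<forall>i j. i + j < d \<longrightarrow> c i j = 0}"

text \<open>
  Substitution of a two-variable power series \<open>G\<close> without constant term into a one-variable
  power series: terms with \<open>n > i + j\<close> do not contribute to the coefficient of
  \<open>t\<^sub>1\<^sup>i t\<^sub>2\<^sup>j\<close>.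
\<close>
definition compose2 :: "'a::comm_ring_1 fps \<Rightarrow> 'a fls2 \<Rightarrow> 'a fls2" where
  "compose2 c G = series2 (\<lambda>i j. \<Sum>n\<le>i+j. fps_nth c n * coeff2 (G ^ n) i j)"


section \<open>Expansions at infinity in the arithmetic local parameter\<close>

text \<open>The equation has exactly one solution in the power series ring.\<close>
definition s_ser :: "(nat \<Rightarrow> 'a::field) \<Rightarrow> 'a fps" where
  "s_ser \<mu> = (THE s. s =
      (1 + fps_const (\<mu> 2) * s + fps_const (\<mu> 4) * s^2 + fps_const (\<mu> 6) * s^3) * fps_X^2
      + (fps_const (\<mu> 1) * s + fps_const (\<mu> 3) * s^2) * fps_X)"

definition x_ser :: "(nat \<Rightarrow> 'a::field) \<Rightarrow> 'a fls" where
  "x_ser \<mu> = 1 / fps_to_fls (s_ser \<mu>)"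

definition y_ser :: "(nat \<Rightarrow> 'a::field) \<Rightarrow> 'a fls" where
  "y_ser \<mu> = - x_ser \<mu> / fls_X"

definition t'_ser :: "(nat \<Rightarrow> 'a::field) \<Rightarrow> 'a fls" where
  "t'_ser \<mu> = x_ser \<mu> / (y_ser \<mu> + fls_const (\<mu> 1) * x_ser \<mu> + fls_const (\<mu> 3))"

text \<open>\<open>\<omega>\<^sub>1 = omega1_ser dt\<close>\<close>
definition omega1_ser :: "(nat \<Rightarrow> 'a::field) \<Rightarrow> 'a fls" where
  "omega1_ser \<mu> =
     fls_deriv (x_ser \<mu>) / (2 * y_ser \<mu> + fls_const (\<mu> 1) * x_ser \<mu> + fls_const (\<mu> 3))"

text \<open>\<open>u\<close> as a series in \<open>t\<close>, and conversely \<open>t\<close> as a series in \<open>u\<close>.\<close>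
definition u_ser :: "(nat \<Rightarrow> 'a::field) \<Rightarrow> 'a fps" where
  "u_ser \<mu> = fps_integral0 (fls_regpart (omega1_ser \<mu>))"

definition t_ser :: "(nat \<Rightarrow> 'a::field) \<Rightarrow> 'a fps" where
  "t_ser \<mu> = fps_inv (u_ser \<mu>)"

definition F_poly :: "(nat \<Rightarrow> 'a::comm_ring_1) \<Rightarrow> 'a \<Rightarrow> 'a \<Rightarrow> 'a \<Rightarrow> 'a \<Rightarrow> 'a" where
  "F_poly \<mu> x y z w =
     x * z * (x + z) + (\<mu> 1 ^ 2 + 2 * \<mu> 2) * x * z + \<mu> 1 * (z * y + x * w)
     + (\<mu> 3 * \<mu> 1 + \<mu> 4) * (x + z) + 2 * y * w + \<mu> 3 * (y + w) + \<mu> 3 ^ 2 + 2 * \<mu> 6"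

text \<open>\<open>\<xi>\<langle>T\<^sub>1, T\<^sub>2\<rangle>\<close>, with \<open>T\<^sub>1, T\<^sub>2\<close> represented by \<open>t1, t2\<close>.\<close>
definition xi_ser :: "(nat \<Rightarrow> 'a::field) \<Rightarrow> 'a fls2" where
  "xi_ser \<mu> =
    (let m = (\<lambda>j. const2 (\<mu> j));
         x = at1 (x_ser \<mu>); y = at1 (y_ser \<mu>); x' = at1 (fls_deriv (x_ser \<mu>));
         z = at2 (x_ser \<mu>); w = at2 (y_ser \<mu>); z' = at2 (fls_deriv (x_ser \<mu>))
     in F_poly m x y z w * x' * z' /
          ((x - z)^2 * (2 * y + m 1 * x + m 3) * (2 * w + m 1 * z + m 3)))"

text \<open>
  \<open>p_ser \<mu> at1 at2\<close> is \<open>p(t\<^sub>1,t\<^sub>2)\<close> and \<open>p_ser \<mu> at2 at1\<close> is \<open>p(t\<^sub>2,t\<^sub>1)\<close>.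
\<close>
definition p_ser :: "(nat \<Rightarrow> 'a::field) \<Rightarrow> ('a fls \<Rightarrow> 'a fls2) \<Rightarrow> ('a fls \<Rightarrow> 'a fls2) \<Rightarrow> 'a fls2" where
  "p_ser \<mu> e f =
     - ((1 / f (x_ser \<mu>) - 1 / e (x_ser \<mu>)) /
        ((f (t'_ser \<mu>) - e fls_X) * (f fls_X - e fls_X)))"

definition q_ser :: "(nat \<Rightarrow> 'a::field) \<Rightarrow> 'a fls" where
  "q_ser \<mu> = - x_ser \<mu> * fls_X * t'_ser \<mu>"

text \<open>
  The termwise integral of \<open>\<xi>\<langle>T\<^sub>1,T\<^sub>2\<rangle> - (T\<^sub>2 - T\<^sub>1)\<^sup>-\<^sup>2 = \<Sum> g\<^sub>i\<^sub>j T\<^sub>1\<^sup>i T\<^sub>2\<^sup>j\<close> (a power series),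
  with \<open>T\<^sub>1\<close> from \<open>t\<^sub>1\<close> to \<open>t\<^sub>2\<close> and \<open>T\<^sub>2\<close> from \<open>t\<^sub>1'\<close> to \<open>t\<^sub>2'\<close>; its term of index \<open>(i,j)\<close> is
  \<open>g\<^sub>i\<^sub>j (t\<^sub>2\<^sup>i\<^sup>+\<^sup>1 - t\<^sub>1\<^sup>i\<^sup>+\<^sup>1)/(i+1) (t\<^sub>2'\<^sup>j\<^sup>+\<^sup>1 - t\<^sub>1'\<^sup>j\<^sup>+\<^sup>1)/(j+1)\<close>, which has order at
  least \<open>i + j + 2\<close>, so that the coefficient of \<open>t\<^sub>1\<^sup>a t\<^sub>2\<^sup>b\<close> is a finite sum.
\<close>
definition xi_integral :: "(nat \<Rightarrow> 'a::field) \<Rightarrow> 'a fls2" where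
  "xi_integral \<mu> =
    (let g = coeff2 (xi_ser \<mu> - 1 / (t2 - t1)^2);
         t1' = at1 (t'_ser \<mu>); t2' = at2 (t'_ser \<mu>)
     in series2 (\<lambda>a b. \<Sum>i\<le>a+b. \<Sum>j\<le>a+b.
          coeff2 (const2 (g i j) * ((t2 ^ (i+1) - t1 ^ (i+1)) / of_nat (i+1))
                                 * ((t2' ^ (j+1) - t1' ^ (j+1)) / of_nat (j+1))) a b))"

definition r_ser :: "(nat \<Rightarrow> 'a::field_char_0) \<Rightarrow> 'a fls2" where
  "r_ser \<mu> = compose2 (fps_exp 1) (xi_integral \<mu>)"


section \<open>The complex elliptic curve and its periods\<close>

text \<open>
  The point at infinity of the projective curve is added by the one-point compactification of
  the affine curve, so a point of the curve is \<open>None\<close> (infinity) or \<open>Some (x, y)\<close>.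
\<close>

definition affine_curve :: "(nat \<Rightarrow> complex) \<Rightarrow> (complex \<times> complex) set" where
  "affine_curve \<mu> =
     {(x, y). y^2 + (\<mu> 1 * x + \<mu> 3) * y = x^3 + \<mu> 2 * x^2 + \<mu> 4 * x + \<mu> 6}"

definition partial_x :: "(nat \<Rightarrow> complex) \<Rightarrow> complex \<times> complex \<Rightarrow> complex" where
  "partial_x \<mu> = (\<lambda>(x, y). \<mu> 1 * y - (3 * x^2 + 2 * \<mu> 2 * x + \<mu> 4))"

definition partial_y :: "(nat \<Rightarrow> complex) \<Rightarrow> complex \<times> complex \<Rightarrow> complex" where
  "partial_y \<mu> = (\<lambda>(x, y). 2 * y + \<mu> 1 * x + \<mu> 3)"

text \<open>The point at infinity is nonsingular for all values of the coefficients.\<close>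
definition nonsingular :: "(nat \<Rightarrow> complex) \<Rightarrow> bool" where
  "nonsingular \<mu> \<longleftrightarrow> (\<forall>P \<in> affine_curve \<mu>. partial_x \<mu> P \<noteq> 0 \<or> partial_y \<mu> P \<noteq> 0)"

definition curve :: "(nat \<Rightarrow> complex) \<Rightarrow> (complex \<times> complex) option topology" where
  "curve \<mu> = Alexandroff_compactification (top_of_set (affine_curve \<mu>))"

text \<open>
  The value of \<open>\<omega>\<^sub>1 = dx / (2y + \<mu>\<^sub>1 x + \<mu>\<^sub>3)\<close> on a tangent vector \<open>(a, b)\<close> at \<open>P\<close>.  Where the
  denominator vanishes (and with it \<open>dx\<close>), the value is obtained from the relation
  \<open>partial_x dx + partial_y dy = 0\<close> on the curve.
\<close>
definition omega1 :: "(nat \<Rightarrow> complex) \<Rightarrow> complex \<times> complex \<Rightarrow> complex \<times> complex \<Rightarrow> complex" where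
  "omega1 \<mu> P = (\<lambda>(a, b). if partial_y \<mu> P \<noteq> 0 then a / partial_y \<mu> P else - b / partial_x \<mu> P)"

definition eta1 :: "(nat \<Rightarrow> complex) \<Rightarrow> complex \<times> complex \<Rightarrow> complex \<times> complex \<Rightarrow> complex" where
  "eta1 \<mu> P v = - fst P * omega1 \<mu> P v"

definition form_integral ::
    "(complex \<times> complex \<Rightarrow> complex \<times> complex \<Rightarrow> complex) \<Rightarrow> (real \<Rightarrow> complex \<times> complex) \<Rightarrow> complex" where
  "form_integral \<phi> \<gamma> = integral {0..1} (\<lambda>s. \<phi> (\<gamma> s) (vector_derivative \<gamma> (at s)))"

text \<open>
  Closed paths are taken piecewise smooth and, since \<open>\<eta>\<^sub>1\<close> has a pole at infinity, inside the
  affine curve.  Homotopies take place in the complete curve.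
\<close>
definition closed_curve_path :: "(nat \<Rightarrow> complex) \<Rightarrow> (real \<Rightarrow> complex \<times> complex) \<Rightarrow> bool" where
  "closed_curve_path \<mu> \<gamma> \<longleftrightarrow>
     valid_path \<gamma> \<and> path_image \<gamma> \<subseteq> affine_curve \<mu> \<and> pathfinish \<gamma> = pathstart \<gamma>"

inductive_set loop_words :: "(real \<Rightarrow> 'a::topological_space) \<Rightarrow> (real \<Rightarrow> 'a) \<Rightarrow> (real \<Rightarrow> 'a) set"
  for \<alpha> \<beta> where
  "(\<lambda>_. pathstart \<alpha>) \<in> loop_words \<alpha> \<beta>"
| "\<alpha> \<in> loop_words \<alpha> \<beta>"
| "\<beta> \<in> loop_words \<alpha> \<beta>"
| "\<gamma> \<in> loop_words \<alpha> \<beta> \<Longrightarrow> reversepath \<gamma> \<in> loop_words \<alpha> \<beta>"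
| "\<gamma> \<in> loop_words \<alpha> \<beta> \<Longrightarrow> \<delta> \<in> loop_words \<alpha> \<beta> \<Longrightarrow> \<gamma> +++ \<delta> \<in> loop_words \<alpha> \<beta>"

definition generate_fundamental_group ::
    "(nat \<Rightarrow> complex) \<Rightarrow> (real \<Rightarrow> complex \<times> complex) \<Rightarrow> (real \<Rightarrow> complex \<times> complex) \<Rightarrow> bool" where
  "generate_fundamental_group \<mu> \<alpha> \<beta> \<longleftrightarrow>
     pathstart \<beta> = pathstart \<alpha> \<and>
     (\<forall>\<gamma>. pathin (curve \<mu>) \<gamma> \<and> \<gamma> 0 = Some (pathstart \<alpha>) \<and> \<gamma> 1 = Some (pathstart \<alpha>) \<longrightarrow>
        (\<exists>\<delta> \<in> loop_words \<alpha> \<beta>.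
           homotopic_with (\<lambda>\<rho>. \<rho> 0 = Some (pathstart \<alpha>) \<and> \<rho> 1 = Some (pathstart \<alpha>))
             (top_of_set {0..1}) (curve \<mu>) \<gamma> (Some \<circ> \<delta>)))"

definition freely_homotopic ::
    "(nat \<Rightarrow> complex) \<Rightarrow> (real \<Rightarrow> complex \<times> complex) \<Rightarrow> (real \<Rightarrow> complex \<times> complex) \<Rightarrow> bool" where
  "freely_homotopic \<mu> \<gamma> \<delta> \<longleftrightarrow>
     homotopic_with (\<lambda>\<rho>. \<rho> 1 = \<rho> 0) (top_of_set {0..1}) (curve \<mu>) (Some \<circ> \<gamma>) (Some \<circ> \<delta>)"

text \<open>
  Two nonzero vectors \<open>v, w\<close> in a tangent line of the curve (a complex line in the plane) satisfy
  \<open>w = c v\<close> with \<open>c\<close> complex; the sign of \<open>Im c\<close> tells whether \<open>(v, w)\<close> is a positively oriented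
  real basis.
\<close>
definition crossing_sign :: "complex \<times> complex \<Rightarrow> complex \<times> complex \<Rightarrow> real" where
  "crossing_sign v w = sgn (Im (cnj (fst v) * fst w + cnj (snd v) * snd w))"

text \<open>
  The intersection number is the signed number of crossings of freely homotopic representatives
  which meet transversally, in finitely many pairs of parameters.
\<close>
definition has_intersection_number ::
    "(nat \<Rightarrow> complex) \<Rightarrow> (real \<Rightarrow> complex \<times> complex) \<Rightarrow> (real \<Rightarrow> complex \<times> complex) \<Rightarrow> real \<Rightarrow> bool" where
  "has_intersection_number \<mu> \<alpha> \<beta> k \<longleftrightarrow>
     (\<exists>\<alpha>' \<beta>' C.
        closed_curve_path \<mu> \<alpha>' \<and> closed_curve_path \<mu> \<beta>' \<and>
        freely_homotopic \<mu> \<alpha> \<alpha>' \<and> freely_homotopic \<mu> \<beta> \<beta>' \<and>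
        C = {(a, b). a \<in> {0..1} \<and> b \<in> {0..1} \<and> \<alpha>' a = \<beta>' b} \<and>
        finite C \<and> C \<subseteq> {0<..<1} \<times> {0<..<1} \<and>
        (\<forall>(a, b) \<in> C. \<alpha>' differentiable (at a) \<and> \<beta>' differentiable (at b) \<and>
           crossing_sign (vector_derivative \<alpha>' (at a)) (vector_derivative \<beta>' (at b)) \<noteq> 0) \<and>
        k = (\<Sum>(a, b) \<in> C.
           crossing_sign (vector_derivative \<alpha>' (at a)) (vector_derivative \<beta>' (at b))))"

definition period_basis ::
    "(nat \<Rightarrow> complex) \<Rightarrow> (real \<Rightarrow> complex \<times> complex) \<Rightarrow> (real \<Rightarrow> complex \<times> complex) \<Rightarrow> bool" where
  "period_basis \<mu> \<alpha> \<beta> \<longleftrightarrow>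
     closed_curve_path \<mu> \<alpha> \<and> closed_curve_path \<mu> \<beta> \<and>
     generate_fundamental_group \<mu> \<alpha> \<beta> \<and> has_intersection_number \<mu> \<alpha> \<beta> 1 \<and>
     Im (form_integral (omega1 \<mu>) \<beta> / form_integral (omega1 \<mu>) \<alpha>) > 0"


section \<open>The sigma function\<close>

definition sigma_unnormalized :: "complex \<Rightarrow> complex \<Rightarrow> complex \<Rightarrow> complex \<Rightarrow> complex" where
  "sigma_unnormalized \<omega>' \<omega>'' \<eta>' u =
     exp (u^2 * \<eta>' / \<omega>' / 2) *
     (\<Sum>\<^sub>\<infinity>n::int. exp (of_real pi * \<i> * (\<omega>'' / \<omega>') * (of_int n + 1/2)^2
                   + 2 * of_real pi * \<i> * (of_int n + 1/2) * (u / \<omega>' + 1/2)))"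

definition sigma ::
    "(nat \<Rightarrow> complex) \<Rightarrow> (real \<Rightarrow> complex \<times> complex) \<Rightarrow> (real \<Rightarrow> complex \<times> complex) \<Rightarrow> complex \<Rightarrow> complex" where
  "sigma \<mu> \<alpha> \<beta> u =
    (let \<theta> = sigma_unnormalized (form_integral (omega1 \<mu>) \<alpha>) (form_integral (omega1 \<mu>) \<beta>)
               (form_integral (eta1 \<mu>) \<alpha>);
         c = (THE c. c \<noteq> 0 \<and> (\<lambda>z. c * \<theta> z - z) \<in> O[at 0](\<lambda>z. z^2))
     in c * \<theta> u)"

text \<open>\<open>S\<close> gives the Taylor coefficients of \<open>\<sigma>\<close> at 0 as polynomials in the \<open>\<mu>\<^sub>j\<close>.\<close>
definition sigma_taylor_polys :: "(nat \<Rightarrow> mupoly) \<Rightarrow> bool" where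
  "sigma_taylor_polys S \<longleftrightarrow>
     (\<forall>n. S n \<in> mupolys) \<and>
     (\<forall>\<mu> \<alpha> \<beta>. nonsingular \<mu> \<and> period_basis \<mu> \<alpha> \<beta> \<longrightarrow>
        fps_expansion (sigma \<mu> \<alpha> \<beta>) 0 = Abs_fps (\<lambda>n. mupoly_eval \<mu> (S n)))"

end

theory Submission
  imports Defs
begin

unbundle no vec_syntax
unbundle fps_syntax

text \<open>
  Let \<open>x = u\<^sup>-\<^sup>2 + \<dots>\<close> be the first coordinate as a series in the analytic coordinate, and let
  \<open>sig\<close> be the series with \<open>(log sig)'' = - x\<close> and \<open>sig = u + \<dots>\<close>.  Both sides of the three-term relation
  \<open>sig(u + v) sig(u - v) = sig(u)\<^sup>2 sig(v)\<^sup>2 (x(v) - x(u))\<close> solve the wave equation for the logarithm, with the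
  same initial values, so the relation holds; it implies the duplication formula and the addition theorem.
  By the latter the 2-form is \<open>x(u - v) du dv\<close>, the mixed second derivative of \<open>log sig(u - v)\<close>.  Since \<open>t'\<close>
  has the analytic coordinate \<open>- u\<close>, its double integral is
  \<open>log (sig(2u) sig(2v) / sig(u + v)\<^sup>2)\<close> up to elementary factors, and the three-term relation and the duplication
  formula turn this into the product formula for \<open>sig(u - v)\<^sup>2\<close>.

  It remains to identify \<open>sig\<close> with the Taylor series of the theta quotient.  By the duplication formula \<open>sig\<close>
  is entire.  Its zeros form a discrete group \<open>\<Lambda>\<close>, and \<open>u \<mapsto> (x, y)\<close> is a covering of the complete curve
  by the plane with deck group \<open>\<Lambda>\<close>; it is onto because the image of \<open>x\<close> is open, and closed by Hurwitz' theorem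
  applied to the addition theorem.  Lifting loops shows that \<open>\<Lambda>\<close> is generated by the two periods.  Finally theta and
  \<open>sig\<close> times a Gaussian factor are quasi-periodic with the same zeros, hence proportional by Liouville's theorem.
\<close>

text \<open>The curve coefficients are indeterminates on the formal side and complex numbers on the
  analytic side, so the formal identities are proved over an arbitrary field of characteristic 0 and
  used for both. The link is a recursion for the coefficients of \<open>sig\<close> that divides by
  integers only and so produces universal polynomials with rational coefficients. These denominators
  are the obstacle to integrality, which is therefore never read off from \<open>sig\<close>. The
  factors p, q and the regular part of the 2-form arise from integral series by inverting units and
  cancelling linear factors monic in \<open>t\<^sub>1\<close>; integration and the exponential
  preserve Hurwitz integrality because it can be checked on derivatives. The passage to the analytic
  coordinate rests on dt/du = W(t) with W integral. The displayed terms of r are not found by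
  integrating: r has a closed form, is symmetric, and r - 1 is divisible by
  \<open>(t\<^sub>1 - t\<^sub>2)\<^sup>2\<close>, so three coefficients with respect to
  \<open>t\<^sub>1\<close> determine r up to degree 6. Nonsingularity enters where a limit of
  translates of X might be constant, and at the branch points of X, where Y is the
  coordinate.\<close>

text \<open>The outer series variable is \<open>t\<^sub>1\<close>, as in the iterated Laurent series.\<close>
type_synonym 'a fps2 = "'a fps fps"

section \<open>Double power series filtered by total degree, and summable families\<close>

definition lift1 :: "'a::zero fps \<Rightarrow> 'a fps2" where
  "lift1 f = Abs_fps (\<lambda>i. fps_const (f $ i))"

abbreviation lift2 :: "'a::zero fps \<Rightarrow> 'a fps2" where
  "lift2 \<equiv> fps_const"

abbreviation const_fps2 :: "'a::zero \<Rightarrow> 'a fps2" where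
  "const_fps2 c \<equiv> fps_const (fps_const c)"

text \<open>Order at least n in the total degree. Substitutions and exponentials converge in this
  filtration, and an identity of series may be checked modulo every order
  (\<open>eq_if_vanishes\<close>).\<close>

definition vanishes :: "nat \<Rightarrow> 'a::zero fps2 \<Rightarrow> bool" where
  "vanishes n F \<longleftrightarrow> (\<forall>i j. i + j < n \<longrightarrow> F $ i $ j = 0)"

text \<open>Lifts, substitutions, the exchange of variables and the embeddings into Laurent series
  all have to be pushed through polynomial identities; as one predicate they share the rewrite rules
  \<open>is_hom_simps\<close>.\<close>

definition is_hom :: "('a::ring_1 \<Rightarrow> 'b::ring_1) \<Rightarrow> bool" where
  "is_hom \<psi> \<longleftrightarrow> (\<forall>x y. \<psi> (x + y) = \<psi> x + \<psi> y) \<and> (\<forall>x y. \<psi> (x * y) = \<psi> x * \<psi> y) \<and> \<psi> 1 = 1"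

lemma is_hom_add: "is_hom \<psi> \<Longrightarrow> \<psi> (x + y) = \<psi> x + \<psi> y"
  and is_hom_mult: "is_hom \<psi> \<Longrightarrow> \<psi> (x * y) = \<psi> x * \<psi> y"
  and is_hom_1: "is_hom \<psi> \<Longrightarrow> \<psi> 1 = 1"
  by (simp_all add: is_hom_def)

lemma is_hom_0: assumes "is_hom \<psi>" shows "\<psi> 0 = 0"
  using is_hom_add[OF assms, of 0 0] by simp

lemma is_hom_uminus: assumes "is_hom \<psi>" shows "\<psi> (- x) = - \<psi> x"
  using is_hom_add[OF assms, of x "- x"] is_hom_0[OF assms] by (simp add: add_eq_0_iff)

lemma is_hom_diff: assumes "is_hom \<psi>" shows "\<psi> (x - y) = \<psi> x - \<psi> y"
  using is_hom_add[OF assms, of x "- y"] is_hom_uminus[OF assms] by simp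

lemma is_hom_power: assumes "is_hom \<psi>" shows "\<psi> (x ^ n) = \<psi> x ^ n"
  by (induction n) (simp_all add: is_hom_1[OF assms] is_hom_mult[OF assms])

lemma is_hom_sum: assumes "is_hom \<psi>" shows "\<psi> (\<Sum>i\<in>A. f i) = (\<Sum>i\<in>A. \<psi> (f i))"
  by (induction A rule: infinite_finite_induct)
     (simp_all add: is_hom_0[OF assms] is_hom_add[OF assms])

lemma is_hom_of_nat: assumes "is_hom \<psi>" shows "\<psi> (of_nat n) = of_nat n"
  by (induction n) (simp_all add: is_hom_0[OF assms] is_hom_1[OF assms] is_hom_add[OF assms])

lemma is_hom_numeral: assumes "is_hom \<psi>" shows "\<psi> (numeral n) = numeral n"
  using is_hom_of_nat[OF assms, of "numeral n"] by simp

lemmas is_hom_simps = is_hom_add is_hom_mult is_hom_1 is_hom_0 is_hom_uminus is_hom_diff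
  is_hom_power is_hom_numeral is_hom_of_nat

lemma fps2_mult_nth:
  "(F * G) $ i $ j = (\<Sum>k\<le>i. \<Sum>l\<le>j. F $ k $ l * G $ (i - k) $ (j - l))"
  for F G :: "'a::comm_ring_1 fps2"
  by (simp add: fps_mult_nth fps_sum_nth atLeast0AtMost)

lemma vanishes_add: "vanishes n F \<Longrightarrow> vanishes n G \<Longrightarrow> vanishes n (F + G)"
  for F G :: "'a::comm_ring_1 fps2"
  by (simp add: vanishes_def)

lemma vanishes_uminus: "vanishes n F \<Longrightarrow> vanishes n (- F)"
  for F G :: "'a::comm_ring_1 fps2"
  by (simp add: vanishes_def)

lemma vanishes_diff: "vanishes n F \<Longrightarrow> vanishes n G \<Longrightarrow> vanishes n (F - G)"
  for F G :: "'a::comm_ring_1 fps2"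
  by (simp add: vanishes_def)

lemma vanishes_0 [simp]: "vanishes n 0" "vanishes 0 F"
  by (simp_all add: vanishes_def)

lemma vanishes_sum: "(\<And>i. i \<in> A \<Longrightarrow> vanishes n (f i)) \<Longrightarrow> vanishes n (\<Sum>i\<in>A. f i)"
  for f :: "'b \<Rightarrow> 'a::comm_ring_1 fps2"
  by (induction A rule: infinite_finite_induct) (auto intro: vanishes_add)

lemma vanishes_mono: "vanishes n F \<Longrightarrow> m \<le> n \<Longrightarrow> vanishes m F"
  by (auto simp: vanishes_def)

lemma vanishes_mult: 
  fixes F G :: "'a::comm_ring_1 fps2"
  assumes "vanishes m F" "vanishes n G" shows "vanishes (m + n) (F * G)"
  unfolding vanishes_def
proof (intro allI impI)
  fix i j assume "i + j < m + n"
  have "F $ k $ l * G $ (i - k) $ (j - l) = 0" if "k \<le> i" "l \<le> j" for k l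
  proof (cases "k + l < m")
    case True
    then show ?thesis using assms(1) by (simp add: vanishes_def)
  next
    case False
    then have "(i - k) + (j - l) < n" using that \<open>i + j < m + n\<close> by linarith
    then show ?thesis using assms(2) by (simp add: vanishes_def)
  qed
  then show "(F * G) $ i $ j = 0" by (simp add: fps2_mult_nth)
qed

lemma vanishes_mult_left: "vanishes m F \<Longrightarrow> vanishes m (F * G)"
  and vanishes_mult_right: "vanishes m G \<Longrightarrow> vanishes m (F * G)"
  for F G :: "'a::comm_ring_1 fps2"
  using vanishes_mult[of m F 0 G] vanishes_mult[of 0 F m G] by simp_all

lemma vanishes_power: "vanishes (Suc 0) F \<Longrightarrow> vanishes n (F ^ n)"
  for F :: "'a::comm_ring_1 fps2"
  by (induction n) (use vanishes_mult[of "Suc 0" F] in \<open>force+\<close>)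

lemma fps2_eqI: "(\<And>i j. F $ i $ j = G $ i $ j) \<Longrightarrow> F = G"
  by (intro fps_ext)

lemma eq_if_vanishes: "(\<And>n. vanishes n (F - G)) \<Longrightarrow> F = G"
  for F G :: "'a::comm_ring_1 fps2"
  by (rule fps2_eqI) (metis vanishes_def fps_sub_nth lessI right_minus_eq)

text \<open>A summable family, encoded as a power series in an auxiliary variable so that the Cauchy
  product of two families is the product of \<open>fps\<close>.\<close>

definition graded :: "'a::comm_ring_1 fps2 fps \<Rightarrow> bool" where
  "graded A \<longleftrightarrow> (\<forall>n. vanishes n (A $ n))"

text \<open>For graded \<open>A\<close> this is the value at 1 of the power series \<open>A\<close>.\<close>
definition gsum :: "'a::comm_ring_1 fps2 fps \<Rightarrow> 'a fps2" where
  "gsum A = Abs_fps (\<lambda>i. Abs_fps (\<lambda>j. \<Sum>n\<le>i+j. A $ n $ i $ j))"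

text \<open>A partial sum agrees with the infinite sum up to the order of the first omitted term.
  Identities for finite sums thereby pass to \<open>gsum\<close>.\<close>

lemma gsum_cong: assumes "graded A" shows "vanishes N (gsum A - (\<Sum>n<N. A $ n))"
  unfolding vanishes_def
proof (intro allI impI)
  fix i j assume N: "i + j < N"
  have "(\<Sum>n<N. A $ n $ i $ j) = (\<Sum>n\<le>i+j. A $ n $ i $ j)"
    using assms N by (intro sum.mono_neutral_right) (auto simp: graded_def vanishes_def)
  then show "(gsum A - (\<Sum>n<N. A $ n)) $ i $ j = 0"
    by (simp add: gsum_def fps_sum_nth)
qed

lemma graded_mult: assumes "graded A" "graded B" shows "graded (A * B)"
  unfolding graded_def fps_mult_nth
proof (intro allI vanishes_sum)
  fix n k :: nat assume "k \<in> {0..n}"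
  then show "vanishes n (A $ k * B $ (n - k))"
    using vanishes_mult[of k "A $ k" "n - k" "B $ (n - k)"] assms by (simp add: graded_def)
qed

lemma gsum_add: "gsum (A + B) = gsum A + gsum B"
  by (intro fps2_eqI) (simp add: gsum_def sum.distrib)

lemma gsum_mult: assumes "graded A" "graded B" shows "gsum (A * B) = gsum A * gsum B"
proof (rule eq_if_vanishes)
  fix N
  define a b where "a = (\<Sum>n<N. A $ n)" and "b = (\<Sum>n<N. B $ n)"
  define S where "S = (\<Sum>n<N. (A * B) $ n)"
  have 1: "vanishes N (gsum A * gsum B - a * b)"
  proof -
    have "gsum A * gsum B - a * b = (gsum A - a) * gsum B + a * (gsum B - b)"
      by (simp add: algebra_simps)
    then show ?thesis unfolding a_def b_def
      by (simp add: vanishes_add vanishes_mult_left vanishes_mult_right gsum_cong assms)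
  qed
  have S: "S = (\<Sum>(k,l) \<in> {(k,l). k + l < N}. A $ k * B $ l)"
    unfolding S_def sum.triangle_reindex by (simp add: fps_mult_nth atLeast0AtMost)
  \<comment> \<open>The product of the partial sums has more terms than the partial sum of the
    Cauchy product; each surplus term has \<open>k + l \<ge> N\<close> and hence order at least
    N.\<close>
  have "a * b = (\<Sum>(k,l) \<in> {..<N} \<times> {..<N}. A $ k * B $ l)"
    unfolding a_def b_def by (simp add: sum_product sum.cartesian_product)
  also have "\<dots> = S + (\<Sum>(k,l) \<in> {..<N} \<times> {..<N} - {(k,l). k + l < N}. A $ k * B $ l)"
    unfolding S by (subst sum.subset_diff[of "{(k,l). k + l < N}"]) (auto simp: add.commute)
  finally have "a * b - S = (\<Sum>(k,l) \<in> {..<N} \<times> {..<N} - {(k,l). k + l < N}. A $ k * B $ l)"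
    by simp
  also have "vanishes N \<dots>"
  proof (rule vanishes_sum, clarsimp)
    fix k l assume "\<not> k + l < N"
    then show "vanishes N (A $ k * B $ l)"
      using vanishes_mult[of k "A $ k" l "B $ l"] assms vanishes_mono[of "k + l" _ N]
      by (simp add: graded_def)
  qed
  finally have 2: "vanishes N (a * b - S)" .
  have 3: "vanishes N (gsum (A * B) - S)"
    unfolding S_def by (intro gsum_cong graded_mult assms)
  have "gsum (A * B) - gsum A * gsum B =
     (gsum (A * B) - S) - (a * b - S) - (gsum A * gsum B - a * b)" by simp
  then show "vanishes N (gsum (A * B) - gsum A * gsum B)"
    using 1 2 3 by (metis vanishes_diff)
qed

lemma gsum_const [simp]: "gsum (fps_const c) = c"
  by (intro fps2_eqI) (simp add: gsum_def if_distrib[of "\<lambda>x. x $ _ $ _"] cong: if_cong)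

lemma graded_const: "graded (fps_const c)"
  by (simp add: graded_def)

lemma gsum_eq_upto: assumes "graded A" "i + j \<le> N" shows "gsum A $ i $ j = (\<Sum>n\<le>N. A $ n $ i $ j)"
  unfolding gsum_def using assms
  by (simp, intro sum.mono_neutral_left) (auto simp: graded_def vanishes_def)

subsection \<open>Substitution\<close>

text \<open>The terms of the series F evaluated at \<open>a\<close>, its coefficients being carried
  along by \<psi>. Constants as \<psi> give \<open>comp1\<close>; the substitution into the inner
  variable as \<psi> gives \<open>subst2\<close>. One argument thus proves both
  multiplicative.\<close>

definition subst_coeffs :: "('b::comm_ring_1 \<Rightarrow> 'a::comm_ring_1 fps2) \<Rightarrow> 'a fps2 \<Rightarrow> 'b fps \<Rightarrow> 'a fps2 fps"
  where "subst_coeffs \<psi> a F = Abs_fps (\<lambda>m. \<psi> (F $ m) * a ^ m)"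

lemma graded_subst_coeffs: "vanishes (Suc 0) a \<Longrightarrow> graded (subst_coeffs \<psi> a F)"
  by (simp add: graded_def subst_coeffs_def vanishes_power vanishes_mult_right)

lemma is_hom_gsum_subst_coeffs:
  assumes "is_hom \<psi>" "vanishes (Suc 0) a"
  shows "is_hom (\<lambda>F. gsum (subst_coeffs \<psi> a F))"
proof -
  have pow: "a ^ n = a ^ x * a ^ (n - x)" if "x \<le> n" for n x :: nat
    using that by (simp flip: power_add)
  have *: "subst_coeffs \<psi> a (F + G) = subst_coeffs \<psi> a F + subst_coeffs \<psi> a G"
       "subst_coeffs \<psi> a (F * G) = subst_coeffs \<psi> a F * subst_coeffs \<psi> a G" for F G
  proof -
    show "subst_coeffs \<psi> a (F + G) = subst_coeffs \<psi> a F + subst_coeffs \<psi> a G"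
      by (rule fps_ext) (simp add: subst_coeffs_def is_hom_add[OF assms(1)] algebra_simps)
    show "subst_coeffs \<psi> a (F * G) = subst_coeffs \<psi> a F * subst_coeffs \<psi> a G"
      unfolding subst_coeffs_def fps_eq_iff fps_mult_nth fps_nth_Abs_fps
        is_hom_sum[OF assms(1)] is_hom_mult[OF assms(1)] sum_distrib_right
      by (intro allI sum.cong refl) (simp add: pow mult_ac)
  qed
  have 1: "subst_coeffs \<psi> a 1 = fps_const 1"
    by (rule fps_ext) (simp add: subst_coeffs_def is_hom_1[OF assms(1)] is_hom_0[OF assms(1)])
  show ?thesis
    unfolding is_hom_def * 1 gsum_add
    by (simp add: gsum_mult graded_subst_coeffs assms flip: fps_const_1_eq_1)
qed

definition comp1 :: "'a::comm_ring_1 fps \<Rightarrow> 'a fps2 \<Rightarrow> 'a fps2" where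
  "comp1 c g = gsum (subst_coeffs const_fps2 g c)"

definition subst2 :: "'a::comm_ring_1 fps2 \<Rightarrow> 'a fps2 \<Rightarrow> 'a fps2 \<Rightarrow> 'a fps2" where
  "subst2 F a b = gsum (subst_coeffs (\<lambda>f. comp1 f b) a F)"

lemma is_hom_const_fps2: "is_hom (const_fps2 :: 'a::comm_ring_1 \<Rightarrow> _)"
  by (simp add: is_hom_def)

lemma is_hom_comp1: "vanishes (Suc 0) g \<Longrightarrow> is_hom (\<lambda>c. comp1 c g)"
  unfolding comp1_def by (intro is_hom_gsum_subst_coeffs is_hom_const_fps2)

lemma is_hom_subst2: "vanishes (Suc 0) a \<Longrightarrow> vanishes (Suc 0) b \<Longrightarrow> is_hom (\<lambda>F. subst2 F a b)"
  unfolding subst2_def by (intro is_hom_gsum_subst_coeffs is_hom_comp1)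

lemma comp1_const [simp]: "comp1 (fps_const c) g = const_fps2 c"
proof -
  have "subst_coeffs const_fps2 g (fps_const c) = fps_const (const_fps2 c)"
    by (rule fps_ext) (simp add: subst_coeffs_def)
  then show ?thesis by (simp add: comp1_def)
qed

lemma subst2_lift2: "subst2 (lift2 f) a b = comp1 f b"
proof -
  have "comp1 0 b = 0" using comp1_const[of 0 b] by simp
  then have "subst_coeffs (\<lambda>f. comp1 f b) a (lift2 f) = fps_const (comp1 f b)"
    by (intro fps_ext) (simp add: subst_coeffs_def)
  then show ?thesis by (simp add: subst2_def)
qed

lemma subst2_lift1: "subst2 (lift1 f) a b = comp1 f a"
  unfolding subst2_def comp1_def[of f a] by (simp add: subst_coeffs_def lift1_def)

lemma subst2_const [simp]: "subst2 (const_fps2 c) a b = const_fps2 c"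
  by (simp add: subst2_lift2)

lemma comp1_X: assumes "vanishes (Suc 0) g" shows "comp1 fps_X g = g"
  unfolding comp1_def
proof (rule fps2_eqI)
  fix i j
  have "gsum (subst_coeffs const_fps2 g fps_X) $ i $ j =
    (\<Sum>n\<le>Suc (i+j). subst_coeffs const_fps2 g fps_X $ n $ i $ j)"
    by (rule gsum_eq_upto[OF graded_subst_coeffs[OF assms]]) simp
  also have "\<dots> = (\<Sum>n\<le>Suc (i+j). if n = 1 then g $ i $ j else 0)"
    by (intro sum.cong) (auto simp: subst_coeffs_def)
  also have "\<dots> = g $ i $ j" by simp
  finally show "gsum (subst_coeffs const_fps2 g fps_X) $ i $ j = g $ i $ j" .
qed

lemma gsum_vanishes: assumes "\<And>n. vanishes N (A $ n)" shows "vanishes N (gsum A)"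
  using assms by (simp add: vanishes_def gsum_def)

lemma comp1_vanishes: 
  assumes "\<And>k. k < n \<Longrightarrow> c $ k = 0" "vanishes (Suc 0) g" shows "vanishes n (comp1 c g)"
  unfolding comp1_def
proof (rule gsum_vanishes)
  fix m show "vanishes n (subst_coeffs const_fps2 g c $ m)"
  proof (cases "m < n")
    case True then show ?thesis by (simp add: subst_coeffs_def assms)
  next
    case False
    then show ?thesis unfolding subst_coeffs_def
      using vanishes_mono[OF vanishes_power[OF assms(2), of m], of n] by (simp add: vanishes_mult_right)
  qed
qed

lemma subst2_vanishes: 
  assumes "vanishes n F" "vanishes (Suc 0) a" "vanishes (Suc 0) b" shows "vanishes n (subst2 F a b)"
  unfolding subst2_def
proof (rule gsum_vanishes)
  fix m
  have "vanishes (n - m) (comp1 (F $ m) b)"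
    using assms by (intro comp1_vanishes) (auto simp: vanishes_def)
  then have "vanishes ((n - m) + m) (comp1 (F $ m) b * a ^ m)"
    by (intro vanishes_mult vanishes_power assms)
  then have "vanishes n (comp1 (F $ m) b * a ^ m)"
    by (rule vanishes_mono) simp
  then show "vanishes n (subst_coeffs (\<lambda>f. comp1 f b) a F $ m)"
    by (simp add: subst_coeffs_def)
qed

text \<open>Substitution of series without constant term does not lower the order, so it commutes
  with partial sums up to terms of high order.\<close>

lemma subst2_gsum:
  assumes "graded A" "vanishes (Suc 0) a" "vanishes (Suc 0) b"
  shows "subst2 (gsum A) a b = gsum (Abs_fps (\<lambda>n. subst2 (A $ n) a b))"
proof (rule eq_if_vanishes)
  fix N
  note h = is_hom_subst2[OF assms(2,3)]
  have g: "graded (Abs_fps (\<lambda>n. subst2 (A $ n) a b))"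
    using assms by (simp add: graded_def subst2_vanishes)
  have 1: "vanishes N (subst2 (gsum A - (\<Sum>n<N. A $ n)) a b)"
    by (intro subst2_vanishes gsum_cong assms)
  have 2: "subst2 (gsum A - (\<Sum>n<N. A $ n)) a b = subst2 (gsum A) a b - (\<Sum>n<N. subst2 (A $ n) a b)"
    by (simp add: is_hom_diff[OF h] is_hom_sum[OF h])
  have 3: "vanishes N (gsum (Abs_fps (\<lambda>n. subst2 (A $ n) a b)) - (\<Sum>n<N. subst2 (A $ n) a b))"
    using gsum_cong[OF g, of N] by simp
  show "vanishes N (subst2 (gsum A) a b - gsum (Abs_fps (\<lambda>n. subst2 (A $ n) a b)))"
    using vanishes_diff[OF 1 3] unfolding 2 by simp
qed

lemma subst2_comp1:
  assumes "vanishes (Suc 0) g" "vanishes (Suc 0) a" "vanishes (Suc 0) b"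
  shows "subst2 (comp1 c g) a b = comp1 c (subst2 g a b)"
proof -
  note h = is_hom_subst2[OF assms(2,3)]
  have "Abs_fps (\<lambda>n. subst2 (subst_coeffs const_fps2 g c $ n) a b) = subst_coeffs const_fps2 (subst2 g a b) c"
    by (rule fps_ext) (simp add: subst_coeffs_def is_hom_mult[OF h] is_hom_power[OF h])
  then show ?thesis
    unfolding comp1_def by (simp add: subst2_gsum graded_subst_coeffs assms)
qed

lemma lift1_hom: "is_hom (lift1 :: 'a::comm_ring_1 fps \<Rightarrow> _)"
  unfolding is_hom_def lift1_def
  by (auto simp: fps_eq_iff fps2_mult_nth fps_mult_nth fps_sum_nth if_distrib sum.If_cases
      intro!: sum.cong)

lemma lift2_hom: "is_hom (lift2 :: 'a::comm_ring_1 fps \<Rightarrow> _)"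
  by (simp add: is_hom_def)

lemma lift1_vanishes: "(\<And>k. k < n \<Longrightarrow> f $ k = 0) \<Longrightarrow> vanishes n (lift1 f)"
  by (auto simp: vanishes_def lift1_def)

lemma lift2_vanishes: "(\<And>k. k < n \<Longrightarrow> f $ k = 0) \<Longrightarrow> vanishes n (lift2 f)"
  by (auto simp: vanishes_def)

lemma lift1_vanishes1: "f $ 0 = 0 \<Longrightarrow> vanishes (Suc 0) (lift1 f)"
  by (rule lift1_vanishes) simp

lemma lift2_vanishes1: "f $ 0 = 0 \<Longrightarrow> vanishes (Suc 0) (lift2 f)"
  by (rule lift2_vanishes) simp

lemma lift1_nth [simp]: "lift1 f $ i $ j = (if j = 0 then f $ i else 0)"
  by (simp add: lift1_def)

lemma comp1_lift1: assumes "f $ 0 = 0" shows "comp1 c (lift1 f) = lift1 (c oo f)"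
proof (rule fps2_eqI)
  fix i j
  have p: "lift1 f ^ n = lift1 (f ^ n)" for n by (simp add: is_hom_power[OF lift1_hom])
  have "comp1 c (lift1 f) $ i $ j = (\<Sum>n\<le>i+j. c $ n * lift1 (f ^ n) $ i $ j)"
    by (simp add: comp1_def gsum_def subst_coeffs_def p del: lift1_nth)
  also have "\<dots> = lift1 (c oo f) $ i $ j"
    by (cases "j = 0") (simp_all add: fps_compose_nth atLeast0AtMost)
  finally show "comp1 c (lift1 f) $ i $ j = lift1 (c oo f) $ i $ j" .
qed

lemma comp1_lift2: assumes "f $ 0 = 0" shows "comp1 c (lift2 f) = lift2 (c oo f)"
proof (rule fps2_eqI)
  fix i j
  have "comp1 c (lift2 f) $ i $ j = (\<Sum>n\<le>i+j. c $ n * lift2 (f ^ n) $ i $ j)"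
    by (cases "i = 0") (simp_all add: comp1_def gsum_def subst_coeffs_def fps_const_power)
  also have "\<dots> = lift2 (c oo f) $ i $ j"
    by (cases "i = 0") (simp_all add: fps_compose_nth atLeast0AtMost)
  finally show "comp1 c (lift2 f) $ i $ j = lift2 (c oo f) $ i $ j" .
qed

text \<open>Associativity of composition is a special case of \<open>subst2_comp1\<close>, the
  one-variable series being regarded as series in the outer variable.\<close>

lemma comp1_compose:
  assumes "f $ 0 = 0" "vanishes (Suc 0) g" shows "comp1 (c oo f) g = comp1 c (comp1 f g)"
proof -
  have "comp1 (c oo f) g = subst2 (lift1 (c oo f)) g g" by (simp add: subst2_lift1)
  also have "\<dots> = comp1 c (subst2 (lift1 f) g g)"
    by (simp add: comp1_lift1[symmetric] assms subst2_comp1 lift1_vanishes1)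
  finally show ?thesis by (simp add: subst2_lift1)
qed

subsection \<open>Derivations\<close>

definition deriv2 :: "'a::comm_ring_1 fps2 \<Rightarrow> 'a fps2" where
  "deriv2 F = Abs_fps (\<lambda>i. fps_deriv (F $ i))"

text \<open>The last clause, a loss of at most one order, lets a derivation pass through infinite
  sums. Both partial derivatives satisfy it.\<close>

definition is_deriv :: "('a::comm_ring_1 fps2 \<Rightarrow> 'a fps2) \<Rightarrow> bool" where
  "is_deriv d \<longleftrightarrow> (\<forall>F G. d (F + G) = d F + d G) \<and> (\<forall>F G. d (F * G) = d F * G + F * d G) \<and>
     (\<forall>c. d (const_fps2 c) = 0) \<and> (\<forall>n F. vanishes (Suc n) F \<longrightarrow> vanishes n (d F))"

lemma is_deriv_deriv1: "is_deriv (fps_deriv :: 'a::comm_ring_1 fps2 \<Rightarrow> _)"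
  by (auto simp: is_deriv_def vanishes_def fps_of_nat algebra_simps simp flip: fps_of_nat)

lemma is_deriv_deriv2: "is_deriv (deriv2 :: 'a::comm_ring_1 fps2 \<Rightarrow> _)"
proof -
  have "fps_deriv (\<Sum>i\<in>A. f i) = (\<Sum>i\<in>A. fps_deriv (f i))" for f :: "nat \<Rightarrow> 'a fps" and A
    by (induction A rule: infinite_finite_induct) auto
  then show ?thesis
    by (auto simp: is_deriv_def vanishes_def deriv2_def fps_eq_iff[where ?'a = "'a fps"] fps_mult_nth
        sum.distrib simp del: mult.commute)
qed

lemma is_deriv_simps:
  assumes "is_deriv d"
  shows "d (F + G) = d F + d G" "d (F * G) = d F * G + F * d G" "d (const_fps2 c) = 0"
    "d 0 = 0" "d 1 = 0" "d (- F) = - d F" "d (F - G) = d F - d G"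
proof -
  show 0: "d (F + G) = d F + d G" "d (F * G) = d F * G + F * d G" "d (const_fps2 c) = 0" for F G c
    using assms by (auto simp: is_deriv_def)
  show z: "d 0 = 0" "d 1 = 0" using 0(3)[of 0] 0(3)[of 1] by simp_all
  show m: "d (- F) = - d F" for F using 0(1)[of F "- F"] z by (simp add: add_eq_0_iff)
  show "d (F - G) = d F - d G" using 0(1)[of F "- G"] m by simp
qed

lemma is_deriv_sum: "is_deriv d \<Longrightarrow> d (\<Sum>i\<in>A. f i) = (\<Sum>i\<in>A. d (f i))"
  by (induction A rule: infinite_finite_induct) (auto simp: is_deriv_simps)

lemma is_deriv_power: assumes "is_deriv d" shows "d (F ^ Suc n) = of_nat (Suc n) * F ^ n * d F"
  by (induction n) (auto simp: is_deriv_simps[OF assms] algebra_simps)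

lemma is_deriv_vanishes: "is_deriv d \<Longrightarrow> vanishes (Suc n) F \<Longrightarrow> vanishes n (d F)"
  by (auto simp: is_deriv_def)

text \<open>A derivation may lower the order by one, so the derived family is graded only after a
  shift of the index; the term of index 0 has to be split off.\<close>

lemma is_deriv_gsum:
  assumes "is_deriv d" "graded A"
  shows "d (gsum A) = d (A $ 0) + gsum (Abs_fps (\<lambda>n. d (A $ Suc n)))"
proof (rule eq_if_vanishes)
  fix N
  have g: "graded (Abs_fps (\<lambda>n. d (A $ Suc n)))"
    using assms by (simp add: graded_def is_deriv_vanishes)
  have "vanishes N (d (gsum A - (\<Sum>n<Suc N. A $ n)))"
    by (rule is_deriv_vanishes[OF assms(1)], rule gsum_cong[OF assms(2)])
  also have "d (gsum A - (\<Sum>n<Suc N. A $ n)) = d (gsum A) - d (A $ 0) - (\<Sum>n<N. d (A $ Suc n))"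
    by (simp add: is_deriv_simps[OF assms(1)] is_deriv_sum[OF assms(1)] sum.lessThan_Suc_shift del: sum.lessThan_Suc)
  finally have 1: "vanishes N (d (gsum A) - d (A $ 0) - (\<Sum>n<N. d (A $ Suc n)))" .
  have 2: "vanishes N (gsum (Abs_fps (\<lambda>n. d (A $ Suc n))) - (\<Sum>n<N. d (A $ Suc n)))"
    using gsum_cong[OF g, of N] by simp
  show "vanishes N (d (gsum A) - (d (A $ 0) + gsum (Abs_fps (\<lambda>n. d (A $ Suc n)))))"
    using vanishes_diff[OF 1 2] by (simp add: algebra_simps)
qed

lemma gsum_mult_const: "graded A \<Longrightarrow> gsum (Abs_fps (\<lambda>n. A $ n * c)) = gsum A * c"
  using gsum_mult[of A "fps_const c"] graded_const[of c]
  by (metis fps_ext fps_mult_right_const_nth fps_nth_Abs_fps gsum_const)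

lemma comp1_deriv:
  assumes "is_deriv d" "vanishes (Suc 0) g"
  shows "d (comp1 c g) = comp1 (fps_deriv c) g * d g"
proof -
  have e: "d (subst_coeffs const_fps2 g c $ Suc n) = subst_coeffs const_fps2 g (fps_deriv c) $ n * d g" for n
    by (simp add: subst_coeffs_def is_deriv_simps[OF assms(1)] is_deriv_power[OF assms(1)] algebra_simps
        flip: fps_of_nat del: of_nat_Suc power_Suc)
  have z: "d (subst_coeffs const_fps2 g c $ 0) = 0"
    by (simp add: subst_coeffs_def is_deriv_simps[OF assms(1)])
  show ?thesis
    unfolding comp1_def is_deriv_gsum[OF assms(1) graded_subst_coeffs[OF assms(2)]] e z
    by (simp add: gsum_mult_const graded_subst_coeffs assms)
qed

lemma gsum_shift:
  assumes "graded A" shows "gsum A = A $ 0 + gsum (Abs_fps (\<lambda>n. A $ Suc n))"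
proof (rule fps2_eqI)
  fix i j
  have "gsum A $ i $ j = (\<Sum>n\<le>Suc (i+j). A $ n $ i $ j)"
    by (rule gsum_eq_upto[OF assms]) simp
  also have "\<dots> = A $ 0 $ i $ j + (\<Sum>n\<le>i+j. A $ Suc n $ i $ j)"
    by (subst sum.atMost_Suc_shift) simp
  finally show "gsum A $ i $ j = (A $ 0 + gsum (Abs_fps (\<lambda>n. A $ Suc n))) $ i $ j"
    by (simp add: gsum_def)
qed

lemma subst2_deriv:
  assumes "is_deriv d" "vanishes (Suc 0) a" "vanishes (Suc 0) b"
  shows "d (subst2 F a b) = subst2 (fps_deriv F) a b * d a + subst2 (deriv2 F) a b * d b"
proof -
  let ?S = "subst_coeffs (\<lambda>f. comp1 f b) a"
  note dd = is_deriv_simps[OF assms(1)] comp1_deriv[OF assms(1,3)] is_deriv_power[OF assms(1)]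
  have h: "is_hom (\<lambda>f. comp1 f b)" by (rule is_hom_comp1[OF assms(3)])
  have g: "graded (?S H)" for H by (rule graded_subst_coeffs[OF assms(2)])
  have e: "Abs_fps (\<lambda>n. d (?S F $ Suc n)) = 
      Abs_fps (\<lambda>n. ?S (fps_deriv F) $ n * d a) + Abs_fps (\<lambda>n. ?S (deriv2 F) $ Suc n * d b)"
    by (rule fps_ext)
      (simp add: subst_coeffs_def dd deriv2_def is_hom_mult[OF h] is_hom_of_nat[OF h] algebra_simps del: of_nat_Suc power_Suc)
  have z: "d (?S F $ 0) = ?S (deriv2 F) $ 0 * d b"
    by (simp add: subst_coeffs_def dd deriv2_def)
  have "d (subst2 F a b) = d (?S F $ 0) + gsum (Abs_fps (\<lambda>n. d (?S F $ Suc n)))"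
    unfolding subst2_def by (rule is_deriv_gsum[OF assms(1) g])
  also have "\<dots> = gsum (Abs_fps (\<lambda>n. ?S (fps_deriv F) $ n * d a)) + 
     (Abs_fps (\<lambda>n. ?S (deriv2 F) $ n * d b) $ 0 + gsum (Abs_fps (\<lambda>n. ?S (deriv2 F) $ Suc n * d b)))"
    unfolding e z gsum_add by (simp add: algebra_simps)
  \<comment> \<open>In the part coming from the inner derivative the summands keep their order, so
    the term of index 0 can be put back.\<close>
  also have "Abs_fps (\<lambda>n. ?S (deriv2 F) $ n * d b) $ 0 + gsum (Abs_fps (\<lambda>n. ?S (deriv2 F) $ Suc n * d b))
     = gsum (Abs_fps (\<lambda>n. ?S (deriv2 F) $ n * d b))"
    using g by (subst (2) gsum_shift) (auto simp: graded_def intro!: vanishes_mult_left)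
  finally show ?thesis by (simp add: gsum_mult_const g subst2_def)
qed

subsection \<open>Embedding into iterated Laurent series\<close>

text \<open>Identities are proved for power series, where substitution is available, and moved along
  this embedding to the iterated Laurent series, where quotients are available.\<close>

definition to_fls2 :: "'a::comm_ring_1 fps2 \<Rightarrow> 'a fls2" where
  "to_fls2 F = fps_to_fls (Abs_fps (\<lambda>i. fps_to_fls (F $ i)))"

lemma fps_to_fls_sum: "fps_to_fls (\<Sum>i\<in>A. f i) = (\<Sum>i\<in>A. fps_to_fls (f i :: 'a::comm_ring_1 fps))"
  by (induction A rule: infinite_finite_induct) auto

lemma is_hom_fps_to_fls: "is_hom (fps_to_fls :: 'a::comm_ring_1 fps \<Rightarrow> _)"
  by (simp add: is_hom_def fls_times_fps_to_fls)

lemma is_hom_to_fls2: "is_hom (to_fls2 :: 'a::comm_ring_1 fps2 \<Rightarrow> _)"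
proof -
  let ?m = "\<lambda>F :: 'a fps2. Abs_fps (\<lambda>i. fps_to_fls (F $ i))"
  have "?m (F + G) = ?m F + ?m G" "?m (F * G) = ?m F * ?m G" "?m 1 = 1" for F G
    by (simp_all add: fps_eq_iff[where ?'a = "'a fls"] fps_mult_nth fps_to_fls_sum fls_times_fps_to_fls
        fps_one_nth del: fps_to_fls_nth)
  then show ?thesis
    by (simp add: is_hom_def to_fls2_def fls_times_fps_to_fls)
qed

lemmas to_fls2_simps = is_hom_simps[OF is_hom_to_fls2]

lemma to_fls2_inject [simp]: "to_fls2 F = to_fls2 G \<longleftrightarrow> F = G"
  by (auto simp: to_fls2_def fps_eq_iff[where ?'a = "'a fls"]) (simp add: fps_eq_iff[where ?'a = "'a fps"])

lemma to_fls2_eq_0_iff [simp]: "to_fls2 F = 0 \<longleftrightarrow> F = 0"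
  by (metis to_fls2_inject is_hom_0 is_hom_to_fls2)

lemma series2_to_fls2: "series2 c = to_fls2 (Abs_fps (\<lambda>i. Abs_fps (c i)))"
  by (simp add: series2_def series1_def to_fls2_def)

lemma coeff2_to_fls2 [simp]: "coeff2 (to_fls2 F) i j = F $ i $ j"
  by (simp add: coeff2_def to_fls2_def)

lemma at1_fps_to_fls: "at1 (fps_to_fls f) = to_fls2 (lift1 f)"
  by (intro fls_eqI) (simp add: at1.rep_eq to_fls2_def lift1_def)

lemma at2_fps_to_fls: "at2 (fps_to_fls f) = to_fls2 (lift2 f)"
proof -
  have "Abs_fps (\<lambda>i. fps_to_fls (lift2 f $ i)) = fps_const (fps_to_fls f)"
    by (rule fps_ext) simp
  then show ?thesis by (simp add: to_fls2_def at2_def)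
qed

lemma const2_to_fls2: "const2 c = to_fls2 (const_fps2 c)"
  using at2_fps_to_fls[of "fps_const c"] by (simp add: const2_def at2_def)

lemma t1_to_fls2: "t1 = to_fls2 (lift1 fps_X)"
  using at1_fps_to_fls[of fps_X] by (simp add: t1_def)

lemma t2_to_fls2: "t2 = to_fls2 (lift2 fps_X)"
  using at2_fps_to_fls[of fps_X] by (simp add: t2_def)

lemma is_hom_at2: "is_hom (at2 :: 'a::comm_ring_1 fls \<Rightarrow> _)"
  by (simp add: is_hom_def at2_def fls_plus_const)

lemma fls_subdegree_at1: "fls_subdegree (at1 f) = fls_subdegree (f :: 'a::comm_ring_1 fls)"
proof (cases "f = 0")
  case True
  then have "at1 f = 0" by (intro fls_eqI) (simp add: at1.rep_eq)
  then show ?thesis using True by simp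
next
  case False
  then show ?thesis
    by (intro fls_subdegree_eqI) (auto simp: at1.rep_eq)
qed

lemma is_hom_at1: "is_hom (at1 :: 'a::comm_ring_1 fls \<Rightarrow> _)"
proof -
  have c: "fls_const (\<Sum>i\<in>A. f i) = (\<Sum>i\<in>A. fls_const (f i :: 'a))" for A and f :: "int \<Rightarrow> 'a"
    by (induction A rule: infinite_finite_induct) (auto simp flip: fls_plus_const)
  have "at1 (f * g) = at1 f * at1 g" for f g :: "'a fls"
    by (intro fls_eqI) (simp add: at1.rep_eq fls_times_nth(1) fls_subdegree_at1 c)
  moreover have "at1 (f + g) = at1 f + at1 g" for f g :: "'a fls"
    by (intro fls_eqI) (simp add: at1.rep_eq fls_plus_const)
  moreover have "at1 (1 :: 'a fls) = 1"
    by (intro fls_eqI) (simp add: at1.rep_eq)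
  ultimately show ?thesis by (simp add: is_hom_def)
qed

lemma is_hom_inverse:
  fixes \<psi> :: "'a::field \<Rightarrow> 'b::field"
  assumes "is_hom \<psi>" shows "\<psi> (x / y) = \<psi> x / \<psi> y"
proof (cases "y = 0")
  case False
  then have 1: "\<psi> y * \<psi> (1 / y) = 1" using is_hom_mult[OF assms, of y "1 / y"] is_hom_1[OF assms] by simp
  have "\<psi> (x / y) = \<psi> x * \<psi> (1 / y)" using is_hom_mult[OF assms, of x "1 / y"] by simp
  then show ?thesis using 1 by (metis divide_inverse inverse_unique)
qed (simp add: is_hom_0[OF assms])

lemmas at_simps = is_hom_simps[OF is_hom_at1] is_hom_simps[OF is_hom_at2]
  is_hom_inverse[OF is_hom_at1] is_hom_inverse[OF is_hom_at2]

lemma at1_const: "at1 (fls_const c) = const2 c" and at2_const: "at2 (fls_const c) = const2 c"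
proof -
  show "at1 (fls_const c) = const2 c"
    by (intro fls_eqI) (simp add: at1.rep_eq const2_def)
  show "at2 (fls_const c) = const2 c"
    by (simp add: at2_def const2_def)
qed

lemma compose2_to_fls2:
  assumes "vanishes (Suc 0) g" shows "compose2 c (to_fls2 g) = to_fls2 (comp1 c g)"
proof -
  have "to_fls2 g ^ n = to_fls2 (g ^ n)" for n by (simp add: to_fls2_simps)
  then show ?thesis
    by (simp add: compose2_def series2_to_fls2 comp1_def gsum_def subst_coeffs_def)
qed

subsection \<open>Coefficient rings\<close>

text \<open>A subset of the coefficient field rather than a type: the same integrality lemmas are
  used with \<open>Z_mu\<close> and with \<open>Q_mu\<close>.\<close>

definition is_subring :: "'a::comm_ring_1 set \<Rightarrow> bool" where
  "is_subring A \<longleftrightarrow> 1 \<in> A \<and> (\<forall>x\<in>A. \<forall>y\<in>A. x - y \<in> A \<and> x * y \<in> A)"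

lemma is_subringD:
  assumes "is_subring A"
  shows "1 \<in> A" "0 \<in> A" "x \<in> A \<Longrightarrow> y \<in> A \<Longrightarrow> x - y \<in> A" "x \<in> A \<Longrightarrow> y \<in> A \<Longrightarrow> x * y \<in> A"
    "x \<in> A \<Longrightarrow> - x \<in> A" "x \<in> A \<Longrightarrow> y \<in> A \<Longrightarrow> x + y \<in> A"
proof -
  show 1: "1 \<in> A" and m: "x \<in> A \<Longrightarrow> y \<in> A \<Longrightarrow> x - y \<in> A" "x \<in> A \<Longrightarrow> y \<in> A \<Longrightarrow> x * y \<in> A" for x y
    using assms by (auto simp: is_subring_def)
  show 0: "0 \<in> A" using m(1)[OF 1 1] by simp
  show u: "x \<in> A \<Longrightarrow> - x \<in> A" for x using m(1)[OF 0, of x] by simp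
  show "x \<in> A \<Longrightarrow> y \<in> A \<Longrightarrow> x + y \<in> A" using m(1)[of x "- y"] u[of y] by simp
qed

lemma is_subring_sum: "is_subring A \<Longrightarrow> (\<And>i. i \<in> I \<Longrightarrow> f i \<in> A) \<Longrightarrow> sum f I \<in> A"
  by (induction I rule: infinite_finite_induct) (auto intro: is_subringD)

lemma is_subring_power: "is_subring A \<Longrightarrow> x \<in> A \<Longrightarrow> x ^ n \<in> A"
  by (induction n) (auto intro: is_subringD)

lemma is_subring_of_nat: "is_subring A \<Longrightarrow> of_nat n \<in> A"
  by (induction n) (auto intro: is_subringD)

lemma is_subring_numeral: "is_subring A \<Longrightarrow> numeral n \<in> A"
  using is_subring_of_nat[of A "numeral n"] by simp

lemmas is_subring_intros = is_subringD is_subring_sum is_subring_power is_subring_of_nat is_subring_numeral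

definition coeffs_in :: "'a::zero set \<Rightarrow> 'a fps set" where
  "coeffs_in A = {f. \<forall>n. f $ n \<in> A}"

lemma is_subring_coeffs_in: assumes "is_subring A" shows "is_subring (coeffs_in A)"
proof -
  have "(1 :: 'a fps) $ n \<in> A" for n using assms by (cases n) (auto intro: is_subringD)
  moreover have "f - g \<in> coeffs_in A" "f * g \<in> coeffs_in A" if "f \<in> coeffs_in A" "g \<in> coeffs_in A" for f g
    using that assms by (auto simp: coeffs_in_def fps_mult_nth intro!: is_subring_intros)
  ultimately show ?thesis
    unfolding is_subring_def by (auto simp: coeffs_in_def)
qed

abbreviation coeffs2_in :: "'a::zero set \<Rightarrow> 'a fps2 set" where
  "coeffs2_in A \<equiv> coeffs_in (coeffs_in A)"

lemma coeffs_in_const: "is_subring A \<Longrightarrow> c \<in> A \<Longrightarrow> fps_const c \<in> coeffs_in A"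
  by (auto simp: coeffs_in_def is_subringD)

lemma coeffs_in_X: "is_subring A \<Longrightarrow> fps_X \<in> coeffs_in A"
  by (auto simp: coeffs_in_def fps_X_def is_subringD)

text \<open>The coefficients of the inverse solve a recursion in which the only division is by the
  leading coefficient, that is, multiplication by c.\<close>

lemma coeffs_in_inverse:
  fixes f g :: "'a::comm_ring_1 fps"
  assumes "is_subring A" "f \<in> coeffs_in A" "f * g = 1" "c \<in> A" "f $ 0 * c = 1"
  shows "g \<in> coeffs_in A"
proof -
  have "g $ n \<in> A" for n
  proof (induction n rule: less_induct)
    case (less n)
    have "(\<Sum>i\<le>n. f $ i * g $ (n - i)) = (1 :: 'a fps) $ n"
      using assms(3) by (metis fps_mult_nth atLeast0AtMost)
    then have "f $ 0 * g $ n = (1 :: 'a fps) $ n - (\<Sum>i\<in>{1..n}. f $ i * g $ (n - i))"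
      by (simp add: atMost_atLeast0 sum.atLeast_Suc_atMost[of 0] algebra_simps)
    then have "c * (f $ 0 * g $ n) = c * ((1 :: 'a fps) $ n - (\<Sum>i\<in>{1..n}. f $ i * g $ (n - i)))"
      by simp
    moreover have "c * (f $ 0 * g $ n) = g $ n"
      using assms(5) by (metis mult.commute mult.left_commute mult_1)
    moreover have "(1 :: 'a fps) $ n \<in> A" using assms(1) by (cases n) (auto intro: is_subringD)
    ultimately show ?case
      using assms less by (auto simp: coeffs_in_def intro!: is_subring_intros)
  qed
  then show ?thesis by (simp add: coeffs_in_def)
qed

text \<open>Geometric series in \<open>1 - F\<close>, which has no constant term.\<close>

lemma fps2_unit: 
  fixes F :: "'a::comm_ring_1 fps2"
  assumes "F $ 0 $ 0 = 1" shows "\<exists>G. F * G = 1"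
proof -
  have v: "vanishes (Suc 0) (1 - F)" using assms by (auto simp: vanishes_def)
  note h = is_hom_simps[OF is_hom_comp1[OF v]]
  define E where "E = comp1 (Abs_fps (\<lambda>_. 1)) (1 - F)"
  have "(1 - fps_X) * Abs_fps (\<lambda>_. 1 :: 'a) = 1"
    by (rule fps_ext) (auto simp: fps_X_mult_nth algebra_simps)
  then have "comp1 ((1 - fps_X) * Abs_fps (\<lambda>_. 1)) (1 - F) = 1" by (simp add: h)
  then have "F * E = 1" by (simp add: h comp1_X[OF v] E_def)
  then show ?thesis ..
qed

lemma coeffs2_in_inverse:
  fixes F G :: "'a::comm_ring_1 fps2"
  assumes "is_subring A" "F \<in> coeffs2_in A" "F * G = 1" "F $ 0 $ 0 = 1"
  shows "G \<in> coeffs2_in A"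
proof -
  have 1: "F $ 0 * G $ 0 = 1" using assms(3) by (metis fps_mult_nth_0 fps_one_nth)
  have "G $ 0 \<in> coeffs_in A"
    by (rule coeffs_in_inverse[of _ "F $ 0" _ 1])
      (use assms 1 in \<open>auto simp: coeffs_in_def is_subringD\<close>)
  then show ?thesis
    using assms 1 by (intro coeffs_in_inverse[of "coeffs_in A" F G "G $ 0"] is_subring_coeffs_in)
qed

lemma coeffs2_in_lift1: "is_subring A \<Longrightarrow> f \<in> coeffs_in A \<Longrightarrow> lift1 f \<in> coeffs2_in A"
  and coeffs2_in_lift2: "is_subring A \<Longrightarrow> f \<in> coeffs_in A \<Longrightarrow> lift2 f \<in> coeffs2_in A"
  by (auto simp: coeffs_in_def is_subringD)

lemma power_series1_iff: "fps_to_fls f \<in> power_series1 A \<longleftrightarrow> f \<in> coeffs_in A"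
proof -
  have "f = Abs_fps (\<lambda>j. f $ j)" by (simp add: fps_eq_iff)
  then show ?thesis
    by (force simp: power_series1_def series1_def coeffs_in_def)
qed

lemma power_series2_iff: "to_fls2 F \<in> power_series2 A \<longleftrightarrow> F \<in> coeffs2_in A"
proof -
  have "F = Abs_fps (\<lambda>i. Abs_fps (\<lambda>j. F $ i $ j))" by (simp add: fps_eq_iff)
  then show ?thesis
    by (force simp: power_series2_def series2_to_fls2 coeffs_in_def)
qed

lemma terms_from1_iff: "fps_to_fls f \<in> terms_from1 d \<longleftrightarrow> (\<forall>n<d. f $ n = 0)"
proof -
  have "f = Abs_fps (\<lambda>j. f $ j)" by (simp add: fps_eq_iff)
  then show ?thesis
    by (force simp: terms_from1_def series1_def)
qed

lemma terms_from2_iff: "to_fls2 F \<in> terms_from2 d \<longleftrightarrow> vanishes d F"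
proof -
  have "F = Abs_fps (\<lambda>i. Abs_fps (\<lambda>j. F $ i $ j))" by (simp add: fps_eq_iff)
  then show ?thesis
    by (force simp: terms_from2_def series2_to_fls2 vanishes_def)
qed

subsection \<open>Division by a linear factor\<close>

text \<open>A linear factor monic in the outer variable can be cancelled without leaving the
  coefficient ring. Comparing coefficients expresses \<open>G $ k\<close> by the product and by
  \<open>h * G $ Suc k\<close>; as h has no constant term, the latter involves, at inner index j,
  only coefficients of G of smaller inner index.\<close>

lemma coeffs2_in_cancel:
  fixes G :: "'a::comm_ring_1 fps2"
  assumes A: "is_subring A" and h: "h \<in> coeffs_in A" "h $ 0 = 0"
    and F: "(lift1 fps_X - lift2 h) * G \<in> coeffs2_in A"
  shows "G \<in> coeffs2_in A"
proof -
  have X: "lift1 fps_X = (fps_X :: 'a fps2)"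
    by (auto simp: fps_eq_iff lift1_def fps_X_def)
  have G: "G $ k = ((lift1 fps_X - lift2 h) * G) $ Suc k + h * G $ Suc k" for k
    by (simp add: X left_diff_distrib)
  have "G $ k $ j \<in> A" for k j
  proof (induction j arbitrary: k rule: less_induct)
    case (less j)
    have "(h * G $ Suc k) $ j = (\<Sum>l\<in>{1..j}. h $ l * G $ Suc k $ (j - l))"
      using h by (simp add: fps_mult_nth sum.atLeast_Suc_atMost[of 0])
    also have "\<dots> \<in> A" using less h A by (auto simp: coeffs_in_def intro!: is_subring_intros)
    finally have "(h * G $ Suc k) $ j \<in> A" .
    moreover have "((lift1 fps_X - lift2 h) * G) $ Suc k $ j \<in> A" using F by (simp add: coeffs_in_def)
    ultimately show ?case by (subst G) (simp add: A is_subringD)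
  qed
  then show ?thesis by (simp add: coeffs_in_def)
qed

text \<open>The hypothesis states, degree by degree, that F vanishes on the diagonal.\<close>

lemma diagonal_zero_divide:
  fixes F :: "'a::comm_ring_1 fps2"
  assumes "\<And>n. (\<Sum>k\<le>n. F $ k $ (n - k)) = 0"
  shows "\<exists>G. F = (lift1 fps_X - lift2 fps_X) * G"
proof -
  have X: "lift1 fps_X = (fps_X :: 'a fps2)"
    by (auto simp: fps_eq_iff lift1_def fps_X_def)
  \<comment> \<open>Division by the difference of the variables telescopes along each antidiagonal,
    so the quotient consists of negated partial sums; it ends at the edge because the full sum is
    0.\<close>
  define G where "G = Abs_fps (\<lambda>i. Abs_fps (\<lambda>j. - (\<Sum>k\<le>i. F $ k $ (i + j + 1 - k))))"
  have "F $ i $ j = ((lift1 fps_X - lift2 fps_X) * G) $ i $ j" for i j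
  proof -
    have e: "((lift1 fps_X - lift2 fps_X) * G) $ i $ j = 
       (if i = 0 then 0 else G $ (i - 1) $ j) - (if j = 0 then 0 else G $ i $ (j - 1))"
      by (simp add: X left_diff_distrib)
    show ?thesis
    proof (cases i)
      case 0
      then show ?thesis unfolding e using assms[of 0] by (auto simp: G_def)
    next
      case (Suc i')
      then show ?thesis unfolding e using assms[of i] by (auto simp: G_def algebra_simps add_eq_0_iff)
    qed
  qed
  then show ?thesis by (intro exI[of _ G] fps2_eqI)
qed

subsection \<open>Hurwitz series in two variables\<close>

text \<open>The bound on the degree supports induction: coefficients of degree N + 1 are controlled
  by the two partial derivatives up to degree N, and these may involve the series itself.\<close>

definition hurwitz_upto :: "'a::field_char_0 set \<Rightarrow> nat \<Rightarrow> 'a fps2 \<Rightarrow> bool" where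
  "hurwitz_upto A N F \<longleftrightarrow> (\<forall>i j. i + j \<le> N \<longrightarrow> F $ i $ j * (fact i * fact j) \<in> A)"

definition hurwitz2 :: "'a::field_char_0 set \<Rightarrow> 'a fps2 \<Rightarrow> bool" where
  "hurwitz2 A F \<longleftrightarrow> (\<forall>N. hurwitz_upto A N F)"

lemma hurwitz_series2_iff: "to_fls2 F \<in> hurwitz_series2 A \<longleftrightarrow> hurwitz2 A F"
proof
  assume "to_fls2 F \<in> hurwitz_series2 A"
  then show "hurwitz2 A F"
    by (auto simp: hurwitz_series2_def series2_to_fls2 hurwitz2_def hurwitz_upto_def)
next
  assume *: "hurwitz2 A F"
  have "F = Abs_fps (\<lambda>i. Abs_fps (\<lambda>j. (F $ i $ j * (fact i * fact j)) / (fact i * fact j)))"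
    by (simp add: fps_eq_iff)
  moreover have "\<forall>i j. F $ i $ j * (fact i * fact j) \<in> A" 
    using * by (auto simp: hurwitz2_def hurwitz_upto_def)
  ultimately show "to_fls2 F \<in> hurwitz_series2 A"
    unfolding hurwitz_series2_def series2_to_fls2 mem_Collect_eq
    by (intro exI[of _ "\<lambda>i j. F $ i $ j * (fact i * fact j)"]) simp
qed

lemma hurwitz_upto_mono: "hurwitz_upto A N F \<Longrightarrow> M \<le> N \<Longrightarrow> hurwitz_upto A M F"
  by (auto simp: hurwitz_upto_def)

lemma hurwitz_upto_mult:
  assumes A: "is_subring A" and F: "hurwitz_upto A N F" and G: "hurwitz_upto A N G"
  shows "hurwitz_upto A N (F * G)"
  unfolding hurwitz_upto_def
proof (intro allI impI)
  fix i j assume ij: "i + j \<le> N"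
  have "(F * G) $ i $ j * (fact i * fact j) = (\<Sum>k\<le>i. \<Sum>l\<le>j. of_nat (i choose k) * of_nat (j choose l) *
     ((F $ k $ l * (fact k * fact l)) * (G $ (i - k) $ (j - l) * (fact (i - k) * fact (j - l)))))"
    unfolding fps2_mult_nth sum_distrib_right
  proof (intro sum.cong refl)
    fix k l assume "k \<in> {..i}" "l \<in> {..j}"
    \<comment> \<open>The factorials recombine into binomial coefficients, which are
      integers.\<close>
    then have e: "of_nat (i choose k) * fact k * fact (i - k) = (fact i :: 'a)"
      "of_nat (j choose l) * fact l * fact (j - l) = (fact j :: 'a)"
      by (simp_all add: binomial_fact)
    show "F $ k $ l * G $ (i - k) $ (j - l) * (fact i * fact j) = of_nat (i choose k) * of_nat (j choose l) *
     ((F $ k $ l * (fact k * fact l)) * (G $ (i - k) $ (j - l) * (fact (i - k) * fact (j - l))))"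
      unfolding e[symmetric] by (simp only: mult_ac)
  qed
  also have "\<dots> \<in> A"
  proof (intro is_subring_sum[OF A])
    fix k l assume "k \<in> {..i}" "l \<in> {..j}"
    then have "F $ k $ l * (fact k * fact l) \<in> A" "G $ (i - k) $ (j - l) * (fact (i - k) * fact (j - l)) \<in> A"
      using F G ij by (auto simp: hurwitz_upto_def)
    then show "of_nat (i choose k) * of_nat (j choose l) *
     ((F $ k $ l * (fact k * fact l)) * (G $ (i - k) $ (j - l) * (fact (i - k) * fact (j - l)))) \<in> A"
      using A by (simp add: is_subringD is_subring_of_nat)
  qed
  finally show "(F * G) $ i $ j * (fact i * fact j) \<in> A" .
qed

lemma hurwitz2_mult: "is_subring A \<Longrightarrow> hurwitz2 A F \<Longrightarrow> hurwitz2 A G \<Longrightarrow> hurwitz2 A (F * G)"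
  by (auto simp: hurwitz2_def hurwitz_upto_mult)

lemma is_subring_hurwitz2: assumes "is_subring A" shows "is_subring {F. hurwitz2 A F}"
  using assms
  by (auto simp: is_subring_def[of "{F. hurwitz2 A F}"] hurwitz2_mult)
     (auto simp: hurwitz2_def hurwitz_upto_def left_diff_distrib is_subringD fps_one_nth)

lemma hurwitz2_coeffs2_in: "is_subring A \<Longrightarrow> F \<in> coeffs2_in A \<Longrightarrow> hurwitz2 A F"
  unfolding hurwitz2_def hurwitz_upto_def coeffs_in_def
  by (metis (no_types, lifting) mem_Collect_eq is_subringD(4) is_subring_of_nat of_nat_fact)

lemma hurwitz_upto_Suc:
  assumes "F $ 0 $ 0 \<in> A" "hurwitz_upto A N (fps_deriv F)" "hurwitz_upto A N (deriv2 F)"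
  shows "hurwitz_upto A (Suc N) F"
  unfolding hurwitz_upto_def
proof (intro allI impI)
  fix i j assume ij: "i + j \<le> Suc N"
  consider "i = 0" "j = 0" | i' where "i = Suc i'" | j' where "i = 0" "j = Suc j'" by (cases i; cases j) auto
  then show "F $ i $ j * (fact i * fact j) \<in> A"
  proof cases
    case 1 then show ?thesis using assms(1) by simp
  next
    case (2 i')
    then have "fps_deriv F $ i' $ j * (fact i' * fact j) \<in> A" using assms(2) ij by (auto simp: hurwitz_upto_def)
    then show ?thesis using 2 by (simp add: algebra_simps fps_of_nat[symmetric] flip: fps_of_nat)
  next
    case (3 j')
    then have "i + j' \<le> N" using ij by simp
    then have *: "deriv2 F $ i $ j' * (fact i * fact j') \<in> A" using assms(3) by (simp only: hurwitz_upto_def)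
    then have "F $ i $ j * (fact i * fact j) \<in> A \<longleftrightarrow> deriv2 F $ i $ j' * (fact i * fact j') \<in> A"
      using 3 by (simp add: deriv2_def mult_ac)
    then show ?thesis using * by blast
  qed
qed

lemma hurwitz2I:
  assumes "F $ 0 $ 0 \<in> A" "hurwitz2 A (fps_deriv F)" "hurwitz2 A (deriv2 F)"
  shows "hurwitz2 A F"
proof -
  have "hurwitz_upto A (Suc N) F" for N
    using assms by (intro hurwitz_upto_Suc) (simp_all add: hurwitz2_def)
  then show ?thesis
    unfolding hurwitz2_def using hurwitz_upto_mono[of A "Suc _" F] by (metis le_SucI order_refl)
qed

lemma hurwitz2_deriv1: assumes "hurwitz2 A F" shows "hurwitz2 A (fps_deriv F)"
  unfolding hurwitz2_def hurwitz_upto_def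
proof (intro allI impI)
  fix i j
  have "F $ Suc i $ j * (fact (Suc i) * fact j) \<in> A" using assms unfolding hurwitz2_def hurwitz_upto_def by blast
  moreover have "fps_deriv F $ i $ j * (fact i * fact j) = F $ Suc i $ j * (fact (Suc i) * fact j)"
    by (simp add: mult_ac flip: fps_of_nat del: of_nat_Suc) 
  ultimately show "fps_deriv F $ i $ j * (fact i * fact j) \<in> A" by (simp only:)
qed

lemma hurwitz2_deriv2: assumes "hurwitz2 A F" shows "hurwitz2 A (deriv2 F)"
  unfolding hurwitz2_def hurwitz_upto_def
proof (intro allI impI)
  fix i j
  have "F $ i $ Suc j * (fact i * fact (Suc j)) \<in> A" using assms unfolding hurwitz2_def hurwitz_upto_def by blast
  moreover have "deriv2 F $ i $ j * (fact i * fact j) = F $ i $ Suc j * (fact i * fact (Suc j))"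
    by (simp add: mult_ac deriv2_def del: of_nat_Suc) 
  ultimately show "deriv2 F $ i $ j * (fact i * fact j) \<in> A" by (simp only:)
qed

text \<open>The denominator disappears in both partial derivatives, which are \<open>F ^ n\<close>
  times a derivative of F. This is what makes termwise integrals Hurwitz integral.\<close>

lemma hurwitz2_divided_power:
  assumes A: "is_subring A" and F: "hurwitz2 A F" "F $ 0 $ 0 = 0"
  shows "hurwitz2 A (const_fps2 (1 / of_nat (Suc n)) * F ^ Suc n)"
proof -
  have d: "d (const_fps2 (1 / of_nat (Suc n)) * F ^ Suc n) = F ^ n * d F" if "is_deriv d" for d
  proof -
    have "const_fps2 (1 / of_nat (Suc n)) * (of_nat (Suc n) :: 'a fps2) = 1"
      by (simp add: fps_of_nat[symmetric] del: of_nat_Suc)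
    then show ?thesis 
      unfolding is_deriv_simps[OF that] is_deriv_power[OF that] by (simp add: mult.assoc[symmetric] del: of_nat_Suc)
  qed
  have p: "hurwitz2 A (F ^ n)" using is_subring_power[OF is_subring_hurwitz2[OF A], of F n] F by simp
  show ?thesis
  proof (rule hurwitz2I)
    show "(const_fps2 (1 / of_nat (Suc n)) * F ^ Suc n) $ 0 $ 0 \<in> A"
      using F A by (simp add: is_subringD)
    show "hurwitz2 A (fps_deriv (const_fps2 (1 / of_nat (Suc n)) * F ^ Suc n))"
      unfolding d[OF is_deriv_deriv1] using A F by (intro hurwitz2_mult p hurwitz2_deriv1)
    show "hurwitz2 A (deriv2 (const_fps2 (1 / of_nat (Suc n)) * F ^ Suc n))"
      unfolding d[OF is_deriv_deriv2] using A F by (intro hurwitz2_mult p hurwitz2_deriv2)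
  qed
qed

lemma comp1_nth_0_0: "comp1 c g $ 0 $ 0 = c $ 0"
  by (simp add: comp1_def gsum_def subst_coeffs_def)

text \<open>The partial derivatives are the exponential itself times those of G, so integrality up
  to degree N gives degree N + 1.\<close>

lemma hurwitz2_exp:
  assumes A: "is_subring A" and G: "hurwitz2 A G" "G $ 0 $ 0 = 0"
  shows "hurwitz2 A (comp1 (fps_exp 1) G)"
proof -
  have v: "vanishes (Suc 0) G" using G by (simp add: vanishes_def)
  have "hurwitz_upto A N (comp1 (fps_exp 1) G)" for N
  proof (induction N)
    case 0
    then show ?case using A by (simp add: hurwitz_upto_def comp1_nth_0_0 is_subringD)
  next
    case (Suc N)
    have d: "d (comp1 (fps_exp 1) G) = comp1 (fps_exp 1) G * d G" if "is_deriv d" for d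
      using comp1_deriv[OF that v, of "fps_exp 1"] by simp
    show ?case
    proof (rule hurwitz_upto_Suc)
      show "comp1 (fps_exp 1) G $ 0 $ 0 \<in> A" using A by (simp add: comp1_nth_0_0 is_subringD)
      show "hurwitz_upto A N (fps_deriv (comp1 (fps_exp 1) G))"
        unfolding d[OF is_deriv_deriv1] 
        using Suc hurwitz2_deriv1[OF G(1)] by (intro hurwitz_upto_mult A) (auto simp: hurwitz2_def)
      show "hurwitz_upto A N (deriv2 (comp1 (fps_exp 1) G))"
        unfolding d[OF is_deriv_deriv2] 
        using Suc hurwitz2_deriv2[OF G(1)] by (intro hurwitz_upto_mult A) (auto simp: hurwitz2_def)
    qed
  qed
  then show ?thesis by (simp add: hurwitz2_def)
qed

section \<open>The expansions at infinity\<close>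

text \<open>For fixed s the equation at infinity is the quadratic equation
  \<open>a T^2 + b T = s\<close> in the parameter, with these coefficients. Its roots are the
  parameters t and t' of the two points with the same x-coordinate; many of the formulas below are
  Vieta's.\<close>

definition curve_a :: "(nat \<Rightarrow> 'b::comm_ring_1) \<Rightarrow> 'b \<Rightarrow> 'b" where
  "curve_a m s = 1 + m 2 * s + m 4 * s^2 + m 6 * s^3"

definition curve_b :: "(nat \<Rightarrow> 'b::comm_ring_1) \<Rightarrow> 'b \<Rightarrow> 'b" where
  "curve_b m s = m 1 * s + m 3 * s^2"

text \<open>The difference quotient in s of \<open>s - a(s) t^2 - b(s) t\<close> at fixed t. For t
  without constant term it has constant term 1 and is a unit.\<close>

definition chord_den :: "(nat \<Rightarrow> 'b::comm_ring_1) \<Rightarrow> 'b \<Rightarrow> 'b \<Rightarrow> 'b \<Rightarrow> 'b" where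
  "chord_den m t s s' = 1 - t * (m 1 + m 3 * (s + s')) - t^2 * (m 2 + m 4 * (s + s') + m 6 * (s^2 + s * s' + s'^2))"

lemma chord_identity:
  "s = curve_a m s * t^2 + curve_b m s * t \<Longrightarrow>
     (s - s') * chord_den m t s s' = curve_a m s' * t^2 + curve_b m s' * t - s'"
proof -
  have "(s - s') * chord_den m t s s' = 
      (s - (curve_a m s * t^2 + curve_b m s * t)) + (curve_a m s' * t^2 + curve_b m s' * t - s')"
    by (simp add: curve_a_def curve_b_def chord_den_def algebra_simps power2_eq_square power3_eq_cube)
  then show "s = curve_a m s * t^2 + curve_b m s * t \<Longrightarrow>
     (s - s') * chord_den m t s s' = curve_a m s' * t^2 + curve_b m s' * t - s'" by simp
qed

text \<open>The difference of two solutions is annihilated by \<open>chord_den\<close>, whose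
  constant term is 1.\<close>

lemma curve_eq_unique:
  fixes f g :: "'a::field fps"
  assumes "\<tau> $ 0 = 0"
    and "f = curve_a m f * \<tau>^2 + curve_b m f * \<tau>"
    and "g = curve_a m g * \<tau>^2 + curve_b m g * \<tau>"
  shows "f = g"
proof -
  have "(f - g) * chord_den m \<tau> f g = 0"
    unfolding chord_identity[OF assms(2)] using assms(3) by simp
  moreover have "chord_den m \<tau> f g $ 0 = 1"
    using assms(1) by (simp add: chord_den_def power2_eq_square)
  then have "chord_den m \<tau> f g \<noteq> 0" by auto
  ultimately show ?thesis by simp
qed

text \<open>Inversion of \<open>1 + c2 X^2 + ...\<close> up to degree 5: the negated coefficients
  are corrected only by the square of \<open>c2 X^2\<close> and by the cross term
  \<open>2 c2 c3 X^5\<close>.\<close>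

lemma reciprocal_expansion:
  fixes f :: "'a::field_char_0 fps"
  assumes "f $ 0 = 1" "f $ Suc 0 = 0" "f $ 2 = c2" "f $ 3 = c3" "f $ 4 = c4" "f $ 5 = c5" "n < 6"
  shows "(f * (1 - fps_const c2 * fps_X^2 - fps_const c3 * fps_X^3 - fps_const (c4 - c2^2) * fps_X^4
      - fps_const (c5 - 2 * c2 * c3) * fps_X^5)) $ n = (if n = 0 then 1 else 0)"
proof -
  have f: "f $ Suc (Suc 0) = c2" "f $ Suc (Suc (Suc 0)) = c3" "f $ Suc (Suc (Suc (Suc 0))) = c4" 
    "f $ Suc (Suc (Suc (Suc (Suc 0)))) = c5"
    using assms(3-6) by (simp_all add: numeral_eq_Suc)
  have "n = 0 \<or> n = Suc 0 \<or> n = 2 \<or> n = 3 \<or> n = 4 \<or> n = 5" using assms(7) by linarith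
  then show ?thesis
    unfolding right_diff_distrib mult.left_commute[of f "fps_const _"] fps_sub_nth fps_mult_left_const_nth 
      fps_X_power_mult_right_nth mult_1_right
    by (elim disjE) (simp_all add: assms(1,2) f numeral_eq_Suc algebra_simps)
qed

text \<open>The field stays arbitrary because the formal identities are needed twice, for the
  indeterminates \<open>mu\<close> and for complex coefficients.\<close>

locale weierstrass_coeffs =
  fixes \<mu> :: "nat \<Rightarrow> 'a::field_char_0"
begin

abbreviation m :: "nat \<Rightarrow> 'a fps" where "m j \<equiv> fps_const (\<mu> j)"
abbreviation m2 :: "nat \<Rightarrow> 'a fps2" where "m2 j \<equiv> const_fps2 (\<mu> j)"

definition step :: "'a fps \<Rightarrow> 'a fps" where
  "step s = curve_a m s * fps_X^2 + curve_b m s * fps_X"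

text \<open>Each term of \<open>step\<close> carries a factor \<open>fps_X\<close>, so every
  application determines one more coefficient: a contraction.\<close>

lemma step_cong:
  assumes "\<And>i. i < n \<Longrightarrow> f $ i = g $ i" "i \<le> n" shows "step f $ i = step g $ i"
proof -
  have eq: "(F * H) $ i = (G * K) $ i" if "\<And>i. i < n \<Longrightarrow> F $ i = G $ i" "\<And>i. i < n \<Longrightarrow> H $ i = K $ i" "i < n" 
    for F G H K :: "'a fps" and i
    unfolding fps_mult_nth by (intro sum.cong) (use that in auto)
  note p = eq[OF assms(1) assms(1)] eq[OF assms(1) eq[OF assms(1) assms(1)]]
  have ab: "curve_a m f $ i = curve_a m g $ i" "curve_b m f $ i = curve_b m g $ i" if "i < n" for i
    unfolding curve_a_def curve_b_def power2_eq_square power3_eq_cube using that p assms(1)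
    by (simp_all add: mult.assoc)
  show ?thesis
    using assms(2) by (auto simp: step_def fps_X_power_mult_right_nth ab)
qed

definition iterate :: "nat \<Rightarrow> 'a fps" where "iterate n = (step ^^ n) 0"

lemma iterate_stable: "i < n \<Longrightarrow> iterate (Suc n) $ i = iterate n $ i"
proof (induction n arbitrary: i)
  case (Suc n)
  have "step (iterate (Suc n)) $ i = step (iterate n) $ i"
    by (rule step_cong[of n]) (use Suc in auto)
  then show ?case by (simp add: iterate_def)
qed simp

lemma iterate_stable': "i < n \<Longrightarrow> n \<le> k \<Longrightarrow> iterate k $ i = iterate n $ i"
  by (rotate_tac 1, induction k rule: dec_induct) (simp_all add: iterate_stable)

text \<open>Coefficientwise limit of the iterates. That every coefficient already occurs in some
  iterate is recorded because it yields the integrality of the solution.\<close>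

lemma ex_solution: "\<exists>s. s = step s \<and> (\<forall>n. \<exists>k. s $ n = iterate k $ n)"
proof -
  define s where "s = Abs_fps (\<lambda>n. iterate (Suc n) $ n)"
  have *: "s $ i = iterate k $ i" if "i < k" for i k
    using iterate_stable'[of i "Suc i" k] that by (simp add: s_def)
  have "s $ n = step s $ n" for n
  proof -
    have "step s $ n = step (iterate n) $ n" by (rule step_cong[of n]) (use * in auto)
    also have "\<dots> = iterate (Suc n) $ n" by (simp add: iterate_def)
    finally show ?thesis by (simp add: s_def)
  qed
  then have "s = step s" by (rule fps_ext)
  moreover have "\<exists>k. s $ n = iterate k $ n" for n using *[of n "Suc n"] by blast
  ultimately show ?thesis by blast
qed

definition S :: "'a fps" where "S = s_ser \<mu>"

lemma S_eq_iff: "s_ser \<mu> = (THE s. s = step s)"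
  by (simp add: s_ser_def step_def curve_a_def curve_b_def)

lemma S_eq: "S = curve_a m S * fps_X^2 + curve_b m S * fps_X"
  and S_iterate: "\<exists>k. S $ n = iterate k $ n"
proof -
  obtain s where s: "s = step s" "\<forall>n. \<exists>k. s $ n = iterate k $ n" using ex_solution by blast
  have "S = s" unfolding S_def S_eq_iff
  proof (rule the_equality)
    show "s = step s" by (fact s(1))
    show "f = s" if "f = step f" for f
      using curve_eq_unique[of fps_X f m s] that s(1) unfolding step_def by simp
  qed
  then show "S = curve_a m S * fps_X^2 + curve_b m S * fps_X" "\<exists>k. S $ n = iterate k $ n"
    using s unfolding step_def by blast+
qed

text \<open>By uniqueness every solution of the equation in another parameter is a reparametrization
  of S. This will give x<t'> = x<t> and the expansion in the analytic coordinate.\<close>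

lemma S_compose:
  assumes "\<tau> $ 0 = 0" "f = curve_a m f * \<tau>^2 + curve_b m f * \<tau>" shows "S oo \<tau> = f"
proof (rule curve_eq_unique[OF assms(1) _ assms(2)])
  have "S oo \<tau> = (curve_a m S * fps_X^2 + curve_b m S * fps_X) oo \<tau>" using S_eq by simp
  then show "S oo \<tau> = curve_a m (S oo \<tau>) * \<tau>^2 + curve_b m (S oo \<tau>) * \<tau>"
    using assms(1) by (simp add: curve_a_def curve_b_def fps_compose_add_distrib fps_compose_mult_distrib fps_compose_power[OF assms(1), symmetric])
qed

lemma S_low: "S $ 0 = 0" "S $ Suc 0 = 0" "S $ 2 = 1" "S $ 3 = \<mu> 1" "S $ 4 = \<mu> 1 ^ 2 + \<mu> 2"
  "S $ 5 = \<mu> 1 ^ 3 + 2 * \<mu> 1 * \<mu> 2 + \<mu> 3"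
proof -
  have g: "S $ n = (if n < 2 then 0 else curve_a m S $ (n - 2)) + (if n = 0 then 0 else curve_b m S $ (n - 1))" for n
    by (subst S_eq) (simp add: fps_X_power_mult_right_nth)
  show 0: "S $ 0 = 0" by (subst g) simp
  note simps = curve_a_def curve_b_def power2_eq_square power3_eq_cube fps_mult_nth numeral_eq_Suc algebra_simps
  show 1: "S $ Suc 0 = 0" by (subst g) (simp add: simps 0)
  show 2: "S $ 2 = 1" by (subst g) (simp add: simps 0 1)
  note s2 = 2[unfolded numeral_2_eq_2]
  show 3: "S $ 3 = \<mu> 1" by (subst g) (simp add: simps 0 1 s2)
  note s3 = 3[unfolded numeral_3_eq_3]
  show 4: "S $ 4 = \<mu> 1 ^ 2 + \<mu> 2" by (subst g) (simp add: simps 0 1 s2 s3)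
  have s4: "S $ Suc (Suc (Suc (Suc 0))) = \<mu> 1 ^ 2 + \<mu> 2" using 4 by (simp add: numeral_eq_Suc)
  show 5: "S $ 5 = \<mu> 1 ^ 3 + 2 * \<mu> 1 * \<mu> 2 + \<mu> 3" by (subst g) (simp add: simps 0 1 s2 s3 s4)
qed

lemma S_nonzero: "S \<noteq> 0" using S_low(3) by auto

definition a :: "'a fps" where "a = curve_a m S"
definition b :: "'a fps" where "b = curve_b m S"

lemma S_ab: "S = a * fps_X^2 + b * fps_X" using S_eq by (simp add: a_def b_def)

lemma a_0: "a $ 0 = 1" by (simp add: a_def curve_a_def S_low power2_eq_square power3_eq_cube)

lemma a_nonzero: "a \<noteq> 0" using a_0 by auto

text \<open>Vieta: the product of the roots t and t' of the quadratic equation is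
  \<open>- S / a\<close>.\<close>

definition T' :: "'a fps" where "T' = - fps_shift 1 S * inverse a"

lemma aT': "a * T' * fps_X = - S"
proof -
  have "fps_shift 1 S * fps_X = S"
    using S_low by (intro fps_ext) (auto simp: fps_mult_fps_X_commute)
  moreover have "a * inverse a = 1" by (simp add: inverse_mult_eq_1' a_0)
  moreover have "a * T' * fps_X = - ((a * inverse a) * (fps_shift 1 S * fps_X))"
    unfolding T'_def by (simp only: mult_minus_left mult_minus_right mult_ac)
  ultimately show ?thesis by simp
qed

lemma sum_T': "a * (fps_X + T') = - b"
proof -
  have "fps_X * (a * (fps_X + T')) = fps_X * (- b)"
    using aT' S_ab by algebra
  then show ?thesis by (simp only: mult_cancel_left fps_X_neq_zero) auto
qed

lemma T'_eq: "S = a * T'^2 + b * T'"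
proof -
  have "fps_X^2 * a * S = fps_X^2 * a * (a * T'^2 + b * T')"
    using aT' S_ab by algebra
  then show ?thesis using a_nonzero by simp
qed

lemma T'_low: "T' $ 0 = 0" "T' $ Suc 0 = - 1"
proof -
  have "S $ Suc (Suc 0) = 1" using S_low(3) unfolding numeral_2_eq_2 .
  then show "T' $ 0 = 0" "T' $ Suc 0 = - 1"
    using a_0 by (simp_all add: T'_def S_low(1,2) fps_mult_nth)
qed

lemma S_compose_T': "S oo T' = S"
  by (rule S_compose[OF T'_low(1)]) (rule T'_eq[unfolded a_def b_def])

text \<open>\<open>W\<close> is 1 minus the s-derivative of \<open>a(s) t^2 + b(s) t\<close>, and
  \<open>\<Phi>\<close> below is its t-derivative, so implicit differentiation gives S' = \<Phi> /
  W. The differential \<omega>_1 turns out to be dt / W.\<close>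

definition W :: "'a fps" where
  "W = 1 - (m 1 + 2 * m 3 * S) * fps_X - (m 2 + 2 * m 4 * S + 3 * m 6 * S^2) * fps_X^2"

definition \<Phi> :: "'a fps" where "\<Phi> = 2 * a * fps_X + b"

lemma S_deriv: "fps_deriv S * W = \<Phi>"
proof -
  have "fps_deriv S = fps_deriv (curve_a m S * fps_X^2 + curve_b m S * fps_X)" using S_eq by simp
  also have "\<dots> = (m 2 + 2 * m 4 * S + 3 * m 6 * S^2) * fps_deriv S * fps_X^2 + 2 * a * fps_X
     + (m 1 + 2 * m 3 * S) * fps_deriv S * fps_X + b"
  proof -
    have d: "fps_deriv (S^2) = 2 * S * fps_deriv S" "fps_deriv (S^3) = 3 * S^2 * fps_deriv S"
      "fps_deriv (fps_X^2 :: 'a fps) = 2 * fps_X"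
      by (simp_all add: power2_eq_square power3_eq_cube algebra_simps)
    show ?thesis 
      unfolding curve_a_def curve_b_def a_def b_def
      by (simp add: d) (simp add: algebra_simps power2_eq_square)
  qed
  finally show ?thesis unfolding W_def \<Phi>_def by algebra
qed

lemma W_0: "W $ 0 = 1" by (simp add: W_def power2_eq_square)

definition \<Omega> :: "'a fps" where "\<Omega> = inverse W"

lemma \<Omega>_W: "\<Omega> * W = 1" "W * \<Omega> = 1"
  by (simp_all add: \<Omega>_def inverse_mult_eq_1 inverse_mult_eq_1' W_0)

lemma S_deriv': "fps_deriv S = \<Phi> * \<Omega>"
proof -
  have "fps_deriv S = fps_deriv S * W * \<Omega>" by (simp add: mult.assoc \<Omega>_W)
  then show ?thesis by (simp add: S_deriv)
qed

lemma \<Omega>_0: "\<Omega> $ 0 = 1" using W_0 by (simp add: \<Omega>_def)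

lemma \<Phi>_nonzero: "\<Phi> \<noteq> 0"
proof -
  have "\<Phi> $ Suc 0 = 2" by (simp add: \<Phi>_def a_0 b_def curve_b_def power2_eq_square S_low fps_mult_nth_1)
  then show ?thesis by auto
qed

lemma S_\<Phi>: "fps_X * (\<Phi> + b) = 2 * S"
  using S_ab unfolding \<Phi>_def by algebra

abbreviation fl :: "'a fps \<Rightarrow> 'a fls" where "fl \<equiv> fps_to_fls"

lemmas fl_simps = is_hom_simps[OF is_hom_fps_to_fls]

lemma x_ser_eq: "x_ser \<mu> = 1 / fl S" by (simp add: x_ser_def S_def)

lemma fl_S_nonzero: "fl S \<noteq> 0" using S_nonzero by simp

lemma fl_b: "fl b = fl S * (fls_const (\<mu> 1) + fls_const (\<mu> 3) * fl S)"
  by (simp add: b_def curve_b_def fls_times_fps_to_fls power2_eq_square algebra_simps)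

lemma fl_S_ab: "fl S = fl a * fls_X^2 + fl b * fls_X"
  by (subst S_ab) (simp add: fls_times_fps_to_fls fps_to_fls_power)

lemma fls_X_nonzero: "(fls_X :: 'a fls) \<noteq> 0" by simp

lemma x_S: "x_ser \<mu> * fl S = 1" using fl_S_nonzero by (simp add: x_ser_eq)

lemma y_X: "y_ser \<mu> * fls_X = - x_ser \<mu>"
  using nonzero_eq_divide_eq[OF fls_X_nonzero, of "y_ser \<mu>" "- x_ser \<mu>"] unfolding y_ser_def by blast

lemma y_eq: "(y_ser \<mu> + fls_const (\<mu> 1) * x_ser \<mu> + fls_const (\<mu> 3)) * (fl S)^2 = - fl a * fls_X"
proof -
  have "(y_ser \<mu> + fls_const (\<mu> 1) * x_ser \<mu> + fls_const (\<mu> 3)) * (fl S)^2 * fls_X = - fl a * fls_X * fls_X"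
    using x_S y_X fl_b fl_S_ab by algebra
  then show ?thesis by (simp only: mult_right_cancel[OF fls_X_nonzero])
qed

lemma t'_ser_eq: "t'_ser \<mu> = fl T'"
proof -
  have a: "fl a \<noteq> 0" using a_nonzero by simp
  have "fl (a * T' * fps_X) = fl (- S)" by (simp only: aT')
  then have "fl a * fl T' * fls_X = - fl S" by (simp add: fls_times_fps_to_fls)
  then have "fl T' = - fl S / (fl a * fls_X)" using a by (simp add: field_simps)
  moreover have "t'_ser \<mu> = - fl S / (fl a * fls_X)"
  proof -
    have "y_ser \<mu> + fls_const (\<mu> 1) * x_ser \<mu> + fls_const (\<mu> 3) = - fl a * fls_X / (fl S)^2"
      using y_eq fl_S_nonzero by (subst nonzero_eq_divide_eq) simp_all
    then show ?thesis
      unfolding t'_ser_def x_ser_eq using a fl_S_nonzero by (simp only:) (simp add: power2_eq_square field_simps)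
  qed
  ultimately show ?thesis by simp
qed

text \<open>With x = 1 / S and t t' = - S / a the factor S cancels.\<close>

lemma q_ser_eq: "q_ser \<mu> = fl (inverse a)"
proof -
  have a: "fl a \<noteq> 0" using a_nonzero by simp
  have "fl a * fl (inverse a) = 1"
    by (simp add: fls_times_fps_to_fls[symmetric] inverse_mult_eq_1' a_0)
  moreover have "fl (a * T' * fps_X) = fl (- S)" by (simp only: aT')
  then have "fl a * fl T' * fls_X = - fl S" by (simp add: fls_times_fps_to_fls)
  then have "fl a * q_ser \<mu> = 1" 
    using fl_S_nonzero by (simp add: q_ser_def t'_ser_eq x_ser_eq field_simps)
  ultimately show ?thesis using a by (metis mult_cancel_left)
qed

lemma two_y_eq: "2 * y_ser \<mu> + fls_const (\<mu> 1) * x_ser \<mu> + fls_const (\<mu> 3) = - fl \<Phi> / (fl S)^2"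
proof -
  have "fls_X * (fl \<Phi> + fl b) = 2 * fl S"
    using arg_cong[OF S_\<Phi>, of fl] by (simp add: fls_times_fps_to_fls)
  then have "(2 * y_ser \<mu> + fls_const (\<mu> 1) * x_ser \<mu> + fls_const (\<mu> 3)) * (fl S)^2 * fls_X = - fl \<Phi> * fls_X"
    using x_S y_X fl_b by algebra
  then have "(2 * y_ser \<mu> + fls_const (\<mu> 1) * x_ser \<mu> + fls_const (\<mu> 3)) * (fl S)^2 = - fl \<Phi>"
    by (simp only: mult_right_cancel[OF fls_X_nonzero])
  then show ?thesis using fl_S_nonzero by (subst nonzero_eq_divide_eq) simp_all
qed

lemma x_deriv: "fls_deriv (x_ser \<mu>) = - fl (fps_deriv S) / (fl S)^2"
proof -
  have "x_ser \<mu> * fl S = 1" using fl_S_nonzero by (simp add: x_ser_eq)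
  then have "fls_deriv (x_ser \<mu>) * fl S + x_ser \<mu> * fl (fps_deriv S) = 0"
    by (metis fls_deriv_mult fls_deriv_one fls_deriv_fps_to_fls add.commute)
  then show ?thesis using fl_S_nonzero by (simp add: x_ser_eq field_simps power2_eq_square add_eq_0_iff)
qed

lemma omega1_ser_eq: "omega1_ser \<mu> = fl \<Omega>"
proof -
  have p: "fl \<Phi> \<noteq> 0" using \<Phi>_nonzero by simp
  have "fps_deriv S = \<Phi> * \<Omega>" by (rule S_deriv')
  then show ?thesis
    unfolding omega1_ser_def two_y_eq x_deriv using p fl_S_nonzero
    by (simp add: fls_times_fps_to_fls)
qed

lemma x_deriv': "fls_deriv (x_ser \<mu>) = fl \<Omega> * (2 * y_ser \<mu> + fls_const (\<mu> 1) * x_ser \<mu> + fls_const (\<mu> 3))"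
proof -
  have "fps_deriv S = \<Phi> * \<Omega>" by (rule S_deriv')
  then show ?thesis unfolding two_y_eq x_deriv by (simp add: fls_times_fps_to_fls)
qed

definition U :: "'a fps" where "U = fps_integral0 \<Omega>"

lemma u_ser_eq: "u_ser \<mu> = U" by (simp add: u_ser_def U_def omega1_ser_eq)

lemma U_simps: "U $ 0 = 0" "U $ Suc 0 = 1" "fps_deriv U = \<Omega>"
  by (simp_all add: U_def \<Omega>_0 fps_deriv_fps_integral)

text \<open>Differentiate S(t') = S(t). As the t-derivative of a quadratic polynomial, \<Phi> takes
  opposite values at its two roots, so \<omega>_1 changes sign when t is replaced by t'.\<close>

lemma U_compose_T': "U oo T' = - U"
proof -
  have 0: "(f oo T') $ 0 = f $ 0" for f by simp
  have "fps_deriv (S oo T') = (fps_deriv S oo T') * fps_deriv T'" by (rule fps_compose_deriv[OF T'_low(1)])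
  moreover have "fps_deriv S = \<Phi> * \<Omega>" by (rule S_deriv')
  moreover have "\<Phi> oo T' = - \<Phi>"
  proof -
    have c: "(m j oo T') = m j" for j by simp
    have "a oo T' = a" "b oo T' = b" 
      by (simp_all add: a_def b_def curve_a_def curve_b_def fps_compose_add_distrib T'_low
          fps_compose_mult_distrib[OF T'_low(1)] fps_compose_power[OF T'_low(1), symmetric] S_compose_T')
    then have "\<Phi> oo T' = 2 * a * T' + b" 
      by (simp add: \<Phi>_def fps_compose_add_distrib fps_compose_mult_distrib[OF T'_low(1)] T'_low)
    then show ?thesis using sum_T' unfolding \<Phi>_def by algebra
  qed
  ultimately have "\<Phi> * \<Omega> = - \<Phi> * (\<Omega> oo T') * fps_deriv T'"
    by (simp add: S_compose_T' fps_compose_mult_distrib[OF T'_low(1)])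
  then have "\<Phi> * \<Omega> = \<Phi> * - ((\<Omega> oo T') * fps_deriv T')" by (simp add: algebra_simps)
  then have "\<Omega> = - ((\<Omega> oo T') * fps_deriv T')" using \<Phi>_nonzero by (metis mult_cancel_left)
  then have "(\<Omega> oo T') * fps_deriv T' = - \<Omega>" by (metis minus_minus)
  then have "fps_deriv (U oo T') = fps_deriv (- U)"
    by (simp add: fps_compose_deriv[OF T'_low(1)] U_simps)
  then show ?thesis
    using U_simps(1) by (subst (asm) fps_deriv_eq_iff) (simp add: T'_low)
qed

subsection \<open>Integrality\<close>

lemma S_coeffs_in:
  assumes "is_subring A" "\<And>j. j \<in> {1,2,3,4,6} \<Longrightarrow> \<mu> j \<in> A" shows "S \<in> coeffs_in A"
proof -
  note s = is_subring_coeffs_in[OF assms(1)]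
  have *: "iterate k \<in> coeffs_in A" for k
    by (induction k) (auto simp: iterate_def step_def curve_a_def curve_b_def
        intro!: is_subring_intros[OF s] coeffs_in_const coeffs_in_X assms)
  have "S $ n \<in> A" for n
    using S_iterate[of n] * by (auto simp: coeffs_in_def)
  then show ?thesis by (simp add: coeffs_in_def)
qed

lemma coeffs_in_all:
  assumes "is_subring A" "\<And>j. j \<in> {1,2,3,4,6} \<Longrightarrow> \<mu> j \<in> A"
  shows "a \<in> coeffs_in A" "inverse a \<in> coeffs_in A" "T' \<in> coeffs_in A" "W \<in> coeffs_in A" "\<Omega> \<in> coeffs_in A"
proof -
  note s = is_subring_coeffs_in[OF assms(1)]
  note i = is_subring_intros[OF s] coeffs_in_const[OF assms(1)] coeffs_in_X[OF assms(1)] S_coeffs_in[OF assms] assms(2)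
  show a: "a \<in> coeffs_in A" unfolding a_def curve_a_def by (intro i) auto
  show ai: "inverse a \<in> coeffs_in A"
    by (rule coeffs_in_inverse[OF assms(1) a _ is_subringD(1)[OF assms(1)]]) (simp_all add: inverse_mult_eq_1' a_0)
  have "fps_shift 1 S \<in> coeffs_in A" using S_coeffs_in[OF assms] by (auto simp: coeffs_in_def)
  then show "T' \<in> coeffs_in A" unfolding T'_def using ai by (intro i)
  show W: "W \<in> coeffs_in A" unfolding W_def by (intro i) auto
  show "\<Omega> \<in> coeffs_in A" unfolding \<Omega>_def
    by (rule coeffs_in_inverse[OF assms(1) W _ is_subringD(1)[OF assms(1)]]) (simp_all add: inverse_mult_eq_1' W_0)
qed

subsection \<open>The series p and q\<close>

text \<open>The units that exhibit p as a quotient of integral series: p(t1, t2) is the series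
  \<open>a\<close> at t2 divided by \<open>D12\<close>, and correspondingly for \<open>D21\<close>
  with the variables exchanged.\<close>

definition D12 :: "'a fps2" where "D12 = chord_den m2 (lift1 fps_X) (lift1 S) (lift2 S)"
definition D21 :: "'a fps2" where "D21 = chord_den m2 (lift2 fps_X) (lift2 S) (lift1 S)"

lemma D_0: "D12 $ 0 $ 0 = 1" "D21 $ 0 $ 0 = 1"
  by (simp_all add: D12_def D21_def chord_den_def power2_eq_square)

text \<open>The quadratic polynomial \<open>a T^2 + b T - s\<close> of the second point has the
  roots t and t' of that point. Its value at the parameter of the first point factors into the two
  linear terms in the denominator of p, and by the chord identity it is the difference of the values
  of s times \<open>chord_den\<close>. The maps \<open>e\<close> and \<open>f\<close> stand for
  \<open>at1\<close> and \<open>at2\<close> in either order.\<close>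

lemma p_ser_aux:
  fixes e f :: "'a fls \<Rightarrow> 'a fls2"
  assumes "is_hom e" "is_hom f" and c: "\<And>c. e (fls_const c) = const2 c" "\<And>c. f (fls_const c) = const2 c"
    and ne: "e (fl S) \<noteq> f (fl S)"
    and nz: "chord_den (\<lambda>j. const2 (\<mu> j)) (e fls_X) (e (fl S)) (f (fl S)) \<noteq> 0"
  shows "p_ser \<mu> e f * chord_den (\<lambda>j. const2 (\<mu> j)) (e fls_X) (e (fl S)) (f (fl S)) = f (fl a)"
proof -
  let ?M = "\<lambda>j. const2 (\<mu> j)"
  note e = is_hom_simps[OF assms(1)] is_hom_inverse[OF assms(1)]
  note f = is_hom_simps[OF assms(2)] is_hom_inverse[OF assms(2)]
  have ab: "fl a = curve_a (\<lambda>j. fls_const (\<mu> j)) (fl S)" "fl b = curve_b (\<lambda>j. fls_const (\<mu> j)) (fl S)"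
    by (simp_all add: a_def b_def curve_a_def curve_b_def fls_times_fps_to_fls fps_to_fls_power)
  have 1: "e (fl S) = curve_a ?M (e (fl S)) * (e fls_X)^2 + curve_b ?M (e (fl S)) * e fls_X"
    using arg_cong[OF fl_S_ab, of e] unfolding ab by (simp add: curve_a_def curve_b_def e c)
  have fa: "f (fl a) = curve_a ?M (f (fl S))" "f (fl b) = curve_b ?M (f (fl S))"
    by (simp_all add: ab curve_a_def curve_b_def f c)
  have "fl a * fl T' * fls_X = - fl S" using arg_cong[OF aT', of fl] by (simp add: fls_times_fps_to_fls)
  from arg_cong[OF this, of f] have 2: "f (fl a) * f (fl T') * f fls_X = - f (fl S)" by (simp add: f)
  have "fl a * (fls_X + fl T') = - fl b" using arg_cong[OF sum_T', of fl] by (simp add: fls_times_fps_to_fls)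
  from arg_cong[OF this, of f] have 3: "f (fl a) * (f fls_X + f (fl T')) = - f (fl b)" by (simp add: f)
  let ?D = "chord_den ?M (e fls_X) (e (fl S)) (f (fl S))" and ?t = "e fls_X"
  have 4: "(e (fl S) - f (fl S)) * ?D = f (fl a) * ?t^2 + f (fl b) * ?t - f (fl S)"
    unfolding fa by (rule chord_identity[OF 1])
  have 5: "f (fl a) * ((f (fl T') - ?t) * (f fls_X - ?t)) = (e (fl S) - f (fl S)) * ?D"
    unfolding 4 using 2 3 by algebra
  have nz: "(f (fl T') - ?t) * (f fls_X - ?t) \<noteq> 0" using 5 ne nz by auto
  have "p_ser \<mu> e f = (e (fl S) - f (fl S)) / ((f (fl T') - ?t) * (f fls_X - ?t))"
    unfolding p_ser_def t'_ser_eq x_ser_eq by (simp add: e f minus_divide_left)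
  then have "p_ser \<mu> e f * ?D = ((e (fl S) - f (fl S)) * ?D) / ((f (fl T') - ?t) * (f fls_X - ?t))" by simp
  then show ?thesis unfolding 5[symmetric] using nz by simp
qed

lemma const2_eq: "(\<lambda>j. const2 (\<mu> j)) = (\<lambda>j. to_fls2 (m2 j))"
  by (simp add: const2_to_fls2)

lemma chord_den_to_fls2:
  "chord_den (\<lambda>j. const2 (\<mu> j)) (to_fls2 t) (to_fls2 s) (to_fls2 s') = to_fls2 (chord_den m2 t s s')"
  by (simp add: const2_eq chord_den_def to_fls2_simps)

lemma lift_S_neq: "lift1 S \<noteq> lift2 S"
proof
  assume "lift1 S = lift2 S"
  then have "lift1 S $ 2 $ 0 = lift2 S $ 2 $ 0" by simp
  then show False by (simp add: S_low)
qed

lemma p12_eq: "p_ser \<mu> at1 at2 * to_fls2 D12 = to_fls2 (lift2 a)"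
proof -
  have X: "at1 fls_X = to_fls2 (lift1 fps_X)" using t1_to_fls2 by (simp add: t1_def)
  have "D12 \<noteq> 0" using D_0 by auto
  then show ?thesis
    using p_ser_aux[OF is_hom_at1 is_hom_at2 at1_const at2_const] lift_S_neq
    unfolding at1_fps_to_fls at2_fps_to_fls X chord_den_to_fls2 by (simp add: D12_def)
qed

lemma p21_eq: "p_ser \<mu> at2 at1 * to_fls2 D21 = to_fls2 (lift1 a)"
proof -
  have X: "at2 fls_X = to_fls2 (lift2 fps_X)" using t2_to_fls2 by (simp add: t2_def)
  have "D21 \<noteq> 0" using D_0 by auto
  then show ?thesis
    using p_ser_aux[OF is_hom_at2 is_hom_at1 at2_const at1_const] lift_S_neq[symmetric]
    unfolding at1_fps_to_fls at2_fps_to_fls X chord_den_to_fls2 by (simp add: D21_def)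
qed

definition P12 :: "'a fps2" where "P12 = (SOME G. D12 * G = 1) * lift2 a"
definition P21 :: "'a fps2" where "P21 = (SOME G. D21 * G = 1) * lift1 a"

lemma P12_D12: "P12 * D12 = lift2 a" and P21_D21: "P21 * D21 = lift1 a"
  using someI_ex[OF fps2_unit[OF D_0(1)]] someI_ex[OF fps2_unit[OF D_0(2)]]
  by (simp_all add: P12_def P21_def mult_ac)

lemma p12_ser_eq: "p_ser \<mu> at1 at2 = to_fls2 P12"
proof -
  have "D12 \<noteq> 0" using D_0 by auto
  moreover have "to_fls2 P12 * to_fls2 D12 = p_ser \<mu> at1 at2 * to_fls2 D12"
    unfolding p12_eq P12_D12[symmetric] by (simp add: to_fls2_simps)
  ultimately show ?thesis by simp
qed

lemma p21_ser_eq: "p_ser \<mu> at2 at1 = to_fls2 P21"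
proof -
  have "D21 \<noteq> 0" using D_0 by auto
  moreover have "to_fls2 P21 * to_fls2 D21 = p_ser \<mu> at2 at1 * to_fls2 D21"
    unfolding p21_eq P21_D21[symmetric] by (simp add: to_fls2_simps)
  ultimately show ?thesis by simp
qed

lemma P12_0: "P12 $ 0 $ 0 = 1"
  using arg_cong[OF P12_D12, of "\<lambda>F. F $ 0 $ 0"] by (simp add: D_0 a_0)

lemma D12_coeffs2_in:
  assumes "is_subring A" "\<And>j. j \<in> {1,2,3,4,6} \<Longrightarrow> \<mu> j \<in> A"
  shows "D12 \<in> coeffs2_in A" "D21 \<in> coeffs2_in A"
proof -
  note s = is_subring_coeffs_in[OF assms(1)]
  note ss = is_subring_coeffs_in[OF s]
  note i = is_subring_intros[OF ss] coeffs_in_const[OF s] coeffs_in_const[OF assms(1)]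
      coeffs2_in_lift1[OF assms(1)] coeffs_in_X[OF assms(1)] S_coeffs_in[OF assms] assms(2)
  show "D12 \<in> coeffs2_in A" unfolding D12_def chord_den_def by (intro i) auto
  show "D21 \<in> coeffs2_in A" unfolding D21_def chord_den_def by (intro i) auto
qed

lemma P12_coeffs2_in:
  assumes "is_subring A" "\<And>j. j \<in> {1,2,3,4,6} \<Longrightarrow> \<mu> j \<in> A"
  shows "P12 \<in> coeffs2_in A"
proof -
  note s = is_subring_coeffs_in[OF assms(1)]
  have "(SOME G. D12 * G = 1) \<in> coeffs2_in A"
    by (rule coeffs2_in_inverse[OF assms(1) D12_coeffs2_in(1)[OF assms] someI_ex[OF fps2_unit[OF D_0(1)]] D_0(1)])
  moreover have "lift2 a \<in> coeffs2_in A"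
    by (intro coeffs2_in_lift2 coeffs_in_all assms)
  ultimately show ?thesis 
    unfolding P12_def by (intro is_subringD(4)[OF is_subring_coeffs_in[OF s]])
qed

lemma S_vanishes: "vanishes 2 (lift1 S)" "vanishes 2 (lift2 S)"
  using S_low(1,2) by (intro lift1_vanishes lift2_vanishes; auto simp: less_2_cases_iff)+

lemma a_low: "a $ 0 = 1" "a $ Suc 0 = 0" "a $ 2 = \<mu> 2" "a $ 3 = \<mu> 2 * \<mu> 1" 
    "a $ 4 = \<mu> 2 * (\<mu> 1 ^ 2 + \<mu> 2) + \<mu> 4"
    "a $ 5 = \<mu> 2 * (\<mu> 1 ^ 3 + 2 * \<mu> 1 * \<mu> 2 + \<mu> 3) + 2 * \<mu> 4 * \<mu> 1"
  using S_low
  by (simp_all add: a_def curve_a_def power2_eq_square power3_eq_cube fps_mult_nth numeral_eq_Suc)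

lemma P12_expansion:
  "vanishes 3 (P12 - (1 + m2 1 * lift1 fps_X + m2 2 * (lift2 fps_X)^2 + (m2 2 + m2 1 ^ 2) * (lift1 fps_X)^2))"
  (is "vanishes 3 (P12 - ?P)")
proof -
  let ?X = "lift1 fps_X :: 'a fps2" and ?Y = "lift2 fps_X :: 'a fps2"
  have X: "vanishes 1 ?X" "vanishes 1 ?Y" by (simp_all add: lift1_vanishes1 lift2_vanishes1)
  have m3: "vanishes 3 (F * G * H)" if "vanishes 1 F" "vanishes 1 G" "vanishes 1 H" for F G H :: "'a fps2"
    using vanishes_mult[OF vanishes_mult[OF that(1,2)] that(3)] by (simp add: numeral_3_eq_3)
  define R1 where "R1 = lift2 (a - (1 + m 2 * fps_X^2))"
  have R1: "vanishes 3 R1" unfolding R1_def 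
    by (rule lift2_vanishes) (auto simp: less_Suc_eq numeral_3_eq_3 a_low fps_X_power_nth)
  have a: "lift2 a = 1 + m2 2 * ?Y^2 + R1" 
    unfolding R1_def by (simp add: is_hom_simps[OF lift2_hom] del: fps_const_power)
  define R2 where "R2 = - ?X * (m2 3 * (lift1 S + lift2 S)) - 
      ?X * (?X * (m2 4 * (lift1 S + lift2 S) + m2 6 * ((lift1 S)^2 + lift1 S * lift2 S + (lift2 S)^2)))"
  have "vanishes (1 + 2) (?X * (m2 3 * (lift1 S + lift2 S)))"
    by (intro vanishes_mult vanishes_mult_right vanishes_add S_vanishes X)
  moreover have "vanishes (1 + 2) (?X * (?X * (m2 4 * (lift1 S + lift2 S) + m2 6 * ((lift1 S)^2 + lift1 S * lift2 S + (lift2 S)^2))))"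
    unfolding power2_eq_square
    by (intro vanishes_mult X(1) vanishes_mult_right vanishes_add S_vanishes)
  ultimately have R2: "vanishes 3 R2" unfolding R2_def 
    by (simp add: vanishes_diff vanishes_uminus del: One_nat_def)
  have D: "D12 = 1 - m2 1 * ?X - m2 2 * ?X^2 + R2"
    by (simp add: D12_def chord_den_def R2_def algebra_simps power2_eq_square)
  define G where "G = (SOME G. D12 * G = 1)"
  have G: "D12 * G = 1" unfolding G_def by (rule someI_ex[OF fps2_unit[OF D_0(1)]])
  \<comment> \<open>With the inverse G of \<open>D12\<close> factored out, the bracket consists of
    products of known expansions, so no inverse has to be expanded.\<close>
  have "P12 - ?P = G * (lift2 a - ?P * D12)"
    using G P12_def unfolding G_def[symmetric] by algebra
  also have "lift2 a - ?P * D12 = R1 - ?P * R2 + ?X * ?X * ?X * (m2 1 * m2 2 + (m2 2 + m2 1 ^ 2) * (m2 1 + m2 2 * ?X))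
      + ?Y * ?Y * ?X * (m2 2 * (m2 1 + m2 2 * ?X))"
    unfolding a D by algebra
  also have "vanishes 3 (G * \<dots>)"
    by (intro vanishes_mult_right vanishes_add vanishes_diff R1 R2 vanishes_mult_left m3 X) 
  finally show ?thesis .
qed

lemma q_expansion:
  assumes "n < 6"
  shows "(inverse a - (1 - m 2 * fps_X^2 - m 2 * m 1 * fps_X^3 - (m 2 * m 1 ^ 2 + m 4) * fps_X^4
            - (m 2 * m 1 ^ 3 + 2 * m 4 * m 1 + m 2 * m 3) * fps_X^5)) $ n = 0" (is "(inverse a - ?Q) $ n = 0")
proof -
  have e: "inverse a - ?Q = inverse a * (1 - a * ?Q)"
  proof -
    have "inverse a * a = 1" using inverse_mult_eq_1[of a] a_0 by simp
    then show ?thesis by (simp only: right_diff_distrib mult_1_right mult_1_left mult.assoc[symmetric])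
  qed
  \<comment> \<open>These are the coefficients of \<open>reciprocal_expansion\<close> for the values
    in \<open>a_low\<close>; the terms with the square of \<open>\<mu> 2\<close> cancel.\<close>
  have "?Q = 1 - fps_const (\<mu> 2) * fps_X^2 - fps_const (\<mu> 2 * \<mu> 1) * fps_X^3
     - fps_const ((\<mu> 2 * (\<mu> 1 ^ 2 + \<mu> 2) + \<mu> 4) - (\<mu> 2)^2) * fps_X^4 
     - fps_const ((\<mu> 2 * (\<mu> 1 ^ 3 + 2 * \<mu> 1 * \<mu> 2 + \<mu> 3) + 2 * \<mu> 4 * \<mu> 1) - 2 * \<mu> 2 * (\<mu> 2 * \<mu> 1)) * fps_X^5"
    (is "_ = ?R")
    unfolding numeral_fps_const fps_const_mult fps_const_add fps_const_power
    by (simp add: algebra_simps power2_eq_square)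
  moreover have "(1 - a * ?R) $ k = 0" if "k < 6" for k
    unfolding fps_sub_nth reciprocal_expansion[OF a_low that] by (simp add: fps_one_nth)
  ultimately have h: "(1 - a * ?Q) $ k = 0" if "k < 6" for k using that by presburger
  show ?thesis unfolding e fps_mult_nth[of "inverse a"]
  proof (intro sum.neutral ballI)
    fix x
    have "n - x < 6" using assms by simp
    then show "inverse a $ x * (1 - a * ?Q) $ (n - x) = 0" by (simp only: h mult_zero_right)
  qed
qed

end

lemma coeffs2_in_split:
  assumes "is_subring A" "F \<in> coeffs2_in A" "F $ 0 $ 0 = 1"
  shows "\<exists>f g. F = 1 + lift1 fps_X * f + lift2 fps_X * g \<and> f \<in> coeffs2_in A \<and> g \<in> coeffs2_in A"
proof (intro exI conjI)
  have X: "lift1 fps_X = (fps_X :: 'a fps2)"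
    by (auto simp: fps_eq_iff lift1_def fps_X_def)
  show "F = 1 + lift1 fps_X * fps_shift 1 F + lift2 fps_X * lift2 (fps_shift 1 (F $ 0))"
  proof (rule fps2_eqI)
    fix i j show "F $ i $ j = (1 + lift1 fps_X * fps_shift 1 F + lift2 fps_X * lift2 (fps_shift 1 (F $ 0))) $ i $ j"
      using assms(3) by (cases i; cases j) (simp_all add: X)
  qed
  show "fps_shift 1 F \<in> coeffs2_in A" using assms by (auto simp: coeffs_in_def)
  show "lift2 (fps_shift 1 (F $ 0)) \<in> coeffs2_in A" 
    using assms by (intro coeffs2_in_lift2) (auto simp: coeffs_in_def)
qed

section \<open>The sigma series\<close>

text \<open>Completing the square turns the curve equation into \<open>(2 * y + \<mu> 1 * x + \<mu>
  3)^2 = 4 * x^3 + b2 * x^2 + 2 * b4 * x + b6\<close>.\<close>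

definition b2 :: "(nat \<Rightarrow> 'a::comm_ring_1) \<Rightarrow> 'a" where "b2 \<mu> = \<mu> 1 ^ 2 + 4 * \<mu> 2"
definition b4 :: "(nat \<Rightarrow> 'a::comm_ring_1) \<Rightarrow> 'a" where "b4 \<mu> = 2 * \<mu> 4 + \<mu> 1 * \<mu> 3"
definition b6 :: "(nat \<Rightarrow> 'a::comm_ring_1) \<Rightarrow> 'a" where "b6 \<mu> = \<mu> 3 ^ 2 + 4 * \<mu> 6"

text \<open>
  The coefficients of the regular part of the solution \<open>X = u\<^sup>-\<^sup>2 + \<dots>\<close> of
  \<open>X'' = 6 X\<^sup>2 + b\<^sub>2 X + b\<^sub>4\<close>.  That equation leaves the coefficient of \<open>u\<^sup>4\<close> free; it is
  fixed by the first order equation \<open>X'\<^sup>2 = 4 X\<^sup>3 + b\<^sub>2 X\<^sup>2 + 2 b\<^sub>4 X + b\<^sub>6\<close>.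
\<close>
fun wp_coeff :: "(nat \<Rightarrow> 'a::field_char_0) \<Rightarrow> nat \<Rightarrow> 'a" where
  "wp_coeff \<mu> n =
    (if n = 0 then - b2 \<mu> / 12 else if n = 1 then 0 
     else if n = 4 then - (b6 \<mu> + 24 * wp_coeff \<mu> 0 * wp_coeff \<mu> 2 + 4 * wp_coeff \<mu> 0 ^ 3 
        + b2 \<mu> * (2 * wp_coeff \<mu> 2 + wp_coeff \<mu> 0 ^ 2) + 2 * b4 \<mu> * wp_coeff \<mu> 0) / 28
     else (6 * (\<Sum>i\<le>n-2. wp_coeff \<mu> i * wp_coeff \<mu> (n - 2 - i)) + b2 \<mu> * wp_coeff \<mu> (n - 2)
        + (if n = 2 then b4 \<mu> else 0)) / ((of_nat n - 4) * (of_nat n + 3)))"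

declare wp_coeff.simps [simp del]

text \<open>Up to denominators the equation says that log P is annihilated by the wave operator; the
  cleared form allows P to vanish at the origin. In the coefficient of index n the only new unknown
  is \<open>P $ Suc (Suc n)\<close>, multiplied by \<open>P $ 0\<close> and by positive
  integers.\<close>

lemma wave_unique:
  fixes P Q :: "'a::field_char_0 fps2"
  assumes P: "P * (deriv2 (deriv2 P) - fps_deriv (fps_deriv P)) = (deriv2 P)^2 - (fps_deriv P)^2"
    and Q: "Q * (deriv2 (deriv2 Q) - fps_deriv (fps_deriv Q)) = (deriv2 Q)^2 - (fps_deriv Q)^2"
    and init: "P $ 0 = Q $ 0" "P $ 1 = Q $ 1" "P $ 0 \<noteq> 0"
  shows "P = Q"
proof (rule fps_ext)
  fix N
  have "\<forall>k\<le>Suc n. P $ k = Q $ k" for n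
  proof (induction n)
    case 0
    then show ?case using init by (auto simp: le_Suc_eq)
  next
    case (Suc n)
    have eq: "P $ k = Q $ k" if "k \<le> Suc n" for k using Suc that by blast
    have "(P * fps_deriv (fps_deriv P)) $ n = (P * deriv2 (deriv2 P) - (deriv2 P)^2 + (fps_deriv P)^2) $ n"
      using P by (simp add: algebra_simps)
    also have "\<dots> = (Q * deriv2 (deriv2 Q) - (deriv2 Q)^2 + (fps_deriv Q)^2) $ n"
      unfolding power2_eq_square fps_sub_nth fps_add_nth fps_mult_nth
      by (intro arg_cong2[of _ _ _ _ "(+)"] arg_cong2[of _ _ _ _ "(-)"] sum.cong refl)
        (auto simp: deriv2_def eq)
    also have "\<dots> = (Q * fps_deriv (fps_deriv Q)) $ n"
      using Q by (simp add: algebra_simps)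
    finally have 1: "(\<Sum>k=0..n. P $ k * fps_deriv (fps_deriv P) $ (n - k)) = (\<Sum>k=0..n. Q $ k * fps_deriv (fps_deriv Q) $ (n - k))"
      unfolding fps_mult_nth .
    have 2: "(\<Sum>k=Suc 0..n. P $ k * fps_deriv (fps_deriv P) $ (n - k)) = (\<Sum>k=Suc 0..n. Q $ k * fps_deriv (fps_deriv Q) $ (n - k))"
      by (intro sum.cong refl) (auto simp: eq)
    have "P $ 0 * fps_deriv (fps_deriv P) $ n = Q $ 0 * fps_deriv (fps_deriv Q) $ n"
      using 1 2 by (simp add: sum.atLeast_Suc_atMost[of 0])
    then have "fps_deriv (fps_deriv P) $ n = fps_deriv (fps_deriv Q) $ n"
      using init by simp
    then have "of_nat (Suc n) * (of_nat (Suc (Suc n)) * P $ Suc (Suc n)) = of_nat (Suc n) * (of_nat (Suc (Suc n)) * Q $ Suc (Suc n))"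
      by (simp del: of_nat_Suc)
    moreover have "(of_nat (Suc k) :: 'a fps) \<noteq> 0" for k by (simp del: of_nat_Suc)
    ultimately have "P $ Suc (Suc n) = Q $ Suc (Suc n)" by (metis mult_cancel_left)
    then show ?case using eq by (auto simp: le_Suc_eq)
  qed
  then show "P $ N = Q $ N" by (metis le_SucI order_refl)
qed

lemma comp1_nth_0: "g $ 0 = fps_X \<Longrightarrow> comp1 c g $ 0 = c"
proof -
  assume g: "g $ 0 = fps_X"
  have p: "(g ^ n) $ 0 = fps_X ^ n" for n by (induction n) (simp_all add: g)
  show ?thesis
    by (rule fps_ext) (simp add: comp1_def gsum_def subst_coeffs_def p fps_X_power_nth if_distrib cong: if_cong)
qed

abbreviation X1 :: "'a::comm_ring_1 fps2" where "X1 \<equiv> lift1 fps_X"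
abbreviation X2 :: "'a::comm_ring_1 fps2" where "X2 \<equiv> lift2 fps_X"

lemma X1_eq: "(X1 :: 'a::comm_ring_1 fps2) = fps_X"
  by (auto simp: fps_eq_iff lift1_def fps_X_def)

lemma vanishes_X: "vanishes (Suc 0) (X1 :: 'a::comm_ring_1 fps2)" "vanishes (Suc 0) (X2 :: 'a fps2)"
  by (simp_all add: lift1_vanishes1 lift2_vanishes1)

lemma deriv_lift: 
  "fps_deriv (lift1 f) = lift1 (fps_deriv f)" "fps_deriv (lift2 f) = 0"
  "deriv2 (lift1 f) = 0" "deriv2 (lift2 f) = lift2 (fps_deriv f)" for f :: "'a::comm_ring_1 fps"
  by (auto simp: fps2_eqI fps_eq_iff deriv2_def simp flip: fps_of_nat)

lemma deriv2_simps: "deriv2 (F + G) = deriv2 F + deriv2 G" "deriv2 (F * G) = deriv2 F * G + F * deriv2 G"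
  "deriv2 (- F) = - deriv2 F" "deriv2 (F - G) = deriv2 F - deriv2 G" "deriv2 1 = 0" "deriv2 0 = 0"
  using is_deriv_simps[OF is_deriv_deriv2] by auto

context weierstrass_coeffs
begin

definition D :: "'a fps" where "D = Abs_fps (wp_coeff \<mu>)"

abbreviation B2 where "B2 \<equiv> fps_const (b2 \<mu>)"
abbreviation B4 where "B4 \<equiv> fps_const (b4 \<mu>)"
abbreviation B6 where "B6 \<equiv> fps_const (b6 \<mu>)"

lemma D_low: "D $ 0 = - b2 \<mu> / 12" "D $ Suc 0 = 0"
  "D $ 4 = - (b6 \<mu> + 24 * D $ 0 * D $ 2 + 4 * (D $ 0) ^ 3 + b2 \<mu> * (2 * D $ 2 + (D $ 0)^2) + 2 * b4 \<mu> * D $ 0) / 28"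
  unfolding D_def fps_nth_Abs_fps by (subst wp_coeff.simps, simp)+

lemma D_rec:
  assumes "n \<ge> 2"
  shows "(of_nat n * (of_nat n - 1) - 12) * D $ n = 6 * (D^2) $ (n - 2) + b2 \<mu> * D $ (n - 2) + (if n = 2 then b4 \<mu> else 0)"
proof (cases "n = 4")
  \<comment> \<open>Resonance: the factor of \<open>D $ 4\<close> is 0, and the right-hand side
    vanishes as well because \<open>D $ 0\<close> is \<open>- b2 \<mu> / 12\<close> and
    \<open>D $ Suc 0\<close> is 0.\<close>
  case True
  have "(D^2) $ 2 = 2 * D $ 0 * D $ 2 + (D $ Suc 0)^2"
    by (simp add: power2_eq_square fps_mult_nth numeral_2_eq_2 algebra_simps)
  then show ?thesis using True D_low(1,2) by (simp add: algebra_simps)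
next
  case False
  have e: "of_nat n * (of_nat n - 1) - 12 = ((of_nat n - 4) * (of_nat n + 3) :: 'a)"
    by (simp add: algebra_simps)
  have "of_nat n - 4 \<noteq> (0 :: 'a)" using False of_nat_eq_iff[of n 4, where ?'a = 'a] by simp
  moreover have "of_nat n + 3 \<noteq> (0 :: 'a)" using of_nat_neq_0[of "n + 2", where ?'a = 'a] by (simp add: add_ac)
  ultimately have nz: "(of_nat n - 4) * (of_nat n + 3) \<noteq> (0 :: 'a)" by simp
  show ?thesis
    unfolding e D_def fps_nth_Abs_fps using assms False nz
    by (subst wp_coeff.simps) (simp add: power2_eq_square fps_mult_nth atLeast0AtMost)
qed

text \<open>The second order equation for u^-2 + D, multiplied by u^2 after the poles of order 4
  have cancelled.\<close>

lemma D_ode: "fps_X^2 * fps_deriv (fps_deriv D) = 12 * D + B2 + fps_X^2 * (6 * D^2 + B2 * D + B4)"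
proof (rule fps_ext)
  fix n :: nat
  have num: "12 * D = fps_const 12 * D" "6 * D^2 = fps_const 6 * D^2" by (simp_all add: numeral_fps_const)
  have "n = 0 \<or> n = 1 \<or> n \<ge> 2" by linarith
  then show "(fps_X^2 * fps_deriv (fps_deriv D)) $ n = (12 * D + B2 + fps_X^2 * (6 * D^2 + B2 * D + B4)) $ n"
  proof (elim disjE)
    assume n: "n \<ge> 2"
    then obtain k where k: "n = Suc (Suc k)" by (metis add_2_eq_Suc le_Suc_ex)
    have "(fps_X^2 * fps_deriv (fps_deriv D)) $ n = of_nat n * (of_nat n - 1) * D $ n"
      unfolding k by (simp add: fps_X_power_mult_nth)
    moreover have "(12 * D + B2 + fps_X^2 * (6 * D^2 + B2 * D + B4)) $ n = 
        12 * D $ n + (6 * (D^2) $ (n - 2) + b2 \<mu> * D $ (n - 2) + (if n = 2 then b4 \<mu> else 0))"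
      unfolding num k by (simp add: fps_X_power_mult_nth)
    ultimately show ?thesis using D_rec[OF n] by (simp add: left_diff_distrib diff_eq_eq add_ac)
  qed (use D_low in \<open>simp_all add: num fps_X_power_mult_nth\<close>)
qed

definition Xl :: "'a fls" where "Xl = fls_X_inv^2 + fl D"
definition Xl' :: "'a fls" where "Xl' = - 2 * fls_X_inv^3 + fl (fps_deriv D)"

lemma XI: "fls_X * fls_X_inv = (1 :: 'a fls)"
  by (metis fls_inverse_X fls_X_nonzero right_inverse)

lemma Xl_deriv: "fls_deriv Xl = Xl'"
  by (simp add: Xl_def Xl'_def power2_eq_square power3_eq_cube fls_deriv_fps_to_fls algebra_simps)

lemma Xl'_deriv: "fls_deriv Xl' = 6 * Xl^2 + fls_const (b2 \<mu>) * Xl + fls_const (b4 \<mu>)"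
proof -
  have "fls_X^2 * fl (fps_deriv (fps_deriv D)) = 
     12 * fl D + fls_const (b2 \<mu>) + fls_X^2 * (6 * (fl D)^2 + fls_const (b2 \<mu>) * fl D + fls_const (b4 \<mu>))"
    using arg_cong[OF D_ode, of fl] by (simp add: fls_times_fps_to_fls fps_to_fls_power)
  moreover have "fls_deriv Xl' = 6 * fls_X_inv^4 + fl (fps_deriv (fps_deriv D))"
    by (simp add: Xl'_def power2_eq_square power3_eq_cube power4_eq_xxxx fls_deriv_fps_to_fls algebra_simps)
  ultimately show ?thesis using XI unfolding Xl_def by algebra
qed

text \<open>By the second order equation the difference of both sides has derivative 0. Its constant
  value involves the free coefficient \<open>D $ 4\<close>, which was chosen to make it 0.\<close>

lemma Xl_ode: "Xl'^2 = 4 * Xl^3 + fls_const (b2 \<mu>) * Xl^2 + 2 * fls_const (b4 \<mu>) * Xl + fls_const (b6 \<mu>)"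
proof -
  define E where "E = Xl'^2 - (4 * Xl^3 + fls_const (b2 \<mu>) * Xl^2 + 2 * fls_const (b4 \<mu>) * Xl + fls_const (b6 \<mu>))"
  have "fls_deriv E = 2 * Xl' * (6 * Xl^2 + fls_const (b2 \<mu>) * Xl + fls_const (b4 \<mu>)) 
      - (12 * Xl^2 * Xl' + 2 * fls_const (b2 \<mu>) * Xl * Xl' + 2 * fls_const (b4 \<mu>) * Xl')"
    unfolding E_def by (simp add: power2_eq_square power3_eq_cube Xl_deriv Xl'_deriv algebra_simps)
  also have "\<dots> = 0" by algebra
  finally have 1: "E = fls_const (E $$ 0)" by (simp add: fls_deriv_eq_0_iff)
  \<comment> \<open>The difference E times the fourth power of the variable, a power series; its
    coefficient of index 4 is the constant in question.\<close>
  define G where "G = - 4 * fps_X * fps_deriv D + fps_X^4 * (fps_deriv D)^2 - 12 * D - 12 * fps_X^2 * D^2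
     - 4 * fps_X^4 * D^3 - B2 - 2 * B2 * fps_X^2 * D - B2 * fps_X^4 * D^2 - 2 * B4 * fps_X^2 - 2 * B4 * fps_X^4 * D - B6 * fps_X^4"
  have "E = fls_X_inv^4 * fl G"
  proof -
    have "fl G = - 4 * fls_X * fl (fps_deriv D) + fls_X^4 * (fl (fps_deriv D))^2 - 12 * fl D - 12 * fls_X^2 * (fl D)^2
     - 4 * fls_X^4 * (fl D)^3 - fls_const (b2 \<mu>) - 2 * fls_const (b2 \<mu>) * fls_X^2 * fl D - fls_const (b2 \<mu>) * fls_X^4 * (fl D)^2 
     - 2 * fls_const (b4 \<mu>) * fls_X^2 - 2 * fls_const (b4 \<mu>) * fls_X^4 * fl D - fls_const (b6 \<mu>) * fls_X^4"
      unfolding G_def by (simp add: fls_times_fps_to_fls fps_to_fls_power)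
    then show ?thesis using XI unfolding E_def Xl_def Xl'_def by algebra
  qed
  then have "E $$ 0 = G $ 4"
    by (simp add: fls_X_inv_power_times_conv_shift)
  also have "G $ 4 = 0"
  proof -
    have num: "fps_const 4 = (4 :: 'a fps)" "fps_const 12 = (12 :: 'a fps)" "fps_const 2 = (2 :: 'a fps)"
      by (simp_all add: numeral_fps_const)
    have "G = X4 * ((fps_deriv D)^2 - fps_const 4 * D^3 - B2 * D^2 - fps_const 2 * (B4 * D) - B6) 
        - fps_const 4 * (fps_X * fps_deriv D) - fps_const 12 * D - fps_X^2 * (fps_const 12 * D^2 + fps_const 2 * (B2 * D) + fps_const 2 * B4) - B2"
      if "X4 = fps_X ^ 4" for X4
      unfolding G_def num that by algebra
    moreover have "(D^2) $ 2 = 2 * D $ 0 * D $ 2 + (D $ Suc 0)^2" "(D^2) $ 0 = (D $ 0)^2" "(D^3) $ 0 = (D $ 0)^3"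
      by (simp_all add: power2_eq_square power3_eq_cube fps_mult_nth numeral_2_eq_2 algebra_simps)
    moreover have "((fps_deriv D)^2) $ 0 = (D $ Suc 0)^2" by (simp add: power2_eq_square)
    moreover have "fps_deriv D $ 3 = 4 * D $ 4" by (simp add: eval_nat_numeral)
    ultimately have "G $ 4 = (D $ Suc 0)^2 - 4 * (D $ 0)^3 - b2 \<mu> * (D $ 0)^2 - 2 * (b4 \<mu> * D $ 0) - b6 \<mu>
         - 4 * (4 * D $ 4) - 12 * D $ 4 - (12 * (2 * D $ 0 * D $ 2 + (D $ Suc 0)^2) + 2 * (b2 \<mu> * D $ 2))"
      by (simp add: fps_X_power_mult_nth)
    moreover have "28 * D $ 4 = - (b6 \<mu> + 24 * D $ 0 * D $ 2 + 4 * (D $ 0) ^ 3 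
        + b2 \<mu> * (2 * D $ 2 + (D $ 0)^2) + 2 * b4 \<mu> * D $ 0)"
      by (subst D_low(3)) simp
    ultimately have "G $ 4 = 0" using D_low(2) by algebra
    then show ?thesis .
  qed
  finally have "E = 0" using 1 by simp
  then show ?thesis by (simp add: E_def)
qed

text \<open>\<open>sig\<close> is u times the exponential of minus the double integral of D, so its
  second logarithmic derivative is -u^-2 - D = -X. The series \<open>nu\<close> and
  \<open>kap\<close> are sig^2 X and sig^3 X', which have no poles.\<close>

definition J :: "'a fps" where "J = fps_integral0 D"
definition ee :: "'a fps" where "ee = fps_exp 1 oo (- fps_integral0 J)"
definition sig :: "'a fps" where "sig = fps_X * ee"
definition nu :: "'a fps" where "nu = ee^2 * (1 + fps_X^2 * D)"
definition kap :: "'a fps" where "kap = sig * fps_deriv nu - 2 * fps_deriv sig * nu"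

lemma J_deriv: "fps_deriv J = D" by (simp add: J_def fps_deriv_fps_integral)

lemma ee_deriv: "fps_deriv ee = - J * ee"
  by (simp add: ee_def fps_compose_deriv fps_deriv_fps_integral algebra_simps)

lemma ee_0: "ee $ 0 = 1" by (simp add: ee_def)

lemma sig_deriv: "fps_deriv sig = ee - fps_X * J * ee"
  by (simp add: sig_def ee_deriv algebra_simps)

lemma nu_sig: "nu = (fps_deriv sig)^2 - sig * fps_deriv (fps_deriv sig)"
  unfolding sig_deriv by (simp add: nu_def sig_def ee_deriv J_deriv algebra_simps power2_eq_square)

lemma sig_nu_0: "sig $ 0 = 0" "sig $ Suc 0 = 1" "nu $ 0 = 1" "nu $ Suc 0 = 0"
proof -
  have "fps_deriv ee $ 0 = 0" by (simp add: ee_deriv J_def)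
  then have "ee $ Suc 0 = 0" by simp
  then show "sig $ 0 = 0" "sig $ Suc 0 = 1" "nu $ 0 = 1" "nu $ Suc 0 = 0"
    by (simp_all add: sig_def nu_def ee_0 power2_eq_square fps_mult_nth_1)
qed

lemma sig_nonzero: "sig \<noteq> 0" using sig_nu_0(2) by auto
lemma nu_nonzero: "nu \<noteq> 0" using sig_nu_0(3) by auto

lemma fl_nu: "fl nu = (fl sig)^2 * Xl"
  using XI unfolding nu_def sig_def Xl_def 
  by (simp add: fls_times_fps_to_fls fps_to_fls_power) algebra

lemma fl_nu_deriv: "fl (fps_deriv nu) = 2 * fl sig * fl (fps_deriv sig) * Xl + (fl sig)^2 * Xl'"
proof -
  have "fls_deriv (fl nu) = fls_deriv ((fl sig)^2 * Xl)" by (simp add: fl_nu)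
  then show ?thesis by (simp add: fls_deriv_fps_to_fls Xl_deriv power2_eq_square algebra_simps)
qed

lemma fl_kap: "fl kap = (fl sig)^3 * Xl'"
  unfolding kap_def by (simp add: fls_times_fps_to_fls fl_nu fl_nu_deriv algebra_simps power2_eq_square power3_eq_cube)

subsection \<open>The three-term relation\<close>

text \<open>With \<open>X2\<close> for u and \<open>X1\<close> for v this is sig(u)^2 sig(v)^2 (X(v)
  - X(u)), written without poles.\<close>

definition Q2 :: "'a fps2" where "Q2 = (lift2 sig)^2 * lift1 nu - (lift1 sig)^2 * lift2 nu"

definition zl :: "'a fls" where "zl = fl (fps_deriv sig) / fl sig"

text \<open>\<open>zl\<close> is the Weierstrass zeta function, with derivative -X. All these
  derivatives are polynomials in zl, X and X' times a power of sig, which turns the differential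
  identities below into polynomial ones.\<close>

lemma sig_log_derivs:
  "fl (fps_deriv sig) = zl * fl sig" "fl (fps_deriv (fps_deriv sig)) = (zl^2 - Xl) * fl sig"
  "fl (fps_deriv nu) = (2 * zl * Xl + Xl') * (fl sig)^2"
  "fl (fps_deriv (fps_deriv nu)) = (4 * zl^2 * Xl - 2 * Xl^2 + 4 * zl * Xl' + (6 * Xl^2 + fls_const (b2 \<mu>) * Xl + fls_const (b4 \<mu>))) * (fl sig)^2"
proof -
  have s: "fl sig \<noteq> 0" using sig_nonzero by simp
  show 1: "fl (fps_deriv sig) = zl * fl sig" using s by (simp add: zl_def)
  have "fl nu = (fl (fps_deriv sig))^2 - fl sig * fl (fps_deriv (fps_deriv sig))"
    by (subst nu_sig) (simp add: fls_times_fps_to_fls fps_to_fls_power)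
  then have "fl sig * fl (fps_deriv (fps_deriv sig)) = fl sig * ((zl^2 - Xl) * fl sig)"
    unfolding fl_nu 1 by algebra
  then show 2: "fl (fps_deriv (fps_deriv sig)) = (zl^2 - Xl) * fl sig" using s by simp
  show 3: "fl (fps_deriv nu) = (2 * zl * Xl + Xl') * (fl sig)^2"
    unfolding fl_nu_deriv 1 by algebra
  have "fls_deriv (fl (fps_deriv nu)) = fls_deriv (2 * fl sig * fl (fps_deriv sig) * Xl + (fl sig)^2 * Xl')"
    by (simp add: fl_nu_deriv)
  then have "fl (fps_deriv (fps_deriv nu)) = 2 * (fl (fps_deriv sig))^2 * Xl + 2 * fl sig * fl (fps_deriv (fps_deriv sig)) * Xl
    + 4 * fl sig * fl (fps_deriv sig) * Xl' + (fl sig)^2 * (6 * Xl^2 + fls_const (b2 \<mu>) * Xl + fls_const (b4 \<mu>))"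
    by (simp add: fls_deriv_fps_to_fls Xl_deriv Xl'_deriv power2_eq_square algebra_simps)
  then show "fl (fps_deriv (fps_deriv nu)) = (4 * zl^2 * Xl - 2 * Xl^2 + 4 * zl * Xl' + (6 * Xl^2 + fls_const (b2 \<mu>) * Xl + fls_const (b4 \<mu>))) * (fl sig)^2"
    unfolding 1 2 by algebra
qed

text \<open>In the Laurent series field both sides become \<open>s^4 * z^4\<close> times polynomials
  in the zeta function, X and X' at the two places; they agree modulo the first order equation at
  each place.\<close>

lemma Q2_wave: "Q2 * (deriv2 (deriv2 Q2) - fps_deriv (fps_deriv Q2)) = (deriv2 Q2)^2 - (fps_deriv Q2)^2"
proof -
  define s z where "s = at2 (fl sig)" and "z = at1 (fl sig)"
  define x w where "x = at2 Xl" and "w = at1 Xl"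
  define x' w' where "x' = at2 Xl'" and "w' = at1 Xl'"
  define l k where "l = at2 zl" and "k = at1 zl"
  define c2 c4 c6 where "c2 = const2 (b2 \<mu>)" and "c4 = const2 (b4 \<mu>)" and "c6 = const2 (b6 \<mu>)"
  note at = at_simps at1_const at2_const
  have u: "at2 (fl nu) = s^2 * x" "at2 (fl (fps_deriv sig)) = l * s" "at2 (fl (fps_deriv (fps_deriv sig))) = (l^2 - x) * s"
    "at2 (fl (fps_deriv nu)) = (2 * l * x + x') * s^2"
    "at2 (fl (fps_deriv (fps_deriv nu))) = (4 * l^2 * x - 2 * x^2 + 4 * l * x' + (6 * x^2 + c2 * x + c4)) * s^2"
    unfolding sig_log_derivs fl_nu by (simp_all add: at s_def x_def l_def x'_def c2_def c4_def)
  have v: "at1 (fl nu) = z^2 * w" "at1 (fl (fps_deriv sig)) = k * z" "at1 (fl (fps_deriv (fps_deriv sig))) = (k^2 - w) * z"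
    "at1 (fl (fps_deriv nu)) = (2 * k * w + w') * z^2"
    "at1 (fl (fps_deriv (fps_deriv nu))) = (4 * k^2 * w - 2 * w^2 + 4 * k * w' + (6 * w^2 + c2 * w + c4)) * z^2"
    unfolding sig_log_derivs fl_nu by (simp_all add: at z_def w_def k_def w'_def c2_def c4_def)
  have od: "x'^2 = 4 * x^3 + c2 * x^2 + 2 * c4 * x + c6" "w'^2 = 4 * w^3 + c2 * w^2 + 2 * c4 * w + c6"
    using arg_cong[OF Xl_ode, of at2] arg_cong[OF Xl_ode, of at1]
    by (simp_all add: at x_def w_def x'_def w'_def c2_def c4_def c6_def)
  note fold = at1_fps_to_fls[symmetric] at2_fps_to_fls[symmetric] 
  have Q: "to_fls2 Q2 = s^2 * z^2 * (w - x)"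
    unfolding Q2_def power2_eq_square
    by (simp add: to_fls2_simps fold u v fls_times_fps_to_fls at_simps) (simp add: s_def[symmetric] z_def[symmetric] algebra_simps power2_eq_square)
  have Qu: "to_fls2 (deriv2 Q2) = s^2 * z^2 * (2 * l * w - 2 * l * x - x')"
    unfolding Q2_def power2_eq_square deriv2_simps deriv_lift
    by (simp add: to_fls2_simps fold u v fls_times_fps_to_fls at_simps) (simp add: s_def[symmetric] z_def[symmetric] algebra_simps power2_eq_square)
  have Qv: "to_fls2 (fps_deriv Q2) = s^2 * z^2 * (2 * k * w + w' - 2 * k * x)"
    unfolding Q2_def power2_eq_square fps_deriv_sub fps_deriv_mult deriv_lift
    by (simp add: to_fls2_simps fold u v fls_times_fps_to_fls at_simps) (simp add: s_def[symmetric] z_def[symmetric] algebra_simps power2_eq_square)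
  have Quu: "to_fls2 (deriv2 (deriv2 Q2)) = s^2 * z^2 * ((4 * l^2 - 2 * x) * w - (4 * l^2 * x - 2 * x^2 + 4 * l * x' + (6 * x^2 + c2 * x + c4)))"
    unfolding Q2_def power2_eq_square deriv2_simps deriv_lift
    by (simp add: to_fls2_simps fold u v fls_times_fps_to_fls at_simps) (simp add: s_def[symmetric] z_def[symmetric] algebra_simps power2_eq_square)
  have Qvv: "to_fls2 (fps_deriv (fps_deriv Q2)) = s^2 * z^2 * ((4 * k^2 * w - 2 * w^2 + 4 * k * w' + (6 * w^2 + c2 * w + c4)) - (4 * k^2 - 2 * w) * x)"
    unfolding Q2_def power2_eq_square fps_deriv_sub fps_deriv_add fps_deriv_mult deriv_lift
    by (simp add: to_fls2_simps fold u v fls_times_fps_to_fls at_simps) (simp add: s_def[symmetric] z_def[symmetric] algebra_simps power2_eq_square)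
  have "to_fls2 (Q2 * (deriv2 (deriv2 Q2) - fps_deriv (fps_deriv Q2))) = to_fls2 ((deriv2 Q2)^2 - (fps_deriv Q2)^2)"
    unfolding to_fls2_simps Q Qu Qv Quu Qvv using od by algebra
  then show ?thesis by simp
qed

lemma vanishes_pm: "vanishes (Suc 0) (X2 + X1 :: 'a fps2)" "vanishes (Suc 0) (X2 - X1 :: 'a fps2)"
  by (simp_all add: vanishes_add vanishes_diff vanishes_X)

definition Fp where "Fp f = comp1 f (X2 + X1 :: 'a fps2)"
definition Fm where "Fm f = comp1 f (X2 - X1 :: 'a fps2)"

lemma F_derivs: "fps_deriv (Fp f) = Fp (fps_deriv f)" "deriv2 (Fp f) = Fp (fps_deriv f)"
  "fps_deriv (Fm f) = - Fm (fps_deriv f)" "deriv2 (Fm f) = Fm (fps_deriv f)"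
  unfolding Fp_def Fm_def
  by (simp_all add: comp1_deriv[OF is_deriv_deriv1] comp1_deriv[OF is_deriv_deriv2] vanishes_pm deriv_lift
     deriv2_simps lift1_hom[unfolded is_hom_def])

lemma F_nth_0: "Fp f $ 0 = f" "Fm f $ 0 = f"
  unfolding Fp_def Fm_def by (simp_all add: comp1_nth_0 lift1_def)

lemma F_nth_1: "Fp f $ Suc 0 = fps_deriv f" "Fm f $ Suc 0 = - fps_deriv f"
  using arg_cong[OF F_derivs(1), of "\<lambda>F. F $ 0" f] arg_cong[OF F_derivs(3), of "\<lambda>F. F $ 0" f]
  by (simp_all add: F_nth_0)

text \<open>The logarithm of the product is a function of u + v plus a function of u - v, so it
  solves the wave equation. At v = 0 the product is sig^2 and its v-derivative is 0, as for
  \<open>Q2\<close>.\<close>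

theorem three_term: "Fp sig * Fm sig = Q2"
proof (rule wave_unique)
  show "Fp sig * Fm sig * (deriv2 (deriv2 (Fp sig * Fm sig)) - fps_deriv (fps_deriv (Fp sig * Fm sig))) =
     (deriv2 (Fp sig * Fm sig))^2 - (fps_deriv (Fp sig * Fm sig))^2"
    by (simp add: deriv2_simps F_derivs algebra_simps power2_eq_square)
  show "Q2 * (deriv2 (deriv2 Q2) - fps_deriv (fps_deriv Q2)) = (deriv2 Q2)^2 - (fps_deriv Q2)^2" by (rule Q2_wave)
  show "(Fp sig * Fm sig) $ 0 = Q2 $ 0"
    by (simp add: F_nth_0 Q2_def lift1_def sig_nu_0 power2_eq_square)
  show "(Fp sig * Fm sig) $ 1 = Q2 $ 1"
    by (simp add: fps_mult_nth_1 F_nth_0 F_nth_1 Q2_def lift1_def sig_nu_0 power2_eq_square)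
  show "(Fp sig * Fm sig) $ 0 \<noteq> 0" by (simp add: F_nth_0 sig_nonzero)
qed

lemma three_term_subst:
  assumes "vanishes (Suc 0) g" "vanishes (Suc 0) k"
  shows "comp1 sig (k + g) * comp1 sig (k - g) = (comp1 sig k)^2 * comp1 nu g - (comp1 sig g)^2 * comp1 nu k"
proof -
  note h = is_hom_subst2[OF assms]
  have "subst2 (Fp sig * Fm sig) g k = subst2 Q2 g k" by (simp add: three_term)
  then show ?thesis
    unfolding Q2_def Fp_def Fm_def is_hom_simps[OF h] subst2_comp1[OF vanishes_pm(1) assms] subst2_comp1[OF vanishes_pm(2) assms]
      subst2_lift1 subst2_lift2 comp1_X[OF assms(1)] comp1_X[OF assms(2)] .
qed

text \<open>Exchanging u and v reverses the sign of the right-hand side of the three-term relation.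
  Cancelling sig(u + v) leaves sig(u - v) = - sig(v - u), and v is put to 0.\<close>

lemma sig_odd: "sig oo (- fps_X) = - sig"
proof -
  have "Fp sig * (Fm sig + comp1 sig (X1 - X2)) = 0"
    unfolding Fp_def Fm_def distrib_left three_term_subst[OF vanishes_X(1) vanishes_X(2)]
      three_term_subst[OF vanishes_X(2) vanishes_X(1), unfolded add.commute[of X1 X2]] by simp
  moreover have "Fp sig \<noteq> 0" using F_nth_0(1)[of sig] sig_nonzero by auto
  ultimately have "Fm sig + comp1 sig (X1 - X2) = 0" by simp
  then have e: "subst2 (Fm sig + comp1 sig (X1 - X2)) 0 X2 = subst2 0 0 X2" by simp
  have v: "vanishes (Suc 0) (0 :: 'a fps2)" by simp
  note h = is_hom_simps[OF is_hom_subst2[OF v vanishes_X(2)]]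
  have d: "vanishes (Suc 0) (X1 - X2 :: 'a fps2)" by (simp add: vanishes_diff vanishes_X)
  have "comp1 sig X2 + comp1 sig (- X2) = 0"
    using e unfolding Fm_def h subst2_comp1[OF vanishes_pm(2) v vanishes_X(2)] subst2_comp1[OF d v vanishes_X(2)]
      subst2_lift1 subst2_lift2 comp1_X[OF v] comp1_X[OF vanishes_X(2)] by simp
  moreover have "comp1 sig (- X2) = lift2 (sig oo (- fps_X))"
    using comp1_lift2[of "- fps_X" sig] by simp
  moreover have "comp1 sig X2 = lift2 sig" using comp1_lift2[of fps_X sig] by simp
  ultimately have "lift2 (sig + (sig oo (- fps_X))) = lift2 0" by simp
  then have "sig + (sig oo (- fps_X)) = 0" by (metis fps_const_eq_0_iff fps_const_0_eq_0)
  then show ?thesis by (simp add: add_eq_0_iff)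
qed

text \<open>Differentiate the three-term relation with respect to v and put u = v, where sig(u - v)
  vanishes and only sig(2u) times sig'(0) = 1 survives.\<close>

lemma duplication_subst:
  assumes "vanishes (Suc 0) k"
  shows "comp1 sig (k + k) = - comp1 sig k * comp1 kap k"
proof -
  note h = is_hom_simps[OF is_hom_subst2[OF assms assms]] is_hom_simps[OF is_hom_comp1[OF assms]]
  have 0: "comp1 f (0 :: 'a fps2) = const_fps2 (f $ 0)" for f
  proof -
    have "subst_coeffs const_fps2 0 f = fps_const (const_fps2 (f $ 0))"
      by (rule fps_ext) (simp add: subst_coeffs_def power_0_left)
    then show ?thesis by (simp add: comp1_def)
  qed
  have "fps_deriv (Fp sig * Fm sig) = fps_deriv Q2" by (simp add: three_term)
  then have "Fp (fps_deriv sig) * Fm sig - Fp sig * Fm (fps_deriv sig) = 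
      (lift2 sig)^2 * lift1 (fps_deriv nu) - 2 * lift1 sig * lift1 (fps_deriv sig) * lift2 nu"
    by (simp add: Q2_def F_derivs power2_eq_square deriv_lift algebra_simps)
  from arg_cong[OF this, of "\<lambda>F. subst2 F k k"] show ?thesis
    unfolding Fp_def Fm_def h kap_def subst2_comp1[OF vanishes_pm(1) assms assms] subst2_comp1[OF vanishes_pm(2) assms assms]
      subst2_lift1 subst2_lift2 comp1_X[OF assms]
    by (simp add: 0 sig_nu_0 algebra_simps power2_eq_square)
qed

lemma duplication: "sig oo (2 * fps_X) = - sig * kap"
proof -
  have "comp1 sig (X2 + X2) = lift2 (sig oo (2 * fps_X))"
    using comp1_lift2[of "fps_X + fps_X" sig] by simp
  moreover have "comp1 c X2 = lift2 c" for c :: "'a fps" using comp1_lift2[of fps_X c] by simp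
  ultimately have "lift2 (sig oo (2 * fps_X)) = lift2 (- sig * kap)"
    using duplication_subst[OF vanishes_X(2)] by simp
  then show ?thesis by (metis fps_nth_fps_const)
qed

subsection \<open>Addition\<close>

text \<open>The addition theorem \<open>4 X(u - v) = ((X'(u) + X'(v)) / (X(u) - X(v)))^2 - 4 (X(u) +
  X(v)) - b2\<close> without poles. The u-derivative minus the v-derivative annihilates functions of
  u + v, so applied twice to the logarithm of the three-term relation it isolates (log sig)'' at u -
  v.\<close>

lemma addition:
  "4 * Fm nu * (lift2 nu * (lift1 sig)^2 - lift1 nu * (lift2 sig)^2)^2 * (lift2 sig)^2 * (lift1 sig)^2 =
   (Fm sig)^2 * ((lift2 kap * (lift1 sig)^3 + lift1 kap * (lift2 sig)^3)^2 - 
     (4 * (lift2 nu * (lift1 sig)^2 + lift1 nu * (lift2 sig)^2) + const_fps2 (b2 \<mu>) * (lift2 sig)^2 * (lift1 sig)^2) *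
       (lift2 nu * (lift1 sig)^2 - lift1 nu * (lift2 sig)^2)^2)"
proof -
  define d where "d F = deriv2 F - fps_deriv F" for F :: "'a fps2"
  have dd: "d (F * G) = d F * G + F * d G" "d (F - G) = d F - d G" "d (F + G) = d F + d G" for F G
    by (simp_all add: d_def deriv2_simps algebra_simps)
  have d2: "d 2 = 0" unfolding d_def numeral_fps_const by (simp add: deriv2_def fps_eq_iff)
  have dF: "d (Fp f) = 0" "d (Fm f) = 2 * Fm (fps_deriv f)" "d 0 = 0" for f by (simp_all add: d_def F_derivs deriv2_simps)
  have nu: "Fm nu = (Fm (fps_deriv sig))^2 - Fm sig * Fm (fps_deriv (fps_deriv sig))"
    by (subst nu_sig) (simp add: Fm_def is_hom_simps[OF is_hom_comp1[OF vanishes_pm(2)]])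
  \<comment> \<open>The factor 4 arises because \<open>d\<close> acts on functions of u - v as twice
    the derivative.\<close>
  have "(d (Fp sig * Fm sig))^2 - Fp sig * Fm sig * d (d (Fp sig * Fm sig)) = 4 * (Fp sig)^2 * Fm nu"
    unfolding dd dF d2 nu by algebra
  then have "4 * (Fp sig * Fm sig)^2 * Fm nu = (Fm sig)^2 * ((d (Fp sig * Fm sig))^2 - Fp sig * Fm sig * d (d (Fp sig * Fm sig)))"
    by algebra
  then have *: "4 * Q2^2 * Fm nu = (Fm sig)^2 * ((d Q2)^2 - Q2 * d (d Q2))"
    unfolding three_term .
  define s z where "s = at2 (fl sig)" and "z = at1 (fl sig)"
  define x w where "x = at2 Xl" and "w = at1 Xl"
  define x' w' where "x' = at2 Xl'" and "w' = at1 Xl'"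
  define l k where "l = at2 zl" and "k = at1 zl"
  define c2 c4 where "c2 = const2 (b2 \<mu>)" and "c4 = const2 (b4 \<mu>)"
  note at = at_simps at1_const at2_const
  have u: "at2 (fl nu) = s^2 * x" "at2 (fl (fps_deriv sig)) = l * s" "at2 (fl (fps_deriv (fps_deriv sig))) = (l^2 - x) * s"
    "at2 (fl (fps_deriv nu)) = (2 * l * x + x') * s^2"
    "at2 (fl (fps_deriv (fps_deriv nu))) = (4 * l^2 * x - 2 * x^2 + 4 * l * x' + (6 * x^2 + c2 * x + c4)) * s^2"
    "at2 (fl kap) = s^3 * x'"
    unfolding sig_log_derivs fl_nu fl_kap by (simp_all add: at s_def x_def l_def x'_def c2_def c4_def)
  have v: "at1 (fl nu) = z^2 * w" "at1 (fl (fps_deriv sig)) = k * z" "at1 (fl (fps_deriv (fps_deriv sig))) = (k^2 - w) * z"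
    "at1 (fl (fps_deriv nu)) = (2 * k * w + w') * z^2"
    "at1 (fl (fps_deriv (fps_deriv nu))) = (4 * k^2 * w - 2 * w^2 + 4 * k * w' + (6 * w^2 + c2 * w + c4)) * z^2"
    "at1 (fl kap) = z^3 * w'"
    unfolding sig_log_derivs fl_nu fl_kap by (simp_all add: at z_def w_def k_def w'_def c2_def c4_def)
  note fold = at1_fps_to_fls[symmetric] at2_fps_to_fls[symmetric] 
  have Q: "to_fls2 Q2 = s^2 * z^2 * (w - x)"
    unfolding Q2_def power2_eq_square
    by (simp add: to_fls2_simps fold u v fls_times_fps_to_fls at_simps) (simp add: s_def[symmetric] z_def[symmetric] algebra_simps power2_eq_square)
  have dQ: "to_fls2 (d Q2) = s^2 * z^2 * (2 * l * w - 2 * l * x - x' - (2 * k * w + w' - 2 * k * x))"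
    unfolding d_def Q2_def power2_eq_square deriv2_simps fps_deriv_sub fps_deriv_mult deriv_lift
    by (simp add: to_fls2_simps fold u v fls_times_fps_to_fls at_simps) (simp add: s_def[symmetric] z_def[symmetric] algebra_simps power2_eq_square)
  have ddQ: "to_fls2 (d (d Q2)) = s^2 * z^2 * ((4 * l^2 - 2 * x) * w - (4 * l^2 * x - 2 * x^2 + 4 * l * x' + (6 * x^2 + c2 * x + c4))
      + ((4 * k^2 * w - 2 * w^2 + 4 * k * w' + (6 * w^2 + c2 * w + c4)) - (4 * k^2 - 2 * w) * x)
      - 2 * (2 * l * (2 * k * w + w') - 2 * k * (2 * l * x + x')))"
    unfolding d_def Q2_def power2_eq_square deriv2_simps fps_deriv_sub fps_deriv_add fps_deriv_mult deriv_lift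
    by (simp add: to_fls2_simps fold u v fls_times_fps_to_fls at_simps) (simp add: s_def[symmetric] z_def[symmetric] algebra_simps power2_eq_square)
  define y where "y = to_fls2 (Fm sig)"
  define n where "n = to_fls2 (Fm nu)"
  have "4 * (s^2 * z^2 * (w - x))^2 * n = y^2 * (s^2 * z^2)^2 * ((x' + w')^2 - (4 * (x + w) + c2) * (x - w)^2)"
  proof -
    have "4 * (s^2 * z^2 * (w - x))^2 * n = y^2 * ((to_fls2 (d Q2))^2 - to_fls2 Q2 * to_fls2 (d (d Q2)))"
      using arg_cong[OF *, of to_fls2] by (simp add: to_fls2_simps Q y_def n_def)
    also have "(to_fls2 (d Q2))^2 - to_fls2 Q2 * to_fls2 (d (d Q2)) = (s^2 * z^2)^2 * ((x' + w')^2 - (4 * (x + w) + c2) * (x - w)^2)"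
      unfolding Q dQ ddQ by (simp add: algebra_simps power2_eq_square)
    finally show ?thesis by (simp add: mult.assoc)
  qed
  then have "4 * n * (s^2 * x * z^2 - z^2 * w * s^2)^2 * s^2 * z^2 = 
     y^2 * ((s^3 * x' * z^3 + z^3 * w' * s^3)^2 - (4 * (s^2 * x * z^2 + z^2 * w * s^2) + c2 * s^2 * z^2) * (s^2 * x * z^2 - z^2 * w * s^2)^2)"
    by algebra
  then have "4 * to_fls2 (Fm nu) * (to_fls2 (lift2 nu) * (to_fls2 (lift1 sig))^2 - to_fls2 (lift1 nu) * (to_fls2 (lift2 sig))^2)^2 
     * (to_fls2 (lift2 sig))^2 * (to_fls2 (lift1 sig))^2 =
   (to_fls2 (Fm sig))^2 * ((to_fls2 (lift2 kap) * (to_fls2 (lift1 sig))^3 + to_fls2 (lift1 kap) * (to_fls2 (lift2 sig))^3)^2 - 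
     (4 * (to_fls2 (lift2 nu) * (to_fls2 (lift1 sig))^2 + to_fls2 (lift1 nu) * (to_fls2 (lift2 sig))^2) + to_fls2 (const_fps2 (b2 \<mu>)) * (to_fls2 (lift2 sig))^2 * (to_fls2 (lift1 sig))^2) *
       (to_fls2 (lift2 nu) * (to_fls2 (lift1 sig))^2 - to_fls2 (lift1 nu) * (to_fls2 (lift2 sig))^2)^2)"
    unfolding fold u v y_def n_def c2_def const2_to_fls2 s_def[symmetric] z_def[symmetric] .
  then have "to_fls2 (4 * Fm nu * (lift2 nu * (lift1 sig)^2 - lift1 nu * (lift2 sig)^2)^2 * (lift2 sig)^2 * (lift1 sig)^2) =
     to_fls2 ((Fm sig)^2 * ((lift2 kap * (lift1 sig)^3 + lift1 kap * (lift2 sig)^3)^2 - 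
     (4 * (lift2 nu * (lift1 sig)^2 + lift1 nu * (lift2 sig)^2) + const_fps2 (b2 \<mu>) * (lift2 sig)^2 * (lift1 sig)^2) *
       (lift2 nu * (lift1 sig)^2 - lift1 nu * (lift2 sig)^2)^2))"
    by (simp only: to_fls2_simps)
  then show ?thesis by (simp only: to_fls2_inject)
qed

subsection \<open>The arithmetic parameter as a series in the analytic coordinate\<close>

definition Yl :: "'a fls" where "Yl = (Xl' - fls_const (\<mu> 1) * Xl - fls_const (\<mu> 3)) / 2"

lemma Xl_Yl: "Yl^2 + (fls_const (\<mu> 1) * Xl + fls_const (\<mu> 3)) * Yl = 
   Xl^3 + fls_const (\<mu> 2) * Xl^2 + fls_const (\<mu> 4) * Xl + fls_const (\<mu> 6)"
proof -
  have Y: "2 * Yl = Xl' - fls_const (\<mu> 1) * Xl - fls_const (\<mu> 3)" by (simp add: Yl_def)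
  have c: "fls_const (b2 \<mu>) = (fls_const (\<mu> 1))^2 + 4 * fls_const (\<mu> 2)"
    "fls_const (b4 \<mu>) = 2 * fls_const (\<mu> 4) + fls_const (\<mu> 1) * fls_const (\<mu> 3)"
    "fls_const (b6 \<mu>) = (fls_const (\<mu> 3))^2 + 4 * fls_const (\<mu> 6)"
    by (simp_all add: b2_def b4_def b6_def fls_const_power flip: fls_plus_const fls_const_mult_const fls_const_numeral)
  have "4 * (Yl^2 + (fls_const (\<mu> 1) * Xl + fls_const (\<mu> 3)) * Yl) = 
     4 * (Xl^3 + fls_const (\<mu> 2) * Xl^2 + fls_const (\<mu> 4) * Xl + fls_const (\<mu> 6))"
    using Xl_ode Y unfolding c by algebra
  then show ?thesis by (metis mult_cancel_left zero_neq_numeral)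
qed

text \<open>1/X and -X/Y as quotients of power series: \<open>den\<close> is 2 sig^3 Y and has the
  constant term -2.\<close>

definition Su :: "'a fps" where "Su = sig^2 * inverse nu"
definition den where "den = kap - m 1 * sig * nu - m 3 * sig^3"
definition tau :: "'a fps" where "tau = - 2 * sig * nu * inverse den"

lemma Su_nu: "Su * nu = sig^2"
  by (simp add: Su_def mult.assoc inverse_mult_eq_1 sig_nu_0)

lemma den_0: "den $ 0 = - 2"
  by (simp add: den_def kap_def sig_nu_0 power3_eq_cube fps_mult_nth_1 numeral_fps_const)

lemma tau_den: "tau * den = - 2 * sig * nu"
  by (simp add: tau_def mult.assoc inverse_mult_eq_1 den_0)

lemma tau_low: "tau $ 0 = 0" "tau $ Suc 0 = 1"
proof -
  show 0: "tau $ 0 = 0" by (simp add: tau_def sig_nu_0)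
  have "(tau * den) $ Suc 0 = (- 2 * sig * nu) $ Suc 0" by (simp only: tau_den)
  then have "tau $ Suc 0 * (- 2) = - 2" by (simp add: fps_mult_nth_1 0 den_0 sig_nu_0 numeral_fps_const)
  then show "tau $ Suc 0 = 1" by simp
qed

lemma fl_tau: "fl tau * Yl = - Xl" and Yl_nonzero: "Yl \<noteq> 0" and fl_Su: "fl Su * Xl = 1"
proof -
  have s: "fl sig \<noteq> 0" "fl nu \<noteq> 0" "fl den \<noteq> 0" using sig_nonzero nu_nonzero den_0 by auto
  have d: "fl den = 2 * (fl sig)^3 * Yl"
    unfolding den_def by (simp add: fls_times_fps_to_fls fps_to_fls_power fl_nu fl_kap Yl_def algebra_simps power2_eq_square power3_eq_cube)
  show "Yl \<noteq> 0" using d s by auto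
  have "2 * (fl sig)^3 * (fl tau * Yl) = 2 * (fl sig)^3 * - Xl"
  proof -
    have "fl tau * fl den = - 2 * fl sig * fl nu"
      using arg_cong[OF tau_den, of fl] by (simp add: fls_times_fps_to_fls)
    then show ?thesis using d fl_nu by algebra
  qed
  moreover have "2 * (fl sig)^3 \<noteq> 0" using s(1) by simp
  ultimately show "fl tau * Yl = - Xl" by (metis mult_left_cancel)
  have "(fl sig)^2 * (fl Su * Xl) = (fl sig)^2 * 1"
    using arg_cong[OF Su_nu, of fl] by (simp add: fls_times_fps_to_fls fps_to_fls_power fl_nu mult_ac)
  moreover have "(fl sig)^2 \<noteq> 0" using s(1) by simp
  ultimately show "fl Su * Xl = 1" by (metis mult_left_cancel)
qed

text \<open>The curve equation for (X, Y) is the equation at infinity for s = 1/X with the parameter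
  -X/Y, so uniqueness applies.\<close>

lemma S_tau: "S oo tau = Su"
proof (rule S_compose[OF tau_low(1)])
  have X: "Xl \<noteq> 0" using fl_Su by auto
  define v where "v = - Xl / Yl"
  define r where "r = 1 / Xl"
  have v: "fl tau = v" "fl Su = r" unfolding v_def r_def
    by (subst nonzero_eq_divide_eq[OF Yl_nonzero], rule fl_tau, subst nonzero_eq_divide_eq[OF X], rule fl_Su)
  have "r = curve_a (\<lambda>j. fls_const (\<mu> j)) r * v^2 + curve_b (\<lambda>j. fls_const (\<mu> j)) r * v"
  proof -
    have 1: "r * Xl = 1" "v * Yl = - Xl" using X Yl_nonzero by (simp_all add: r_def v_def)
    have "Yl^2 * Xl * (curve_a (\<lambda>j. fls_const (\<mu> j)) r * v^2 + curve_b (\<lambda>j. fls_const (\<mu> j)) r * v) = Yl^2"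
      unfolding curve_a_def curve_b_def using 1 Xl_Yl by algebra
    moreover have "Yl^2 * Xl * r = Yl^2" using 1 by algebra
    ultimately show ?thesis using X Yl_nonzero by (metis mult_cancel_left no_zero_divisors power_not_zero)
  qed
  then have "fl Su = fl (curve_a m Su * tau^2 + curve_b m Su * tau)"
    unfolding v[symmetric] by (simp add: curve_a_def curve_b_def fls_times_fps_to_fls fps_to_fls_power)
  then show "Su = curve_a m Su * tau^2 + curve_b m Su * tau" by (simp only: fps_to_fls_eq_iff)
qed

lemma Phi_tau: "(\<Phi> oo tau) * nu^2 = - sig * kap"
proof -
  have "\<Phi> oo tau = 2 * curve_a m Su * tau + curve_b m Su"
    by (simp add: \<Phi>_def a_def b_def curve_a_def curve_b_def fps_compose_add_distrib tau_low
        fps_compose_mult_distrib[OF tau_low(1)] fps_compose_power[OF tau_low(1), symmetric] S_tau)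
  then have "fl (\<Phi> oo tau) = 2 * curve_a (\<lambda>j. fls_const (\<mu> j)) (fl Su) * fl tau + curve_b (\<lambda>j. fls_const (\<mu> j)) (fl Su)"
    by (simp add: curve_a_def curve_b_def fls_times_fps_to_fls fps_to_fls_power)
  moreover have "Yl * Xl^2 * (2 * curve_a (\<lambda>j. fls_const (\<mu> j)) (fl Su) * fl tau + curve_b (\<lambda>j. fls_const (\<mu> j)) (fl Su)) = - Yl * Xl'"
  proof -
    have Y: "2 * Yl = Xl' - fls_const (\<mu> 1) * Xl - fls_const (\<mu> 3)" by (simp add: Yl_def)
    show ?thesis using Y Xl_Yl fl_Su fl_tau unfolding curve_a_def curve_b_def by algebra
  qed
  ultimately have "Xl^2 * fl (\<Phi> oo tau) = - Xl'" using Yl_nonzero by (simp add: mult.assoc) (metis mult_cancel_left mult_minus_right)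
  then have "fl ((\<Phi> oo tau) * nu^2) = fl (- sig * kap)"
    by (simp add: fls_times_fps_to_fls fps_to_fls_power fl_nu fl_kap) algebra
  then show ?thesis by (simp only: fps_to_fls_eq_iff)
qed

lemma Su_deriv: "fps_deriv Su * nu^2 = - sig * kap"
proof -
  have "fps_deriv (Su * nu) = fps_deriv (sig^2)" by (simp add: Su_nu)
  then have "fps_deriv Su * nu + Su * fps_deriv nu = 2 * sig * fps_deriv sig" 
    by (simp add: power2_eq_square algebra_simps)
  then show ?thesis using Su_nu unfolding kap_def by algebra
qed

text \<open>X' = 2Y + \<mu>_1 X + \<mu>_3 says that \<omega>_1 pulls back to du. For series this
  amounts to comparing two computations of the derivative of 1/X = S(tau).\<close>

lemma U_tau: "U oo tau = fps_X"
proof -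
  have "fps_deriv Su = (fps_deriv S oo tau) * fps_deriv tau"
    using fps_compose_deriv[OF tau_low(1), of S] by (simp add: S_tau)
  also have "fps_deriv S oo tau = (\<Phi> oo tau) * (\<Omega> oo tau)" 
    by (simp add: S_deriv' fps_compose_mult_distrib[OF tau_low(1)])
  finally have "fps_deriv Su * nu^2 = (\<Phi> oo tau) * nu^2 * ((\<Omega> oo tau) * fps_deriv tau)" 
    by (simp only: mult_ac)
  then have "- sig * kap * 1 = - sig * kap * ((\<Omega> oo tau) * fps_deriv tau)" unfolding Su_deriv Phi_tau by simp
  moreover have "- sig * kap \<noteq> 0"
  proof -
    have "kap $ 0 \<noteq> 0" by (simp add: kap_def sig_nu_0 numeral_fps_const)
    then show ?thesis using sig_nonzero by auto
  qed
  ultimately have "(\<Omega> oo tau) * fps_deriv tau = 1" by (metis mult_cancel_left)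
  then have "fps_deriv (U oo tau) = fps_deriv fps_X"
    by (simp add: fps_compose_deriv[OF tau_low(1)] U_simps)
  then show ?thesis
    by (subst (asm) fps_deriv_eq_iff) (simp add: tau_low U_simps)
qed

lemma fps_inv_U: "fps_inv U = tau"
proof -
  have "fps_inv U = (fps_inv U oo U) oo tau"
    by (subst fps_compose_assoc[symmetric]) (simp_all add: U_tau tau_low U_simps)
  then show ?thesis by (simp add: fps_inv U_simps tau_low)
qed

lemma t_ser_eq: "t_ser \<mu> = tau" by (simp add: t_ser_def u_ser_eq fps_inv_U)

lemma tau_U: "tau oo U = fps_X"
  using fps_inv[of U] by (simp add: U_simps fps_inv_U)

text \<open>The relation nu = sig^2 X at u = U(t), where X = 1/S; \<open>kap_U\<close> does the same
  for kap = sig^3 X'.\<close>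

lemma sig_U_square: "(sig oo U)^2 = S * (nu oo U)"
proof -
  have "S = S oo (tau oo U)" by (simp add: tau_U)
  also have "\<dots> = Su oo U" by (simp add: fps_compose_assoc tau_low U_simps S_tau)
  finally have "S * (nu oo U) = (Su * nu) oo U" by (simp add: fps_compose_mult_distrib U_simps)
  then show ?thesis by (simp add: Su_nu fps_compose_power U_simps)
qed

lemma kap_U: "S * (kap oo U) = - (sig oo U) * \<Phi> * (nu oo U)"
proof -
  note cd = fps_compose_deriv[OF U_simps(1)]
  have "fps_deriv ((sig oo U)^2) = fps_deriv (S * (nu oo U))" by (simp add: sig_U_square)
  then have "\<Omega> * (2 * (sig oo U) * (fps_deriv sig oo U)) = \<Omega> * (\<Phi> * (nu oo U) + S * (fps_deriv nu oo U))"
    by (simp add: cd S_deriv' U_simps power2_eq_square algebra_simps)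
  moreover have "\<Omega> \<noteq> 0" using \<Omega>_0 by auto
  ultimately have 1: "2 * (sig oo U) * (fps_deriv sig oo U) = \<Phi> * (nu oo U) + S * (fps_deriv nu oo U)"
    by simp
  have "kap oo U = (sig oo U) * (fps_deriv nu oo U) - 2 * (fps_deriv sig oo U) * (nu oo U)"
    by (simp add: kap_def fps_compose_sub_distrib fps_compose_mult_distrib U_simps)
  then show ?thesis using 1 sig_U_square by algebra
qed

end

section \<open>The series r\<close>

lemma subst2_nth:
  assumes "vanishes (Suc 0) g" "vanishes (Suc 0) h" "i + j \<le> N"
  shows "subst2 F g h $ i $ j = (\<Sum>p\<le>N. \<Sum>n\<le>N. (const_fps2 (F $ p $ n) * (g ^ p * h ^ n)) $ i $ j)"
proof -
  have "subst2 F g h $ i $ j = (\<Sum>p\<le>N. (comp1 (F $ p) h * g ^ p) $ i $ j)"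
    unfolding subst2_def
    by (subst gsum_eq_upto[OF graded_subst_coeffs[OF assms(1)] assms(3)]) (simp add: subst_coeffs_def)
  also have "\<dots> = (\<Sum>p\<le>N. \<Sum>n\<le>N. (const_fps2 (F $ p $ n) * (g ^ p * h ^ n)) $ i $ j)"
  proof (intro sum.cong refl)
    fix p
    let ?S = "\<Sum>n\<le>N. const_fps2 (F $ p $ n) * h ^ n"
    have "vanishes (Suc N) (comp1 (F $ p) h - ?S)"
      using gsum_cong[OF graded_subst_coeffs[OF assms(2)], of "Suc N" const_fps2 "F $ p"]
      unfolding comp1_def lessThan_Suc_atMost by (simp add: subst_coeffs_def)
    then have "vanishes (Suc N) ((comp1 (F $ p) h - ?S) * g ^ p)" by (rule vanishes_mult_left)
    then have "((comp1 (F $ p) h - ?S) * g ^ p) $ i $ j = 0"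
      unfolding vanishes_def using assms(3) by (simp add: less_Suc_eq_le)
    then have "(comp1 (F $ p) h * g ^ p) $ i $ j = (?S * g ^ p) $ i $ j" by (simp add: left_diff_distrib)
    also have "?S * g ^ p = (\<Sum>n\<le>N. const_fps2 (F $ p $ n) * (g ^ p * h ^ n))"
      unfolding sum_distrib_right by (intro sum.cong refl) (simp only: mult_ac)
    also have "\<dots> $ i $ j = (\<Sum>n\<le>N. (const_fps2 (F $ p $ n) * (g ^ p * h ^ n)) $ i $ j)"
      by (simp only: fps_sum_nth)
    finally show "(comp1 (F $ p) h * g ^ p) $ i $ j = (\<Sum>n\<le>N. (const_fps2 (F $ p $ n) * (g ^ p * h ^ n)) $ i $ j)" .
  qed
  finally show ?thesis .
qed

subsection \<open>Exchanging the variables\<close>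

definition swap :: "'a::comm_ring_1 fps2 \<Rightarrow> 'a fps2" where
  "swap F = Abs_fps (\<lambda>i. Abs_fps (\<lambda>j. F $ j $ i))"

lemma swap_nth [simp]: "swap F $ i $ j = F $ j $ i" by (simp add: swap_def)

lemma is_hom_swap: "is_hom (swap :: 'a::comm_ring_1 fps2 \<Rightarrow> _)"
proof -
  have "swap (F * G) = swap F * swap G" for F G :: "'a fps2"
    unfolding fps_eq_iff fps2_mult_nth swap_nth by (auto intro: sum.swap)
  moreover have "swap (1 :: 'a fps2) = 1" by (auto simp: fps_eq_iff fps_one_nth)
  ultimately show ?thesis by (auto simp: is_hom_def fps_eq_iff)
qed

lemma swap_lift: "swap (lift1 f) = lift2 f" "swap (lift2 f) = lift1 f"
  by (auto simp: fps_eq_iff)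

lemma swap_comp1: "swap (comp1 c g) = comp1 c (swap g)"
proof -
  have "swap (g ^ n) = swap g ^ n" for n by (rule is_hom_power[OF is_hom_swap])
  then have "(swap g ^ n) $ i $ j = (g ^ n) $ j $ i" for n i j by (metis swap_nth)
  then show ?thesis
    by (intro fps2_eqI) (simp add: comp1_def gsum_def subst_coeffs_def add.commute)
qed

lemma comp1_axis1:
  assumes "g $ 0 = f" "f $ 0 = 0" shows "comp1 c g $ 0 = c oo f"
proof (rule fps_ext)
  fix j
  have "(g ^ n) $ 0 = f ^ n" for n by (induction n) (simp_all add: assms(1))
  then show "comp1 c g $ 0 $ j = (c oo f) $ j"
    by (simp add: comp1_def gsum_def subst_coeffs_def fps_compose_nth atLeast0AtMost)
qed

lemma X_diff_cancel_vanishes: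
  fixes G :: "'a::comm_ring_1 fps2"
  assumes "vanishes (Suc n) ((X1 - X2) * G)" shows "vanishes n G"
  unfolding vanishes_def
proof (intro allI impI)
  fix i j assume "i + j < n"
  then show "G $ i $ j = 0"
  proof (induction j arbitrary: i)
    case 0
    then have "((X1 - X2) * G) $ Suc i $ 0 = 0" using assms by (simp only: vanishes_def)
    then show ?case by (simp add: X1_eq left_diff_distrib)
  next
    case (Suc j)
    then have "((X1 - X2) * G) $ Suc i $ Suc j = 0" using assms by (simp only: vanishes_def)
    then show ?case using Suc.IH[of "Suc i"] Suc.prems by (simp add: X1_eq left_diff_distrib)
  qed
qed

text \<open>The difference quotient of f: every monomial of total degree n gets the coefficient of f
  of index n + 1.\<close>

definition quot :: "'a::comm_ring_1 fps \<Rightarrow> 'a fps2" where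
  "quot f = Abs_fps (\<lambda>i. Abs_fps (\<lambda>j. f $ (Suc (i + j))))"

lemma quot: "lift1 f - lift2 f = (X1 - X2) * quot f"
proof (rule fps2_eqI)
  fix i j
  show "(lift1 f - lift2 f) $ i $ j = ((X1 - X2) * quot f) $ i $ j"
    by (cases i; cases j) (simp_all add: X1_eq left_diff_distrib quot_def)
qed

lemma X1_X2_neq: "X1 - X2 \<noteq> (0 :: 'a::comm_ring_1 fps2)"
proof
  assume "X1 - X2 = (0 :: 'a fps2)"
  then have "(X1 - X2 :: 'a fps2) $ 1 $ 0 = 0" by simp
  then show False by simp
qed

subsection \<open>Logarithmic derivatives\<close>

text \<open>The mixed second derivative of log F, multiplied by F^2.\<close>

abbreviation log_mixed :: "'a::comm_ring_1 fps2 \<Rightarrow> 'a fps2" where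
  "log_mixed F \<equiv> F * fps_deriv (deriv2 F) - fps_deriv F * deriv2 F"

lemma fps_deriv_deriv2: "fps_deriv (deriv2 F) = deriv2 (fps_deriv F)"
  by (auto simp: fps_eq_iff deriv2_def algebra_simps simp flip: fps_of_nat)

lemma log_mixed_mult: "log_mixed (F * G) = F^2 * log_mixed G + G^2 * log_mixed F"
  by (simp add: deriv2_simps power2_eq_square algebra_simps)

text \<open>The mixed logarithmic derivative and the values on both axes determine the series: if E
  = F - F' has order N, the equation gives order N - 1 for the mixed derivative of E, hence order N
  + 1 for E off the axes.\<close>

lemma log_mixed_unique:
  fixes F F' g :: "'a::field_char_0 fps2"
  assumes F: "log_mixed F = g * F^2" and F': "log_mixed F' = g * F'^2"
    and axes: "\<And>i. F $ i $ 0 = F' $ i $ 0" "\<And>j. F $ 0 $ j = F' $ 0 $ j" and one: "F' $ 0 $ 0 = 1"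
  shows "F = F'"
proof (rule eq_if_vanishes)
  fix N
  define E where "E = F - F'"
  obtain I where I: "F' * I = 1" using fps2_unit[OF one] by blast
  show "vanishes N (F - F')" unfolding E_def[symmetric]
  proof (induction N)
    case (Suc N)
    have "fps_deriv (deriv2 E) = I * (- E * fps_deriv (deriv2 F) + fps_deriv E * deriv2 F + fps_deriv F' * deriv2 E 
        + g * (E * (F + F')))"
    proof -
      have E: "fps_deriv (deriv2 E) = fps_deriv (deriv2 F) - fps_deriv (deriv2 F')"
        "fps_deriv E = fps_deriv F - fps_deriv F'" "deriv2 E = deriv2 F - deriv2 F'"
        by (simp_all add: E_def deriv2_simps)
      have "F' * fps_deriv (deriv2 E) = - E * fps_deriv (deriv2 F) + fps_deriv E * deriv2 F + fps_deriv F' * deriv2 E 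
        + g * (E * (F + F'))"
        using F F' unfolding E fps_deriv_sub unfolding E_def by algebra
      then have "I * (F' * fps_deriv (deriv2 E)) = I * (- E * fps_deriv (deriv2 F) + fps_deriv E * deriv2 F + fps_deriv F' * deriv2 E 
        + g * (E * (F + F')))" by simp
      then show ?thesis using I by (simp add: mult.assoc[symmetric] mult.commute[of I])
    qed
    moreover have "vanishes k \<dots>" if "N = Suc k" for k
    proof -
      have "vanishes k (fps_deriv E)" "vanishes k (deriv2 E)" "vanishes k E"
        using Suc that is_deriv_vanishes[OF is_deriv_deriv1] is_deriv_vanishes[OF is_deriv_deriv2] 
        by (auto intro: vanishes_mono)
      then show ?thesis
        by (intro vanishes_mult_right[of _ _ I]) (simp add: vanishes_mult_left vanishes_mult_right vanishes_add vanishes_diff)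
    qed
    ultimately have v: "vanishes k (fps_deriv (deriv2 E))" if "N = Suc k" for k using that by simp
    show ?case unfolding vanishes_def
    proof (intro allI impI)
      fix i j assume ij: "i + j < Suc N"
      show "E $ i $ j = 0"
      proof (cases i; cases j)
        fix i' j' assume s: "i = Suc i'" "j = Suc j'"
        then obtain k where k: "N = Suc k" using ij by (cases N) auto
        have "fps_deriv (deriv2 E) $ i' $ j' = 0" using v[OF k] ij s k by (auto simp: vanishes_def)
        then have "of_nat (Suc i') * (of_nat (Suc j') * E $ i $ j) = 0"
          using s by (simp add: deriv2_def del: of_nat_Suc flip: fps_of_nat)
        then show ?thesis by (simp del: of_nat_Suc)
      qed (use axes in \<open>auto simp: E_def\<close>)
    qed
  qed simp
qed

lemma is_const_if_derivs_0:
  fixes F :: "'a::field_char_0 fps2"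
  assumes "fps_deriv F = 0" "deriv2 F = 0" shows "F = const_fps2 (F $ 0 $ 0)"
proof (rule fps2_eqI)
  fix i j
  have 1: "of_nat (Suc i) * F $ Suc i $ j = 0" for i j
    using arg_cong[OF assms(1), of "\<lambda>F. F $ i $ j"] by (simp del: of_nat_Suc flip: fps_of_nat)
  have 2: "of_nat (Suc j) * F $ i $ Suc j = 0" for i j
    using arg_cong[OF assms(2), of "\<lambda>F. F $ i $ j"] by (simp add: deriv2_def del: of_nat_Suc)
  show "F $ i $ j = const_fps2 (F $ 0 $ 0) $ i $ j"
    using 1 2 by (cases i; cases j) (auto simp del: of_nat_Suc)
qed

abbreviation exp2 :: "'a::field_char_0 fps2 \<Rightarrow> 'a fps2" where "exp2 \<equiv> comp1 (fps_exp 1)"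

lemma exp2_deriv: "is_deriv d \<Longrightarrow> vanishes (Suc 0) F \<Longrightarrow> d (exp2 F) = exp2 F * d F"
  using comp1_deriv[of d F "fps_exp 1"] by simp

lemma exp2_nth_0: "exp2 F $ 0 $ 0 = 1" by (simp add: comp1_nth_0_0)

lemma exp2_minus: 
  assumes "vanishes (Suc 0) F" shows "exp2 F * exp2 (- F) = 1"
proof -
  have v: "vanishes (Suc 0) (- F)" using assms by (rule vanishes_uminus)
  have d: "d (exp2 F * exp2 (- F)) = 0" if "is_deriv d" for d
    by (simp add: is_deriv_simps[OF that] exp2_deriv[OF that assms] exp2_deriv[OF that v])
  then have "exp2 F * exp2 (- F) = const_fps2 ((exp2 F * exp2 (- F)) $ 0 $ 0)"
    using d[OF is_deriv_deriv1] d[OF is_deriv_deriv2] by (intro is_const_if_derivs_0)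
  then show ?thesis by (simp add: exp2_nth_0)
qed

lemma exp2_add: 
  assumes "vanishes (Suc 0) F" "vanishes (Suc 0) G" shows "exp2 (F + G) = exp2 F * exp2 G"
proof -
  have v: "vanishes (Suc 0) (- F)" "vanishes (Suc 0) (- G)" "vanishes (Suc 0) (F + G)"
    using assms by (auto intro: vanishes_uminus vanishes_add)
  let ?Z = "exp2 (F + G) * exp2 (- F) * exp2 (- G)"
  have d: "d ?Z = 0" if "is_deriv d" for d
    by (simp add: is_deriv_simps[OF that] exp2_deriv[OF that v(1)] exp2_deriv[OF that v(2)] exp2_deriv[OF that v(3)] algebra_simps)
  then have "?Z = const_fps2 (?Z $ 0 $ 0)"
    using d[OF is_deriv_deriv1] d[OF is_deriv_deriv2] by (intro is_const_if_derivs_0)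
  then have "?Z = 1" by (simp add: exp2_nth_0)
  then have "exp2 F * exp2 G = ?Z * exp2 F * exp2 G" by simp
  also have "\<dots> = exp2 (F + G) * (exp2 F * exp2 (- F)) * (exp2 G * exp2 (- G))" by (simp only: mult_ac)
  finally show ?thesis by (simp add: exp2_minus assms)
qed

lemma field_aux:
  fixes d h g x :: "'b::field"
  assumes "d \<noteq> 0" "h \<noteq> 0" "x * (d * h)^2 = d^2 * g * h^2 + h^2"
  shows "x - 1 / d^2 = g"
proof -
  have "h^2 * (x * d^2) = h^2 * (d^2 * g + 1)" using assms(3) by algebra
  then have "x * d^2 = d^2 * g + 1" using assms(2) by simp
  then show ?thesis using assms(1) by (simp add: field_simps)
qed

context weierstrass_coeffs
begin

abbreviation U1 where "U1 \<equiv> lift1 U"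
abbreviation U2 where "U2 \<equiv> lift2 U"

lemma vanishes_U: "vanishes (Suc 0) U1" "vanishes (Suc 0) U2" "vanishes (Suc 0) (U2 - U1)" "vanishes (Suc 0) (U1 - U2)"
  by (auto intro!: vanishes_diff lift1_vanishes1 lift2_vanishes1 U_simps)

text \<open>The quotient of sig(U2 - U1) by X2 - X1: the first factor is (U2 - U1) / (X2 - X1), and
  sig(u) = u ee(u).\<close>

definition H :: "'a fps2" where "H = quot U * comp1 ee (U2 - U1)"

lemma comp1_uminus: "vanishes (Suc 0) g \<Longrightarrow> comp1 c (- g) = comp1 (c oo (- fps_X)) g"
proof -
  assume g: "vanishes (Suc 0) g"
  show ?thesis
    by (subst comp1_compose[OF _ g]) (simp_all add: is_hom_uminus[OF is_hom_comp1[OF g]] comp1_X[OF g])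
qed

lemma comp1_sig_uminus: "vanishes (Suc 0) g \<Longrightarrow> comp1 sig (- g) = - comp1 sig g"
  by (simp add: comp1_uminus sig_odd is_hom_uminus[OF is_hom_comp1])

lemma ee_even: "ee oo (- fps_X) = ee"
proof -
  have "(- fps_X) * (ee oo (- fps_X)) = (- fps_X) * ee"
    using sig_odd by (simp add: sig_def fps_compose_mult_distrib)
  then show ?thesis by simp
qed

lemma sig_H: "comp1 sig (U2 - U1) = (X2 - X1) * H"
proof -
  note h = is_hom_simps[OF is_hom_comp1[OF vanishes_U(3)]]
  have "comp1 sig (U2 - U1) = (U2 - U1) * comp1 ee (U2 - U1)"
    by (simp add: sig_def h comp1_X[OF vanishes_U(3)])
  moreover have "U2 - U1 = (X2 - X1) * quot U" using quot[of U] by (metis minus_diff_eq mult_minus_left)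
  ultimately show ?thesis by (metis H_def mult.assoc)
qed

lemma swap_quot: "swap (quot f) = quot f" by (auto simp: fps_eq_iff quot_def add.commute)

lemma swap_H: "swap H = H"
  unfolding H_def is_hom_mult[OF is_hom_swap] swap_quot swap_comp1 is_hom_diff[OF is_hom_swap] swap_lift
  using comp1_uminus[OF vanishes_U(3), of ee] by (simp add: ee_even)

lemma H_0: "H $ 0 $ 0 = 1"
  by (simp add: H_def quot_def comp1_nth_0_0 ee_0 U_simps)

definition h0 :: "'a fps" where "h0 = H $ 0"

lemma h0_0: "h0 $ 0 = 1" by (simp add: h0_def H_0)

definition Hi where "Hi = (SOME G. H * G = 1)"

lemma H_Hi: "H * Hi = 1"
  unfolding Hi_def by (rule someI_ex[OF fps2_unit[OF H_0]])

text \<open>The mixed second derivative of log H. It will be the regular part of the 2-form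
  (\<open>xi_ser_regular\<close>).\<close>

definition Gx :: "'a fps2" where "Gx = log_mixed H * Hi^2"

lemma log_mixed_H: "log_mixed H = Gx * H^2"
  using H_Hi unfolding Gx_def by algebra

text \<open>The mixed derivative of log sig(U2 - U1) is X(U2 - U1) \<Omega>(t1) \<Omega>(t2);
  splitting off the factor X2 - X1 of sig(U2 - U1) separates the double pole.\<close>

lemma log_mixed_sig_U: 
  "(X2 - X1)^2 * Gx * H^2 + H^2 = comp1 nu (U2 - U1) * lift1 \<Omega> * lift2 \<Omega>"
proof -
  note h = is_hom_simps[OF is_hom_comp1[OF vanishes_U(3)]]
  note c = comp1_deriv[OF is_deriv_deriv1 vanishes_U(3)] comp1_deriv[OF is_deriv_deriv2 vanishes_U(3)]
  have 1: "log_mixed (comp1 sig (U2 - U1)) = comp1 nu (U2 - U1) * lift1 \<Omega> * lift2 \<Omega>"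
    by (simp add: c nu_sig h deriv2_simps deriv_lift U_simps algebra_simps power2_eq_square)
  have "log_mixed (X2 - X1 :: 'a fps2) = 1"
    by (simp add: deriv2_simps deriv_lift is_hom_simps[OF lift1_hom])
  then have "log_mixed (comp1 sig (U2 - U1)) = (X2 - X1)^2 * log_mixed H + H^2"
    unfolding sig_H log_mixed_mult by simp
  then show ?thesis unfolding 1 log_mixed_H by (simp add: algebra_simps)
qed

subsection \<open>The 2-form\<close>

lemma sig_U_square_fl: "(fl (sig oo U))^2 * x_ser \<mu> = fl (nu oo U)"
proof -
  have "(fl (sig oo U))^2 = fl S * fl (nu oo U)"
    using arg_cong[OF sig_U_square, of fl] by (simp add: fls_times_fps_to_fls fps_to_fls_power)
  then show ?thesis using x_S by algebra
qed

abbreviation Yx :: "'a fls" where "Yx \<equiv> 2 * y_ser \<mu> + fls_const (\<mu> 1) * x_ser \<mu> + fls_const (\<mu> 3)"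

lemma kap_U_fl: "(fl (sig oo U))^3 * Yx = fl (kap oo U)"
proof -
  have 1: "Yx * (fl S)^2 = - fl \<Phi>" unfolding two_y_eq using fl_S_nonzero by simp
  have 2: "fl S * fl (kap oo U) = - fl (sig oo U) * fl \<Phi> * fl (nu oo U)"
    using arg_cong[OF kap_U, of fl] by (simp add: fls_times_fps_to_fls)
  have "(fl S)^2 * ((fl (sig oo U))^3 * Yx) = (fl S)^2 * fl (kap oo U)"
    using 1 2 sig_U_square_fl x_S by algebra
  moreover have "(fl S)^2 \<noteq> 0" using fl_S_nonzero by simp
  ultimately show ?thesis by (metis mult_left_cancel)
qed

lemma curve_eq_fl: "(y_ser \<mu>)^2 + (fls_const (\<mu> 1) * x_ser \<mu> + fls_const (\<mu> 3)) * y_ser \<mu> = 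
  (x_ser \<mu>)^3 + fls_const (\<mu> 2) * (x_ser \<mu>)^2 + fls_const (\<mu> 4) * x_ser \<mu> + fls_const (\<mu> 6)"
proof -
  have ab: "fl a = 1 + fls_const (\<mu> 2) * fl S + fls_const (\<mu> 4) * (fl S)^2 + fls_const (\<mu> 6) * (fl S)^3" 
    by (simp_all add: a_def curve_a_def fls_times_fps_to_fls fps_to_fls_power)
  have "(fl S)^3 * fls_X^2 * ((y_ser \<mu>)^2 + (fls_const (\<mu> 1) * x_ser \<mu> + fls_const (\<mu> 3)) * y_ser \<mu>) = 
  (fl S)^3 * fls_X^2 * ((x_ser \<mu>)^3 + fls_const (\<mu> 2) * (x_ser \<mu>)^2 + fls_const (\<mu> 4) * x_ser \<mu> + fls_const (\<mu> 6))"
    using fl_S_ab x_S y_X unfolding ab fl_b by algebra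
  moreover have "(fl S)^3 * fls_X^2 \<noteq> 0" using fl_S_nonzero by simp
  ultimately show ?thesis by (metis mult_left_cancel)
qed

text \<open>Up to the factor 4, the polynomial F of the 2-form is the numerator of the addition
  theorem for X(u - v), rewritten modulo the two curve equations.\<close>

lemma F_poly_eq:
  fixes M :: "nat \<Rightarrow> 'b::field_char_0"
  assumes "y^2 + (M 1 * x + M 3) * y = x^3 + M 2 * x^2 + M 4 * x + M 6"
    and "w^2 + (M 1 * z + M 3) * w = z^3 + M 2 * z^2 + M 4 * z + M 6"
  shows "4 * F_poly M x y z w = ((2 * y + M 1 * x + M 3) + (2 * w + M 1 * z + M 3))^2 - (4 * (x + z) + (M 1 ^ 2 + 4 * M 2)) * (x - z)^2"
  unfolding F_poly_def using assms by algebra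

lemma const2_field: "const2 (\<mu> 1) ^ 2 + 4 * const2 (\<mu> 2) = const2 (b2 \<mu>)"
proof -
  have "is_hom (const2 :: 'a \<Rightarrow> _)" by (simp add: is_hom_def const2_def fls_plus_const)
  from is_hom_simps[OF this] show ?thesis by (simp add: b2_def)
qed

lemma is_hom_nonzero:
  fixes \<psi> :: "'b::field \<Rightarrow> 'c::field"
  assumes "is_hom \<psi>" "z \<noteq> 0" shows "\<psi> z \<noteq> 0"
  using is_hom_mult[OF assms(1), of z "1 / z"] is_hom_1[OF assms(1)] assms(2) by auto

lemma Yx_nonzero: "Yx \<noteq> 0"
  unfolding two_y_eq using \<Phi>_nonzero fl_S_nonzero by simp

lemma x_at_neq: "at1 (x_ser \<mu>) \<noteq> at2 (x_ser \<mu>)"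
proof
  assume e: "at1 (x_ser \<mu>) = at2 (x_ser \<mu>)"
  have "at1 (x_ser \<mu>) * to_fls2 (lift1 S) = 1" "at2 (x_ser \<mu>) * to_fls2 (lift2 S) = 1"
    using arg_cong[OF x_S, of at1] arg_cong[OF x_S, of at2] by (simp_all add: at_simps at1_fps_to_fls at2_fps_to_fls)
  then have "to_fls2 (lift1 S) = to_fls2 (lift2 S)" using e 
    by (metis mult_cancel_left mult_zero_left zero_neq_one)
  then show False using lift_S_neq by simp
qed

lemma xi_ser_alt:
  "xi_ser \<mu> * (at1 (x_ser \<mu>) - at2 (x_ser \<mu>))^2 = 
     F_poly (\<lambda>j. const2 (\<mu> j)) (at1 (x_ser \<mu>)) (at1 (y_ser \<mu>)) (at2 (x_ser \<mu>)) (at2 (y_ser \<mu>)) * at1 (fl \<Omega>) * at2 (fl \<Omega>)"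
proof -
  have e: "at1 (fls_deriv (x_ser \<mu>)) = at1 (fl \<Omega>) * at1 Yx" "at2 (fls_deriv (x_ser \<mu>)) = at2 (fl \<Omega>) * at2 Yx"
    by (simp_all add: x_deriv' is_hom_mult[OF is_hom_at1] is_hom_mult[OF is_hom_at2])
  have Y: "at1 Yx = 2 * at1 (y_ser \<mu>) + const2 (\<mu> 1) * at1 (x_ser \<mu>) + const2 (\<mu> 3)"
    "at2 Yx = 2 * at2 (y_ser \<mu>) + const2 (\<mu> 1) * at2 (x_ser \<mu>) + const2 (\<mu> 3)"
    by (simp_all add: at_simps at1_const at2_const)
  have nz: "at1 Yx \<noteq> 0" "at2 Yx \<noteq> 0"
    using is_hom_nonzero[OF is_hom_at1 Yx_nonzero] is_hom_nonzero[OF is_hom_at2 Yx_nonzero] by auto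
  have nz': "at1 (x_ser \<mu>) - at2 (x_ser \<mu>) \<noteq> 0" using x_at_neq by simp
  show ?thesis
    unfolding xi_ser_def Let_def e Y[symmetric] using nz nz' by (simp add: field_simps)
qed

text \<open>The 2-form is X(u2 - u1) du1 du2: this is the addition theorem at (U1, U2), in which the
  values of nu and kap are expressed by the coordinates x and y of the two points.\<close>

lemma xi_ser_sig:
  "xi_ser \<mu> * (to_fls2 (comp1 sig (U2 - U1)))^2 = to_fls2 (comp1 nu (U2 - U1) * lift1 \<Omega> * lift2 \<Omega>)"
proof -
  note h = is_hom_simps[OF is_hom_subst2[OF vanishes_U(1,2)]]
  define x z where "x = at1 (x_ser \<mu>)" and "z = at2 (x_ser \<mu>)"
  define y w where "y = at1 (y_ser \<mu>)" and "w = at2 (y_ser \<mu>)"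
  define s1 s2 where "s1 = at1 (fl (sig oo U))" and "s2 = at2 (fl (sig oo U))"
  define N Sg where "N = to_fls2 (comp1 nu (U2 - U1))" and "Sg = to_fls2 (comp1 sig (U2 - U1))"
  define Y1 Y2 where "Y1 = at1 Yx" and "Y2 = at2 Yx"
  define M where "M = (\<lambda>j. const2 (\<mu> j))"
  define c where "c = const2 (b2 \<mu>)"
  have Fm: "subst2 (Fm f) U1 U2 = comp1 f (U2 - U1)" for f
    unfolding Fm_def subst2_comp1[OF vanishes_pm(2) vanishes_U(1,2)] h subst2_lift1 subst2_lift2 
      comp1_X[OF vanishes_U(1)] comp1_X[OF vanishes_U(2)] ..
  note cl = comp1_lift1[OF U_simps(1)] comp1_lift2[OF U_simps(1)]
  have "4 * comp1 nu (U2 - U1) * (lift2 (nu oo U) * (lift1 (sig oo U))^2 - lift1 (nu oo U) * (lift2 (sig oo U))^2)^2 * (lift2 (sig oo U))^2 * (lift1 (sig oo U))^2 =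
   (comp1 sig (U2 - U1))^2 * ((lift2 (kap oo U) * (lift1 (sig oo U))^3 + lift1 (kap oo U) * (lift2 (sig oo U))^3)^2 - 
     (4 * (lift2 (nu oo U) * (lift1 (sig oo U))^2 + lift1 (nu oo U) * (lift2 (sig oo U))^2) + const_fps2 (b2 \<mu>) * (lift2 (sig oo U))^2 * (lift1 (sig oo U))^2) *
       (lift2 (nu oo U) * (lift1 (sig oo U))^2 - lift1 (nu oo U) * (lift2 (sig oo U))^2)^2)"
    using arg_cong[OF addition, of "\<lambda>F. subst2 F U1 U2"]
    unfolding h Fm subst2_const subst2_lift1 subst2_lift2 cl fps_const_compose .
  from arg_cong[OF this, of to_fls2]
  have "4 * N * (at2 (fl (nu oo U)) * s1^2 - at1 (fl (nu oo U)) * s2^2)^2 * s2^2 * s1^2 =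
    Sg^2 * ((at2 (fl (kap oo U)) * s1^3 + at1 (fl (kap oo U)) * s2^3)^2 - 
     (4 * (at2 (fl (nu oo U)) * s1^2 + at1 (fl (nu oo U)) * s2^2) + c * s2^2 * s1^2) *
       (at2 (fl (nu oo U)) * s1^2 - at1 (fl (nu oo U)) * s2^2)^2)"
    unfolding to_fls2_simps at1_fps_to_fls[symmetric] at2_fps_to_fls[symmetric] s1_def s2_def N_def Sg_def c_def const2_to_fls2 .
  moreover have "at2 (fl (nu oo U)) = s2^2 * z" "at1 (fl (nu oo U)) = s1^2 * x" 
     "at2 (fl (kap oo U)) = s2^3 * Y2" "at1 (fl (kap oo U)) = s1^3 * Y1"
    unfolding sig_U_square_fl[symmetric] kap_U_fl[symmetric] s1_def s2_def x_def z_def Y1_def Y2_def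
    by (simp_all only: at_simps)
  ultimately have "(s1 * s2)^6 * (4 * N * (x - z)^2) = (s1 * s2)^6 * (Sg^2 * ((Y1 + Y2)^2 - (4 * (x + z) + c) * (x - z)^2))"
    by (simp only:) algebra
  moreover have "sig oo U \<noteq> 0"
  proof -
    have "(sig oo U) $ Suc 0 = 1" by (simp add: fps_compose_nth sig_nu_0 U_simps)
    then show ?thesis by auto
  qed
  then have "fl (sig oo U) \<noteq> 0" by simp
  then have "s1 \<noteq> 0" "s2 \<noteq> 0" unfolding s1_def s2_def
    by (rule is_hom_nonzero[OF is_hom_at1], rule is_hom_nonzero[OF is_hom_at2])
  then have "(s1 * s2)^6 \<noteq> 0" by simp
  ultimately have "4 * N * (x - z)^2 = Sg^2 * ((Y1 + Y2)^2 - (4 * (x + z) + c) * (x - z)^2)"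
    by (metis mult_left_cancel)
  also have "(Y1 + Y2)^2 - (4 * (x + z) + c) * (x - z)^2 = 4 * F_poly M x y z w"
  proof -
    have "y^2 + (M 1 * x + M 3) * y = x^3 + M 2 * x^2 + M 4 * x + M 6"
      "w^2 + (M 1 * z + M 3) * w = z^3 + M 2 * z^2 + M 4 * z + M 6"
      using arg_cong[OF curve_eq_fl, of at1] arg_cong[OF curve_eq_fl, of at2]
      by (simp_all add: at_simps at1_const at2_const x_def y_def z_def w_def M_def)
    from F_poly_eq[OF this] show ?thesis
      by (simp add: Y1_def Y2_def M_def c_def const2_field[symmetric] at_simps at1_const at2_const x_def y_def z_def w_def)
  qed
  finally have 1: "N * (x - z)^2 = Sg^2 * F_poly M x y z w" by simp
  have 2: "xi_ser \<mu> * (x - z)^2 = F_poly M x y z w * at1 (fl \<Omega>) * at2 (fl \<Omega>)"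
    unfolding x_def y_def z_def w_def M_def by (rule xi_ser_alt)
  have "(x - z)^2 * (xi_ser \<mu> * Sg^2) = (x - z)^2 * (N * at1 (fl \<Omega>) * at2 (fl \<Omega>))"
    using 1 2 by algebra
  moreover have "(x - z)^2 \<noteq> 0" using x_at_neq by (simp add: x_def z_def)
  ultimately have "xi_ser \<mu> * Sg^2 = N * at1 (fl \<Omega>) * at2 (fl \<Omega>)" by (metis mult_left_cancel)
  then show ?thesis by (simp add: Sg_def N_def to_fls2_simps at1_fps_to_fls at2_fps_to_fls)
qed

lemma xi_ser_regular: "xi_ser \<mu> - 1 / (t2 - t1)^2 = to_fls2 Gx"
proof -
  let ?d = "to_fls2 (X2 - X1 :: 'a fps2)"
  have d: "?d \<noteq> 0" using X1_X2_neq[where ?'a = 'a] by (metis minus_diff_eq neg_equal_0_iff_equal to_fls2_eq_0_iff)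
  have H: "to_fls2 H \<noteq> 0" using H_0 by auto
  have "xi_ser \<mu> * (?d * to_fls2 H)^2 = ?d^2 * to_fls2 Gx * (to_fls2 H)^2 + (to_fls2 H)^2"
    using xi_ser_sig unfolding log_mixed_sig_U[symmetric] sig_H to_fls2_simps .
  then have "xi_ser \<mu> - 1 / ?d^2 = to_fls2 Gx" by (rule field_aux[OF d H])
  moreover have "t2 - t1 = ?d" by (simp add: t1_to_fls2 t2_to_fls2 to_fls2_simps)
  ultimately show ?thesis by (simp only:)
qed

end

context weierstrass_coeffs
begin

subsection \<open>The exponential integral\<close>

text \<open>The double primitive of \<open>Gx\<close> that is 0 on both axes.\<close>

definition Lx :: "'a fps2" where
  "Lx = Abs_fps (\<lambda>i. Abs_fps (\<lambda>j. if i = 0 \<or> j = 0 then 0 else Gx $ (i - 1) $ (j - 1) / (of_nat i * of_nat j)))"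

lemma Lx_vanishes: "vanishes (Suc 0) Lx" by (simp add: vanishes_def Lx_def)

lemma Lx_deriv: "fps_deriv (deriv2 Lx) = Gx"
  by (rule fps2_eqI) (simp add: deriv2_def Lx_def del: of_nat_Suc flip: fps_of_nat)

text \<open>Both sides have the mixed logarithmic derivative \<open>Gx\<close>; on the axes
  \<open>Lx\<close> is 0, while H is h0 on both of them by symmetry.\<close>

lemma H_factor: "H = lift1 h0 * lift2 h0 * exp2 Lx"
proof (rule log_mixed_unique[OF log_mixed_H])
  let ?E = "exp2 Lx"
  have e: "fps_deriv ?E = ?E * fps_deriv Lx" "deriv2 ?E = ?E * deriv2 Lx"
    by (rule exp2_deriv[OF is_deriv_deriv1 Lx_vanishes], rule exp2_deriv[OF is_deriv_deriv2 Lx_vanishes])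
  have 1: "log_mixed ?E = Gx * ?E^2"
    unfolding e by (simp add: e fps_deriv_deriv2 deriv2_simps Lx_deriv[symmetric] power2_eq_square algebra_simps)
  have 2: "log_mixed (lift1 h0 * lift2 h0) = 0"
    by (simp add: deriv2_simps deriv_lift algebra_simps)
  show "log_mixed (lift1 h0 * lift2 h0 * ?E) = Gx * (lift1 h0 * lift2 h0 * ?E)^2"
    unfolding log_mixed_mult[of "lift1 h0 * lift2 h0" ?E] 1 2 by (simp add: power_mult_distrib mult_ac)
  have ax: "exp2 Lx $ 0 = 1" using comp1_axis1[of Lx 0 "fps_exp 1"] 
    by (simp add: Lx_def fps_eq_iff[of _ "0 :: 'a fps"])
  have sw: "swap Lx $ 0 = 0" by (simp add: Lx_def swap_def fps_eq_iff)
  have "swap (exp2 Lx) $ 0 = 1" unfolding swap_comp1 using comp1_axis1[OF sw, of "fps_exp 1"] by simp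
  then have ax': "exp2 Lx $ i $ 0 = (1 :: 'a fps) $ i" for i by (metis swap_nth)
  have "(lift1 h0 * lift2 h0 * exp2 Lx) $ 0 = h0" by (simp add: ax lift1_def h0_0)
  then show "H $ 0 $ j = (lift1 h0 * lift2 h0 * exp2 Lx) $ 0 $ j" for j by (simp only: h0_def[symmetric])
  have "swap (lift1 h0 * lift2 h0 * exp2 Lx) $ 0 = h0"
    unfolding is_hom_mult[OF is_hom_swap] swap_lift swap_comp1 
    using comp1_axis1[OF sw, of "fps_exp 1"] by (simp add: lift1_def h0_0)
  then have "(lift1 h0 * lift2 h0 * exp2 Lx) $ i $ 0 = h0 $ i" for i by (metis swap_nth)
  moreover have "H $ i $ 0 = h0 $ i" for i using swap_H by (metis h0_def swap_nth)
  ultimately show "H $ i $ 0 = (lift1 h0 * lift2 h0 * exp2 Lx) $ i $ 0" for i by simp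
  show "(lift1 h0 * lift2 h0 * exp2 Lx) $ 0 $ 0 = 1" by (simp add: h0_0 exp2_nth_0)
qed

abbreviation T1' where "T1' \<equiv> lift1 T'"
abbreviation T2' where "T2' \<equiv> lift2 T'"

lemma vanishes_T': "vanishes (Suc 0) T1'" "vanishes (Suc 0) T2'"
  by (auto intro: lift1_vanishes1 lift2_vanishes1 T'_low)

text \<open>The double integral over a rectangle, as the alternating sum of the primitive over its
  corners.\<close>

definition Gint :: "'a fps2" where
  "Gint = subst2 Lx X2 T2' - subst2 Lx X1 T2' - subst2 Lx X2 T1' + subst2 Lx X1 T1'"

lemma Gint_vanishes: "vanishes (Suc 0) Gint"
  unfolding Gint_def
  by (intro vanishes_add vanishes_diff subst2_vanishes Lx_vanishes vanishes_X vanishes_T')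

lemma H_subst:
  assumes "vanishes (Suc 0) g" "vanishes (Suc 0) k"
  shows "subst2 H g k = comp1 h0 g * comp1 h0 k * exp2 (subst2 Lx g k)"
    and "(k - g) * subst2 H g k = comp1 sig (comp1 U k - comp1 U g)"
proof -
  note h = is_hom_simps[OF is_hom_subst2[OF assms]]
  show "subst2 H g k = comp1 h0 g * comp1 h0 k * exp2 (subst2 Lx g k)"
    by (subst H_factor) (simp only: h subst2_lift1 subst2_lift2 subst2_comp1[OF Lx_vanishes assms])
  have "subst2 ((X2 - X1) * H) g k = subst2 (comp1 sig (U2 - U1)) g k" by (simp only: sig_H)
  then show "(k - g) * subst2 H g k = comp1 sig (comp1 U k - comp1 U g)"
    unfolding h subst2_comp1[OF vanishes_U(3) assms] subst2_lift1 subst2_lift2 comp1_X[OF assms(1)] comp1_X[OF assms(2)] .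
qed

text \<open>Each one-variable factor h0 of H occurs at two corners of opposite sign, so it
  cancels.\<close>

lemma exp2_Gint: "exp2 Gint * (subst2 H X1 T2' * subst2 H X2 T1') = subst2 H X2 T2' * subst2 H X1 T1'"
proof -
  define A B C E where "A = subst2 Lx X2 T2'" and "B = subst2 Lx X1 T2'" and "C = subst2 Lx X2 T1'" and "E = subst2 Lx X1 T1'"
  note v = subst2_vanishes[OF Lx_vanishes]
  have vv: "vanishes (Suc 0) A" "vanishes (Suc 0) B" "vanishes (Suc 0) C" "vanishes (Suc 0) E"
    unfolding A_def B_def C_def E_def by (intro v vanishes_X vanishes_T')+
  have "Gint + (B + C) = A + E" by (simp add: Gint_def A_def B_def C_def E_def)
  then have "exp2 (Gint + (B + C)) = exp2 (A + E)" by simp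
  then have "exp2 Gint * (exp2 B * exp2 C) = exp2 A * exp2 E"
    by (simp only: exp2_add vv Gint_vanishes vanishes_add)
  then show ?thesis
    unfolding H_subst(1)[OF vanishes_X(1) vanishes_T'(2)] H_subst(1)[OF vanishes_X(2) vanishes_T'(1)] 
      H_subst(1)[OF vanishes_X(2) vanishes_T'(2)] H_subst(1)[OF vanishes_X(1) vanishes_T'(1)]
      A_def[symmetric] B_def[symmetric] C_def[symmetric] E_def[symmetric] by algebra
qed

lemma comp1_U: "comp1 U X1 = U1" "comp1 U X2 = U2" "comp1 U T1' = - U1" "comp1 U T2' = - U2"
  using comp1_lift1[of fps_X U] comp1_lift2[of fps_X U] comp1_lift1[OF T'_low(1), of U] comp1_lift2[OF T'_low(1), of U]
  by (simp_all add: U_compose_T' is_hom_uminus[OF lift1_hom])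

lemma sig_double_U: "comp1 sig (U1 + U1) = lift1 (\<Phi> * (nu oo U)^2)" "comp1 sig (U2 + U2) = lift2 (\<Phi> * (nu oo U)^2)"
proof -
  have "S * (- (sig oo U) * (kap oo U)) = S * (\<Phi> * (nu oo U)^2)"
    using kap_U sig_U_square by algebra
  then have 1: "- (sig oo U) * (kap oo U) = \<Phi> * (nu oo U)^2" using S_nonzero by (metis mult_left_cancel)
  show "comp1 sig (U1 + U1) = lift1 (\<Phi> * (nu oo U)^2)"
    unfolding duplication_subst[OF vanishes_U(1)] comp1_lift1[OF U_simps(1)] 1[symmetric]
    by (simp only: is_hom_simps[OF lift1_hom])
  show "comp1 sig (U2 + U2) = lift2 (\<Phi> * (nu oo U)^2)"
    unfolding duplication_subst[OF vanishes_U(2)] comp1_lift2[OF U_simps(1)] 1[symmetric]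
    by (simp only: is_hom_simps[OF lift2_hom])
qed

lemma chord12: "(lift1 S - lift2 S) * D12 = lift2 a * ((X1 - X2) * (X1 - T2'))"
  and chord21: "(lift2 S - lift1 S) * D21 = lift1 a * ((X2 - X1) * (X2 - T1'))"
proof -
  have c: "lift1 (m j) = m2 j" for j by (auto simp: fps_eq_iff)
  note l1 = is_hom_simps[OF lift1_hom] and l2 = is_hom_simps[OF lift2_hom]
  have e1: "lift1 S = curve_a m2 (lift1 S) * X1^2 + curve_b m2 (lift1 S) * X1"
    using arg_cong[OF S_eq, of lift1] unfolding curve_a_def curve_b_def l1 c .
  have e2: "lift2 S = curve_a m2 (lift2 S) * X2^2 + curve_b m2 (lift2 S) * X2"
    using arg_cong[OF S_eq, of lift2] unfolding curve_a_def curve_b_def l2 .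
  have a1: "lift1 a = curve_a m2 (lift1 S)" "lift1 b = curve_b m2 (lift1 S)"
    unfolding a_def b_def curve_a_def curve_b_def l1 c by simp_all
  have a2: "lift2 a = curve_a m2 (lift2 S)" "lift2 b = curve_b m2 (lift2 S)"
    unfolding a_def b_def curve_a_def curve_b_def l2 by simp_all
  have t1: "lift1 a * T1' * X1 = - lift1 S" "lift1 a * (X1 + T1') = - lift1 b"
    using arg_cong[OF aT', of lift1] arg_cong[OF sum_T', of lift1] unfolding l1 by simp_all
  have t2: "lift2 a * T2' * X2 = - lift2 S" "lift2 a * (X2 + T2') = - lift2 b"
    using arg_cong[OF aT', of lift2] arg_cong[OF sum_T', of lift2] unfolding l2 by simp_all
  show "(lift1 S - lift2 S) * D12 = lift2 a * ((X1 - X2) * (X1 - T2'))"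
    unfolding D12_def chord_identity[OF e1] a2[symmetric] using t2 by algebra
  show "(lift2 S - lift1 S) * D21 = lift1 a * ((X2 - X1) * (X2 - T1'))"
    unfolding D21_def chord_identity[OF e2] a1[symmetric] using t1 by algebra
qed

text \<open>Since u(t') = -u(t), the corner values of H are sig(u1 + u2), twice, and sig(2 u1),
  sig(2 u2), up to sign and linear factors. The duplication formula evaluates the last two, and the
  three-term relation exchanges sig(u1 + u2) for sig(u2 - u1) = (X2 - X1) H. The linear factors in t
  and t' combine to the chord factors.\<close>

lemma r_formula: "exp2 Gint = D12 * D21 * H^2"
proof -
  define E where "E = exp2 Gint"
  define sp where "sp = comp1 sig (U2 + U1)"
  define p1 p2 where "p1 = \<Phi>" and "p2 = \<Phi>"
  define F1 F2 n1 n2 where "F1 = lift1 \<Phi>" and "F2 = lift2 \<Phi>" and "n1 = lift1 (nu oo U)" and "n2 = lift2 (nu oo U)"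
  define a1 a2 s1 s2 where "a1 = lift1 a" and "a2 = lift2 a" and "s1 = lift1 S" and "s2 = lift2 S"
  note l1 = is_hom_simps[OF lift1_hom] and l2 = is_hom_simps[OF lift2_hom]
  have v: "vanishes (Suc 0) (U2 + U1)" by (simp add: vanishes_add vanishes_U)
  have neg: "- g - k = - (g + k)" "- g - k = - (k + g)" for g k :: "'a fps2" by simp_all
  have 1: "(T2' - X1) * subst2 H X1 T2' = - sp"
    unfolding H_subst(2)[OF vanishes_X(1) vanishes_T'(2)] comp1_U sp_def neg(1) by (rule comp1_sig_uminus[OF v])
  have 2: "(T1' - X2) * subst2 H X2 T1' = - sp"
    unfolding H_subst(2)[OF vanishes_X(2) vanishes_T'(1)] comp1_U sp_def neg(2) by (rule comp1_sig_uminus[OF v])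
  have vU: "vanishes (Suc 0) (U1 + U1)" "vanishes (Suc 0) (U2 + U2)" by (intro vanishes_add vanishes_U)+
  have 3: "(T2' - X2) * subst2 H X2 T2' = - (F2 * n2^2)"
    unfolding H_subst(2)[OF vanishes_X(2) vanishes_T'(2)] comp1_U F2_def n2_def neg(1)
      comp1_sig_uminus[OF vU(2)] sig_double_U(2) unfolding l2 ..
  have 4: "(T1' - X1) * subst2 H X1 T1' = - (F1 * n1^2)"
    unfolding H_subst(2)[OF vanishes_X(1) vanishes_T'(1)] comp1_U F1_def n1_def neg(1)
      comp1_sig_uminus[OF vU(1)] sig_double_U(1) unfolding l1 ..
  \<comment> \<open>\<Phi> is, up to sign, \<open>a\<close> times the difference of the roots of the
    quadratic equation, so it cancels the linear factors of the corners (t1, t1') and (t2,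
    t2').\<close>
  have aP: "a * (T' - fps_X) = - \<Phi>" using sum_T' unfolding \<Phi>_def by algebra
  have 5: "a1 * (T1' - X1) = - F1" "a2 * (T2' - X2) = - F2"
    using arg_cong[OF aP, of lift1] arg_cong[OF aP, of lift2] unfolding l1 l2 a1_def a2_def F1_def F2_def by simp_all
  have 6: "sp * comp1 sig (U2 - U1) = n1 * n2 * (s2 - s1)"
  proof -
    have "sp * comp1 sig (U2 - U1) = (lift2 (sig oo U))^2 * n1 - (lift1 (sig oo U))^2 * n2"
      unfolding sp_def three_term_subst[OF vanishes_U(1,2)] comp1_lift1[OF U_simps(1)] comp1_lift2[OF U_simps(1)] n1_def n2_def ..
    moreover have "(lift2 (sig oo U))^2 = s2 * n2" "(lift1 (sig oo U))^2 = s1 * n1"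
      using arg_cong[OF sig_U_square, of lift1] arg_cong[OF sig_U_square, of lift2] 
      unfolding l1 l2 s1_def s2_def n1_def n2_def by simp_all
    ultimately show ?thesis by algebra
  qed
  have 7: "(s1 - s2) * D12 = a2 * ((X1 - X2) * (X1 - T2'))" "(s2 - s1) * D21 = a1 * ((X2 - X1) * (X2 - T1'))"
    unfolding s1_def s2_def a1_def a2_def by (rule chord12, rule chord21)
  have 8: "E * (subst2 H X1 T2' * subst2 H X2 T1') = subst2 H X2 T2' * subst2 H X1 T1'"
    unfolding E_def by (rule exp2_Gint)
  have "E * sp^2 * ((T2' - X2) * (T1' - X1)) = (T2' - X1) * (T1' - X2) * (F1 * F2 * n1^2 * n2^2)"
    using 1 2 3 4 8 by algebra
  then have "F1 * F2 * (E * sp^2) = F1 * F2 * (a1 * a2 * (T2' - X1) * (T1' - X2) * (n1^2 * n2^2))"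
    using 5 by algebra
  moreover have nz: "F1 * F2 \<noteq> 0" "(n1 * n2)^2 \<noteq> 0"
  proof -
    have "lift1 f \<noteq> 0" "lift2 f \<noteq> 0" if "f \<noteq> 0" for f :: "'a fps"
      using that by (auto simp: lift1_def fps_eq_iff)
    moreover have "(nu oo U) $ 0 = 1" by (simp add: sig_nu_0)
    then have "nu oo U \<noteq> 0" by (metis fps_zero_nth zero_neq_one)
    ultimately show "F1 * F2 \<noteq> 0" "(n1 * n2)^2 \<noteq> 0"
      using \<Phi>_nonzero by (simp_all add: F1_def F2_def n1_def n2_def)
  qed
  ultimately have 9: "E * sp^2 = a1 * a2 * (T2' - X1) * (T1' - X2) * (n1^2 * n2^2)"
    by (metis mult_left_cancel)
  have "(n1 * n2)^2 * (E * (s2 - s1)^2) = (n1 * n2)^2 * (a1 * a2 * (T2' - X1) * (T1' - X2) * ((X2 - X1) * H)^2)"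
    using 6 9 unfolding sig_H by algebra
  then have "E * (s2 - s1)^2 = a1 * a2 * (T2' - X1) * (T1' - X2) * ((X2 - X1) * H)^2"
    using nz(2) by (metis mult_left_cancel)
  then have "(s2 - s1)^2 * E = (s2 - s1)^2 * (D12 * D21 * H^2)"
    using 7 by algebra
  moreover have "(s2 - s1)^2 \<noteq> 0" using lift_S_neq by (simp add: s1_def s2_def)
  ultimately have "E = D12 * D21 * H^2" by (metis mult_left_cancel)
  then show ?thesis by (simp only: E_def)
qed

definition Gterm :: "nat \<Rightarrow> nat \<Rightarrow> 'a fps2" where
  "Gterm i j = const_fps2 (Gx $ i $ j) * ((X2 ^ (i+1) - X1 ^ (i+1)) * const_fps2 (1 / of_nat (i+1)))
       * ((T2' ^ (j+1) - T1' ^ (j+1)) * const_fps2 (1 / of_nat (j+1)))"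

lemma subst2_Lx_nth:
  assumes "vanishes (Suc 0) g" "vanishes (Suc 0) h" "i + j \<le> N"
  shows "subst2 Lx g h $ i $ j = (\<Sum>p\<le>N. \<Sum>n\<le>N. (const_fps2 (Gx $ p $ n) * const_fps2 (1 / of_nat (p+1)) * const_fps2 (1 / of_nat (n+1)) * (g ^ (p+1) * h ^ (n+1))) $ i $ j)"
proof -
  \<comment> \<open>The range is enlarged by one: row and column 0 of \<open>Lx\<close> are 0, and
    its other coefficients are those of \<open>Gx\<close> with both indices shifted.\<close>
  have "subst2 Lx g h $ i $ j = (\<Sum>p\<le>Suc N. \<Sum>n\<le>Suc N. (const_fps2 (Lx $ p $ n) * (g ^ p * h ^ n)) $ i $ j)"
    by (rule subst2_nth[OF assms(1,2)]) (use assms(3) in simp)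
  also have "\<dots> = (\<Sum>p\<le>N. \<Sum>n\<le>N. (const_fps2 (Lx $ Suc p $ Suc n) * (g ^ Suc p * h ^ Suc n)) $ i $ j)"
    unfolding sum.atMost_Suc_shift[of _ N] by (simp add: Lx_def del: power_Suc)
  also have "\<dots> = (\<Sum>p\<le>N. \<Sum>n\<le>N. (const_fps2 (Gx $ p $ n) * const_fps2 (1 / of_nat (p+1)) * const_fps2 (1 / of_nat (n+1)) * (g ^ (p+1) * h ^ (n+1))) $ i $ j)"
    by (intro sum.cong refl) (simp add: Lx_def del: power_Suc of_nat_Suc)
  finally show ?thesis .
qed

text \<open>The truncated sums are those in the definition of \<open>xi_integral\<close>; the
  omitted terms have too large an order to contribute.\<close>

lemma Gint_nth: "Gint $ i $ j = (\<Sum>p\<le>i+j. \<Sum>n\<le>i+j. Gterm p n $ i $ j)"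
proof -
  have e: "Gterm p n = const_fps2 (Gx $ p $ n) * const_fps2 (1 / of_nat (p+1)) * const_fps2 (1 / of_nat (n+1)) * (X2 ^ (p+1) * T2' ^ (n+1))
     - const_fps2 (Gx $ p $ n) * const_fps2 (1 / of_nat (p+1)) * const_fps2 (1 / of_nat (n+1)) * (X1 ^ (p+1) * T2' ^ (n+1))
     - const_fps2 (Gx $ p $ n) * const_fps2 (1 / of_nat (p+1)) * const_fps2 (1 / of_nat (n+1)) * (X2 ^ (p+1) * T1' ^ (n+1))
     + const_fps2 (Gx $ p $ n) * const_fps2 (1 / of_nat (p+1)) * const_fps2 (1 / of_nat (n+1)) * (X1 ^ (p+1) * T1' ^ (n+1))" for p n
    unfolding Gterm_def by algebra
  note s = subst2_Lx_nth[OF _ _ order_refl[of "i + j"]]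
  show ?thesis
    unfolding Gint_def fps_add_nth fps_sub_nth e sum.distrib sum_subtractf
      s[OF vanishes_X(2) vanishes_T'(2)] s[OF vanishes_X(1) vanishes_T'(2)] s[OF vanishes_X(2) vanishes_T'(1)]
      s[OF vanishes_X(1) vanishes_T'(1)] ..
qed

lemma of_nat_fls2: "1 / (of_nat n :: 'a fls2) = to_fls2 (const_fps2 (1 / of_nat n))" if "n > 0"
proof -
  have "to_fls2 (const_fps2 (1 / of_nat n)) * of_nat n = to_fls2 (const_fps2 (1 / of_nat n) * of_nat n)"
    by (simp add: to_fls2_simps)
  also have "const_fps2 (1 / of_nat n) * of_nat n = (1 :: 'a fps2)"
    using that by (simp add: fps_of_nat[symmetric])
  finally have "to_fls2 (const_fps2 (1 / of_nat n)) * of_nat n = (1 :: 'a fls2)" by (simp add: to_fls2_simps)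
  moreover have "(of_nat n :: 'a fls2) \<noteq> 0" using that by simp
  ultimately show ?thesis by (simp add: divide_eq_eq)
qed

lemma xi_integral_eq: "xi_integral \<mu> = to_fls2 Gint"
proof -
  have g: "coeff2 (xi_ser \<mu> - 1 / (t2 - t1)^2) i j = Gx $ i $ j" for i j
    unfolding xi_ser_regular by simp
  have t: "const2 (Gx $ i $ j) * ((t2 ^ (i+1) - t1 ^ (i+1)) / of_nat (i+1)) * 
      ((at2 (t'_ser \<mu>) ^ (j+1) - at1 (t'_ser \<mu>) ^ (j+1)) / of_nat (j+1)) = to_fls2 (Gterm i j)" for i j
  proof -
    have d: "y / of_nat (k + 1) = y * to_fls2 (const_fps2 (1 / of_nat (k + 1)))" for y :: "'a fls2" and k
      using of_nat_fls2[of "k + 1"] by (metis add_gr_0 divide_inverse inverse_eq_divide zero_less_one)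
    show ?thesis
      unfolding d Gterm_def t'_ser_eq at1_fps_to_fls at2_fps_to_fls t1_to_fls2 t2_to_fls2 const2_to_fls2 to_fls2_simps ..
  qed
  show ?thesis
    unfolding xi_integral_def Let_def g t coeff2_to_fls2 series2_to_fls2 Gint_nth[symmetric]
    by (simp add: fps_eq_iff)
qed

lemma r_ser_eq: "r_ser \<mu> = to_fls2 (exp2 Gint)"
  by (simp add: r_ser_def xi_integral_eq compose2_to_fls2 Gint_vanishes)

subsection \<open>Integrality of r\<close>

text \<open>\<open>s1^2 s2^2 t1 t2\<close> times the polynomial F at x = 1/s and y = -1/(s t), which
  is a power series.\<close>

definition Fi :: "'a fps2" where
  "Fi = (let x = lift1 S; z = lift2 S in (x + z) * X1 * X2 + (m2 1 ^ 2 + 2 * m2 2) * x * z * X1 * X2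
     - m2 1 * x * z * (X2 + X1) + (m2 3 * m2 1 + m2 4) * (x * z^2 + x^2 * z) * X1 * X2
     + 2 * x * z - m2 3 * (x * z^2 * X2 + x^2 * z * X1) + (m2 3 ^ 2 + 2 * m2 6) * x^2 * z^2 * X1 * X2)"

lemma Gx_Fi: "(quot S)^2 * X1 * X2 + (lift1 S - lift2 S)^2 * X1 * X2 * Gx = Fi * lift1 \<Omega> * lift2 \<Omega>"
proof -
  define x z where "x = at1 (x_ser \<mu>)" and "z = at2 (x_ser \<mu>)"
  define y w where "y = at1 (y_ser \<mu>)" and "w = at2 (y_ser \<mu>)"
  define s1 s2 where "s1 = to_fls2 (lift1 S)" and "s2 = to_fls2 (lift2 S)"
  define d where "d = to_fls2 (X2 - X1 :: 'a fps2)"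
  define M where "M = (\<lambda>j. const2 (\<mu> j))"
  define O1 O2 where "O1 = to_fls2 (lift1 \<Omega>)" and "O2 = to_fls2 (lift2 \<Omega>)"
  have nz: "s1 \<noteq> 0" "s2 \<noteq> 0" "d \<noteq> 0"
    using S_nonzero X1_X2_neq[where ?'a = 'a] 
    by (auto simp: s1_def s2_def d_def fps_eq_iff[of "lift1 S"] fps_eq_iff[of S])
      (auto simp: fps_eq_iff)?
  have xs: "x * s1 = 1" "z * s2 = 1" 
    using arg_cong[OF x_S, of at1] arg_cong[OF x_S, of at2] 
    by (simp_all add: at_simps at1_fps_to_fls at2_fps_to_fls x_def z_def s1_def s2_def)
  have t: "at1 fls_X = t1" "at2 fls_X = t2" by (simp_all add: t1_def t2_def)
  have yt: "y * t1 = - x" "w * t2 = - z"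
    using arg_cong[OF y_X, of at1] arg_cong[OF y_X, of at2] 
    by (simp_all add: at_simps t x_def z_def y_def w_def)
  have F: "to_fls2 Fi = s1^2 * s2^2 * t1 * t2 * F_poly M x y z w"
  proof -
    have "to_fls2 Fi = (s1 + s2) * t1 * t2 + (M 1 ^ 2 + 2 * M 2) * s1 * s2 * t1 * t2
     - M 1 * s1 * s2 * (t2 + t1) + (M 3 * M 1 + M 4) * (s1 * s2^2 + s1^2 * s2) * t1 * t2
     + 2 * s1 * s2 - M 3 * (s1 * s2^2 * t2 + s1^2 * s2 * t1) + (M 3 ^ 2 + 2 * M 6) * s1^2 * s2^2 * t1 * t2"
      unfolding Fi_def Let_def M_def const2_to_fls2 t1_to_fls2 t2_to_fls2 s1_def s2_def to_fls2_simps ..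
    also have "\<dots> = s1^2 * s2^2 * t1 * t2 * F_poly M x y z w"
      unfolding F_poly_def using xs yt by algebra
    finally show ?thesis .
  qed
  have 1: "xi_ser \<mu> * (x - z)^2 = F_poly M x y z w * O1 * O2"
    using xi_ser_alt unfolding x_def y_def z_def w_def M_def O1_def O2_def at1_fps_to_fls at2_fps_to_fls .
  have td: "t2 - t1 = d" by (simp add: t1_to_fls2 t2_to_fls2 to_fls2_simps d_def)
  have 2: "xi_ser \<mu> * d^2 = to_fls2 Gx * d^2 + 1"
    using xi_ser_regular nz(3) unfolding td by (simp add: field_simps)
  have 3: "(s1 - s2) = - d * to_fls2 (quot S)"
    using arg_cong[OF quot[of S], of to_fls2] by (simp add: to_fls2_simps s1_def s2_def d_def algebra_simps)
  have 4: "(x - z) * s1 * s2 = s2 - s1" using xs by algebra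
  have "(s1 - s2)^2 * xi_ser \<mu> * t1 * t2 = to_fls2 Fi * O1 * O2"
    using 1 4 unfolding F by algebra
  then have "d^2 * ((to_fls2 (quot S))^2 * t1 * t2 + (s1 - s2)^2 * t1 * t2 * to_fls2 Gx) = d^2 * (to_fls2 Fi * O1 * O2)"
    using 2 3 by algebra
  then have "(to_fls2 (quot S))^2 * t1 * t2 + (s1 - s2)^2 * t1 * t2 * to_fls2 Gx = to_fls2 Fi * O1 * O2"
    using nz(3) by (metis mult_left_cancel power_not_zero)
  then have "to_fls2 ((quot S)^2 * X1 * X2 + (lift1 S - lift2 S)^2 * X1 * X2 * Gx) = to_fls2 (Fi * lift1 \<Omega> * lift2 \<Omega>)"
    unfolding s1_def s2_def O1_def O2_def t1_to_fls2 t2_to_fls2 to_fls2_simps .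
  then show ?thesis by (simp only: to_fls2_inject)
qed

text \<open>Multiplying the 2-form by the square of s1 - s2 and by t1 t2 clears all its
  denominators. Up to units, s1 - s2 is (X1 - X2)(X1 - T2'), so \<open>Gx\<close> is recovered by
  cancelling linear factors monic in X1 and finally X2, without any division of
  coefficients.\<close>

lemma Gx_coeffs2_in:
  assumes A: "is_subring A" and mu: "\<And>j. j \<in> {1,2,3,4,6} \<Longrightarrow> \<mu> j \<in> A"
  shows "Gx \<in> coeffs2_in A"
proof -
  note s = is_subring_coeffs_in[OF A]
  note ss = is_subring_coeffs_in[OF s]
  note i = is_subring_intros[OF ss] coeffs_in_const[OF s] coeffs_in_const[OF A]
      coeffs2_in_lift1[OF A] coeffs_in_X[OF A] S_coeffs_in[OF A mu] coeffs_in_all[OF A mu] D12_coeffs2_in[OF A mu] mu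
  have "Fi * lift1 \<Omega> * lift2 \<Omega> - (quot S)^2 * X1 * X2 \<in> coeffs2_in A"
  proof -
    have "quot S \<in> coeffs2_in A" using S_coeffs_in[OF A mu] by (auto simp: coeffs_in_def quot_def)
    moreover have "Fi \<in> coeffs2_in A" unfolding Fi_def Let_def by (intro i) auto
    ultimately show ?thesis by (intro i) auto
  qed
  then have 1: "(lift1 S - lift2 S)^2 * X1 * X2 * Gx \<in> coeffs2_in A"
    using Gx_Fi by (metis add_diff_cancel_left')
  have ia: "lift2 a * lift2 (inverse a) = 1" 
  proof -
    have "a * inverse a = 1" by (rule inverse_mult_eq_1') (simp add: a_0)
    then show ?thesis by (simp only: fps_const_mult fps_const_1_eq_1)
  qed
  have "D12^2 * lift2 (inverse a)^2 * ((lift1 S - lift2 S)^2 * X1 * X2 * Gx) \<in> coeffs2_in A"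
    by (intro i 1) auto
  \<comment> \<open>The factor X1 is written as \<open>X1 - lift2 0\<close> so that it is cancelled
    by the same lemma as the others.\<close>
  also have "D12^2 * lift2 (inverse a)^2 * ((lift1 S - lift2 S)^2 * X1 * X2 * Gx) = 
     (X1 - lift2 fps_X) * ((X1 - lift2 fps_X) * ((X1 - T2') * ((X1 - T2') * ((X1 - lift2 0) * (X2 * Gx)))))"
  proof -
    have z: "lift2 0 = (0 :: 'a fps2)" by simp
    show ?thesis unfolding z using chord12 ia by algebra
  qed
  finally have c1: "(X1 - lift2 fps_X) * ((X1 - lift2 fps_X) * ((X1 - T2') * ((X1 - T2') * ((X1 - lift2 0) * (X2 * Gx))))) \<in> coeffs2_in A" .
  have X0: "fps_X $ 0 = (0 :: 'a)" "(0 :: 'a fps) $ 0 = 0" by simp_all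
  note cX = coeffs2_in_cancel[OF A coeffs_in_X[OF A] X0(1)]
  note cT = coeffs2_in_cancel[OF A coeffs_in_all(3)[OF A mu] T'_low(1)]
  note c0 = coeffs2_in_cancel[OF A is_subringD(2)[OF s] X0(2)]
  have "X2 * Gx \<in> coeffs2_in A" by (rule c0[OF cT[OF _ cT[OF _ cX[OF cX[OF c1]]]]])
  then have "(X2 * Gx) $ p $ Suc q \<in> A" for p q by (simp only: coeffs_in_def mem_Collect_eq)
  then show ?thesis by (simp add: coeffs_in_def)
qed

text \<open>Every term of the integral is an integral coefficient of \<open>Gx\<close> times
  differences of powers F^(n+1) / (n+1) with F integral, and the exponential preserves Hurwitz
  integrality.\<close>

lemma r_hurwitz:
  assumes A: "is_subring A" and mu: "\<And>j. j \<in> {1,2,3,4,6} \<Longrightarrow> \<mu> j \<in> A"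
  shows "hurwitz2 A (exp2 Gint)"
proof (rule hurwitz2_exp[OF A])
  note h = is_subringD[OF is_subring_hurwitz2[OF A], simplified]
  note c = hurwitz2_coeffs2_in[OF A]
  have dp: "hurwitz2 A (F ^ (n+1) * const_fps2 (1 / of_nat (n+1)))" if "hurwitz2 A F" "F $ 0 $ 0 = 0" for F n
    using hurwitz2_divided_power[OF A that, of n] by (simp add: mult.commute)
  have G: "hurwitz2 A (Gterm p n)" for p n
  proof -
    have "hurwitz2 A (const_fps2 (Gx $ p $ n))"
      using Gx_coeffs2_in[OF A mu] by (intro c coeffs_in_const A is_subring_coeffs_in) (auto simp: coeffs_in_def)
    moreover have "hurwitz2 A X1" "hurwitz2 A X2" "hurwitz2 A T1'" "hurwitz2 A T2'"
      by (intro c coeffs2_in_lift1 coeffs2_in_lift2 A coeffs_in_X coeffs_in_all mu; assumption?)+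
    ultimately show ?thesis unfolding Gterm_def left_diff_distrib
      by (intro h(4) h(3) dp) (simp_all add: T'_low)
  qed
  show "hurwitz2 A Gint"
    unfolding hurwitz2_def hurwitz_upto_def Gint_nth sum_distrib_right
    using G by (intro allI impI is_subring_sum[OF A]) (auto simp: hurwitz2_def hurwitz_upto_def)
  show "Gint $ 0 $ 0 = 0" using Gint_vanishes by (simp add: vanishes_def)
qed

end

section \<open>The product formula\<close>

lemma coeffs2_in_comp1:
  assumes A: "is_subring A" and "c \<in> coeffs_in A" "g \<in> coeffs2_in A"
  shows "comp1 c g \<in> coeffs2_in A"
proof -
  have "g ^ n \<in> coeffs2_in A" for n
    using is_subring_power[OF is_subring_coeffs_in[OF is_subring_coeffs_in[OF A]]] assms by blast
  then show ?thesis using assms(2)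
    by (auto simp: coeffs_in_def comp1_def gsum_def subst_coeffs_def intro!: is_subring_intros[OF A])
qed

lemma hurwitz2_nth_0_0: assumes "hurwitz2 A F" shows "F $ 0 $ 0 \<in> A"
proof -
  have "F $ 0 $ 0 * (fact 0 * fact 0) \<in> A" using assms unfolding hurwitz2_def hurwitz_upto_def by blast
  then show ?thesis by simp
qed

lemma subst2_nth_0_0: "subst2 F g h $ 0 $ 0 = F $ 0 $ 0"
  by (simp add: subst2_def gsum_def subst_coeffs_def comp1_nth_0_0)

lemma subst2_diagonal:
  "subst2 F X2 X2 $ 0 $ n = (\<Sum>k\<le>n. F $ k $ (n - k))"
proof -
  have p: "(X2 :: 'a fps2) ^ p = lift2 (fps_X ^ p)" for p by (simp add: fps_const_power)
  have "subst2 F X2 X2 $ 0 $ n = (\<Sum>p\<le>n. \<Sum>q\<le>n. (const_fps2 (F $ p $ q) * (X2 ^ p * X2 ^ q)) $ 0 $ n)"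
    by (rule subst2_nth[OF vanishes_X(2) vanishes_X(2)]) simp
  also have "\<dots> = (\<Sum>p\<le>n. \<Sum>q\<le>n. if q = n - p then F $ p $ q else 0)"
    by (intro sum.cong refl) (auto simp: power_add[symmetric] p fps_X_power_nth simp del: power_add)
  also have "\<dots> = (\<Sum>k\<le>n. F $ k $ (n - k))" by simp
  finally show ?thesis .
qed

text \<open>The quotient by one factor X1 - X2 is antisymmetric, so in characteristic 0 it vanishes
  on the diagonal again.\<close>

lemma symmetric_diagonal_divide:
  fixes F :: "'a::field_char_0 fps2"
  assumes sym: "swap F = F" and diag: "subst2 F X2 X2 = 0"
  shows "\<exists>G. F = (X1 - X2)^2 * G"
proof -
  have "\<exists>G. F = (X1 - X2) * G"
    by (rule diagonal_zero_divide) (use subst2_diagonal[of F] diag in simp)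
  then obtain G where G: "F = (X1 - X2) * G" by blast
  have "(X1 - X2) * (swap G + G) = 0"
    using sym unfolding G is_hom_mult[OF is_hom_swap] is_hom_diff[OF is_hom_swap] swap_lift by (simp add: algebra_simps)
  then have "swap G + G = 0" using X1_X2_neq[where ?'a = 'a] by simp
  then have "(swap G + G) $ i $ j = 0" for i j by (simp only: fps_zero_nth)
  then have anti: "G $ j $ i = - G $ i $ j" for i j by (simp add: eq_neg_iff_add_eq_0)
  have "\<exists>G'. G = (X1 - X2) * G'"
  proof (rule diagonal_zero_divide)
    fix n
    have "(\<Sum>k\<le>n. G $ k $ (n - k)) = (\<Sum>k\<le>n. G $ (n - k) $ (n - (n - k)))"
      by (rule sum.reindex_bij_witness[of _ "\<lambda>k. n - k" "\<lambda>k. n - k"]) auto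
    also have "\<dots> = (\<Sum>k\<le>n. - G $ k $ (n - k))"
      by (intro sum.cong refl) (simp add: anti[of "n - _"])
    finally have "(\<Sum>k\<le>n. G $ k $ (n - k)) = - (\<Sum>k\<le>n. G $ k $ (n - k))" by (simp add: sum_negf)
    then show "(\<Sum>k\<le>n. G $ k $ (n - k)) = 0" by simp
  qed
  then show ?thesis unfolding G by (metis mult.assoc power2_eq_square)
qed

lemma coeffs2_in_split2:
  assumes A: "is_subring A" and F: "F \<in> coeffs2_in A" "vanishes 2 F"
  shows "\<exists>f g h. F = X1^2 * f + X1 * X2 * g + X2^2 * h \<and> f \<in> coeffs2_in A \<and> g \<in> coeffs2_in A \<and> h \<in> coeffs2_in A"
proof (intro exI conjI)
  let ?f = "fps_shift 2 F" and ?g = "lift2 (fps_shift 1 (F $ 1))" and ?h = "lift2 (fps_shift 2 (F $ 0))"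
  show "F = X1^2 * ?f + X1 * X2 * ?g + X2^2 * ?h"
  proof (rule fps2_eqI)
    fix i j
    have v: "F $ 0 $ 0 = 0" "F $ 0 $ Suc 0 = 0" "F $ Suc 0 $ 0 = 0" using F(2) by (auto simp: vanishes_def)
    have e: "X1^2 * ?f + X1 * X2 * ?g + X2^2 * ?h = fps_X^2 * ?f + fps_X * lift2 (fps_X * fps_shift 1 (F $ 1)) + lift2 (fps_X^2 * fps_shift 2 (F $ 0))"
      by (simp add: X1_eq fps_const_power mult.assoc)
    consider "i = 0" | "i = 1" | k where "i = Suc (Suc k)" by (metis One_nat_def not0_implies_Suc)
    then show "F $ i $ j = (X1^2 * ?f + X1 * X2 * ?g + X2^2 * ?h) $ i $ j"
    proof cases
      case 1 then show ?thesis unfolding e using v by (cases j; cases "j - 1") (auto simp: fps_X_power_mult_nth)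
    next
      case 2 then show ?thesis unfolding e using v by (cases j) (auto simp: fps_X_power_mult_nth)
    next
      case 3 then show ?thesis unfolding e by (auto simp: fps_X_power_mult_nth)
    qed
  qed
  show "?f \<in> coeffs2_in A" using F by (auto simp: coeffs_in_def)
  show "?g \<in> coeffs2_in A" "?h \<in> coeffs2_in A" 
    using F by (intro coeffs2_in_lift2 A; auto simp: coeffs_in_def)+
qed

context weierstrass_coeffs
begin

lemma P21_coeffs2_in:
  assumes "is_subring A" "\<And>j. j \<in> {1,2,3,4,6} \<Longrightarrow> \<mu> j \<in> A"
  shows "P21 \<in> coeffs2_in A"
proof -
  note s = is_subring_coeffs_in[OF assms(1)]
  have "(SOME G. D21 * G = 1) \<in> coeffs2_in A"
    by (rule coeffs2_in_inverse[OF assms(1) D12_coeffs2_in(2)[OF assms] someI_ex[OF fps2_unit[OF D_0(2)]] D_0(2)])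
  moreover have "lift1 a \<in> coeffs2_in A"
    by (intro coeffs2_in_lift1 coeffs_in_all assms)
  ultimately show ?thesis 
    unfolding P21_def by (intro is_subringD(4)[OF is_subring_coeffs_in[OF s]])
qed

subsection \<open>Rational coefficients\<close>

text \<open>\<open>div\<close> makes A an algebra over the rationals, as the recursions for D, ee
  and U divide by integers.\<close>

lemma rational_coeffs:
  assumes A: "is_subring A" and mu: "\<And>j. j \<in> {1,2,3,4,6} \<Longrightarrow> \<mu> j \<in> A" and div: "\<And>x n. x \<in> A \<Longrightarrow> n > 0 \<Longrightarrow> x / of_nat n \<in> A"
  shows "D \<in> coeffs_in A" "ee \<in> coeffs_in A" "sig \<in> coeffs_in A" "U \<in> coeffs_in A" "H \<in> coeffs2_in A"
proof -
  note i = is_subringD[OF A] is_subring_sum[OF A] is_subring_power[OF A] is_subring_of_nat[OF A] is_subring_numeral[OF A]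
  have divn: "x / numeral k \<in> A" if "x \<in> A" for x k using div[OF that, of "numeral k"] by simp
  \<comment> \<open>Both signs occur: the divisor \<open>(of_nat n - 4) * (of_nat n + 3)\<close> in
    the recursion is negative for n < 4.\<close>
  have divz: "x / of_int z \<in> A" if "x \<in> A" for x z
  proof -
    consider "z = 0" | "z > 0" | "z < 0" by linarith
    then show ?thesis
    proof cases
      case 2
      then have "x / of_int z = x / of_nat (nat z)" by simp
      then show ?thesis using div[OF that, of "nat z"] 2 by (simp only: zero_less_nat_eq)
    next
      case 3
      then have "x / of_int z = - x / of_nat (nat (- z))" by simp
      then show ?thesis using div[OF i(5)[OF that], of "nat (- z)"] 3 by (simp only: zero_less_nat_eq neg_0_less_iff_less)
    qed (simp add: i(2))
  qed
  have b: "b2 \<mu> \<in> A" "b4 \<mu> \<in> A" "b6 \<mu> \<in> A" unfolding b2_def b4_def b6_def by (intro i mu; simp)+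
  have D: "wp_coeff \<mu> n \<in> A" for n
  proof (induction n rule: less_induct)
    case (less n)
    have d: "x / ((of_nat n - 4) * (of_nat n + 3)) \<in> A" if "x \<in> A" for x
      using divz[OF that, of "(int n - 4) * (int n + 3)"] by simp
    show ?case
      unfolding wp_coeff.simps[of \<mu> n]
      using less by (auto intro!: i b mu divn d)
  qed
  then show "D \<in> coeffs_in A" by (simp add: D_def coeffs_in_def)
  have J: "J $ n \<in> A" for n using D div[of "wp_coeff \<mu> (n - 1)" n] i(2) 
    by (cases n) (auto simp: J_def fps_integral_def D_def field_simps)
  have e: "ee $ n \<in> A" for n
  proof (induction n rule: less_induct)
    case (less n)
    show ?case
    proof (cases n)
      case (Suc k)
      have "of_nat n * ee $ n = (- J * ee) $ k" using arg_cong[OF ee_deriv, of "\<lambda>f. f $ k"] Suc by simp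
      then have "ee $ n = (- J * ee) $ k / of_nat n" using Suc by (simp add: field_simps del: of_nat_Suc)
      moreover have "(- J * ee) $ k \<in> A" unfolding fps_mult_nth using less Suc J by (auto intro!: i)
      ultimately show ?thesis using div[of "(- J * ee) $ k" n] Suc by (simp only: zero_less_Suc)
    qed (simp add: ee_0 i)
  qed
  then show ee: "ee \<in> coeffs_in A" by (simp add: coeffs_in_def)
  show "sig \<in> coeffs_in A" unfolding sig_def 
    by (intro is_subringD(4)[OF is_subring_coeffs_in[OF A]] coeffs_in_X A ee)
  have "U $ n \<in> A" for n using coeffs_in_all(5)[OF A mu] div[of "\<Omega> $ (n - 1)" n] i(2)
    by (cases n) (auto simp: U_def fps_integral_def coeffs_in_def field_simps)
  then show U: "U \<in> coeffs_in A" by (simp add: coeffs_in_def)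
  have "quot U \<in> coeffs2_in A" using U by (simp add: quot_def coeffs_in_def)
  then show "H \<in> coeffs2_in A" unfolding H_def
    by (intro is_subringD(3,4)[OF is_subring_coeffs_in[OF is_subring_coeffs_in[OF A]]] coeffs2_in_comp1 A ee coeffs2_in_lift1 coeffs2_in_lift2 U)
qed

definition r2 :: "'a fps2" where "r2 = exp2 Gint"

lemma swap_D: "swap D12 = D21" "swap D21 = D12"
proof -
  have "swap (m2 j) = m2 j" for j by (auto simp: fps_eq_iff)
  then show "swap D12 = D21" "swap D21 = D12"
    unfolding D12_def D21_def chord_den_def is_hom_simps[OF is_hom_swap] swap_lift by simp_all
qed

lemma swap_r2: "swap r2 = r2"
  unfolding r2_def r_formula is_hom_simps[OF is_hom_swap] swap_D swap_H by (simp only: mult.commute[of D21 D12])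

text \<open>On the diagonal the difference quotient of U becomes its derivative and sig(u)/u becomes
  1.\<close>

lemma subst2_H_diag: "subst2 H X2 X2 = lift2 \<Omega>"
proof -
  note h = is_hom_simps[OF is_hom_subst2[OF vanishes_X(2) vanishes_X(2)]]
  \<comment> \<open>The defining relation of \<open>quot U\<close> reads 0 = 0 on the diagonal, so
    it is differentiated before it is restricted.\<close>
  have "fps_deriv (U1 - U2) = fps_deriv ((X1 - X2) * quot U)" by (rule arg_cong[OF quot])
  then have "lift1 \<Omega> = quot U + (X1 - X2) * fps_deriv (quot U)"
    by (simp add: deriv_lift U_simps is_hom_simps[OF lift1_hom])
  then have "subst2 (lift1 \<Omega>) X2 X2 = subst2 (quot U + (X1 - X2) * fps_deriv (quot U)) X2 X2" by simp
  then have 1: "subst2 (quot U) X2 X2 = lift2 \<Omega>"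
    unfolding h subst2_lift1 subst2_lift2 comp1_X[OF vanishes_X(2)] using comp1_lift2[of fps_X \<Omega>] by simp
  have "comp1 ee (0 :: 'a fps2) = 1"
  proof -
    have "subst_coeffs const_fps2 0 ee = fps_const 1"
      by (rule fps_ext) (simp add: subst_coeffs_def power_0_left ee_0)
    then show ?thesis unfolding comp1_def by (simp only: gsum_const)
  qed
  then show ?thesis
    unfolding H_def h 1 subst2_comp1[OF vanishes_U(3) vanishes_X(2) vanishes_X(2)] subst2_lift1 subst2_lift2 by simp
qed

lemma subst2_D_diag: "subst2 D12 X2 X2 = lift2 W" "subst2 D21 X2 X2 = lift2 W"
proof -
  note h = is_hom_simps[OF is_hom_subst2[OF vanishes_X(2) vanishes_X(2)]]
  have S: "comp1 S X2 = lift2 S" using comp1_lift2[of fps_X S] by simp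
  have W: "lift2 W = 1 - X2 * (m2 1 + m2 3 * (lift2 S + lift2 S)) - X2^2 * (m2 2 + m2 4 * (lift2 S + lift2 S) + m2 6 * ((lift2 S)^2 + lift2 S * lift2 S + (lift2 S)^2))"
    unfolding W_def is_hom_simps[OF lift2_hom] by algebra
  show "subst2 D12 X2 X2 = lift2 W" "subst2 D21 X2 X2 = lift2 W"
    unfolding D12_def D21_def chord_den_def W h subst2_const subst2_lift1 subst2_lift2 comp1_X[OF vanishes_X(2)] S by simp_all
qed

text \<open>On the diagonal \<open>D12\<close> and \<open>D21\<close> become W, and H becomes
  \<Omega> = 1/W.\<close>

lemma r2_diag: "subst2 (r2 - 1) X2 X2 = 0"
proof -
  note h = is_hom_simps[OF is_hom_subst2[OF vanishes_X(2) vanishes_X(2)]]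
  have "lift2 W * lift2 \<Omega> = 1" using \<Omega>_W(2) by simp
  then show ?thesis
    unfolding r2_def r_formula h subst2_D_diag subst2_H_diag by algebra
qed

text \<open>r - 1 is symmetric and 0 on the diagonal, which gives the factor
  \<open>(X1 - X2)^2\<close>; order 4 of r - 1 leaves order 2 for the cofactor, that is, membership
  in the square of the ideal of the two variables.\<close>

lemma r2_split:
  assumes A: "is_subring A" and mu: "\<And>j. j \<in> {1,2,3,4,6} \<Longrightarrow> \<mu> j \<in> A" and div: "\<And>x n. x \<in> A \<Longrightarrow> n > 0 \<Longrightarrow> x / of_nat n \<in> A"
    and van: "vanishes 4 (r2 - 1)"
  shows "\<exists>f g h. r2 = 1 + (X1 - X2)^2 * (X1^2 * f + X1 * X2 * g + X2^2 * h) \<and> f \<in> coeffs2_in A \<and> g \<in> coeffs2_in A \<and> h \<in> coeffs2_in A"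
proof -
  note s = is_subring_coeffs_in[OF A]
  note ss = is_subring_coeffs_in[OF s]
  have "swap (r2 - 1) = r2 - 1" by (simp add: is_hom_simps[OF is_hom_swap] swap_r2)
  from symmetric_diagonal_divide[OF this r2_diag] obtain G where G: "r2 - 1 = (X1 - X2)^2 * G" by blast
  have "vanishes (Suc (Suc 2)) ((X1 - X2) * ((X1 - X2) * G))" using van unfolding G by (simp add: power2_eq_square mult.assoc)
  then have v: "vanishes 2 G" by (rule X_diff_cancel_vanishes[OF X_diff_cancel_vanishes])
  have "r2 \<in> coeffs2_in A"
    unfolding r2_def r_formula
    by (intro is_subringD(4)[OF ss] is_subring_power[OF ss] D12_coeffs2_in A mu rational_coeffs div)
  then have G2: "(X1 - lift2 fps_X) * ((X1 - lift2 fps_X) * G) \<in> coeffs2_in A"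
    using is_subringD(3)[OF ss _ is_subringD(1)[OF ss], of r2] unfolding G power2_eq_square mult.assoc by blast
  have X0: "fps_X $ 0 = (0 :: 'a)" by simp
  note cX = coeffs2_in_cancel[OF A coeffs_in_X[OF A] X0]
  have "G \<in> coeffs2_in A" by (rule cX[OF cX[OF G2]])
  from coeffs2_in_split2[OF A this v] show ?thesis using G by (metis add.commute diff_add_cancel)
qed

lemma sig_U12: "(comp1 sig (U1 - U2))^2 = ((X2 - X1) * H)^2"
proof -
  have "U1 - U2 = - (U2 - U1)" by simp
  then have "comp1 sig (U1 - U2) = - comp1 sig (U2 - U1)" using comp1_sig_uminus[OF vanishes_U(3)] by metis
  then show ?thesis by (simp add: sig_H)
qed

text \<open>By \<open>r_formula\<close>, r is sig(U2 - U1)^2 / (X2 - X1)^2 times the chord factors;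
  these cancel against the denominators of p, and the numerators of p cancel against q.\<close>

theorem product_formula:
  "(comp1 sig (U1 - U2))^2 = (X2 - X1)^2 * lift1 (inverse a) * lift2 (inverse a) * P12 * P21 * r2"
proof -
  have ia: "a * inverse a = 1" by (rule inverse_mult_eq_1') (simp add: a_0)
  have "lift1 a * lift1 (inverse a) = 1" "lift2 a * lift2 (inverse a) = 1"
    using arg_cong[OF ia, of lift1] arg_cong[OF ia, of lift2] 
    unfolding is_hom_simps[OF lift1_hom] is_hom_simps[OF lift2_hom] .
  then show ?thesis unfolding sig_U12 r2_def r_formula using P12_D12 P21_D21 by algebra
qed

subsection \<open>Hurwitz integrality in the analytic coordinates\<close>

lemma tau_deriv: "fps_deriv tau = W oo tau"
proof -
  have 1: "(\<Omega> oo tau) * fps_deriv tau = 1"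
    using arg_cong[OF U_tau, of fps_deriv] by (simp add: fps_compose_deriv[OF tau_low(1)] U_simps)
  have "(W * \<Omega>) oo tau = 1" by (simp add: \<Omega>_W)
  then have "(W oo tau) * (\<Omega> oo tau) = 1" by (simp add: fps_compose_mult_distrib tau_low)
  then show ?thesis using 1 by (metis mult.assoc mult_1_left mult_1_right)
qed

abbreviation tau1 where "tau1 \<equiv> lift1 tau"
abbreviation tau2 where "tau2 \<equiv> lift2 tau"

lemma vanishes_tau: "vanishes (Suc 0) tau1" "vanishes (Suc 0) tau2"
  by (auto intro: lift1_vanishes1 lift2_vanishes1 tau_low)

text \<open>tau' = W(tau) with W integral: the partial derivatives of F(tau1, tau2) are
  substitutions into partial derivatives of F times W, again Hurwitz integral. Hence the induction
  over the degree runs for all F at once.\<close>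

lemma hurwitz2_subst_tau:
  assumes A: "is_subring A" and mu: "\<And>j. j \<in> {1,2,3,4,6} \<Longrightarrow> \<mu> j \<in> A" and "hurwitz2 A F"
  shows "hurwitz2 A (subst2 F tau1 tau2)"
proof -
  note h = is_hom_subst2[OF vanishes_tau]
  have "hurwitz_upto A N (subst2 F tau1 tau2)" if "hurwitz2 A F" for N F
    using that
  proof (induction N arbitrary: F)
    case 0
    then show ?case using hurwitz2_nth_0_0[of A F] by (simp add: hurwitz_upto_def subst2_nth_0_0)
  next
    case (Suc N)
    have W: "hurwitz2 A (lift1 W)" "hurwitz2 A (lift2 W)"
      by (intro hurwitz2_coeffs2_in[OF A] coeffs2_in_lift1 coeffs2_in_lift2 A coeffs_in_all mu; assumption)+
    have t: "lift1 (fps_deriv tau) = subst2 (lift1 W) tau1 tau2" "lift2 (fps_deriv tau) = subst2 (lift2 W) tau1 tau2"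
      unfolding tau_deriv subst2_lift1 subst2_lift2 comp1_lift1[OF tau_low(1)] comp1_lift2[OF tau_low(1)] by simp_all
    have 1: "fps_deriv (subst2 F tau1 tau2) = subst2 (fps_deriv F * lift1 W) tau1 tau2"
      unfolding subst2_deriv[OF is_deriv_deriv1 vanishes_tau] deriv_lift t is_hom_mult[OF h] by simp
    have 2: "deriv2 (subst2 F tau1 tau2) = subst2 (deriv2 F * lift2 W) tau1 tau2"
      unfolding subst2_deriv[OF is_deriv_deriv2 vanishes_tau] deriv_lift t is_hom_mult[OF h] by simp
    show ?case
    proof (rule hurwitz_upto_Suc)
      show "subst2 F tau1 tau2 $ 0 $ 0 \<in> A" unfolding subst2_nth_0_0 by (rule hurwitz2_nth_0_0[OF Suc.prems])
      show "hurwitz_upto A N (fps_deriv (subst2 F tau1 tau2))" unfolding 1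
        by (intro Suc.IH hurwitz2_mult A W hurwitz2_deriv1 Suc.prems)
      show "hurwitz_upto A N (deriv2 (subst2 F tau1 tau2))" unfolding 2
        by (intro Suc.IH hurwitz2_mult A W hurwitz2_deriv2 Suc.prems)
    qed
  qed
  then show ?thesis using assms(3) by (simp add: hurwitz2_def)
qed

lemma tau_hurwitz:
  assumes A: "is_subring A" and mu: "\<And>j. j \<in> {1,2,3,4,6} \<Longrightarrow> \<mu> j \<in> A"
  shows "tau $ n * fact n \<in> A"
proof -
  have "hurwitz2 A (subst2 X1 tau1 tau2)"
    by (intro hurwitz2_subst_tau A mu hurwitz2_coeffs2_in coeffs2_in_lift1 coeffs_in_X)
  then have "hurwitz2 A tau1" unfolding subst2_lift1 comp1_X[OF vanishes_tau(1)] .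
  then have "tau1 $ n $ 0 * (fact n * fact 0) \<in> A" unfolding hurwitz2_def hurwitz_upto_def by blast
  then show ?thesis by simp
qed

lemma sig_X12_subst: "(comp1 sig (X1 - X2))^2 = subst2 ((comp1 sig (U1 - U2))^2) tau1 tau2"
proof -
  note h = is_hom_simps[OF is_hom_subst2[OF vanishes_tau]]
  show ?thesis
    unfolding h subst2_comp1[OF vanishes_U(4) vanishes_tau] subst2_lift1 subst2_lift2 comp1_lift1[OF tau_low(1)] 
      comp1_lift2[OF tau_low(1)] U_tau by simp
qed

lemma sig_X12_hurwitz:
  assumes A: "is_subring A" and mu: "\<And>j. j \<in> {1,2,3,4,6} \<Longrightarrow> \<mu> j \<in> A"
  shows "hurwitz2 A ((comp1 sig (X1 - X2))^2)"
proof -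
  note h = is_subringD[OF is_subring_hurwitz2[OF A], simplified] is_subring_power[OF is_subring_hurwitz2[OF A], simplified]
  note c = hurwitz2_coeffs2_in[OF A]
  have "hurwitz2 A ((X2 - X1)^2 * lift1 (inverse a) * lift2 (inverse a) * P12 * P21 * r2)"
  proof (intro h(4))
    show "hurwitz2 A ((X2 - X1)^2)"
      by (intro h(7) h(3) c coeffs2_in_lift1 coeffs2_in_lift2 coeffs_in_X A)
    show "hurwitz2 A (lift1 (inverse a))" "hurwitz2 A (lift2 (inverse a))"
      by (intro c coeffs2_in_lift1 coeffs2_in_lift2 A coeffs_in_all mu; assumption)+
    show "hurwitz2 A P12" "hurwitz2 A P21"
      by (intro c P12_coeffs2_in P21_coeffs2_in A mu; assumption)+
    show "hurwitz2 A r2" unfolding r2_def by (rule r_hurwitz[OF A mu])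
  qed
  then show ?thesis
    unfolding sig_X12_subst product_formula by (intro hurwitz2_subst_tau A mu)
qed

lemma sig_X12_split:
  assumes A: "is_subring A" and mu: "\<And>j. j \<in> {1,2,3,4,6} \<Longrightarrow> \<mu> j \<in> A" and div: "\<And>x n. x \<in> A \<Longrightarrow> n > 0 \<Longrightarrow> x / of_nat n \<in> A"
  shows "\<exists>f g. (comp1 sig (X1 - X2))^2 = (X1 - X2)^2 * (1 + X1 * f + X2 * g) \<and> f \<in> coeffs2_in A \<and> g \<in> coeffs2_in A"
proof -
  note s = is_subring_coeffs_in[OF A]
  note ss = is_subring_coeffs_in[OF s]
  have v: "vanishes (Suc 0) (X1 - X2 :: 'a fps2)" by (intro vanishes_diff vanishes_X)
  have "comp1 sig (X1 - X2) = (X1 - X2) * comp1 ee (X1 - X2)"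
    by (simp add: sig_def is_hom_mult[OF is_hom_comp1[OF v]] comp1_X[OF v])
  then have 1: "(comp1 sig (X1 - X2))^2 = (X1 - X2)^2 * (comp1 ee (X1 - X2))^2" by (simp add: power_mult_distrib)
  have 2: "(comp1 ee (X1 - X2))^2 \<in> coeffs2_in A"
    by (intro is_subring_power[OF ss] coeffs2_in_comp1[OF A] rational_coeffs[OF A mu div] 
         is_subringD(3)[OF ss] coeffs2_in_lift1[OF A] coeffs2_in_lift2[OF A] coeffs_in_X[OF A])
  have 3: "(comp1 ee (X1 - X2))^2 $ 0 $ 0 = 1" by (simp add: power2_eq_square comp1_nth_0_0 ee_0)
  show ?thesis unfolding 1 using coeffs2_in_split[OF A 2 3] by metis
qed

end

section \<open>The expansion of r\<close>

text \<open>A monomial of degree at most 4 has an exponent at most 2 in one of the variables, so by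
  symmetry rows 0, 1 and 2 suffice. Each of them follows from the row of the product with the same
  index and the earlier rows of G.\<close>

lemma vanishes_5_symmetric:
  fixes G :: "'a::comm_ring_1 fps2"
  assumes sym: "swap G = G" 
    and 0: "\<And>j. j \<le> 6 \<Longrightarrow> ((X1 - X2)^2 * G) $ 0 $ j = 0"
    and 1: "\<And>j. j \<le> 5 \<Longrightarrow> ((X1 - X2)^2 * G) $ 1 $ j = 0"
    and 2: "\<And>j. j \<le> 4 \<Longrightarrow> ((X1 - X2)^2 * G) $ 2 $ j = 0"
  shows "vanishes 5 G"
proof -
  have e: "((X1 - X2)^2 * G) $ i $ Suc (Suc j) = (if i < 2 then 0 else G $ (i - 2) $ Suc (Suc j)) 
     - 2 * (if i = 0 then 0 else G $ (i - 1) $ Suc j) + G $ i $ j" for i j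
  proof -
    have "(X1 - X2)^2 * G = fps_X^2 * G - 2 * (fps_X * (X2 * G)) + X2 * (X2 * G)"
      unfolding X1_eq by (simp add: algebra_simps power2_eq_square)
    then show ?thesis by (simp add: fps_X_power_mult_nth numeral_fps_const) 
  qed
  have G0: "G $ 0 $ j = 0" if "j \<le> 4" for j
    using 0[of "Suc (Suc j)"] e[of 0 j] that by simp
  have G1: "G $ 1 $ j = 0" if "j \<le> 3" for j
    using 1[of "Suc (Suc j)"] e[of 1 j] G0[of "Suc j"] that by simp
  have G2: "G $ 2 $ j = 0" if "j \<le> 2" for j
    using 2[of "Suc (Suc j)"] e[of 2 j] G0[of "Suc (Suc j)"] G1[of "Suc j"] that by simp
  have s: "G $ i $ j = G $ j $ i" for i j by (metis sym swap_nth)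
  show ?thesis unfolding vanishes_def
  proof (intro allI impI)
    fix i j assume ij: "i + j < (5::nat)"
    have "i = 0 \<or> i = 1 \<or> i = 2 \<or> j = 0 \<or> j = 1" using ij by linarith
    then show "G $ i $ j = 0"
    proof (elim disjE)
      assume "j = 0" then show ?thesis using s[of i j] G0[of i] ij by simp
    next
      assume "j = 1" then show ?thesis using s[of i j] G1[of i] ij by simp
    qed (use ij G0 G1 G2 in auto)
  qed
qed

context weierstrass_coeffs
begin

lemma S_chord: "S * chord_den m fps_X S 0 = fps_X^2"
  using chord_identity[of S m fps_X 0] S_eq by (simp add: curve_a_def curve_b_def)

lemma sig_U_deriv: "2 * (sig oo U) * (fps_deriv sig oo U) = \<Phi> * (nu oo U) + S * (fps_deriv nu oo U)"
proof -
  have "fps_deriv ((sig oo U)^2) = fps_deriv (S * (nu oo U))" by (simp add: sig_U_square)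
  then have "\<Omega> * (2 * (sig oo U) * (fps_deriv sig oo U)) = \<Omega> * (\<Phi> * (nu oo U) + S * (fps_deriv nu oo U))"
    by (simp add: fps_compose_deriv[OF U_simps(1)] S_deriv' U_simps power2_eq_square algebra_simps)
  moreover have "\<Omega> \<noteq> 0" using \<Omega>_0 by auto
  ultimately show ?thesis by simp
qed

lemma \<Omega>_low: "\<Omega> $ 0 = 1" "\<Omega> $ Suc 0 = \<mu> 1" "\<Omega> $ 2 = \<mu> 1 ^ 2 + \<mu> 2"
proof -
  have W: "W $ 0 = 1" "W $ Suc 0 = - \<mu> 1" "W $ 2 = - \<mu> 2"
    using S_low by (simp_all add: W_def power2_eq_square fps_mult_nth numeral_2_eq_2 numeral_fps_const fps_X_def)
  show 0: "\<Omega> $ 0 = 1" by (rule \<Omega>_0)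
  have "(\<Omega> * W) $ Suc 0 = 0" by (simp add: \<Omega>_W)
  then show 1: "\<Omega> $ Suc 0 = \<mu> 1" by (simp add: fps_mult_nth 0 W add_eq_0_iff)
  have "(\<Omega> * W) $ 2 = 0" by (simp add: \<Omega>_W)
  then show 2: "\<Omega> $ 2 = \<mu> 1 ^ 2 + \<mu> 2" using W
    by (simp add: fps_mult_nth numeral_2_eq_2 0 1 power2_eq_square algebra_simps add_eq_0_iff)
qed

text \<open>Taylor expansion in X1 of (X2 - X1)^2 r = D12 D21 sig(U2 - U1)^2. The products of sig,
  sig' and sig'' at U are eliminated by sig^2 = S nu and its derivatives, so that only S, nu and nu'
  remain.\<close>

lemma r2_coeffs:
  defines "N \<equiv> nu oo U" and "N' \<equiv> fps_deriv nu oo U"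
  shows "r2 $ 0 = N" "r2 $ 1 = - N'" 
    "2 * N * r2 $ 2 = - (N^2 * (fps_const (b4 \<mu>) * S + fps_const (\<mu> 3 ^ 2 + 2 * \<mu> 6) * S^2)) - m 1 * N' * N + N'^2"
proof -
  define Z where "Z = comp1 sig (U2 - U1)"
  define al al' al'' where "al = sig oo U" and "al' = fps_deriv sig oo U" and "al'' = fps_deriv (fps_deriv sig) oo U"
  define d where "d = chord_den m fps_X S 0"
  define c1 e1 f2 where "c1 = m 1 + m 3 * S" and "e1 = m 2 + m 4 * S + m 6 * S^2" and "f2 = fps_X * m 3 + fps_X^2 * (m 4 + m 6 * S)"
  note sq = power2_eq_square
  have ax: "comp1 f (U2 - U1) $ 0 = f oo U" for f
    by (rule comp1_axis1) (simp_all add: lift1_def U_simps)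
  have Z0: "Z $ 0 = al" by (simp add: Z_def ax al_def)
  have dZ: "fps_deriv Z = - comp1 (fps_deriv sig) (U2 - U1) * lift1 \<Omega>"
    unfolding Z_def comp1_deriv[OF is_deriv_deriv1 vanishes_U(3)] by (simp add: deriv_lift U_simps)
  have lO: "lift1 \<Omega> $ 0 = 1" "lift1 (fps_deriv \<Omega>) $ 0 = m 1" by (simp_all add: lift1_def \<Omega>_low)
  have "Z $ 1 = fps_deriv Z $ 0" by simp
  also have "\<dots> = - al'" unfolding dZ using lO by (simp add: ax al'_def)
  finally have Z1: "Z $ 1 = - al'" .
  have "2 * Z $ 2 = fps_deriv (fps_deriv Z) $ 0" by (simp add: numeral_2_eq_2)
  also have "\<dots> = al'' - m 1 * al'"
    unfolding dZ by (simp add: comp1_deriv[OF is_deriv_deriv1 vanishes_U(3)] deriv_lift U_simps)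
      (simp add: ax al'_def al''_def lO)
  finally have Z2: "2 * Z $ 2 = al'' - m 1 * al'" .
  have S1: "lift1 S $ 0 = 0" "lift1 S $ 1 = 0" "lift1 S $ 2 = 1" using S_low by (simp_all add: lift1_def)
  have DD: "D12 $ 0 = 1" "D12 $ 1 = - c1" "D12 $ 2 = - e1" "D21 $ 0 = d" "D21 $ 1 = 0" "D21 $ 2 = - f2"
    using S1 unfolding D12_def D21_def chord_den_def sq X1_eq d_def c1_def e1_def f2_def
    by (simp_all add: fps_mult_nth numeral_2_eq_2 algebra_simps fps_X_def[where ?'a = "'a fps"] fps_const_mult[symmetric] del: fps_const_mult)
  have main: "(X2 - X1)^2 * r2 = D12 * D21 * Z^2"
    unfolding r2_def r_formula Z_def sig_H by algebra
  have L: "((X2 - X1)^2 * r2) $ 0 = fps_X^2 * r2 $ 0" "((X2 - X1)^2 * r2) $ 1 = fps_X^2 * r2 $ 1 - 2 * fps_X * r2 $ 0"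
    "((X2 - X1)^2 * r2) $ 2 = fps_X^2 * r2 $ 2 - 2 * fps_X * r2 $ 1 + r2 $ 0"
  proof -
    have e: "(X2 - X1)^2 * r2 = lift2 (fps_X^2) * r2 - lift2 (2 * fps_X) * (fps_X * r2) + fps_X^2 * r2"
      unfolding X1_eq is_hom_simps[OF lift2_hom] by algebra
    show "((X2 - X1)^2 * r2) $ 0 = fps_X^2 * r2 $ 0" "((X2 - X1)^2 * r2) $ 1 = fps_X^2 * r2 $ 1 - 2 * fps_X * r2 $ 0"
      "((X2 - X1)^2 * r2) $ 2 = fps_X^2 * r2 $ 2 - 2 * fps_X * r2 $ 1 + r2 $ 0"
      unfolding e by (simp_all add: fps_X_power_mult_nth)
  qed
  have R: "(D12 * D21 * Z^2) $ 0 = d * al^2" "(D12 * D21 * Z^2) $ 1 = - c1 * d * al^2 - 2 * d * al * al'"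
    "(D12 * D21 * Z^2) $ 2 = (- e1 * d - f2) * al^2 + 2 * c1 * d * al * al' + d * (al'^2 + 2 * al * Z $ 2)"
    using DD Z0 Z1 unfolding sq by (simp_all add: fps_mult_nth numeral_2_eq_2 algebra_simps)
  have al2: "al^2 = S * N" unfolding al_def N_def by (rule sig_U_square)
  have alal': "2 * al * al' = \<Phi> * N + S * N'" unfolding al_def al'_def N_def N'_def by (rule sig_U_deriv)
  have alal'': "al * al'' = al'^2 - N"
  proof -
    have "N = (fps_deriv sig)^2 - sig * fps_deriv (fps_deriv sig) oo U" unfolding N_def nu_sig ..
    then show ?thesis by (simp add: al_def al'_def al''_def fps_compose_sub_distrib fps_compose_mult_distrib[OF U_simps(1)] sq)
  qed
  have Sd: "S * d = fps_X^2" unfolding d_def by (rule S_chord)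
  have P: "fps_X * \<Phi> = S * (2 - c1 * fps_X)" using S_\<Phi> unfolding b_def curve_b_def c1_def by algebra
  have eS: "S = (1 + S * e1) * fps_X^2 + S * c1 * fps_X"
    using S_eq unfolding curve_a_def curve_b_def c1_def e1_def by algebra
  have nz: "S \<noteq> 0" "(fps_X :: 'a fps) \<noteq> 0" using S_nonzero by auto
  have "S * (fps_X^2 * r2 $ 0) = S * (fps_X^2 * N)"
    using arg_cong[OF main, of "\<lambda>F. F $ 0"] L R Sd al2 by algebra
  then have "S * fps_X^2 * r2 $ 0 = S * fps_X^2 * N" by (simp only: mult.assoc)
  moreover have nz2: "S * fps_X^2 \<noteq> 0" using nz by simp
  ultimately show R0: "r2 $ 0 = N" by (metis mult_left_cancel)
  have "S * (fps_X^2 * r2 $ 1) = S * (fps_X^2 * - N')"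
    using arg_cong[OF main, of "\<lambda>F. F $ 1"] L R R0 Sd al2 alal' P by algebra
  then have "S * fps_X^2 * r2 $ 1 = S * fps_X^2 * (- N')" by (simp only: mult.assoc)
  then show R1: "r2 $ 1 = - N'" using nz2 by (metis mult_left_cancel)
  have r2e: "fps_X^2 * r2 $ 2 = - 2 * fps_X * N' - N + (- e1 * d - f2) * S * N + c1 * d * (\<Phi> * N + S * N') 
     + d * (2 * al'^2 - N - m 1 * al * al')"
  proof -
    have "fps_X^2 * r2 $ 2 = 2 * fps_X * r2 $ 1 - r2 $ 0 + ((- e1 * d - f2) * al^2 + 2 * c1 * d * al * al' + d * (al'^2 + 2 * al * Z $ 2))"
      using arg_cong[OF main, of "\<lambda>F. F $ 2"] unfolding L(3) R(3) by (simp add: algebra_simps)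
    then show ?thesis unfolding R0 R1 using al2 alal' alal'' Z2 by algebra
  qed
  define T where "T = \<Phi> * N + S * N'"
  have T: "4 * (S * N) * al'^2 = T^2" "2 * (al * al') = T" using al2 alal' unfolding T_def by algebra+
  define tt where "tt = (2 - c1 * fps_X) * N + fps_X * N'"
  have xT: "fps_X * T = S * tt" unfolding T_def tt_def using P by algebra
  have x2: "fps_X^2 = S * (1 - e1 * fps_X^2 - c1 * fps_X)" using eS by algebra
  \<comment> \<open>The factor in front provides the \<open>4 * (S * N)\<close> that turns the
    square of \<open>al'\<close> into the square of \<open>T\<close>; one S is used up by the
    relation \<open>Sd\<close>.\<close>
  have "S^2 * (2 * N) * (fps_X^2 * r2 $ 2) = S^2 * (2 * N) * (- 2 * fps_X * N' - N) + S * (2 * N) * ((- e1 * fps_X^2 - f2 * S) * S * N)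
     + S * N * fps_X^2 * (2 * c1 * T - 2 * N - m 1 * T) + fps_X^2 * T^2"
    unfolding r2e T_def[symmetric] using Sd T by algebra
  also have "\<dots> = S^2 * (2 * N * (- 2 * fps_X * N' - N) - 2 * N^2 * (e1 * fps_X^2 + f2 * S) 
     + N * fps_X * (2 * c1 - m 1) * tt - 2 * N^2 * (1 - e1 * fps_X^2 - c1 * fps_X) + tt^2)"
    using xT x2 by algebra
  also have "\<dots> = S^2 * fps_X^2 * (- (N^2 * ((2 * m 4 + m 1 * m 3) * S + (m 3 ^ 2 + 2 * m 6) * S^2)) - m 1 * N' * N + N'^2)"
    unfolding tt_def f2_def c1_def by algebra
  finally have "S^2 * fps_X^2 * (2 * N * r2 $ 2) = S^2 * fps_X^2 * (- (N^2 * ((2 * m 4 + m 1 * m 3) * S + (m 3 ^ 2 + 2 * m 6) * S^2)) - m 1 * N' * N + N'^2)"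
    by (simp only: mult_ac)
  moreover have "S^2 * fps_X^2 \<noteq> 0" using nz by simp
  ultimately have "2 * N * r2 $ 2 = - (N^2 * ((2 * m 4 + m 1 * m 3) * S + (m 3 ^ 2 + 2 * m 6) * S^2)) - m 1 * N' * N + N'^2"
    by (metis mult_left_cancel)
  moreover have "fps_const (b4 \<mu>) = 2 * m 4 + m 1 * m 3" "fps_const (\<mu> 3 ^ 2 + 2 * \<mu> 6) = m 3 ^ 2 + 2 * m 6"
    by (simp_all add: b4_def numeral_fps_const fps_const_power)
  ultimately show "2 * N * r2 $ 2 = - (N^2 * (fps_const (b4 \<mu>) * S + fps_const (\<mu> 3 ^ 2 + 2 * \<mu> 6) * S^2)) - m 1 * N' * N + N'^2"
    by (simp only:)
qed

section \<open>Low coefficients of the sigma series and of r\<close>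

lemma ee_low: "ee $ 0 = 1" "ee $ Suc 0 = 0" "ee $ 2 = - D $ 0 / 2" "ee $ 3 = 0" 
    "ee $ 4 = (D $ 0)^2 / 8 - D $ 2 / 12" "ee $ 5 = 0" "D $ 3 = 0"
    "ee $ 6 = - (D $ 0 * ee $ 4 + D $ 2 / 3 * ee $ 2 + D $ 4 / 5) / 6"
proof -
  have D3: "D $ 3 = 0" using D_rec[of 3] D_low(2) by (simp add: power2_eq_square fps_mult_nth)
  then show "D $ 3 = 0" .
  have J: "J $ 0 = 0" "J $ Suc 0 = D $ 0" "J $ 2 = 0" "J $ 3 = D $ 2 / 3" "J $ 4 = 0" "J $ 5 = D $ 4 / 5"
    using D_low(2) D3 by (simp_all add: J_def fps_integral_def field_simps)
  have e: "of_nat (Suc n) * ee $ Suc n = - (\<Sum>i=0..n. J $ i * ee $ (n - i))" for n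
    using arg_cong[OF ee_deriv, of "\<lambda>f. f $ n"] by (simp add: fps_mult_nth sum_negf)
  note s = eval_nat_numeral
  show 0: "ee $ 0 = 1" by (rule ee_0)
  show 1: "ee $ Suc 0 = 0" using e[of 0] J by simp
  show 2: "ee $ 2 = - D $ 0 / 2" using e[of 1] J(1,2) 0 1 by (simp add: s field_simps)
  show 3: "ee $ 3 = 0" using e[of 2] J(1-3) 0 1 by (simp add: s)
  have "4 * ee $ 4 = - (D $ 0 * ee $ 2 + D $ 2 / 3)" using e[of 3] J(1-4) 0 1 3 by (simp add: s)
  then show 4: "ee $ 4 = (D $ 0)^2 / 8 - D $ 2 / 12" unfolding 2 by (simp add: field_simps power2_eq_square)
  show 5: "ee $ 5 = 0" using e[of 4] J(1-5) 0 1 3 by (simp add: s)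
  have "6 * ee $ 6 = - (J $ 0 * ee $ 5 + J $ Suc 0 * ee $ 4 + J $ 2 * ee $ 3 + J $ 3 * ee $ 2 + J $ 4 * ee $ Suc 0 + J $ 5 * ee $ 0)" 
    using e[of 5] by (simp add: s)
  then have "6 * ee $ 6 = - (D $ 0 * ee $ 4 + D $ 2 / 3 * ee $ 2 + D $ 4 / 5)" unfolding J 0 1 3 5 by simp
  then show "ee $ 6 = - (D $ 0 * ee $ 4 + D $ 2 / 3 * ee $ 2 + D $ 4 / 5) / 6" by (simp add: field_simps)
qed

text \<open>The first coefficients in nu = 1 + n4 u^4 + n6 u^6 + ..., which has no term in
  u^2.\<close>

definition n4 :: 'a where "n4 = - b4 \<mu> / 12"
definition n6 :: 'a where "n6 = - b2 \<mu> * b4 \<mu> / 360 - b6 \<mu> / 30"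

lemma nu_low: "nu $ 0 = 1" "nu $ Suc 0 = 0" "nu $ 2 = 0" "nu $ 3 = 0" "nu $ 4 = n4" "nu $ 5 = 0" "nu $ 6 = n6"
proof -
  have "- 10 * D $ 2 = 6 * (D $ 0)^2 + b2 \<mu> * D $ 0 + b4 \<mu>"
    using D_rec[of 2] by (simp add: power2_eq_square)
  then have D2: "D $ 2 = - (6 * (D $ 0)^2 + b2 \<mu> * D $ 0 + b4 \<mu>) / 10" by (metis (no_types) minus_divide_left minus_minus mult_minus_left nonzero_mult_div_cancel_left zero_neq_numeral)
  define Q where "Q = ee^2"
  have Q: "Q $ 0 = 1" "Q $ Suc 0 = 0" "Q $ 2 = 2 * ee $ 2" "Q $ 3 = 0" "Q $ 4 = 2 * ee $ 4 + (ee $ 2)^2" "Q $ 5 = 0"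
     "Q $ 6 = 2 * ee $ 6 + 2 * ee $ 2 * ee $ 4"
    using ee_low(1,2,4,6) by (simp_all add: Q_def power2_eq_square fps_mult_nth eval_nat_numeral)
  have nu: "nu = Q + fps_X^2 * (Q * D)" by (simp add: nu_def Q_def algebra_simps)
  have QD: "(Q * D) $ 0 = D $ 0" "(Q * D) $ Suc 0 = 0" "(Q * D) $ 2 = D $ 2 + Q $ 2 * D $ 0" "(Q * D) $ 3 = 0"
    "(Q * D) $ 4 = D $ 4 + Q $ 2 * D $ 2 + Q $ 4 * D $ 0"
    using Q(1,2,4) D_low(2) ee_low(7) by (simp_all add: fps_mult_nth eval_nat_numeral)
  show "nu $ 0 = 1" "nu $ Suc 0 = 0" "nu $ 2 = 0" "nu $ 3 = 0" "nu $ 5 = 0"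
    unfolding nu by (simp_all add: fps_X_power_mult_nth Q QD ee_low(3) D_low(2))
  have "nu $ 4 = Q $ 4 + (Q * D) $ 2" unfolding nu by (simp add: fps_X_power_mult_nth)
  also have "\<dots> = n4" unfolding Q QD ee_low(3,5) D2 n4_def by (simp add: D_low(1) field_simps power2_eq_square)
  finally show "nu $ 4 = n4" .
  have "nu $ 6 = Q $ 6 + (Q * D) $ 4" unfolding nu by (simp add: fps_X_power_mult_nth)
  also have "\<dots> = n6" unfolding Q QD ee_low(3,5,8) D_low(3) D2 n6_def 
    by (simp add: D_low(1) field_simps power2_eq_square power3_eq_cube)
  finally show "nu $ 6 = n6" .
qed

definition U_over_X :: "'a fps" where "U_over_X = fps_shift 1 U"

lemma U_over_X: "U = fps_X * U_over_X" "U_over_X $ 0 = 1" "U_over_X $ Suc 0 = \<mu> 1 / 2" "U_over_X $ 2 = (\<mu> 1 ^ 2 + \<mu> 2) / 3"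
proof -
  show "U = fps_X * U_over_X" using U_simps(1) by (auto simp: U_over_X_def fps_eq_iff fps_X_mult_nth)
  show "U_over_X $ 0 = 1" "U_over_X $ Suc 0 = \<mu> 1 / 2" "U_over_X $ 2 = (\<mu> 1 ^ 2 + \<mu> 2) / 3"
    using \<Omega>_low by (simp_all add: U_over_X_def U_def fps_integral_def field_simps eval_nat_numeral)
qed

lemma fps_mult_nth_2: "(f * g) $ 2 = f $ 0 * g $ 2 + f $ Suc 0 * g $ Suc 0 + f $ 2 * g $ 0" for f g :: "'a fps"
  by (simp add: fps_mult_nth eval_nat_numeral)

lemma U_over_X_power: 
  "(U_over_X ^ 3) $ 0 = 1" "(U_over_X ^ 3) $ Suc 0 = 3 / 2 * \<mu> 1" "(U_over_X ^ 3) $ 2 = (\<mu> 1 ^ 2 + \<mu> 2) + 3 / 4 * \<mu> 1 ^ 2"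
  "(U_over_X ^ 4) $ 0 = 1" "(U_over_X ^ 4) $ Suc 0 = 2 * \<mu> 1" "(U_over_X ^ 4) $ 2 = 4 / 3 * (\<mu> 1 ^ 2 + \<mu> 2) + 3 / 2 * \<mu> 1 ^ 2"
  unfolding power3_eq_cube power4_eq_xxxx fps_mult_nth_2 fps_mult_nth_1 fps_mult_nth_0 U_over_X(2-4)
  by (simp_all add: fps_mult_nth_1 U_over_X(2-4) field_simps power2_eq_square)

definition V4 :: "'a fps" where "V4 = fps_shift 4 (nu oo U)"
definition V3 :: "'a fps" where "V3 = fps_shift 3 (fps_deriv nu oo U)"

lemma compose_shift:
  fixes f :: "'a fps"
  assumes "\<And>i. i < n \<Longrightarrow> f $ i = 0"
  shows "f oo U = fps_X ^ n * (U_over_X ^ n * (fps_shift n f oo U))"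
proof -
  have "f = fps_X ^ n * fps_shift n f" using assms by (auto simp: fps_eq_iff fps_X_power_mult_nth)
  then have "f oo U = U ^ n * (fps_shift n f oo U)"
    by (metis U_simps(1) fps_compose_mult_distrib fps_compose_power fps_X_fps_compose_startby0)
  then show ?thesis by (subst (asm) U_over_X(1)) (simp add: power_mult_distrib mult.assoc)
qed

lemma V4: "nu oo U = 1 + fps_X^4 * V4" "V4 $ 0 = n4" "V4 $ Suc 0 = 2 * \<mu> 1 * n4" 
    "V4 $ 2 = (4 * (\<mu> 1 ^ 2 + \<mu> 2) / 3 + 3 / 2 * \<mu> 1 ^ 2) * n4 + n6"
proof -
  let ?g = "fps_shift 4 nu oo U"
  have g: "?g $ 0 = n4" "?g $ Suc 0 = 0" "?g $ 2 = n6"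
    using nu_low U_simps by (simp_all add: fps_compose_nth eval_nat_numeral fps_mult_nth)
  have "nu - 1 oo U = fps_X^4 * (U_over_X ^ 4 * (fps_shift 4 (nu - 1) oo U))"
  proof (rule compose_shift)
    fix i :: nat assume "i < 4"
    then have "i = 0 \<or> i = Suc 0 \<or> i = 2 \<or> i = 3" by linarith
    then show "(nu - 1) $ i = 0" by (elim disjE) (simp_all add: nu_low)
  qed
  moreover have "fps_shift 4 (nu - 1) = fps_shift 4 nu" by (simp add: fps_eq_iff)
  ultimately have e: "nu oo U = 1 + fps_X^4 * (U_over_X ^ 4 * ?g)"
    by (simp add: fps_compose_sub_distrib algebra_simps)
  then have V: "V4 = U_over_X ^ 4 * ?g" unfolding V4_def by (simp add: fps_eq_iff fps_X_power_mult_nth)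
  show "nu oo U = 1 + fps_X^4 * V4" unfolding V by (rule e)
  show "V4 $ 0 = n4" "V4 $ Suc 0 = 2 * \<mu> 1 * n4" 
    "V4 $ 2 = (4 * (\<mu> 1 ^ 2 + \<mu> 2) / 3 + 3 / 2 * \<mu> 1 ^ 2) * n4 + n6"
    unfolding V fps_mult_nth_2 fps_mult_nth_1 fps_mult_nth_0 g U_over_X_power by (simp_all add: fps_mult_nth_1 g U_over_X_power nu_low field_simps)
qed

lemma V3: "fps_deriv nu oo U = fps_X^3 * V3" "V3 $ 0 = 4 * n4" "V3 $ Suc 0 = 6 * \<mu> 1 * n4" 
    "V3 $ 2 = (4 * (\<mu> 1 ^ 2 + \<mu> 2) + 3 * \<mu> 1 ^ 2) * n4 + 6 * n6"
proof -
  let ?g = "fps_shift 3 (fps_deriv nu) oo U"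
  have g: "?g $ 0 = 4 * n4" "?g $ Suc 0 = 0" "?g $ 2 = 6 * n6"
    using nu_low U_simps by (simp_all add: fps_compose_nth eval_nat_numeral fps_mult_nth)
  have e: "fps_deriv nu oo U = fps_X^3 * (U_over_X ^ 3 * (fps_shift 3 (fps_deriv nu) oo U))"
  proof (rule compose_shift)
    fix i :: nat assume "i < 3"
    then have "i = 0 \<or> i = Suc 0 \<or> i = 2" by linarith
    then show "fps_deriv nu $ i = 0" using nu_low(2-4) by (elim disjE) (simp_all add: eval_nat_numeral)
  qed
  then have V: "V3 = U_over_X ^ 3 * ?g" unfolding V3_def by (simp add: fps_eq_iff fps_X_power_mult_nth)
  show "fps_deriv nu oo U = fps_X^3 * V3" unfolding V by (rule e)
  show "V3 $ 0 = 4 * n4" "V3 $ Suc 0 = 6 * \<mu> 1 * n4" 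
    "V3 $ 2 = (4 * (\<mu> 1 ^ 2 + \<mu> 2) + 3 * \<mu> 1 ^ 2) * n4 + 6 * n6"
    unfolding V fps_mult_nth_2 fps_mult_nth_1 fps_mult_nth_0 g U_over_X_power by (simp_all add: fps_mult_nth_1 g U_over_X_power nu_low field_simps)
qed

lemma r2_low0: "r2 $ 0 $ j = (if j = 0 then 1 else if j < 4 then 0 else V4 $ (j - 4))"
  unfolding r2_coeffs(1) V4(1) by (auto simp: fps_X_power_mult_nth)

lemma r2_low1: "r2 $ 1 $ j = (if j < 3 then 0 else - V3 $ (j - 3))"
  unfolding r2_coeffs(2) V3(1) by (auto simp: fps_X_power_mult_nth)

lemma r2_low2: "r2 $ 2 $ 0 = 0" "r2 $ 2 $ Suc 0 = 0" "r2 $ 2 $ 2 = - b4 \<mu> / 2" "r2 $ 2 $ 3 = - b4 \<mu> * \<mu> 1 / 2 - 2 * \<mu> 1 * n4"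
  "r2 $ 2 $ 4 = - b4 \<mu> * (\<mu> 1 ^ 2 + \<mu> 2) / 2 - (\<mu> 3 ^ 2 + 2 * \<mu> 6) / 2 - 3 * \<mu> 1 ^ 2 * n4"
proof -
  have e: "2 * (1 + fps_X^4 * V4) * r2 $ 2 = - ((1 + fps_X^4 * V4)^2 * (fps_const (b4 \<mu>) * S + fps_const (\<mu> 3 ^ 2 + 2 * \<mu> 6) * S^2)) 
     - m 1 * (fps_X^3 * V3) * (1 + fps_X^4 * V4) + (fps_X^3 * V3)^2"
    using r2_coeffs(3) unfolding V4(1) V3(1) .
  define B C where "B = fps_const (b4 \<mu>)" and "C = fps_const (\<mu> 3 ^ 2 + 2 * \<mu> 6)"
  have e': "fps_const 2 * (r2 $ 2) + fps_X^4 * (fps_const 2 * (V4 * r2 $ 2)) = - (B * S + C * S^2) - fps_X^4 * ((2 * V4 + fps_X^4 * V4^2) * (B * S + C * S^2))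
      - m 1 * (fps_X^3 * V3) + fps_X^6 * (V3^2 - fps_X * m 1 * V3 * V4)"
    using e unfolding B_def[symmetric] C_def[symmetric] numeral_fps_const[symmetric] by algebra
  have S2: "(S^2) $ 0 = 0" "(S^2) $ Suc 0 = 0" "(S^2) $ 2 = 0" "(S^2) $ 3 = 0" "(S^2) $ 4 = 1"
    using S_low by (simp_all add: power2_eq_square fps_mult_nth eval_nat_numeral)
  note n = arg_cong[OF e', of "\<lambda>f. f $ k" for k]
  have B: "(B * f) $ k = b4 \<mu> * f $ k" "(C * f) $ k = (\<mu> 3 ^ 2 + 2 * \<mu> 6) * f $ k" for f k by (simp_all add: B_def C_def)
  note n' = n[unfolded fps_add_nth fps_sub_nth fps_neg_nth B fps_mult_left_const_nth fps_X_power_mult_nth mult_minus_left]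
  show 0: "r2 $ 2 $ 0 = 0" using n'[of 0] by (simp add: S_low S2)
  show "r2 $ 2 $ Suc 0 = 0" using n'[of "Suc 0"] by (simp add: S_low S2)
  show "r2 $ 2 $ 2 = - b4 \<mu> / 2" using n'[of 2] by (simp add: S_low S2 field_simps)
  show "r2 $ 2 $ 3 = - b4 \<mu> * \<mu> 1 / 2 - 2 * \<mu> 1 * n4" using n'[of 3] 
    by (simp add: S_low S2 V3 field_simps)
  have h: "2 * r2 $ 2 $ 4 = - b4 \<mu> * (\<mu> 1 ^ 2 + \<mu> 2) - (\<mu> 3 ^ 2 + 2 * \<mu> 6) - 6 * \<mu> 1 ^ 2 * n4"
    using n'[of 4] by (simp add: S_low S2 V3 0 algebra_simps) (simp add: algebra_simps power2_eq_square)?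
  have "r2 $ 2 $ 4 = (- b4 \<mu> * (\<mu> 1 ^ 2 + \<mu> 2) - (\<mu> 3 ^ 2 + 2 * \<mu> 6) - 6 * \<mu> 1 ^ 2 * n4) / 2" 
    unfolding h[symmetric] by simp
  also have "\<dots> = - b4 \<mu> * (\<mu> 1 ^ 2 + \<mu> 2) / 2 - (\<mu> 3 ^ 2 + 2 * \<mu> 6) / 2 - 3 * \<mu> 1 ^ 2 * n4" 
    by (simp add: field_simps)
  finally show "r2 $ 2 $ 4 = - b4 \<mu> * (\<mu> 1 ^ 2 + \<mu> 2) / 2 - (\<mu> 3 ^ 2 + 2 * \<mu> 6) / 2 - 3 * \<mu> 1 ^ 2 * n4" .
qed

text \<open>The expected value of (r - 1) / (X1 - X2)^2 up to degree 4. The last three coefficients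
  are solved one after another from rows 0, 1 and 2 of r; \<open>r_target_coeffs\<close> brings them
  into the displayed form.\<close>

definition r_target :: "'a fps2" where
  "r_target = const_fps2 n4 * (X1 - X2)^2 + const_fps2 (2 * \<mu> 1 * n4) * (X1 - X2)^2 * (X1 + X2) 
     + (const_fps2 (V4 $ 2) * (X1^4 + X2^4) + const_fps2 (V3 $ 2 * - 1 + 2 * V4 $ 2) * X1 * X2 * (X1^2 + X2^2) 
     + const_fps2 (r2 $ 2 $ 4 + 2 * (V3 $ 2 * - 1 + 2 * V4 $ 2) - V4 $ 2) * X1^2 * X2^2)"

lemma r2_expansion: "vanishes 7 (r2 - (1 + (X1 - X2)^2 * r_target))"
proof -
  have sr: "swap (r2 - 1) = r2 - 1" by (simp add: is_hom_simps[OF is_hom_swap] swap_r2)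
  from symmetric_diagonal_divide[OF this r2_diag] obtain G where G: "r2 - 1 = (X1 - X2)^2 * G" by blast
  have sw: "lift1 (fps_const c) = const_fps2 c" for c :: 'a by (auto simp: fps_eq_iff)
  have sG: "swap G = G"
  proof -
    have "(X1 - X2)^2 * swap G = (X1 - X2)^2 * G"
      using sr unfolding G is_hom_simps[OF is_hom_swap] swap_lift by algebra
    moreover have "(X1 - X2 :: 'a fps2)^2 \<noteq> 0" using X1_X2_neq[where ?'a = 'a] by simp
    ultimately show ?thesis by (metis mult_left_cancel)
  qed
  have "swap r_target = r_target"
    unfolding r_target_def is_hom_simps[OF is_hom_swap] swap_lift sw by algebra
  with sG have s: "swap (G - r_target) = G - r_target" by (simp add: is_hom_simps[OF is_hom_swap])
  define x where "x = (fps_X :: 'a fps)"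
  have X1x: "lift1 x = fps_X" unfolding x_def by (rule X1_eq)
  define A B P Q R where "A = fps_const n4" and "B = fps_const (2 * \<mu> 1 * n4)" and "P = fps_const (V4 $ 2)" 
    and "Q = fps_const (V3 $ 2 * - 1 + 2 * V4 $ 2)" and "R = fps_const (r2 $ 2 $ 4 + 2 * (V3 $ 2 * - 1 + 2 * V4 $ 2) - V4 $ 2)"
  \<comment> \<open>Sorted by powers of y, which stands for X1, so that rows 0, 1 and 2 can be read
    off.\<close>
  have ident: "(y - z)^2 * (a * (y - z)^2 + b * (y - z)^2 * (y + z) + (p * (y^4 + z^4) + q * y * z * (y^2 + z^2) + r * y^2 * z^2))
     = (a * z^4 + b * z^5 + p * z^6) + y * (- 4 * a * z^3 - 3 * b * z^4 + (q - 2 * p) * z^5)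
     + y^2 * ((6 * a * z^2 + 2 * b * z^3 + (r - 2 * q + p) * z^4) + y * ((- 4 * a * z + 2 * b * z^2 + (2 * q - 2 * r) * z^3) 
     + y * ((a - 3 * b * z + (r - 2 * q + p) * z^2) + y * (b + (q - 2 * p) * z) + y^2 * p)))"
    for a b p q r y z :: "'a fps2"
    by (simp add: algebra_simps eval_nat_numeral)
  have T: "(X1 - X2)^2 * r_target = lift2 (A * x^4 + B * x^5 + P * x^6) + fps_X * lift2 (- 4 * A * x^3 - 3 * B * x^4 + (Q - 2 * P) * x^5)
     + fps_X^2 * (lift2 (6 * A * x^2 + 2 * B * x^3 + (R - 2 * Q + P) * x^4) + fps_X * (lift2 (- 4 * A * x + 2 * B * x^2 + (2 * Q - 2 * R) * x^3) 
     + fps_X * (lift2 (A - 3 * B * x + (R - 2 * Q + P) * x^2) + fps_X * lift2 (B + (Q - 2 * P) * x) + fps_X^2 * lift2 P)))"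
    unfolding r_target_def is_hom_simps[OF lift2_hom] A_def[symmetric] B_def[symmetric] P_def[symmetric] Q_def[symmetric] 
      R_def[symmetric] x_def[symmetric] X1x by (rule ident)
  have E: "(X1 - X2)^2 * (G - r_target) = r2 - 1 - (X1 - X2)^2 * r_target"
    by (simp add: G right_diff_distrib)
  have T0: "((X1 - X2)^2 * r_target) $ 0 = A * x^4 + B * x^5 + P * x^6"
    "((X1 - X2)^2 * r_target) $ 1 = - 4 * A * x^3 - 3 * B * x^4 + (Q - 2 * P) * x^5"
    "((X1 - X2)^2 * r_target) $ 2 = 6 * A * x^2 + 2 * B * x^3 + (R - 2 * Q + P) * x^4"
    unfolding T by (simp_all add: fps_X_power_mult_nth)
  have t0: "((X1 - X2)^2 * r_target) $ 0 $ j = (if j = 4 then n4 else if j = 5 then 2 * \<mu> 1 * n4 else if j = 6 then V4 $ 2 else 0)" for j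
    unfolding T0 A_def B_def P_def x_def by (auto simp: fps_X_power_nth)
  have t1: "((X1 - X2)^2 * r_target) $ 1 $ j = (if j = 3 then - 4 * n4 else if j = 4 then - 6 * \<mu> 1 * n4 else if j = 5 then - V3 $ 2 else 0)" for j
  proof -
    have "- 4 * A = fps_const (- 4 * n4)" "3 * B = fps_const (6 * \<mu> 1 * n4)" "Q - 2 * P = fps_const (- V3 $ 2)"
      unfolding A_def B_def P_def Q_def numeral_fps_const by simp_all
    then show ?thesis unfolding T0 x_def by (auto simp: fps_X_power_nth)
  qed
  have t2: "((X1 - X2)^2 * r_target) $ 2 $ j = (if j = 2 then 6 * n4 else if j = 3 then 4 * \<mu> 1 * n4 else if j = 4 then r2 $ 2 $ 4 else 0)" for j
  proof -
    have "6 * A = fps_const (6 * n4)" "2 * B = fps_const (4 * \<mu> 1 * n4)" "R - 2 * Q + P = fps_const (r2 $ 2 $ 4)"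
      unfolding A_def B_def P_def Q_def R_def numeral_fps_const by simp_all
    then show ?thesis unfolding T0 x_def by (auto simp: fps_X_power_nth)
  qed
  have b4: "b4 \<mu> = - 12 * n4" by (simp add: n4_def)
  have "vanishes 5 (G - r_target)"
  proof (rule vanishes_5_symmetric[OF s]; unfold E fps_sub_nth)
    fix j :: nat assume "j \<le> 6"
    then have "j = 0 \<or> j = 1 \<or> j = 2 \<or> j = 3 \<or> j = 4 \<or> j = 5 \<or> j = 6" by linarith
    then show "r2 $ 0 $ j - 1 $ 0 $ j - ((X1 - X2)^2 * r_target) $ 0 $ j = 0"
      unfolding t0 r2_low0 by (elim disjE) (simp_all add: V4)
  next
    fix j :: nat assume "j \<le> 5"
    then have "j = 0 \<or> j = 1 \<or> j = 2 \<or> j = 3 \<or> j = 4 \<or> j = 5" by linarith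
    then show "r2 $ 1 $ j - 1 $ 1 $ j - ((X1 - X2)^2 * r_target) $ 1 $ j = 0"
      unfolding t1 r2_low1 by (elim disjE) (simp_all add: V3)
  next
    fix j :: nat assume "j \<le> 4"
    then have "j = 0 \<or> j = 1 \<or> j = 2 \<or> j = 3 \<or> j = 4" by linarith
    then show "r2 $ 2 $ j - 1 $ 2 $ j - ((X1 - X2)^2 * r_target) $ 2 $ j = 0"
      unfolding t2 by (elim disjE) (simp_all add: r2_low2(1-4) b4)
  qed
  moreover have v: "vanishes (Suc 0) (X1 - X2 :: 'a fps2)" by (intro vanishes_diff vanishes_X)
  ultimately have "vanishes (Suc 0 + (Suc 0 + 5)) ((X1 - X2) * ((X1 - X2) * (G - r_target)))"
    by (intro vanishes_mult[OF v vanishes_mult[OF v]])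
  moreover have "r2 - (1 + (X1 - X2)^2 * r_target) = (X1 - X2) * ((X1 - X2) * (G - r_target))"
    using E by algebra
  ultimately show ?thesis by simp
qed

lemma r2_vanishes: "vanishes 4 (r2 - 1)"
  unfolding vanishes_def
proof (intro allI impI)
  fix i j :: nat assume ij: "i + j < 4"
  have s: "r2 $ i $ 0 = r2 $ 0 $ i" "r2 $ i $ Suc 0 = r2 $ Suc 0 $ i" by (metis swap_r2 swap_nth)+
  have "i = 0 \<or> i = 1 \<or> j = 0 \<or> j = 1" using ij by linarith
  then show "(r2 - 1) $ i $ j = 0"
    using ij by (elim disjE) (simp_all add: r2_low0 r2_low1[simplified] s fps_one_nth)
qed

lemma r_target_coeffs:
  "n4 = - (1/12 * \<mu> 1 * \<mu> 3 + 1/6 * \<mu> 4)"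
  "2 * \<mu> 1 * n4 = - (1/6 * \<mu> 1 ^ 2 * \<mu> 3 + 1/3 * \<mu> 4 * \<mu> 1)"
  "V4 $ 2 = - (1/30 * \<mu> 3 ^ 2 + (43/180 * \<mu> 1 ^ 3 + 11/90 * \<mu> 2 * \<mu> 1) * \<mu> 3
                   + 43/90 * \<mu> 4 * \<mu> 1 ^ 2 + 11/45 * \<mu> 2 * \<mu> 4 + 2/15 * \<mu> 6)"
  "V3 $ 2 * - 1 + 2 * V4 $ 2 = 2/15 * \<mu> 3 ^ 2 + (11/90 * \<mu> 1 ^ 3 + 7/45 * \<mu> 2 * \<mu> 1) * \<mu> 3
                   + 11/45 * \<mu> 4 * \<mu> 1 ^ 2 + 14/45 * \<mu> 2 * \<mu> 4 + 8/15 * \<mu> 6"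
  "r2 $ 2 $ 4 + 2 * (V3 $ 2 * - 1 + 2 * V4 $ 2) - V4 $ 2 = - 1/5 * \<mu> 3 ^ 2 + (7/30 * \<mu> 1 ^ 3 - 1/15 * \<mu> 2 * \<mu> 1) * \<mu> 3
                   + 7/15 * \<mu> 4 * \<mu> 1 ^ 2 - 2/15 * \<mu> 2 * \<mu> 4 + 1/5 * \<mu> 6"
  unfolding V4 V3 r2_low2 n6_def n4_def b2_def b4_def b6_def
  by (simp_all add: field_simps power2_eq_square power3_eq_cube)

lemma is_hom_const2: "is_hom (const2 :: 'a \<Rightarrow> _)"
  by (simp add: is_hom_def const2_def fls_plus_const)

lemma r_expansion:
  fixes M defines "M \<equiv> \<lambda>j. const2 (\<mu> j)"
  shows "r_ser \<mu> - (1 - (1/12 * M 1 * M 3 + 1/6 * M 4) * (t1 - t2)^4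
            - (1/6 * M 1 ^ 2 * M 3 + 1/3 * M 4 * M 1) * (t1 - t2)^4 * (t1 + t2)
            + (- (1/30 * M 3 ^ 2 + (43/180 * M 1 ^ 3 + 11/90 * M 2 * M 1) * M 3
                   + 43/90 * M 4 * M 1 ^ 2 + 11/45 * M 2 * M 4 + 2/15 * M 6) * (t1^4 + t2^4)
               + (2/15 * M 3 ^ 2 + (11/90 * M 1 ^ 3 + 7/45 * M 2 * M 1) * M 3
                   + 11/45 * M 4 * M 1 ^ 2 + 14/45 * M 2 * M 4 + 8/15 * M 6) * t1 * t2 * (t1^2 + t2^2)
               + (- 1/5 * M 3 ^ 2 + (7/30 * M 1 ^ 3 - 1/15 * M 2 * M 1) * M 3
                   + 7/15 * M 4 * M 1 ^ 2 - 2/15 * M 2 * M 4 + 1/5 * M 6) * t1^2 * t2^2)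
              * (t1 - t2)^2) \<in> terms_from2 7" (is "_ - ?T \<in> _")
proof -
  have e: "1 - a * d^4 - b * d^4 * s + (- p * u + q * t1 * t2 * v + r * t1^2 * t2^2) * d^2
       = 1 + d^2 * ((- a) * d^2 + (- b) * d^2 * s + ((- p) * u + q * t1 * t2 * v + r * t1^2 * t2^2))" 
    for a b d s p q r t1 t2 u v :: "'a fls2"
    by (simp add: algebra_simps eval_nat_numeral)
  have "to_fls2 (1 + (X1 - X2)^2 * r_target) = ?T"
    unfolding e unfolding r_target_def r_target_coeffs(5) unfolding r_target_coeffs(4) unfolding r_target_coeffs(2,3)
    unfolding r_target_coeffs(1) to_fls2_simps const2_to_fls2[symmetric] 
      is_hom_simps[OF is_hom_const2] is_hom_inverse[OF is_hom_const2] t1_to_fls2[symmetric] t2_to_fls2[symmetric] M_def ..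
  then have "r_ser \<mu> - ?T = to_fls2 (r2 - (1 + (X1 - X2)^2 * r_target))"
    by (simp only: to_fls2_simps r2_def r_ser_eq)
  then show ?thesis using r2_expansion by (simp only: terms_from2_iff)
qed

end

section \<open>Polynomials in the curve coefficients\<close>

lemma poly_mapping_single_induct [case_names zero add]:
  fixes f :: "'a \<Rightarrow>\<^sub>0 'b::monoid_add"
  assumes "P 0" and "\<And>f k c. P f \<Longrightarrow> P (f + Poly_Mapping.single k c)"
  shows "P f"
proof (induction f rule: update_induct)
  case (update f k c)
  have "Poly_Mapping.update k c f = f + Poly_Mapping.single k c"
    using update(1) by (intro poly_mapping_eqI) (auto simp: lookup_update lookup_add lookup_single when_def in_keys_iff)
  then show ?case using assms(2)[OF update(3)] by simp
qed (rule assms(1))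

definition monomial_eval :: "(nat \<Rightarrow> complex) \<Rightarrow> (nat \<Rightarrow>\<^sub>0 nat) \<Rightarrow> complex" where
  "monomial_eval \<mu> k = (\<Prod>j \<in> Poly_Mapping.keys k. \<mu> j ^ Poly_Mapping.lookup k j)"

lemma monomial_eval_add: "monomial_eval \<mu> (k + l) = monomial_eval \<mu> k * monomial_eval \<mu> l"
proof -
  let ?A = "Poly_Mapping.keys k \<union> Poly_Mapping.keys l"
  have "monomial_eval \<mu> x = (\<Prod>j\<in>?A. \<mu> j ^ Poly_Mapping.lookup x j)" if "Poly_Mapping.keys x \<subseteq> ?A" for x
    unfolding monomial_eval_def using that by (intro prod.mono_neutral_left) (auto simp: in_keys_iff)
  from this[of k] this[of l] this[OF keys_add] show ?thesis
    by (simp add: lookup_add power_add prod.distrib)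
qed

lemma mupoly_eval_single: "mupoly_eval \<mu> (Poly_Mapping.single k c) = of_rat c * monomial_eval \<mu> k"
  by (simp add: mupoly_eval_def monomial_eval_def)

lemma mupoly_eval_0: "mupoly_eval \<mu> 0 = 0"
  by (simp add: mupoly_eval_def)

lemma mupoly_eval_add: "mupoly_eval \<mu> (P + Q) = mupoly_eval \<mu> P + mupoly_eval \<mu> Q"
  unfolding mupoly_eval_def
  by (rule setsum_keys_plus_distrib[where f = "\<lambda>k c. of_rat c * (\<Prod>j \<in> Poly_Mapping.keys k. \<mu> j ^ Poly_Mapping.lookup k j)"])
    (simp_all add: of_rat_add distrib_right)

lemma mupoly_eval_mult: "mupoly_eval \<mu> (P * Q) = mupoly_eval \<mu> P * mupoly_eval \<mu> Q"
proof (induction P rule: poly_mapping_single_induct)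
  case (add P k c)
  have "mupoly_eval \<mu> (Poly_Mapping.single k c * Q) = mupoly_eval \<mu> (Poly_Mapping.single k c) * mupoly_eval \<mu> Q"
    by (induction Q rule: poly_mapping_single_induct)
      (simp_all add: mupoly_eval_0 mupoly_eval_add distrib_left mult_single mupoly_eval_single monomial_eval_add of_rat_mult)
  then show ?case using add by (simp add: distrib_right mupoly_eval_add)
qed (simp add: mupoly_eval_0)

text \<open>Relates an element of the fraction field to a function of complex coefficients when both
  come from the same polynomial. The relation is closed under the operations of the recursion for
  \<open>sig\<close>, so the recursion, run in both fields, gives corresponding values.\<close>

definition is_mupoly :: "mufield \<Rightarrow> ((nat \<Rightarrow> complex) \<Rightarrow> complex) \<Rightarrow> bool" where
  "is_mupoly x f \<longleftrightarrow> (\<exists>P\<in>mupolys. to_fract P = x \<and> (\<forall>\<mu>. mupoly_eval \<mu> P = f \<mu>))"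

lemma mupolys_closed:
  "Poly_Mapping.single 0 c \<in> mupolys" 
  "j \<in> {1,2,3,4,6} \<Longrightarrow> Poly_Mapping.single (Poly_Mapping.single j 1) 1 \<in> mupolys"
  "P \<in> mupolys \<Longrightarrow> Q \<in> mupolys \<Longrightarrow> P + Q \<in> mupolys"
  "P \<in> mupolys \<Longrightarrow> Q \<in> mupolys \<Longrightarrow> P * Q \<in> mupolys"
proof -
  show "P * Q \<in> mupolys" if "P \<in> mupolys" "Q \<in> mupolys"
    unfolding mupolys_def
  proof (intro CollectI ballI)
    fix k assume "k \<in> Poly_Mapping.keys (P * Q)"
    then obtain x y where "k = x + y" "x \<in> Poly_Mapping.keys P" "y \<in> Poly_Mapping.keys Q"
      using keys_mult[of P Q] by blast
    then show "Poly_Mapping.keys k \<subseteq> {1, 2, 3, 4, 6}" 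
      using that keys_add[of x y] unfolding mupolys_def by blast
  qed
  show "P + Q \<in> mupolys" if "P \<in> mupolys" "Q \<in> mupolys"
    using that keys_add[of P Q] unfolding mupolys_def by blast
qed (auto simp: mupolys_def)

lemma is_mupoly_const: "is_mupoly (to_fract (Poly_Mapping.single 0 c)) (\<lambda>_. of_rat c)"
  unfolding is_mupoly_def by (intro bexI[OF _ mupolys_closed(1)]) (simp add: mupoly_eval_single monomial_eval_def)

lemma is_mupoly_mu: "j \<in> {1,2,3,4,6} \<Longrightarrow> is_mupoly (mu j) (\<lambda>\<mu>. \<mu> j)"
  unfolding is_mupoly_def mu_def
  by (intro bexI[OF _ mupolys_closed(2)]) (simp_all add: mupoly_eval_single monomial_eval_def)

lemma is_mupoly_add: "is_mupoly x f \<Longrightarrow> is_mupoly y g \<Longrightarrow> is_mupoly (x + y) (\<lambda>\<mu>. f \<mu> + g \<mu>)"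
  unfolding is_mupoly_def using mupolys_closed(3) mupoly_eval_add by (metis to_fract_add)

lemma is_mupoly_mult: "is_mupoly x f \<Longrightarrow> is_mupoly y g \<Longrightarrow> is_mupoly (x * y) (\<lambda>\<mu>. f \<mu> * g \<mu>)"
  unfolding is_mupoly_def using mupolys_closed(4) mupoly_eval_mult by (metis to_fract_mult)

lemma is_mupoly_numeral: "is_mupoly 0 (\<lambda>_. 0)" "is_mupoly 1 (\<lambda>_. 1)" "is_mupoly (numeral k) (\<lambda>_. numeral k)"
proof -
  have "to_fract (numeral k) = (numeral k :: mufield)"
    by (induction k) (simp_all only: numeral.simps to_fract_add to_fract_1)
  then show "is_mupoly (numeral k) (\<lambda>_. numeral k)" using is_mupoly_const[of "numeral k"] by simp
qed (use is_mupoly_const[of 0] is_mupoly_const[of 1] in simp_all)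

lemma is_mupoly_uminus: assumes "is_mupoly x f" shows "is_mupoly (- x) (\<lambda>\<mu>. - f \<mu>)"
proof -
  have e: "to_fract (Poly_Mapping.single 0 (- 1)) = (-1 :: mufield)"
    by (simp add: single_uminus)
  show ?thesis using is_mupoly_mult[OF is_mupoly_const[of "- 1"] assms] unfolding e by simp
qed

lemma is_mupoly_diff: "is_mupoly x f \<Longrightarrow> is_mupoly y g \<Longrightarrow> is_mupoly (x - y) (\<lambda>\<mu>. f \<mu> - g \<mu>)"
  using is_mupoly_add[OF _ is_mupoly_uminus] by simp

lemma is_mupoly_power: "is_mupoly x f \<Longrightarrow> is_mupoly (x ^ n) (\<lambda>\<mu>. f \<mu> ^ n)"
  by (induction n) (auto intro: is_mupoly_mult is_mupoly_numeral)

lemma is_mupoly_sum: "(\<And>i. i \<in> I \<Longrightarrow> is_mupoly (x i) (f i)) \<Longrightarrow> is_mupoly (\<Sum>i\<in>I. x i) (\<lambda>\<mu>. \<Sum>i\<in>I. f i \<mu>)"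
  by (induction I rule: infinite_finite_induct) (simp_all add: is_mupoly_add is_mupoly_numeral)

lemma is_mupoly_divide_of_int:
  assumes "is_mupoly x f"
  shows "is_mupoly (x / of_int z) (\<lambda>\<mu>. f \<mu> / of_int z)"
proof (cases "z = 0")
  case False
  have oi: "to_fract (Poly_Mapping.single 0 (of_int z :: rat)) = (of_int z :: mufield)"
  proof -
    have "to_fract (Poly_Mapping.single 0 (of_nat n :: rat)) = (of_nat n :: mufield)" for n
      by (induction n) (simp_all only: of_nat_0 of_nat_Suc single_add single_zero single_one to_fract_add to_fract_0 to_fract_1)
    then show ?thesis
      by (cases z) (simp_all only: of_int_of_nat_eq of_int_minus single_uminus to_fract_uminus)
  qed
  have "to_fract (Poly_Mapping.single 0 (1 / of_int z :: rat)) * of_int z = (1 :: mufield)"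
    unfolding oi[symmetric] to_fract_mult[symmetric] mult_single using False by simp
  then have e: "to_fract (Poly_Mapping.single 0 (1 / of_int z :: rat)) = (1 / of_int z :: mufield)"
    using False by (simp add: field_simps)
  show ?thesis using is_mupoly_mult[OF assms is_mupoly_const[of "1 / of_int z"]] unfolding e by (simp add: of_rat_divide)
qed (simp add: is_mupoly_numeral)

lemma is_mupoly_divide:
  assumes "is_mupoly x f" 
  shows "is_mupoly (x / numeral k) (\<lambda>\<mu>. f \<mu> / numeral k)" "is_mupoly (x / of_nat n) (\<lambda>\<mu>. f \<mu> / of_nat n)"
  using is_mupoly_divide_of_int[OF assms, of "numeral k"] is_mupoly_divide_of_int[OF assms, of "of_nat n"] by simp_all

lemmas is_mupoly_intros = is_mupoly_add is_mupoly_mult is_mupoly_uminus is_mupoly_diff is_mupoly_power is_mupoly_divide 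
  is_mupoly_numeral is_mupoly_mu is_mupoly_sum

lemma is_mupoly_bs: "is_mupoly (b2 mu) b2" "is_mupoly (b4 mu) b4" "is_mupoly (b6 mu) b6"
  unfolding b2_def b4_def b6_def by (intro is_mupoly_intros; simp)+

lemma is_mupoly_wp_coeff: "is_mupoly (wp_coeff mu n) (\<lambda>\<mu>. wp_coeff \<mu> n)"
proof (induction n rule: less_induct)
  case (less n)
  consider "n = 0" | "n = 1" | "n = 4" | "n \<ge> 2" "n \<noteq> 4" by linarith
  then show ?case
  proof cases
    case 3
    show ?thesis unfolding 3 
      by (subst (1 2) wp_coeff.simps, simp) (intro is_mupoly_intros is_mupoly_bs less; simp add: 3)
  next
    case 4
    \<comment> \<open>Written as one integer constant, possibly negative, the divisor is the same in
      both fields.\<close>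
    have e: "(of_nat n - 4) * (of_nat n + 3) = of_int ((int n - 4) * (int n + 3))" for R :: "'r::field_char_0"
      by simp
    have "is_mupoly ((if n = 2 then b4 mu else 0)) (\<lambda>\<mu>. (if n = 2 then b4 \<mu> else 0))"
      by (simp add: is_mupoly_bs is_mupoly_numeral)
    then have "is_mupoly ((6 * (\<Sum>i\<le>n-2. wp_coeff mu i * wp_coeff mu (n - 2 - i)) + b2 mu * wp_coeff mu (n - 2)
        + (if n = 2 then b4 mu else 0)) / of_int ((int n - 4) * (int n + 3)))
       (\<lambda>\<mu>. (6 * (\<Sum>i\<le>n-2. wp_coeff \<mu> i * wp_coeff \<mu> (n - 2 - i)) + b2 \<mu> * wp_coeff \<mu> (n - 2)
        + (if n = 2 then b4 \<mu> else 0)) / of_int ((int n - 4) * (int n + 3)))"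
      by (intro is_mupoly_divide_of_int is_mupoly_intros is_mupoly_bs less) (use 4 in auto)
    then show ?thesis using 4 by (subst (1 2) wp_coeff.simps) simp
  qed (subst (1 2) wp_coeff.simps, simp add: is_mupoly_intros is_mupoly_bs)+
qed

lemma (in weierstrass_coeffs) sig_nth:
  "sig $ n = (if n = 0 then 0 else ee $ (n - 1))"
  "ee $ Suc n = - (\<Sum>i\<le>n. (if i = 0 then 0 else D $ (i - 1) / of_nat i) * ee $ (n - i)) / of_nat (Suc n)"
proof -
  show "sig $ n = (if n = 0 then 0 else ee $ (n - 1))" by (simp add: sig_def)
  have 1: "of_nat (Suc n) * ee $ Suc n = - (J * ee) $ n" using arg_cong[OF ee_deriv, of "\<lambda>f. f $ n"] by simp
  have "(J * ee) $ n = (\<Sum>i\<le>n. (if i = 0 then 0 else D $ (i - 1) / of_nat i) * ee $ (n - i))"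
    unfolding fps_mult_nth J_def by (simp add: fps_integral_def atLeast0AtMost field_simps cong: if_cong)
  then have e: "of_nat (Suc n) * ee $ Suc n = - (\<Sum>i\<le>n. (if i = 0 then 0 else D $ (i - 1) / of_nat i) * ee $ (n - i))"
    unfolding 1 by (simp only: fps_neg_nth)
  show "ee $ Suc n = - (\<Sum>i\<le>n. (if i = 0 then 0 else D $ (i - 1) / of_nat i) * ee $ (n - i)) / of_nat (Suc n)"
    unfolding e[symmetric] by (rule nonzero_mult_div_cancel_left[symmetric]) (rule of_nat_neq_0)
qed

lemma is_mupoly_ee: "is_mupoly (weierstrass_coeffs.ee mu $ n) (\<lambda>\<mu>. weierstrass_coeffs.ee \<mu> $ n)"
proof (induction n rule: less_induct)
  case (less n)
  show ?case
  proof (cases n)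
    case (Suc k)
    have "is_mupoly (if i = 0 then 0 else wp_coeff mu (i - 1) / of_nat i) (\<lambda>\<mu>. if i = 0 then 0 else wp_coeff \<mu> (i - 1) / of_nat i)" for i
      by (simp add: is_mupoly_intros is_mupoly_wp_coeff)
    then show ?thesis
      unfolding Suc weierstrass_coeffs.sig_nth(2) weierstrass_coeffs.D_def fps_nth_Abs_fps
      by (intro is_mupoly_intros less) (auto simp: Suc)
  qed (simp add: weierstrass_coeffs.ee_0 is_mupoly_intros)
qed

lemma is_mupoly_sig: "is_mupoly (weierstrass_coeffs.sig mu $ n) (\<lambda>\<mu>. weierstrass_coeffs.sig \<mu> $ n)"
  unfolding weierstrass_coeffs.sig_nth(1) by (cases n) (simp_all add: is_mupoly_intros is_mupoly_ee)

lemma is_subring_Z_mu: "is_subring Z_mu"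
  unfolding is_subring_def
proof (intro conjI ballI)
  have int: "Poly_Mapping.lookup (P * Q) k \<in> \<int>" 
    if "\<And>k. Poly_Mapping.lookup P k \<in> \<int>" "\<And>k. Poly_Mapping.lookup Q k \<in> \<int>" for P Q :: mupoly and k
  proof -
    have S: "(\<Sum>l. f l) \<in> \<int>" if "\<And>l. f l \<in> \<int>" for f :: "(nat \<Rightarrow>\<^sub>0 nat) \<Rightarrow> rat"
      unfolding Sum_any.expand_set by (intro Ints_sum that)
    show ?thesis unfolding lookup_mult by (intro S Ints_mult that) (simp add: when_def that)
  qed
  have m1: "Poly_Mapping.single 0 (- 1) \<in> mupolys" by (rule mupolys_closed)
  have l1: "Poly_Mapping.lookup (Poly_Mapping.single 0 (- 1)) k \<in> (\<int> :: rat set)" for k :: "nat \<Rightarrow>\<^sub>0 nat"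
    by (simp add: lookup_single when_def)
  show "1 \<in> Z_mu" unfolding Z_mu_def using mupolys_closed(1)[of 1]
    by (intro image_eqI[of _ _ 1]) (auto simp: lookup_one when_def)
  fix x y assume "x \<in> Z_mu" "y \<in> Z_mu"
  then obtain P Q where P: "x = to_fract P" "P \<in> mupolys" "\<And>k. Poly_Mapping.lookup P k \<in> \<int>"
    and Q: "y = to_fract Q" "Q \<in> mupolys" "\<And>k. Poly_Mapping.lookup Q k \<in> \<int>" unfolding Z_mu_def by blast
  show "x * y \<in> Z_mu" unfolding Z_mu_def using P Q mupolys_closed(4) int by (intro image_eqI[of _ _ "P * Q"]) auto
  have "P - Q = P + Poly_Mapping.single 0 (- 1) * Q" unfolding single_uminus single_one by simp
  moreover have "P + Poly_Mapping.single 0 (- 1) * Q \<in> mupolys" by (intro mupolys_closed P Q)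
  ultimately have "P - Q \<in> mupolys" by metis
  then show "x - y \<in> Z_mu" unfolding Z_mu_def using P Q by (intro image_eqI[of _ _ "P - Q"]) (auto simp: lookup_minus)
qed

lemma mu_in_Z_mu: "j \<in> {1,2,3,4,6} \<Longrightarrow> mu j \<in> Z_mu"
  unfolding mu_def Z_mu_def using mupolys_closed(2)[of j]
  by (intro imageI) (auto simp: lookup_single when_def)

lemma Q_mu_iff: "x \<in> Q_mu \<longleftrightarrow> (\<exists>f. is_mupoly x f)"
proof
  assume "x \<in> Q_mu"
  then obtain P where "P \<in> mupolys" "x = to_fract P" unfolding Q_mu_def by blast
  then have "is_mupoly x (\<lambda>\<mu>. mupoly_eval \<mu> P)" unfolding is_mupoly_def by blast
  then show "\<exists>f. is_mupoly x f" by blast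
qed (auto simp: Q_mu_def is_mupoly_def)

lemma is_subring_Q_mu: "is_subring Q_mu"
  unfolding is_subring_def Ball_def Q_mu_iff using is_mupoly_numeral(2) is_mupoly_diff is_mupoly_mult by meson

lemma mu_in_Q_mu: "j \<in> {1,2,3,4,6} \<Longrightarrow> mu j \<in> Q_mu"
  unfolding Q_mu_iff using is_mupoly_mu by blast

lemma divide_in_Q_mu: "x \<in> Q_mu \<Longrightarrow> x / of_nat n \<in> Q_mu"
  unfolding Q_mu_iff using is_mupoly_divide(2) by blast

lemma sigma_polys_exist:
  "\<exists>S. \<forall>n. S n \<in> mupolys \<and> to_fract (S n) = weierstrass_coeffs.sig mu $ n \<and> 
     (\<forall>\<mu>. mupoly_eval \<mu> (S n) = weierstrass_coeffs.sig \<mu> $ n)"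
  using is_mupoly_sig unfolding is_mupoly_def by (intro choice) blast

section \<open>Convergence of the sigma series\<close>

context
  fixes \<mu> :: "nat \<Rightarrow> complex"
begin

interpretation weierstrass_coeffs \<mu> .

text \<open>Large enough for \<open>D_bound\<close> in the starting cases n \<le> 4 and for the
  modulus of b2; from n = 5 on the recursion propagates the bound.\<close>

definition growth :: real where
  "growth = 1 + 4 * (\<Sum>i\<le>4. norm (D $ i)) + norm (b2 \<mu>)"

lemma growth: "1 \<le> growth" "norm (b2 \<mu>) \<le> growth" "i \<le> 4 \<Longrightarrow> 4 * norm (D $ i) \<le> growth"
proof -
  have s: "0 \<le> (\<Sum>i\<le>4. norm (D $ i))" by (intro sum_nonneg) simp
  then show "1 \<le> growth" "norm (b2 \<mu>) \<le> growth" unfolding growth_def using norm_ge_zero[of "b2 \<mu>"] by linarith+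
  assume "i \<le> 4"
  then have "norm (D $ i) \<le> (\<Sum>i\<le>4. norm (D $ i))" by (intro member_le_sum) auto
  then show "4 * norm (D $ i) \<le> growth" unfolding growth_def using norm_ge_zero[of "b2 \<mu>"] by linarith
qed

lemma D_bound: "norm (D $ n) \<le> growth ^ (n + 2) / 4"
proof (induction n rule: less_induct)
  case (less n)
  note A = growth(1)
  show ?case
  proof (cases "n \<le> 4")
    case True
    have "growth ^ 1 \<le> growth ^ (n + 2)" by (intro power_increasing A) simp
    then show ?thesis using growth(3)[OF True] by simp
  next
    case False
    \<comment> \<open>Now the divisor is (k + 1)(k + 8), against k + 4 terms of the convolution. The
      1/4 in the bound for both factors brings the total to 6 (k + 4) / 16 + 1/4, which is at most
      (k + 1)(k + 8) / 4.\<close>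
    then obtain k where n: "n = k + 5" by (metis add.commute le_Suc_ex not_less_eq_eq numeral_eq_Suc pred_numeral_simps(2) BitM.simps pred_numeral_simps(3))
    have f: "of_nat n * (of_nat n - 1) - 12 = (of_nat ((k + 1) * (k + 8)) :: complex)"
      unfolding n by (simp add: algebra_simps)
    have "real ((k + 1) * (k + 8)) * norm (D $ n) = norm (6 * (D^2) $ (k + 3) + b2 \<mu> * D $ (k + 3))"
      using arg_cong[OF D_rec[of n], of norm] unfolding f by (simp only: norm_mult norm_of_nat) (simp add: n add.commute)
    also have "\<dots> \<le> 6 * norm ((D^2) $ (k + 3)) + norm (b2 \<mu>) * norm (D $ (k + 3))"
      by (rule order_trans[OF norm_triangle_ineq]) (simp add: norm_mult)
    also have "norm ((D^2) $ (k + 3)) \<le> (\<Sum>i=0..k+3. growth ^ (n + 2) / 16)"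
      unfolding power2_eq_square fps_mult_nth
    proof (rule order_trans[OF norm_sum], rule sum_mono)
      fix i assume i: "i \<in> {0..k+3}"
      have "norm (D $ i * D $ (k + 3 - i)) \<le> growth ^ (i + 2) / 4 * (growth ^ (k + 3 - i + 2) / 4)"
        unfolding norm_mult by (intro mult_mono less) (use i n A in auto)
      also have "\<dots> = growth ^ (n + 2) / 16"
      proof -
        have "(i + 2) + (k + 3 - i + 2) = n + 2" using i by (simp add: n)
        then show ?thesis unfolding \<open>(i + 2) + (k + 3 - i + 2) = n + 2\<close>[symmetric] power_add[of growth "i + 2"] by simp
      qed
      finally show "norm (D $ i * D $ (k + 3 - i)) \<le> growth ^ (n + 2) / 16" .
    qed
    also have "\<dots> = real (k + 4) * (growth ^ (n + 2) / 16)" by simp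
    also have "norm (b2 \<mu>) * norm (D $ (k + 3)) \<le> growth ^ 2 * (growth ^ (k + 3 + 2) / 4)"
    proof (intro mult_mono less)
      have "growth ^ 1 \<le> growth ^ 2" by (intro power_increasing A) simp
      then show "norm (b2 \<mu>) \<le> growth ^ 2" using growth(2) by simp
    qed (use n A in auto)
    also have "\<dots> = growth ^ (n + 2) / 4" unfolding n by (simp add: power_add eval_nat_numeral)
    finally have "real ((k + 1) * (k + 8)) * norm (D $ n) \<le> (6 * real (k + 4) / 16 + 1 / 4) * growth ^ (n + 2)"
      by (simp add: algebra_simps)
    also have "\<dots> \<le> (real ((k + 1) * (k + 8)) / 4) * growth ^ (n + 2)"
      using A by (intro mult_right_mono) (simp_all add: field_simps)
    finally have "real ((k + 1) * (k + 8)) * norm (D $ n) \<le> real ((k + 1) * (k + 8)) * (growth ^ (n + 2) / 4)" by simp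
    then show ?thesis by (rule mult_left_le_imp_le) (simp only: of_nat_0_less_iff, simp)
  qed
qed

lemma ee_bound: "norm (ee $ n) \<le> growth ^ n"
proof (induction n rule: less_induct)
  case (less n)
  show ?case
  proof (cases n)
    case (Suc k)
    have t: "norm ((if i = 0 then 0 else D $ (i - 1) / of_nat i) * ee $ (k - i)) \<le> growth ^ Suc k" if "i \<le> k" for i
    proof (cases "i = 0")
      case False
      have "norm (D $ (i - 1)) / real i \<le> norm (D $ (i - 1)) / 1" using False by (intro divide_left_mono) auto
      also have "\<dots> \<le> growth ^ (i + 1)"
      proof -
        have "norm (D $ (i - 1)) \<le> growth ^ (i + 1) / 4" using D_bound[of "i - 1"] False by simp
        moreover have "growth ^ (i + 1) / 4 \<le> growth ^ (i + 1) / 1" using growth(1) by (intro divide_left_mono) auto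
        ultimately show ?thesis by simp
      qed
      finally have "norm (D $ (i - 1)) / real i * norm (ee $ (k - i)) \<le> growth ^ (i + 1) * growth ^ (k - i)"
        using less[of "k - i"] growth(1) by (intro mult_mono) (auto simp: Suc)
      also have "\<dots> = growth ^ Suc k" using that by (simp add: power_add[symmetric])
      finally show ?thesis using False by (simp add: norm_mult norm_divide)
    qed (use growth(1) in simp)
    have "norm (ee $ Suc k) = norm (\<Sum>i\<le>k. (if i = 0 then 0 else D $ (i - 1) / of_nat i) * ee $ (k - i)) / real (Suc k)"
      unfolding sig_nth(2) norm_divide norm_minus_cancel norm_of_nat ..
    also have "\<dots> \<le> (\<Sum>i\<le>k. growth ^ Suc k) / real (Suc k)"
      by (intro divide_right_mono order_trans[OF norm_sum] sum_mono t) auto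
    also have "\<dots> = growth ^ Suc k" by (simp del: of_nat_Suc)
    finally show ?thesis by (simp add: Suc)
  qed (simp add: ee_0)
qed

lemma sig_radius_pos: "fps_conv_radius sig > 0"
proof -
  have "norm (of_real (1 / (2 * growth)) :: complex) \<le> conv_radius (fps_nth ee)"
  proof (rule conv_radius_geI, rule summable_comparison_test'[where N = 0])
    show "summable (\<lambda>n. (1 / 2 :: real) ^ n)" by (simp add: summable_geometric)
    show "norm (ee $ n * of_real (1 / (2 * growth)) ^ n) \<le> (1 / 2) ^ n" for n
    proof -
      have "norm (ee $ n * of_real (1 / (2 * growth)) ^ n) = norm (ee $ n) * (1 / (2 * growth)) ^ n"
        using growth(1) by (simp add: norm_mult norm_power norm_divide)
      also have "\<dots> \<le> growth ^ n * (1 / (2 * growth)) ^ n"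
        using growth(1) by (intro mult_right_mono ee_bound) auto
      also have "\<dots> = (1 / 2) ^ n" using growth(1) by (simp add: power_mult_distrib[symmetric])
      finally show ?thesis .
    qed
  qed
  moreover have "norm (of_real (1 / (2 * growth)) :: complex) > 0" using growth(1) by simp
  ultimately have "fps_conv_radius ee > 0" unfolding fps_conv_radius_def by (metis ereal_less(2) order_less_le_trans)
  then show ?thesis unfolding sig_def using fps_conv_radius_mult[of fps_X ee] by (auto intro: order_less_le_trans)
qed

lemma nu_kap_radius: "fps_conv_radius nu \<ge> fps_conv_radius sig" "fps_conv_radius kap \<ge> fps_conv_radius sig"
proof -
  let ?r = "fps_conv_radius sig"
  have m: "fps_conv_radius (f * g) \<ge> ?r" if "fps_conv_radius f \<ge> ?r" "fps_conv_radius g \<ge> ?r" for f g :: "complex fps"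
    by (rule order_trans[OF _ fps_conv_radius_mult]) (simp add: that)
  have s: "fps_conv_radius (f - g) \<ge> ?r" if "fps_conv_radius f \<ge> ?r" "fps_conv_radius g \<ge> ?r" for f g :: "complex fps"
    by (rule order_trans[OF _ fps_conv_radius_diff]) (simp add: that)
  have d: "fps_conv_radius (fps_deriv f) \<ge> ?r" if "fps_conv_radius f \<ge> ?r" for f :: "complex fps"
    using fps_conv_radius_deriv[of f] that order_trans by blast
  show n: "fps_conv_radius nu \<ge> ?r" unfolding nu_sig power2_eq_square by (intro m s d order_refl)
  show "fps_conv_radius kap \<ge> ?r" unfolding kap_def mult.assoc by (intro m s d n order_refl) simp
qed

text \<open>sig(2u) is a product of series that converge wherever sig does, so the radius of
  convergence r satisfies r \<le> r / 2; being positive, it is infinite.\<close>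

lemma entire_sig: "fps_conv_radius sig = \<infinity>"
proof -
  let ?r = "fps_conv_radius sig"
  have c: "sig oo (2 * fps_X) = Abs_fps (\<lambda>n. sig $ n * 2 ^ n)"
    using fps_compose_linear[of sig 2] by (simp add: numeral_fps_const mult.commute)
  have "?r / ereal 2 = fps_conv_radius (sig oo (2 * fps_X))"
    unfolding c fps_conv_radius_def fps_nth_Abs_fps using conv_radius_mult_power_right[of 2 "fps_nth sig"] by simp
  also have "\<dots> \<ge> ?r"
    unfolding duplication using fps_conv_radius_mult[of "- sig" kap] nu_kap_radius(2) by (simp add: min_def)
  finally have le: "?r \<le> ?r / ereal 2" .
  show ?thesis
  proof (cases ?r)
    case (real r)
    with le have "r \<le> r / 2" by simp
    moreover have "r > 0" using sig_radius_pos real by simp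
    ultimately show ?thesis by simp
  qed (use sig_radius_pos in auto)
qed

lemma entire_nu: "fps_conv_radius nu = \<infinity>" and entire_kap: "fps_conv_radius kap = \<infinity>"
  using nu_kap_radius unfolding entire_sig by auto

end

lemma (in weierstrass_coeffs) kap_square: "kap^2 = 4 * nu^3 + fps_const (b2 \<mu>) * nu^2 * sig^2 + 2 * fps_const (b4 \<mu>) * nu * sig^4 + fps_const (b6 \<mu>) * sig^6"
proof -
  have "(s^3 * y)^2 = 4 * (s^2 * x)^3 + c * (s^2 * x)^2 * s^2 + 2 * d * (s^2 * x) * s^4 + e * s^6"
    if "y^2 = 4 * x^3 + c * x^2 + 2 * d * x + e" for s x y c d e :: "'a fls"
  proof -
    have "(s^3 * y)^2 = s^6 * y^2" by (simp add: power_mult_distrib flip: power_mult)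
    then show ?thesis unfolding that by (simp add: power_mult_distrib algebra_simps flip: power_mult power_add)
  qed
  from this[OF Xl_ode] have "fl (kap^2) = fl (4 * nu^3 + fps_const (b2 \<mu>) * nu^2 * sig^2 + 2 * fps_const (b4 \<mu>) * nu * sig^4 + fps_const (b6 \<mu>) * sig^6)"
    unfolding fl_simps fl_kap fl_nu fps_const_to_fls .
  then show ?thesis by (simp only: fps_to_fls_eq_iff)
qed

lemma (in weierstrass_coeffs) kap_deriv: 
  "sig * fps_deriv kap - 3 * fps_deriv sig * kap = 6 * nu^2 + fps_const (b2 \<mu>) * nu * sig^2 + fps_const (b4 \<mu>) * sig^4"
proof -
  have "fl (fps_deriv kap) = fls_deriv ((fl sig)^3 * Xl')"
    unfolding fl_kap[symmetric] by (simp add: fls_deriv_fps_to_fls)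
  also have "\<dots> = 3 * (fl sig)^2 * fl (fps_deriv sig) * Xl' + (fl sig)^3 * (6 * Xl^2 + fls_const (b2 \<mu>) * Xl + fls_const (b4 \<mu>))"
    by (simp add: power3_eq_cube power2_eq_square Xl'_deriv fls_deriv_fps_to_fls algebra_simps)
  finally have k: "fl (fps_deriv kap) = \<dots>" .
  have "s * (3 * s^2 * s' * y + s^3 * (6 * x^2 + c * x + d)) - 3 * s' * (s^3 * y) = 6 * (s^2 * x)^2 + c * (s^2 * x) * s^2 + d * s^4"
    for s s' x y c d :: "'a fls"
    by algebra
  then have "fl (sig * fps_deriv kap - 3 * fps_deriv sig * kap) = fl (6 * nu^2 + fps_const (b2 \<mu>) * nu * sig^2 + fps_const (b4 \<mu>) * sig^4)"
    unfolding fl_simps k fl_kap fl_nu fps_const_to_fls by blast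
  then show ?thesis by (simp only: fps_to_fls_eq_iff)
qed

section \<open>Analytic sigma function, Weierstrass function and period lattice\<close>

lemma eval_fps_entire:
  fixes F G :: "complex fps"
  assumes "fps_conv_radius F = \<infinity>" "fps_conv_radius G = \<infinity>"
  shows "eval_fps (F + G) z = eval_fps F z + eval_fps G z" "eval_fps (F - G) z = eval_fps F z - eval_fps G z"
    "eval_fps (F * G) z = eval_fps F z * eval_fps G z"
  using assms by (simp_all add: eval_fps_add eval_fps_diff eval_fps_mult)

lemma eval_fps_entire_power: "fps_conv_radius F = \<infinity> \<Longrightarrow> eval_fps (F ^ n) z = eval_fps F z ^ n" for F :: "complex fps"
  by (simp add: eval_fps_power)

lemma entire_closed:
  fixes F G :: "complex fps"
  assumes "fps_conv_radius F = \<infinity>" 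
  shows "fps_conv_radius G = \<infinity> \<Longrightarrow> fps_conv_radius (F + G) = \<infinity>" "fps_conv_radius G = \<infinity> \<Longrightarrow> fps_conv_radius (F - G) = \<infinity>"
    "fps_conv_radius G = \<infinity> \<Longrightarrow> fps_conv_radius (F * G) = \<infinity>" "fps_conv_radius (F ^ n) = \<infinity>"
    "fps_conv_radius (fps_deriv F) = \<infinity>" "fps_conv_radius (- F) = \<infinity>"
  using assms fps_conv_radius_add[of F G] fps_conv_radius_diff[of F G] fps_conv_radius_mult[of F G] 
    fps_conv_radius_power[of F n] fps_conv_radius_deriv[of F] by auto

lemma has_fps_expansion_translate:
  fixes F :: "complex fps"
  assumes "fps_conv_radius F = \<infinity>"
  shows "(\<lambda>w. eval_fps F (z + c * w)) has_fps_expansion Abs_fps (\<lambda>n. c ^ n * eval_fps ((fps_deriv ^^ n) F) z / fact n)"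
proof -
  have entire: "fps_conv_radius ((fps_deriv ^^ n) F) = \<infinity>" for n
    by (induction n) (simp_all add: assms entire_closed)
  have der: "((\<lambda>w. eval_fps G (z + c * w)) has_field_derivative c * eval_fps (fps_deriv G) (z + c * w)) (at w)"
    if "fps_conv_radius G = \<infinity>" for G w
    using that by (auto intro!: derivative_eq_intros)
  have d: "(deriv ^^ n) (\<lambda>w. eval_fps F (z + c * w)) = (\<lambda>w. c ^ n * eval_fps ((fps_deriv ^^ n) F) (z + c * w))" for n
  proof (induction n)
    case (Suc n)
    have "((\<lambda>w. c ^ n * eval_fps ((fps_deriv ^^ n) F) (z + c * w)) has_field_derivative
        c ^ Suc n * eval_fps ((fps_deriv ^^ Suc n) F) (z + c * w)) (at w)" for w
      using DERIV_cmult[OF der[OF entire], of "c ^ n" n w] by (simp add: mult_ac)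
    then show ?case unfolding funpow.simps o_def Suc by (intro ext DERIV_imp_deriv) simp
  qed simp
  have "(\<lambda>w. eval_fps F (z + c * w)) holomorphic_on UNIV"
    using der[OF assms] unfolding holomorphic_on_def field_differentiable_def by (blast intro: has_field_derivative_at_within)
  from has_fps_expansion_fps_expansion[OF open_UNIV UNIV_I this] show ?thesis
    by (simp add: fps_expansion_def d)
qed

lemma entire_eqI:
  assumes "f holomorphic_on UNIV" "g holomorphic_on UNIV" "f has_fps_expansion F" "g has_fps_expansion F"
  shows "f z = g z"
proof -
  have "(\<lambda>z. f z - g z) has_fps_expansion 0"
    using has_fps_expansion_diff[OF assms(3,4)] by simp
  then have "f z - g z = 0"
    by (rule has_fps_expansion_0_analytic_continuation[where A = UNIV]) (auto intro: holomorphic_intros assms)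
  then show ?thesis by simp
qed

lemma has_fps_expansion_linear:
  fixes F :: "complex fps"
  assumes "fps_conv_radius F = \<infinity>"
  shows "(\<lambda>w. eval_fps F (c * w)) has_fps_expansion (F oo (fps_const c * fps_X))"
proof -
  have "(fps_deriv ^^ n) F $ 0 = F $ n * fact n" for n
    by (induction n arbitrary: F) (simp_all add: funpow_swap1 algebra_simps)
  then show ?thesis
    using has_fps_expansion_translate[OF assms, of 0 c] by (simp add: fps_compose_linear eval_fps_at_0)
qed

locale complex_curve =
  fixes \<mu> :: "nat \<Rightarrow> complex"
begin

interpretation wc: weierstrass_coeffs \<mu> .

definition \<sigma> where "\<sigma> = eval_fps wc.sig"
definition \<sigma>' where "\<sigma>' = eval_fps (fps_deriv wc.sig)"
definition \<sigma>'' where "\<sigma>'' = eval_fps (fps_deriv (fps_deriv wc.sig))"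
definition \<nu> where "\<nu> = eval_fps wc.nu"
definition \<nu>' where "\<nu>' = eval_fps (fps_deriv wc.nu)"
definition \<nu>'' where "\<nu>'' = eval_fps (fps_deriv (fps_deriv wc.nu))"
definition \<kappa> where "\<kappa> = eval_fps wc.kap"
definition \<kappa>' where "\<kappa>' = eval_fps (fps_deriv wc.kap)"

lemmas entires = entire_sig[of \<mu>] entire_nu[of \<mu>] entire_kap[of \<mu>]
lemmas entire_derivs = entires[THEN entire_closed(5)] entires[THEN entire_closed(5), THEN entire_closed(5)]

lemma derivs [derivative_intros]: 
  assumes "(f has_field_derivative f') (at z within A)"
  shows "((\<lambda>z. \<sigma> (f z)) has_field_derivative \<sigma>' (f z) * f') (at z within A)" "((\<lambda>z. \<sigma>' (f z)) has_field_derivative \<sigma>'' (f z) * f') (at z within A)" 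
    "((\<lambda>z. \<nu> (f z)) has_field_derivative \<nu>' (f z) * f') (at z within A)" "((\<lambda>z. \<nu>' (f z)) has_field_derivative \<nu>'' (f z) * f') (at z within A)"
    "((\<lambda>z. \<kappa> (f z)) has_field_derivative \<kappa>' (f z) * f') (at z within A)" 
  unfolding \<sigma>_def \<sigma>'_def \<sigma>''_def \<nu>_def \<nu>'_def \<nu>''_def \<kappa>_def \<kappa>'_def
  by (rule DERIV_chain2[OF has_field_derivative_eval_fps assms]; simp add: entires entire_derivs)+

lemma holomorphic [holomorphic_intros]:
  "f holomorphic_on A \<Longrightarrow> (\<lambda>z. \<sigma> (f z)) holomorphic_on A" "f holomorphic_on A \<Longrightarrow> (\<lambda>z. \<sigma>' (f z)) holomorphic_on A"
  "f holomorphic_on A \<Longrightarrow> (\<lambda>z. \<sigma>'' (f z)) holomorphic_on A" "f holomorphic_on A \<Longrightarrow> (\<lambda>z. \<nu> (f z)) holomorphic_on A"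
  "f holomorphic_on A \<Longrightarrow> (\<lambda>z. \<nu>' (f z)) holomorphic_on A" "f holomorphic_on A \<Longrightarrow> (\<lambda>z. \<nu>'' (f z)) holomorphic_on A"
  "f holomorphic_on A \<Longrightarrow> (\<lambda>z. \<kappa> (f z)) holomorphic_on A"
proof -
  have g: "(\<lambda>z. eval_fps F (f z)) holomorphic_on A" if "f holomorphic_on A" "fps_conv_radius F = \<infinity>" for F :: "complex fps"
    using holomorphic_on_compose[OF that(1) holomorphic_on_eval_fps[of "f ` A" F]] that(2) by (simp add: o_def)
  show "f holomorphic_on A \<Longrightarrow> (\<lambda>z. \<sigma> (f z)) holomorphic_on A" "f holomorphic_on A \<Longrightarrow> (\<lambda>z. \<sigma>' (f z)) holomorphic_on A"
    "f holomorphic_on A \<Longrightarrow> (\<lambda>z. \<sigma>'' (f z)) holomorphic_on A" "f holomorphic_on A \<Longrightarrow> (\<lambda>z. \<nu> (f z)) holomorphic_on A"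
    "f holomorphic_on A \<Longrightarrow> (\<lambda>z. \<nu>' (f z)) holomorphic_on A" "f holomorphic_on A \<Longrightarrow> (\<lambda>z. \<nu>'' (f z)) holomorphic_on A"
    "f holomorphic_on A \<Longrightarrow> (\<lambda>z. \<kappa> (f z)) holomorphic_on A"
    unfolding \<sigma>_def \<sigma>'_def \<sigma>''_def \<nu>_def \<nu>'_def \<nu>''_def \<kappa>_def by (rule g; simp add: entires entire_derivs)+
qed

lemma continuous [continuous_intros]:
  assumes "continuous_on A f"
  shows "continuous_on A (\<lambda>z. \<sigma> (f z))" "continuous_on A (\<lambda>z. \<sigma>' (f z))" "continuous_on A (\<lambda>z. \<sigma>'' (f z))" 
    "continuous_on A (\<lambda>z. \<nu> (f z))" "continuous_on A (\<lambda>z. \<nu>' (f z))" "continuous_on A (\<lambda>z. \<nu>'' (f z))" "continuous_on A (\<lambda>z. \<kappa> (f z))"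
  by (rule continuous_on_compose2[OF _ assms, of UNIV]; 
      simp add: holomorphic[OF holomorphic_on_ident, of UNIV, THEN holomorphic_on_imp_continuous_on])+

lemma at_0: "\<sigma> 0 = 0" "\<sigma>' 0 = 1" "\<nu> 0 = 1"
  by (simp_all add: \<sigma>_def \<sigma>'_def \<nu>_def eval_fps_at_0 wc.sig_nu_0)

lemma \<nu>_eq: "\<nu> z = \<sigma>' z ^ 2 - \<sigma> z * \<sigma>'' z"
  using arg_cong[OF wc.nu_sig, of "\<lambda>F. eval_fps F z"]
  by (simp add: \<nu>_def \<sigma>_def \<sigma>'_def \<sigma>''_def eval_fps_entire eval_fps_entire_power entires entire_derivs entire_closed)

lemma \<kappa>_eq: "\<kappa> z = \<sigma> z * \<nu>' z - 2 * \<sigma>' z * \<nu> z"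
  using arg_cong[OF wc.kap_def, of "\<lambda>F. eval_fps F z"]
  by (simp add: \<kappa>_def \<nu>_def \<sigma>_def \<sigma>'_def \<nu>'_def eval_fps_entire eval_fps_entire_power entires entire_derivs entire_closed)

lemma \<kappa>_square: "\<kappa> z ^ 2 = 4 * \<nu> z ^ 3 + b2 \<mu> * \<nu> z ^ 2 * \<sigma> z ^ 2 + 2 * b4 \<mu> * \<nu> z * \<sigma> z ^ 4 + b6 \<mu> * \<sigma> z ^ 6"
  using arg_cong[OF wc.kap_square, of "\<lambda>F. eval_fps F z"]
  by (simp add: \<kappa>_def \<nu>_def \<sigma>_def eval_fps_entire eval_fps_entire_power entires entire_derivs entire_closed)

lemma \<kappa>_deriv: "\<sigma> z * \<kappa>' z - 3 * \<sigma>' z * \<kappa> z = 6 * \<nu> z ^ 2 + b2 \<mu> * \<nu> z * \<sigma> z ^ 2 + b4 \<mu> * \<sigma> z ^ 4"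
  using arg_cong[OF wc.kap_deriv, of "\<lambda>F. eval_fps F z"]
  by (simp add: \<kappa>_def \<kappa>'_def \<nu>_def \<sigma>_def \<sigma>'_def eval_fps_entire eval_fps_entire_power entires entire_derivs entire_closed)

lemma \<sigma>_minus: "\<sigma> (- z) = - \<sigma> z"
proof (rule entire_eqI[where f = "\<lambda>z. \<sigma> (- z)" and g = "\<lambda>z. - \<sigma> z"])
  show "(\<lambda>w. \<sigma> (- w)) has_fps_expansion - wc.sig"
  proof -
    have "fps_const (- 1) * fps_X = (- fps_X :: complex fps)" by (simp flip: fps_const_neg)
    from has_fps_expansion_linear[OF entires(1), of "- 1", unfolded this] show ?thesis unfolding \<sigma>_def by (simp only: wc.sig_odd) simp
  qed
  show "(\<lambda>w. - \<sigma> w) has_fps_expansion - wc.sig"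
    unfolding \<sigma>_def by (intro fps_expansion_intros eval_fps_has_fps_expansion) (simp add: entires)
qed (intro holomorphic_intros)+

lemma duplication: "\<sigma> (2 * z) = - \<sigma> z * \<kappa> z"
proof (rule entire_eqI[where f = "\<lambda>z. \<sigma> (2 * z)" and g = "\<lambda>z. - \<sigma> z * \<kappa> z"])
  show "(\<lambda>w. \<sigma> (2 * w)) has_fps_expansion - wc.sig * wc.kap"
    using has_fps_expansion_linear[OF entires(1), of 2] unfolding \<sigma>_def wc.duplication[unfolded numeral_fps_const] .
  show "(\<lambda>w. - \<sigma> w * \<kappa> w) has_fps_expansion - wc.sig * wc.kap"
    unfolding \<sigma>_def \<kappa>_def by (intro fps_expansion_intros eval_fps_has_fps_expansion; simp add: entires)
qed (intro holomorphic_intros)+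

text \<open>For fixed u both sides are entire in v. The coefficient of index n of
  \<open>Fp sig\<close> is the n-th derivative of sig divided by n!, so evaluating the coefficients
  of the formal relation at u gives the Taylor expansion in v.\<close>

lemma three_term: "\<sigma> (u + v) * \<sigma> (u - v) = \<sigma> u ^ 2 * \<nu> v - \<sigma> v ^ 2 * \<nu> u"
proof (rule entire_eqI[where z = v])
  let ?c = "\<lambda>F. Abs_fps (\<lambda>n. eval_fps (F $ n) u)"
  have entire: "fps_conv_radius ((fps_deriv ^^ n) wc.sig) = \<infinity>" for n
    by (induction n) (simp_all add: entires entire_closed)
  have Fp: "wc.Fp f $ n = fps_const (1 / fact n) * (fps_deriv ^^ n) f" for f n
  proof (induction n arbitrary: f)
    case (Suc n)
    have "of_nat (Suc n) * wc.Fp f $ Suc n = wc.Fp (fps_deriv f) $ n"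
      using arg_cong[OF wc.F_derivs(1), of "\<lambda>F. F $ n" f] by simp
    then have "fps_const (1 / of_nat (Suc n)) * (fps_const (of_nat (Suc n)) * wc.Fp f $ Suc n) = fps_const (1 / of_nat (Suc n)) * (fps_const (1 / fact n) * (fps_deriv ^^ n) (fps_deriv f))"
      unfolding Suc fps_of_nat by simp
    then show ?case unfolding mult.assoc[symmetric] fps_const_mult by (simp add: funpow_swap1 del: of_nat_Suc)
  qed (simp add: wc.F_nth_0)
  have Fm: "wc.Fm f $ n = fps_const ((- 1) ^ n / fact n) * (fps_deriv ^^ n) f" for f n
  proof (induction n arbitrary: f)
    case (Suc n)
    have "of_nat (Suc n) * wc.Fm f $ Suc n = - wc.Fm (fps_deriv f) $ n"
      using arg_cong[OF wc.F_derivs(3), of "\<lambda>F. F $ n" f] by simp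
    then have "fps_const (1 / of_nat (Suc n)) * (fps_const (of_nat (Suc n)) * wc.Fm f $ Suc n) = fps_const (1 / of_nat (Suc n)) * (fps_const (- 1) * (fps_const ((- 1) ^ n / fact n) * (fps_deriv ^^ n) (fps_deriv f)))"
      unfolding fps_neg_nth Suc fps_of_nat by (simp add: fps_const_neg[symmetric] del: fps_const_neg)
    then show ?case unfolding mult.assoc[symmetric] fps_const_mult by (simp add: funpow_swap1 del: of_nat_Suc)
  qed (simp add: wc.F_nth_0)
  have "(\<lambda>w. \<sigma> (u + w)) has_fps_expansion ?c (wc.Fp wc.sig)"
    using has_fps_expansion_translate[OF entires(1), of u 1] by (simp add: \<sigma>_def Fp eval_fps_entire entire)
  moreover have "(\<lambda>w. \<sigma> (u - w)) has_fps_expansion ?c (wc.Fm wc.sig)"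
    using has_fps_expansion_translate[OF entires(1), of u "- 1"] by (simp add: \<sigma>_def Fm eval_fps_entire entire)
  ultimately have "(\<lambda>w. \<sigma> (u + w) * \<sigma> (u - w)) has_fps_expansion ?c (wc.Fp wc.sig) * ?c (wc.Fm wc.sig)"
    by (rule has_fps_expansion_mult)
  also have "?c (wc.Fp wc.sig) * ?c (wc.Fm wc.sig) = ?c (wc.Fp wc.sig * wc.Fm wc.sig)"
  proof (rule fps_ext)
    fix n
    have "eval_fps (\<Sum>i\<in>I. wc.Fp wc.sig $ i * wc.Fm wc.sig $ (n - i)) u = (\<Sum>i\<in>I. eval_fps (wc.Fp wc.sig $ i) u * eval_fps (wc.Fm wc.sig $ (n - i)) u)
       \<and> fps_conv_radius (\<Sum>i\<in>I. wc.Fp wc.sig $ i * wc.Fm wc.sig $ (n - i)) = \<infinity>" if "finite I" for I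
      using that by induction (simp_all add: eval_fps_entire entire_closed entire Fp Fm)
    from this[of "{0..n}"] show "(?c (wc.Fp wc.sig) * ?c (wc.Fm wc.sig)) $ n = ?c (wc.Fp wc.sig * wc.Fm wc.sig) $ n"
      by (simp add: fps_mult_nth)
  qed
  also have "\<dots> = fps_const (\<sigma> u ^ 2) * wc.nu - wc.sig ^ 2 * fps_const (\<nu> u)"
  proof (rule fps_ext)
    fix n
    have l: "(lift2 f * lift1 g :: complex fps2) $ n = fps_const (g $ n) * f" "(lift1 g * lift2 f) $ n = fps_const (g $ n) * f" for f g :: "complex fps"
      by (simp_all add: lift1_def mult.commute)
    have e: "wc.Q2 $ n = fps_const (wc.nu $ n) * wc.sig ^ 2 - fps_const ((wc.sig ^ 2) $ n) * wc.nu"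
      unfolding wc.Q2_def is_hom_simps[OF lift1_hom, symmetric] is_hom_simps[OF lift2_hom, symmetric] fps_sub_nth l ..
    show "?c (wc.Fp wc.sig * wc.Fm wc.sig) $ n = (fps_const (\<sigma> u ^ 2) * wc.nu - wc.sig ^ 2 * fps_const (\<nu> u)) $ n"
      unfolding wc.three_term by (simp add: e eval_fps_entire eval_fps_entire_power entire_closed entires \<sigma>_def \<nu>_def)
  qed
  finally show "(\<lambda>w. \<sigma> (u + w) * \<sigma> (u - w)) has_fps_expansion fps_const (\<sigma> u ^ 2) * wc.nu - wc.sig ^ 2 * fps_const (\<nu> u)" .
  show "(\<lambda>w. \<sigma> u ^ 2 * \<nu> w - \<sigma> w ^ 2 * \<nu> u) has_fps_expansion fps_const (\<sigma> u ^ 2) * wc.nu - wc.sig ^ 2 * fps_const (\<nu> u)"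
    unfolding \<nu>_def[THEN fun_cong, of w for w] \<sigma>_def[THEN fun_cong, of w for w]
    by (intro fps_expansion_intros eval_fps_has_fps_expansion; simp add: entires)
qed (intro holomorphic_intros)+

end

section \<open>The zeros of sigma as a discrete group of periods\<close>

context complex_curve
begin

definition \<Lambda> :: "complex set" where "\<Lambda> = {z. \<sigma> z = 0}"
definition X where "X u = \<nu> u / \<sigma> u ^ 2"
definition X' where "X' u = \<kappa> u / \<sigma> u ^ 3"
definition Y where "Y u = (X' u - \<mu> 1 * X u - \<mu> 3) / 2"
definition \<zeta> where "\<zeta> u = \<sigma>' u / \<sigma> u"

lemma \<nu>_minus: "\<nu> (- z) = \<nu> z"
proof -
  have d: "((\<lambda>z. \<sigma> (- z)) has_field_derivative \<sigma>' (- z) * (- 1)) (at z)" for z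
    by (auto intro!: derivative_eq_intros)
  have "((\<lambda>z. \<sigma> (- z)) has_field_derivative - (\<sigma>' z * 1)) (at z)" for z
    unfolding \<sigma>_minus by (intro derivative_intros)
  with d have s1: "\<sigma>' (- z) = \<sigma>' z" for z
    using DERIV_unique[OF d[of z], of "- (\<sigma>' z * 1)"] by simp
  have "((\<lambda>z. \<sigma>' (- z)) has_field_derivative \<sigma>'' (- z) * (- 1)) (at z)" 
    by (auto intro!: derivative_eq_intros)
  moreover have "((\<lambda>z. \<sigma>' (- z)) has_field_derivative \<sigma>'' z * 1) (at z)"
    unfolding s1 by (intro derivative_intros)
  ultimately have "\<sigma>'' (- z) = - \<sigma>'' z" using DERIV_unique by fastforce
  then show ?thesis unfolding \<nu>_eq \<sigma>_minus s1 by simp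
qed

lemma \<sigma>_nonzero: "\<exists>z. \<sigma> z \<noteq> 0"
proof (rule ccontr)
  assume "\<nexists>z. \<sigma> z \<noteq> 0"
  then have "\<sigma> = (\<lambda>z. 0)" by blast
  moreover have "(\<sigma> has_field_derivative \<sigma>' 0 * 1) (at 0)" by (intro derivative_intros)
  ultimately have "((\<lambda>z. 0 :: complex) has_field_derivative 1) (at 0)" by (simp add: at_0)
  then show False using DERIV_unique[OF _ DERIV_const] by fastforce
qed

lemma zeros_countable: "countable \<Lambda>"
proof -
  have "\<not> \<sigma> constant_on UNIV"
    using \<sigma>_nonzero at_0(1) unfolding constant_on_def by (metis UNIV_I)
  then show ?thesis
    unfolding \<Lambda>_def using connected_UNIV holomorphic_countable_zeros[of \<sigma> UNIV] holomorphic(1)[OF holomorphic_on_ident, of UNIV] by simp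
qed

lemma connected_complement: "connected (- \<Lambda>)"
  by (intro path_connected_imp_connected path_connected_complement_countable zeros_countable) simp

lemma zeros_closed: "closed \<Lambda>" 
  unfolding \<Lambda>_def by (intro closed_Collect_eq continuous_intros)

lemma open_complement: "open (- \<Lambda>)"
  using zeros_closed by (rule open_Compl)

text \<open>At a multiple zero l also \<nu> would vanish, and the three-term relation would give
  \<sigma>(l + v) \<sigma>(l - v) = 0 for all v; but countably many zeros cannot cover the plane in
  this way.\<close>

lemma \<sigma>'_nonzero: assumes "l \<in> \<Lambda>" shows "\<sigma>' l \<noteq> 0"
proof
  assume "\<sigma>' l = 0"
  then have "\<nu> l = 0" using assms by (simp add: \<nu>_eq \<Lambda>_def)
  then have "\<sigma> (l + v) * \<sigma> (l - v) = 0" for v using three_term[of l v] assms by (simp add: \<Lambda>_def)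
  then have "l + v \<in> \<Lambda> \<or> l - v \<in> \<Lambda>" for v unfolding \<Lambda>_def by fastforce
  then have "UNIV \<subseteq> (\<lambda>w. w - l) ` \<Lambda> \<union> (\<lambda>w. l - w) ` \<Lambda>"
  proof (intro subsetI)
    fix v
    from \<open>l + v \<in> \<Lambda> \<or> l - v \<in> \<Lambda>\<close> show "v \<in> (\<lambda>w. w - l) ` \<Lambda> \<union> (\<lambda>w. l - w) ` \<Lambda>"
      by (auto intro: image_eqI[of _ _ "l + v"] image_eqI[of _ _ "l - v"])
  qed
  then have "countable (UNIV :: complex set)" by (rule countable_subset) (simp add: zeros_countable)
  then show False using uncountable_UNIV_complex by simp
qed

lemma \<nu>_nonzero: "l \<in> \<Lambda> \<Longrightarrow> \<nu> l \<noteq> 0"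
  using \<sigma>'_nonzero by (simp add: \<nu>_eq \<Lambda>_def)

text \<open>The three-term relation at (v + l, v), where the factor \<sigma>(l) is 0. It is the
  periodicity X(v + l) = X(v) in a form that also makes sense at lattice points.\<close>

lemma period_\<nu>: "l \<in> \<Lambda> \<Longrightarrow> \<sigma> (v + l) ^ 2 * \<nu> v = \<sigma> v ^ 2 * \<nu> (v + l)"
  using three_term[of "v + l" v] by (simp add: \<Lambda>_def)

lemma lattice_0: "0 \<in> \<Lambda>" by (simp add: \<Lambda>_def at_0)

lemma lattice_minus_iff: "- l \<in> \<Lambda> \<longleftrightarrow> l \<in> \<Lambda>" by (simp add: \<Lambda>_def \<sigma>_minus)

text \<open>\<open>period_\<nu>\<close> at v = k, where the right-hand side is 0 and \<nu>(k) is
  not.\<close>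

lemma lattice_add: "l \<in> \<Lambda> \<Longrightarrow> k \<in> \<Lambda> \<Longrightarrow> k + l \<in> \<Lambda>"
  using period_\<nu>[of l k] \<nu>_nonzero[of k] by (simp add: \<Lambda>_def)

lemma lattice_add_iff: "l \<in> \<Lambda> \<Longrightarrow> k + l \<in> \<Lambda> \<longleftrightarrow> k \<in> \<Lambda>" "l \<in> \<Lambda> \<Longrightarrow> l + k \<in> \<Lambda> \<longleftrightarrow> k \<in> \<Lambda>"
  using lattice_add[of l k] lattice_add[of "- l" "k + l"] by (auto simp: lattice_minus_iff add.commute)

lemma lattice_diff: "l \<in> \<Lambda> \<Longrightarrow> k \<in> \<Lambda> \<Longrightarrow> k - l \<in> \<Lambda>"
  using lattice_add[of "- l" k] by (simp add: lattice_minus_iff)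

lemma lattice_of_int: "l \<in> \<Lambda> \<Longrightarrow> of_int n * l \<in> \<Lambda>"
proof -
  assume l: "l \<in> \<Lambda>"
  have "of_nat k * l \<in> \<Lambda>" for k
    by (induction k) (auto simp: lattice_0 algebra_simps l intro: lattice_add)
  then show ?thesis by (cases n) (auto simp: lattice_minus_iff simp del: of_nat_Suc)
qed

lemma lattice_discrete: obtains \<delta> where "\<delta> > 0" "\<And>l. l \<in> \<Lambda> \<Longrightarrow> norm l < \<delta> \<Longrightarrow> l = 0"
proof -
  obtain w where "\<sigma> w \<noteq> 0" using \<sigma>_nonzero by blast
  then obtain r where "r > 0" "\<And>z. z \<in> ball 0 r - {0} \<Longrightarrow> \<sigma> z \<noteq> 0"
    using isolated_zeros[of \<sigma> UNIV 0 w] holomorphic(1)[OF holomorphic_on_ident, of UNIV] at_0(1) by auto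
  then show ?thesis by (intro that[of r]) (auto simp: \<Lambda>_def)
qed

lemma X_deriv: "u \<notin> \<Lambda> \<Longrightarrow> (X has_field_derivative X' u) (at u)"
proof -
  assume u: "u \<notin> \<Lambda>"
  have "((\<lambda>u. \<nu> u / \<sigma> u ^ 2) has_field_derivative (\<nu>' u * 1 * \<sigma> u ^ 2 - \<nu> u * (of_nat 2 * (\<sigma>' u * 1) * \<sigma> u ^ (2 - Suc 0))) / (\<sigma> u ^ 2 * \<sigma> u ^ 2)) (at u)"
    using u by (intro derivative_eq_intros refl) (auto simp: \<Lambda>_def)
  also have "(\<nu>' u * 1 * \<sigma> u ^ 2 - \<nu> u * (of_nat 2 * (\<sigma>' u * 1) * \<sigma> u ^ (2 - Suc 0))) / (\<sigma> u ^ 2 * \<sigma> u ^ 2) = X' u"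
    using u by (simp add: X'_def \<kappa>_eq \<Lambda>_def field_simps power2_eq_square power3_eq_cube)
  finally show ?thesis unfolding X_def[abs_def] .
qed

lemma X'_deriv: "u \<notin> \<Lambda> \<Longrightarrow> (X' has_field_derivative 6 * X u ^ 2 + b2 \<mu> * X u + b4 \<mu>) (at u)"
proof -
  assume u: "u \<notin> \<Lambda>"
  let ?d = "(\<kappa>' u * 1 * \<sigma> u ^ 3 - \<kappa> u * (of_nat 3 * (\<sigma>' u * 1) * \<sigma> u ^ (3 - Suc 0))) / (\<sigma> u ^ 3 * \<sigma> u ^ 3)"
  have "((\<lambda>u. \<kappa> u / \<sigma> u ^ 3) has_field_derivative ?d) (at u)"
    using u by (intro derivative_eq_intros refl) (auto simp: \<Lambda>_def)
  also have "?d = (\<sigma> u * \<kappa>' u - 3 * \<sigma>' u * \<kappa> u) / \<sigma> u ^ 4"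
    using u by (simp add: \<Lambda>_def field_simps eval_nat_numeral)
  also have "\<dots> = 6 * X u ^ 2 + b2 \<mu> * X u + b4 \<mu>"
    unfolding \<kappa>_deriv using u by (simp add: X_def \<Lambda>_def add_divide_distrib power_divide power2_eq_square eval_nat_numeral)
  finally show ?thesis unfolding X'_def[abs_def] .
qed

lemma \<zeta>_deriv: "u \<notin> \<Lambda> \<Longrightarrow> (\<zeta> has_field_derivative - X u) (at u)"
proof -
  assume u: "u \<notin> \<Lambda>"
  have "((\<lambda>u. \<sigma>' u / \<sigma> u) has_field_derivative (\<sigma>'' u * 1 * \<sigma> u - \<sigma>' u * (\<sigma>' u * 1)) / (\<sigma> u * \<sigma> u)) (at u)"
    using u by (intro derivative_eq_intros refl) (auto simp: \<Lambda>_def)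
  also have "(\<sigma>'' u * 1 * \<sigma> u - \<sigma>' u * (\<sigma>' u * 1)) / (\<sigma> u * \<sigma> u) = - X u"
    by (simp add: X_def \<nu>_eq power2_eq_square minus_divide_left mult.commute)
  finally show ?thesis unfolding \<zeta>_def[abs_def] .
qed

lemma X'_square: "u \<notin> \<Lambda> \<Longrightarrow> X' u ^ 2 = 4 * X u ^ 3 + b2 \<mu> * X u ^ 2 + 2 * b4 \<mu> * X u + b6 \<mu>"
proof -
  assume u: "u \<notin> \<Lambda>"
  have "X' u ^ 2 = \<kappa> u ^ 2 / \<sigma> u ^ 6" by (simp add: X'_def power_divide flip: power_mult)
  also have "\<dots> = 4 * X u ^ 3 + b2 \<mu> * X u ^ 2 + 2 * b4 \<mu> * X u + b6 \<mu>"
    unfolding \<kappa>_square X_def using u by (simp add: \<Lambda>_def add_divide_distrib power_divide flip: power_mult) (simp add: eval_nat_numeral)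
  finally show ?thesis .
qed

lemma X_period: "l \<in> \<Lambda> \<Longrightarrow> X (u + l) = X u"
proof (cases "u \<in> \<Lambda>")
  \<comment> \<open>On the lattice both sides are divisions by 0 and hence 0.\<close>
  case True
  then show "l \<in> \<Lambda> \<Longrightarrow> X (u + l) = X u" using lattice_add[of l u] by (simp add: X_def \<Lambda>_def)
next
  case False
  then show "l \<in> \<Lambda> \<Longrightarrow> X (u + l) = X u"
    using period_\<nu>[of l u] lattice_add_iff(1)[of l u] by (simp add: X_def \<Lambda>_def frac_eq_eq mult.commute)
qed

lemma X'_period: "l \<in> \<Lambda> \<Longrightarrow> X' (u + l) = X' u"
proof (cases "u \<in> \<Lambda>")
  case True
  then show "l \<in> \<Lambda> \<Longrightarrow> X' (u + l) = X' u" using lattice_add[of l u] by (simp add: X'_def \<Lambda>_def)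
next
  case False
  assume l: "l \<in> \<Lambda>"
  then have ul: "u + l \<notin> \<Lambda>" using False lattice_add_iff by blast
  have "((\<lambda>u. X (u + l)) has_field_derivative X' (u + l) * 1) (at u)"
    by (rule DERIV_chain2[of X], rule X_deriv[OF ul]) (auto intro!: derivative_eq_intros)
  then show ?thesis using DERIV_unique[OF X_deriv[OF False]] unfolding X_period[OF l] by simp
qed

lemma X_minus: "X (- u) = X u" by (simp add: X_def \<nu>_minus \<sigma>_minus)

lemma X'_minus: "X' (- u) = - X' u"
proof (cases "u \<in> \<Lambda>")
  case False
  have "((\<lambda>u. X (- u)) has_field_derivative X' (- u) * (- 1)) (at u)"
    by (rule DERIV_chain2[of X], rule X_deriv) (auto intro!: derivative_eq_intros simp: False lattice_minus_iff)
  then show ?thesis using DERIV_unique[OF X_deriv[OF False]] unfolding X_minus by fastforce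
qed (simp add: X'_def \<sigma>_minus \<Lambda>_def)

text \<open>By the three-term relation X u - X v is, up to sign and nonzero factors, \<sigma>(u + v)
  \<sigma>(u - v).\<close>

lemma X_eq_iff:
  assumes "u \<notin> \<Lambda>" "v \<notin> \<Lambda>"
  shows "X u = X v \<longleftrightarrow> u + v \<in> \<Lambda> \<or> u - v \<in> \<Lambda>"
proof -
  have "X u = X v \<longleftrightarrow> \<sigma> u ^ 2 * \<nu> v - \<sigma> v ^ 2 * \<nu> u = 0"
    using assms by (auto simp: X_def \<Lambda>_def frac_eq_eq mult.commute)
  then show ?thesis unfolding three_term[symmetric] by (simp add: \<Lambda>_def)
qed

lemma X'_zero_iff: "u \<notin> \<Lambda> \<Longrightarrow> X' u = 0 \<longleftrightarrow> 2 * u \<in> \<Lambda>"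
  using duplication[of u] by (simp add: X'_def \<Lambda>_def)

lemma XX'_eq_iff:
  assumes "u \<notin> \<Lambda>" "v \<notin> \<Lambda>"
  shows "X u = X v \<and> X' u = X' v \<longleftrightarrow> u - v \<in> \<Lambda>"
proof
  assume *: "X u = X v \<and> X' u = X' v"
  then consider "u - v \<in> \<Lambda>" | "u + v \<in> \<Lambda>" using X_eq_iff[OF assms] by blast
  then show "u - v \<in> \<Lambda>"
  proof cases
    \<comment> \<open>Then v is congruent to -u, so X' u = X' v = - X' u is 0. By the duplication
      formula 2u is a period, and u is congruent to -u.\<close>
    case 2
    then have "X' v = X' (- u)" using X'_period[of "u + v" "- u"] by simp
    then have "X' u = 0" using * by (simp add: X'_minus)
    then have "2 * u \<in> \<Lambda>" using X'_zero_iff assms by simp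
    then show ?thesis using lattice_diff[OF 2, of "2 * u"] by (simp add: algebra_simps)
  qed
next
  assume "u - v \<in> \<Lambda>"
  then show "X u = X v \<and> X' u = X' v" using X_period[of "u - v" v] X'_period[of "u - v" v] by simp
qed

lemma curve_equation_iff:
  "(x, y) \<in> affine_curve \<mu> \<longleftrightarrow> (2 * y + \<mu> 1 * x + \<mu> 3) ^ 2 = 4 * x ^ 3 + b2 \<mu> * x ^ 2 + 2 * b4 \<mu> * x + b6 \<mu>"
proof -
  have "(2 * y + \<mu> 1 * x + \<mu> 3) ^ 2 - (4 * x ^ 3 + b2 \<mu> * x ^ 2 + 2 * b4 \<mu> * x + b6 \<mu>) = 
      4 * (y^2 + (\<mu> 1 * x + \<mu> 3) * y - (x^3 + \<mu> 2 * x^2 + \<mu> 4 * x + \<mu> 6))"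
    unfolding b2_def b4_def b6_def by (simp add: algebra_simps power2_eq_square power3_eq_cube)
  moreover have "a = b \<longleftrightarrow> c = d" if "a - b = 4 * (c - d)" for a b c d :: complex
    using that by auto
  ultimately have "y^2 + (\<mu> 1 * x + \<mu> 3) * y = x^3 + \<mu> 2 * x^2 + \<mu> 4 * x + \<mu> 6 \<longleftrightarrow>
     (2 * y + \<mu> 1 * x + \<mu> 3) ^ 2 = 4 * x ^ 3 + b2 \<mu> * x ^ 2 + 2 * b4 \<mu> * x + b6 \<mu>" by metis
  then show ?thesis unfolding affine_curve_def by simp
qed

lemma partial_y_Y: "2 * Y u + \<mu> 1 * X u + \<mu> 3 = X' u"
  unfolding Y_def by simp (simp add: field_simps)

lemma XY_in_curve: "u \<notin> \<Lambda> \<Longrightarrow> (X u, Y u) \<in> affine_curve \<mu>"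
  unfolding curve_equation_iff partial_y_Y by (rule X'_square)

end

subsection \<open>Surjectivity of the uniformization\<close>

context complex_curve
begin

text \<open>\<open>A (X u) s\<close> is \<sigma>(u + s) \<sigma>(u - s) / \<sigma>(u)^2, and
  \<open>A1\<close>, \<open>A2\<close> are its derivatives in s. The value X u is replaced by a free
  parameter because a limit will be taken in it and not in u.\<close>

definition A where "A a s = \<nu> s - a * \<sigma> s ^ 2"
definition A1 where "A1 a s = \<nu>' s - 2 * a * \<sigma> s * \<sigma>' s"
definition A2 where "A2 a s = \<nu>'' s - 2 * a * (\<sigma>' s ^ 2 + \<sigma> s * \<sigma>'' s)"

text \<open>
  The right-hand side of the addition theorem
  \<open>X (u + s) = translate_X (X u) (X' u) s\<close>, which extends holomorphically to all points of the
  curve in place of \<open>(X u, X' u)\<close>.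
\<close>
definition translate_X where
  "translate_X a b s = - (((A2 a s - 2 * b * \<sigma> s * \<sigma>' s) * A a s - (A1 a s - b * \<sigma> s ^ 2) * A1 a s) / (A a s) ^ 2) / 2"

lemma A_nonzero:
  assumes "u \<notin> \<Lambda>" "A (X u) s \<noteq> 0" 
  shows "u + s \<notin> \<Lambda>" "u - s \<notin> \<Lambda>" "\<sigma> (u + s) * \<sigma> (u - s) = \<sigma> u ^ 2 * A (X u) s"
proof -
  show e: "\<sigma> (u + s) * \<sigma> (u - s) = \<sigma> u ^ 2 * A (X u) s"
  proof -
    have "X u * \<sigma> u ^ 2 = \<nu> u" using assms(1) by (simp add: X_def \<Lambda>_def)
    then show ?thesis unfolding three_term A_def by (simp add: algebra_simps flip: \<open>X u * \<sigma> u ^ 2 = \<nu> u\<close>)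
  qed
  have "\<sigma> u ^ 2 * A (X u) s \<noteq> 0" using assms by (simp add: \<Lambda>_def)
  then show "u + s \<notin> \<Lambda>" "u - s \<notin> \<Lambda>" unfolding e[symmetric] by (auto simp: \<Lambda>_def)
qed

text \<open>The logarithmic derivatives of the three-term relation in u and in s are added, so that
  \<zeta>(u - s) drops out.\<close>

lemma \<zeta>_addition:
  assumes "u \<notin> \<Lambda>" "A (X u) s \<noteq> 0"
  shows "2 * \<zeta> (u + s) = 2 * \<zeta> u + (A1 (X u) s - X' u * \<sigma> s ^ 2) / A (X u) s"
proof -
  note n = A_nonzero[OF assms]
  have "((\<lambda>s. \<sigma> (u + s) * \<sigma> (u - s)) has_field_derivative \<sigma>' (u + s) * \<sigma> (u - s) - \<sigma> (u + s) * \<sigma>' (u - s)) (at s)"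
    by (auto intro!: derivative_eq_intros)
  moreover have "((\<lambda>s. \<sigma> (u + s) * \<sigma> (u - s)) has_field_derivative \<sigma> u ^ 2 * \<nu>' s - 2 * \<sigma> s * \<sigma>' s * \<nu> u) (at s)"
    unfolding three_term by (auto intro!: derivative_eq_intros)
  ultimately have 1: "\<sigma>' (u + s) * \<sigma> (u - s) - \<sigma> (u + s) * \<sigma>' (u - s) = \<sigma> u ^ 2 * \<nu>' s - 2 * \<sigma> s * \<sigma>' s * \<nu> u"
    by (rule DERIV_unique)
  have "((\<lambda>u. \<sigma> (u + s) * \<sigma> (u - s)) has_field_derivative \<sigma>' (u + s) * \<sigma> (u - s) + \<sigma> (u + s) * \<sigma>' (u - s)) (at u)"
    by (auto intro!: derivative_eq_intros)
  moreover have "((\<lambda>u. \<sigma> (u + s) * \<sigma> (u - s)) has_field_derivative 2 * \<sigma> u * \<sigma>' u * \<nu> s - \<sigma> s ^ 2 * \<nu>' u) (at u)"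
    unfolding three_term by (auto intro!: derivative_eq_intros)
  ultimately have 2: "\<sigma>' (u + s) * \<sigma> (u - s) + \<sigma> (u + s) * \<sigma>' (u - s) = 2 * \<sigma> u * \<sigma>' u * \<nu> s - \<sigma> s ^ 2 * \<nu>' u"
    by (rule DERIV_unique)
  have X: "\<nu> u = X u * \<sigma> u ^ 2" "\<nu>' u * \<sigma> u = X' u * \<sigma> u ^ 3 + 2 * \<sigma>' u * \<nu> u" "\<zeta> u * \<sigma> u = \<sigma>' u"
    using assms(1) by (simp_all add: X_def X'_def \<kappa>_eq \<zeta>_def \<Lambda>_def mult.commute)
  have z: "\<zeta> (u + s) * \<sigma> (u + s) = \<sigma>' (u + s)" using n(1) by (simp add: \<zeta>_def \<Lambda>_def)
  have "(\<sigma> u ^ 2 * A (X u) s) * (2 * \<zeta> (u + s)) * \<sigma> u= 2 * \<sigma>' (u + s) * \<sigma> (u - s) * \<sigma> u"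
    unfolding n(3)[symmetric] z[symmetric] by simp
  also have "\<dots> = (\<sigma> u ^ 2 * A (X u) s) * (2 * \<zeta> u) * \<sigma> u + \<sigma> u ^ 2 * (A1 (X u) s - X' u * \<sigma> s ^ 2) * \<sigma> u"
    unfolding A_def A1_def using 1 2 X by algebra
  finally have "\<sigma> u ^ 3 * (A (X u) s * (2 * \<zeta> (u + s))) = \<sigma> u ^ 3 * (A (X u) s * (2 * \<zeta> u) + (A1 (X u) s - X' u * \<sigma> s ^ 2))"
    by (simp add: algebra_simps power2_eq_square power3_eq_cube)
  then have "A (X u) s * (2 * \<zeta> (u + s)) = A (X u) s * (2 * \<zeta> u) + (A1 (X u) s - X' u * \<sigma> s ^ 2)"
    using assms(1) by (simp add: \<Lambda>_def)
  then show ?thesis using assms(2) by (simp add: field_simps)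
qed

text \<open>The s-derivative of \<open>\<zeta>_addition\<close>, since \<zeta>' = -X.\<close>

lemma X_addition:
  assumes "u \<notin> \<Lambda>" "A (X u) s \<noteq> 0"
  shows "X (u + s) = translate_X (X u) (X' u) s"
proof -
  let ?a = "X u" and ?b = "X' u"
  have A: "(A ?a has_field_derivative A1 ?a s) (at s)" "(A1 ?a has_field_derivative A2 ?a s) (at s)" for s
    unfolding A_def[abs_def] A1_def[abs_def] A2_def
    by (auto intro!: derivative_eq_intros simp: algebra_simps power2_eq_square)
  have d: "((\<lambda>s. (A1 ?a s - ?b * \<sigma> s ^ 2) / A ?a s) has_field_derivative
      ((A2 ?a s - ?b * (of_nat 2 * (\<sigma>' s * 1) * \<sigma> s ^ (2 - Suc 0))) * A ?a s - (A1 ?a s - ?b * \<sigma> s ^ 2) * A1 ?a s) / (A ?a s * A ?a s)) (at s)" (is "(_ has_field_derivative ?D) _")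
    using assms(2) by (intro derivative_eq_intros A refl) (auto intro: A)
  have "- 2 * (- z / 2) = 0 + z" for z :: complex by simp
  moreover have "?b * (of_nat 2 * (\<sigma>' s * 1) * \<sigma> s ^ (2 - Suc 0)) = 2 * ?b * \<sigma> s * \<sigma>' s" by simp
  ultimately have t: "- 2 * translate_X ?a ?b s = 0 + ?D" unfolding translate_X_def power2_eq_square[of "A ?a s"] by metis
  have 1: "((\<lambda>s. 2 * \<zeta> u + (A1 ?a s - ?b * \<sigma> s ^ 2) / A ?a s) has_field_derivative - 2 * translate_X ?a ?b s) (at s)"
    unfolding t by (rule DERIV_add[OF DERIV_const d])
  have "\<forall>\<^sub>F s in nhds s. A ?a s \<noteq> 0"
    using DERIV_isCont[OF A(1)] assms(2) t1_space_nhds by (metis continuous_within tendsto_imp_eventually_ne eventually_nhds_conv_at)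
  then have "\<forall>\<^sub>F s in nhds s. 2 * \<zeta> (u + s) = 2 * \<zeta> u + (A1 ?a s - ?b * \<sigma> s ^ 2) / A ?a s"
    by eventually_elim (rule \<zeta>_addition[OF assms(1)])
  then have "((\<lambda>s. 2 * \<zeta> (u + s)) has_field_derivative - 2 * translate_X ?a ?b s) (at s)"
    using 1 by (subst DERIV_cong_ev[OF refl _ refl]) auto
  moreover have "((\<lambda>s. 2 * \<zeta> (u + s)) has_field_derivative 2 * (- X (u + s) * 1)) (at s)"
    by (rule DERIV_cmult, rule DERIV_chain2[of \<zeta>], rule \<zeta>_deriv[OF A_nonzero(1)[OF assms]]) (auto intro!: derivative_eq_intros)
  ultimately have "- 2 * translate_X ?a ?b s = 2 * (- X (u + s) * 1)" by (rule DERIV_unique)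
  then show ?thesis by simp
qed

lemma X_holomorphic: "X holomorphic_on - \<Lambda>"
  unfolding holomorphic_on_def field_differentiable_def using X_deriv has_field_derivative_at_within by blast

lemma X_open: "open U \<Longrightarrow> U \<subseteq> - \<Lambda> \<Longrightarrow> open (X ` U)"
proof (rule open_mapping_thm[OF X_holomorphic open_complement connected_complement])
  \<comment> \<open>Were X constant, X' would vanish identically and every 2u would be a period,
    while the periods are countable.\<close>
  show "\<not> X constant_on - \<Lambda>"
  proof
    assume "X constant_on - \<Lambda>"
    then obtain c where c: "\<And>u. u \<notin> \<Lambda> \<Longrightarrow> X u = c" unfolding constant_on_def by auto
    have "2 * u \<in> \<Lambda>" for u
    proof (cases "u \<in> \<Lambda>")
      case True
      then show ?thesis using lattice_add[of u u] by simp
    next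
      case False
      have "(X has_field_derivative 0) (at u)"
        by (rule has_field_derivative_transform_within_open[OF DERIV_const open_complement]) (use c False in auto)
      then show ?thesis using DERIV_unique[OF X_deriv[OF False]] X'_zero_iff[OF False] by simp
    qed
    then have "UNIV \<subseteq> (\<lambda>z. z / 2) ` \<Lambda>" by (metis (no_types, lifting) image_eqI nonzero_mult_div_cancel_left subsetI zero_neq_numeral)
    then have "countable (UNIV :: complex set)" by (rule countable_subset) (simp add: zeros_countable)
    then show False using uncountable_UNIV_complex by simp
  qed
qed

text \<open>The points u n need not converge, but on a disc of fixed radius the translates X (u n +
  s) depend only on X (u n), X' (u n) and s. Their uniform limit g has g 0 = a. If g is not
  constant, Hurwitz' theorem yields a translate that takes the value a; a constant g would produce a
  singular point over a.\<close>

lemma X_limit_in_range: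
  assumes ns: "nonsingular \<mu>"
    and u: "\<And>n. u n \<notin> \<Lambda>" and a: "(\<lambda>n. X (u n)) \<longlonglongrightarrow> a" and b: "(\<lambda>n. X' (u n)) \<longlonglongrightarrow> b"
  shows "a \<in> X ` (- \<Lambda>)"
proof -
  obtain M where M: "\<And>n. norm (X (u n)) \<le> M" "norm a \<le> M"
  proof -
    from convergent_imp_Bseq[OF convergentI[OF a]] obtain K where "\<And>n. norm (X (u n)) \<le> K" unfolding Bseq_def by blast
    moreover from this have "norm a \<le> K" using tendsto_norm[OF a] by (intro LIMSEQ_le_const2[of "\<lambda>n. norm (X (u n))"]) auto
    ultimately show ?thesis using that by blast
  qed
  obtain M' where M': "\<And>n. norm (X' (u n)) \<le> M'" "norm b \<le> M'"
  proof -
    from convergent_imp_Bseq[OF convergentI[OF b]] obtain K where "\<And>n. norm (X' (u n)) \<le> K" unfolding Bseq_def by blast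
    moreover from this have "norm b \<le> K" using tendsto_norm[OF b] by (intro LIMSEQ_le_const2[of "\<lambda>n. norm (X' (u n))"]) auto
    ultimately show ?thesis using that by blast
  qed
  have M0: "0 \<le> M" using M(2) norm_ge_zero[of a] by linarith
  \<comment> \<open>Since \<open>A x 0\<close> is 1, this gives a radius r such that
    \<open>A x s\<close> is nonzero for all s of norm at most r and all x of norm at most M.\<close>
  have "continuous_on UNIV (\<lambda>s. norm (\<nu> s - 1) + M * norm (\<sigma> s) ^ 2)" by (intro continuous_intros)
  then have "((\<lambda>s. norm (\<nu> s - 1) + M * norm (\<sigma> s) ^ 2) \<longlongrightarrow> norm (\<nu> 0 - 1) + M * norm (\<sigma> 0) ^ 2) (at 0)"
    by (simp add: continuous_on_def)
  then have "\<forall>\<^sub>F s in at 0. norm (\<nu> s - 1) + M * norm (\<sigma> s) ^ 2 < 1"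
    by (rule order_tendstoD) (simp add: at_0)
  then obtain d where d: "d > 0" "\<And>s. s \<noteq> 0 \<Longrightarrow> norm s < d \<Longrightarrow> norm (\<nu> s - 1) + M * norm (\<sigma> s) ^ 2 < 1"
    by (auto simp: eventually_at)
  define r where "r = d / 2"
  have r: "r > 0" using d by (simp add: r_def)
  have Anz: "A x s \<noteq> 0" if x: "norm x \<le> M" and s: "norm s \<le> r" for x s
  proof
    assume "A x s = 0"
    then have "\<nu> s - 1 = x * \<sigma> s ^ 2 - 1" by (simp add: A_def)
    moreover have "norm (1 :: complex) \<le> norm (x * \<sigma> s ^ 2) + norm (x * \<sigma> s ^ 2 - 1)"
      by (metis norm_triangle_sub norm_minus_commute)
    moreover have "norm (x * \<sigma> s ^ 2) \<le> M * norm (\<sigma> s) ^ 2"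
      using x by (simp add: norm_mult norm_power mult_right_mono)
    ultimately have "1 \<le> norm (\<nu> s - 1) + M * norm (\<sigma> s) ^ 2" by simp
    moreover have "norm (\<nu> s - 1) + M * norm (\<sigma> s) ^ 2 < 1"
      using d s by (cases "s = 0") (auto simp: at_0 r_def)
    ultimately show False by simp
  qed
  define F where "F n s = translate_X (X (u n)) (X' (u n)) s" for n s
  define g where "g s = translate_X a b s" for s
  have F: "F n s = X (u n + s)" "u n + s \<notin> \<Lambda>" if "norm s \<le> r" for n s
    using X_addition[OF u Anz[OF M(1) that]] A_nonzero(1)[OF u Anz[OF M(1) that]] by (simp_all add: F_def)
  have hol: "translate_X x y holomorphic_on ball 0 r" if "norm x \<le> M" for x y
    unfolding translate_X_def[abs_def] A1_def A2_def A_def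
    using Anz[OF that] by (intro holomorphic_intros) (auto simp: A_def)
  have ul: "uniform_limit (cball 0 r) F g sequentially"
  proof (rule uniform_limitI)
    fix e :: real assume e: "e > 0"
    define C where "C = cball (0::complex) M \<times> cball (0::complex) M' \<times> cball (0::complex) r"
    have "continuous_on C (\<lambda>p. translate_X (fst p) (fst (snd p)) (snd (snd p)))"
      unfolding translate_X_def A1_def A2_def A_def
      using Anz by (intro continuous_intros) (auto simp: A_def C_def)
    moreover have "compact C" unfolding C_def by (intro compact_Times compact_cball)
    ultimately have "uniformly_continuous_on C (\<lambda>p. translate_X (fst p) (fst (snd p)) (snd (snd p)))"
      by (rule compact_uniformly_continuous)
    from this[unfolded uniformly_continuous_on_def, rule_format, OF e]
    obtain d where d: "d > 0" "\<And>p q. p \<in> C \<Longrightarrow> q \<in> C \<Longrightarrow> dist q p < d \<Longrightarrow> 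
        dist (translate_X (fst q) (fst (snd q)) (snd (snd q))) (translate_X (fst p) (fst (snd p)) (snd (snd p))) < e" by metis
    have "(\<lambda>n. (X (u n), X' (u n))) \<longlonglongrightarrow> (a, b)" by (intro tendsto_Pair a b)
    from tendstoD[OF this d(1)] show "\<forall>\<^sub>F n in sequentially. \<forall>s\<in>cball 0 r. dist (F n s) (g s) < e"
    proof eventually_elim
      case (elim n)
      show ?case
      proof
        fix s :: complex assume s: "s \<in> cball 0 r"
        have "dist (X (u n), X' (u n), s) (a, b, s) = dist (X (u n), X' (u n)) (a, b)"
          by (simp add: dist_Pair_Pair)
        then show "dist (F n s) (g s) < e"
          using d(2)[of "(a, b, s)" "(X (u n), X' (u n), s)"] elim s M M' by (simp add: C_def F_def g_def)
      qed
    qed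
  qed
  have g0: "g 0 = a"
  proof (rule LIMSEQ_unique)
    show "(\<lambda>n. F n 0) \<longlonglongrightarrow> g 0" using r by (intro tendsto_uniform_limitI[OF ul]) auto
    show "(\<lambda>n. F n 0) \<longlonglongrightarrow> a" using a r by (simp add: F)
  qed
  have "\<not> g constant_on ball 0 r"
  proof
    assume "g constant_on ball 0 r"
    then obtain c where c: "\<And>s. s \<in> ball 0 r \<Longrightarrow> g s = c" unfolding constant_on_def by blast
    \<comment> \<open>The first two derivatives of the translates at 0 are X' and X'' at u n. For
      constant g their limits are 0, which gives b = 0 and the vanishing of both partial derivatives
      at the point over a.\<close>
    have lim: "(\<lambda>n. (deriv ^^ k) (F n) 0) \<longlonglongrightarrow> (deriv ^^ k) g 0" for k
    proof (rule higher_deriv_complex_uniform_limit[where A = "ball 0 r"])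
      show "uniform_limit (ball 0 r) F g sequentially" by (rule uniform_limit_on_subset[OF ul]) auto
      show "\<forall>\<^sub>F n in sequentially. F n holomorphic_on ball 0 r" unfolding F_def using hol[OF M(1)] by simp
    qed (use r in auto)
    have gz: "(deriv ^^ k) g 0 = (if k = 0 then c else 0)" for k
    proof -
      have "(deriv ^^ k) g 0 = (deriv ^^ k) (\<lambda>_. c) 0"
        using r c by (intro higher_deriv_cong_ev) (auto intro!: eventually_nhds_in_open[THEN eventually_mono, of "ball 0 r"])
      then show ?thesis by (simp add: higher_deriv_const)
    qed
    have ev: "\<forall>\<^sub>F s in nhds 0. F n s = X (u n + s)" for n
      using r by (intro eventually_nhds_in_open[THEN eventually_mono, of "ball 0 r"]) (auto simp: F)
    have d1: "deriv (\<lambda>s. X (u n + s)) s = X' (u n + s)" if "norm s \<le> r" for n s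
      by (rule DERIV_imp_deriv, rule DERIV_chain2[of X, where Db = 1, simplified], rule X_deriv[OF F(2)[OF that]])
        (auto intro!: derivative_eq_intros)
    have ev1: "\<forall>\<^sub>F s in nhds 0. deriv (\<lambda>s. X (u n + s)) s = X' (u n + s)" for n
      using r by (intro eventually_nhds_in_open[THEN eventually_mono, of "ball 0 r"]) (auto simp: d1)
    have "(deriv ^^ 1) (F n) 0 = X' (u n)" for n
      using higher_deriv_cong_ev[OF ev refl, of 1] d1[of 0] r by simp
    then have "b = 0" using LIMSEQ_unique[OF lim[of 1, unfolded gz] , of b] b by simp
    have "(deriv ^^ 2) (F n) 0 = 6 * X (u n) ^ 2 + b2 \<mu> * X (u n) + b4 \<mu>" for n
    proof -
      have "(deriv ^^ 2) (F n) 0 = deriv (deriv (\<lambda>s. X (u n + s))) 0"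
        using higher_deriv_cong_ev[OF ev refl, of 2] by (simp add: numeral_2_eq_2)
      also have "\<dots> = deriv (\<lambda>s. X' (u n + s)) 0" using ev1 by (rule deriv_cong_ev) simp
      also have "\<dots> = 6 * X (u n) ^ 2 + b2 \<mu> * X (u n) + b4 \<mu>"
        by (rule DERIV_imp_deriv, rule DERIV_chain2[of X', where Db = 1, simplified]) 
          (use X'_deriv[OF u] in \<open>auto intro!: derivative_eq_intros\<close>)
      finally show ?thesis .
    qed
    then have "(\<lambda>n. 6 * X (u n) ^ 2 + b2 \<mu> * X (u n) + b4 \<mu>) \<longlonglongrightarrow> 0" using lim[of 2] by (simp add: gz)
    moreover have "(\<lambda>n. 6 * X (u n) ^ 2 + b2 \<mu> * X (u n) + b4 \<mu>) \<longlonglongrightarrow> 6 * a ^ 2 + b2 \<mu> * a + b4 \<mu>"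
      by (intro tendsto_intros a)
    ultimately have 2: "6 * a ^ 2 + b2 \<mu> * a + b4 \<mu> = 0" using LIMSEQ_unique by blast
    have "(\<lambda>n. X' (u n) ^ 2) \<longlonglongrightarrow> b ^ 2" by (intro tendsto_intros b)
    moreover have "(\<lambda>n. X' (u n) ^ 2) \<longlonglongrightarrow> 4 * a ^ 3 + b2 \<mu> * a ^ 2 + 2 * b4 \<mu> * a + b6 \<mu>"
      unfolding X'_square[OF u] by (intro tendsto_intros a)
    ultimately have 1: "4 * a ^ 3 + b2 \<mu> * a ^ 2 + 2 * b4 \<mu> * a + b6 \<mu> = 0" using LIMSEQ_unique \<open>b = 0\<close> by fastforce
    define y where "y = - (\<mu> 1 * a + \<mu> 3) / 2"
    have y0: "2 * y + \<mu> 1 * a + \<mu> 3 = 0" unfolding y_def by simp (simp add: field_simps)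
    have mem: "(a, y) \<in> affine_curve \<mu>" unfolding curve_equation_iff y0 1 by simp
    have py: "partial_y \<mu> (a, y) = 0" using y0 by (simp add: partial_y_def)
    have "- 2 * partial_x \<mu> (a, y) = 6 * a ^ 2 + b2 \<mu> * a + b4 \<mu>"
      by (simp add: partial_x_def y_def b2_def b4_def field_simps power2_eq_square)
    then have px: "partial_x \<mu> (a, y) = 0" using 2 by simp
    show False using ns mem px py unfolding nonsingular_def by blast
  qed
  then have gc: "\<not> (\<lambda>s. g s - a) constant_on ball 0 r" unfolding constant_on_def by (metis diff_add_cancel)
  have "\<exists>n. \<exists>z\<in>ball 0 r. F n z - a = 0"
  proof (rule ccontr)
    assume no: "\<not> ?thesis"
    have "g 0 - a \<noteq> 0"
    proof (rule Hurwitz_no_zeros[OF open_ball connected_ball, where \<F> = "\<lambda>n s. F n s - a" and g = "\<lambda>s. g s - a"])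
      show "(\<lambda>s. F n s - a) holomorphic_on ball 0 r" for n
        unfolding F_def using hol[OF M(1)] by (intro holomorphic_intros)
      show "(\<lambda>s. g s - a) holomorphic_on ball 0 r" unfolding g_def using hol[OF M(2)] by (intro holomorphic_intros)
      show "uniform_limit K (\<lambda>n s. F n s - a) (\<lambda>s. g s - a) sequentially" if "K \<subseteq> ball 0 r" for K
        by (intro uniform_limit_intros uniform_limit_on_subset[OF ul]) (use that in auto)
    qed (use gc no r in auto)
    then show False by (simp add: g0)
  qed
  then obtain n z where "z \<in> ball 0 r" "F n z = a" by auto
  then have "X (u n + z) = a" "u n + z \<notin> \<Lambda>" using F[of z n] by auto
  then show ?thesis by blast
qed

lemma X_surjective:
  assumes "nonsingular \<mu>"
  shows "X ` (- \<Lambda>) = UNIV"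
proof -
  have "closed (X ` (- \<Lambda>))"
    unfolding closed_sequential_limits
  proof (intro allI impI, elim conjE)
    fix x a assume "\<forall>n. x n \<in> X ` (- \<Lambda>)" and x: "x \<longlonglongrightarrow> a"
    then have "\<forall>n. \<exists>u. u \<notin> \<Lambda> \<and> x n = X u" by blast
    then obtain v where v: "\<And>n. v n \<notin> \<Lambda>" "\<And>n. x n = X (v n)" by metis
    let ?p = "\<lambda>x. 4 * x ^ 3 + b2 \<mu> * x ^ 2 + 2 * b4 \<mu> * x + b6 \<mu>"
    \<comment> \<open>X' (v n) is known only up to sign. Replacing v n by its negative where
      necessary makes X' (w n) at least as close to b as to -b, and the product of the two distances
      tends to 0.\<close>
    define b where "b = csqrt (?p a)"
    define w where "w n = (if norm (X' (v n) - b) \<le> norm (X' (v n) + b) then v n else - v n)" for n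
    have w: "w n \<notin> \<Lambda>" "X (w n) = x n" for n using v by (auto simp: w_def lattice_minus_iff X_minus)
    have m: "norm (X' (w n) - b) \<le> norm (X' (w n) + b)" for n
    proof -
      have "norm (- X' (v n) - b) = norm (X' (v n) + b)" "norm (- X' (v n) + b) = norm (X' (v n) - b)"
        using norm_minus_cancel[of "X' (v n) + b"] by (simp_all add: norm_minus_commute)
      then show ?thesis by (simp add: w_def X'_minus)
    qed
    have "(\<lambda>n. norm (?p (x n) - ?p a)) \<longlonglongrightarrow> norm (?p a - ?p a)" by (intro tendsto_intros x)
    then have l: "(\<lambda>n. sqrt (norm (?p (x n) - ?p a))) \<longlonglongrightarrow> 0" using tendsto_real_sqrt by fastforce
    have "(\<lambda>n. X' (w n) - b) \<longlonglongrightarrow> 0"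
    proof (rule Lim_null_comparison[OF _ l], intro always_eventually allI)
      fix n
      have "(X' (w n) - b) * (X' (w n) + b) = ?p (x n) - ?p a"
        using X'_square[OF w(1)[of n]] unfolding w(2) b_def by (simp add: algebra_simps power2_eq_square[symmetric])
      then have "norm (X' (w n) - b) * norm (X' (w n) + b) = norm (?p (x n) - ?p a)" by (metis norm_mult)
      then have "norm (X' (w n) - b) ^ 2 \<le> norm (?p (x n) - ?p a)"
        using mult_left_mono[OF m norm_ge_zero] by (metis power2_eq_square)
      then show "norm (X' (w n) - b) \<le> sqrt (norm (?p (x n) - ?p a))" by (rule real_le_rsqrt)
    qed
    then have "(\<lambda>n. X' (w n)) \<longlonglongrightarrow> b" by (simp add: LIM_zero_iff)
    then show "a \<in> X ` (- \<Lambda>)" using X_limit_in_range[OF assms w(1)] x by (simp add: w(2))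
  qed
  moreover have "open (X ` (- \<Lambda>))" by (rule X_open[OF open_complement order_refl])
  moreover have "- \<Lambda> \<noteq> {}" using \<sigma>_nonzero by (auto simp: \<Lambda>_def)
  ultimately show ?thesis using clopen[of "X ` (- \<Lambda>)"] by simp
qed

lemma XY_surjective:
  assumes "nonsingular \<mu>" "(x, y) \<in> affine_curve \<mu>"
  obtains u where "u \<notin> \<Lambda>" "X u = x" "Y u = y"
proof -
  from X_surjective[OF assms(1)] obtain v where v: "v \<notin> \<Lambda>" "X v = x" by (metis ComplD UNIV_I imageE)
  have "(2 * y + \<mu> 1 * x + \<mu> 3) ^ 2 = X' v ^ 2"
    using assms(2) X'_square[OF v(1)] unfolding curve_equation_iff v(2) by simp
  then consider "2 * y + \<mu> 1 * x + \<mu> 3 = X' v" | "2 * y + \<mu> 1 * x + \<mu> 3 = X' (- v)"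
    unfolding power2_eq_iff X'_minus by blast
  then show thesis
  proof cases
    case 1
    then have "Y v = y" unfolding Y_def v(2) by (simp add: 1[symmetric])
    then show thesis using that v by blast
  next
    case 2
    then have "Y (- v) = y" unfolding Y_def X_minus v(2) by (simp add: 2[symmetric])
    then show thesis using that[of "- v"] v by (simp add: X_minus lattice_minus_iff)
  qed
qed

end

subsection \<open>The universal covering of the curve\<close>

text \<open>
  The complete curve, a compactification without a metric, is embedded into a Euclidean space by
  inverse stereographic projection, with the point at infinity going to the origin.
\<close>
definition embed_affine :: "complex \<times> complex \<Rightarrow> real \<times> complex \<times> complex" where
  "embed_affine P = (let N = 1 + norm (fst P) ^ 2 + norm (snd P) ^ 2 in (1 / N, fst P / of_real N, snd P / of_real N))"

definition embed_curve :: "(complex \<times> complex) option \<Rightarrow> real \<times> complex \<times> complex" where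
  "embed_curve = case_option 0 embed_affine"

lemma embed_denominator: "1 + norm x ^ 2 + norm y ^ 2 > 0" for x y :: complex
  by (simp add: add_pos_nonneg)

lemma embed_affine_simps:
  "fst (embed_affine P) > 0" "fst (snd (embed_affine P)) / of_real (fst (embed_affine P)) = fst P"
  "snd (snd (embed_affine P)) / of_real (fst (embed_affine P)) = snd P"
proof -
  have N: "1 + norm (fst P) ^ 2 + norm (snd P) ^ 2 > 0" by (rule embed_denominator)
  then have "of_real (1 + norm (fst P) ^ 2 + norm (snd P) ^ 2) \<noteq> (0 :: complex)" by (simp only: of_real_eq_0_iff)
  with N show "fst (embed_affine P) > 0" "fst (snd (embed_affine P)) / of_real (fst (embed_affine P)) = fst P"
    "snd (snd (embed_affine P)) / of_real (fst (embed_affine P)) = snd P"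
    by (simp_all add: embed_affine_def Let_def del: of_real_add)
qed

lemma embed_affine_inject: "embed_affine P = embed_affine Q \<longleftrightarrow> P = Q"
  by (metis embed_affine_simps(2,3) prod_eqI)

lemma continuous_embed_affine: "continuous_on UNIV embed_affine"
proof -
  have N: "1 + norm (fst P) ^ 2 + norm (snd P) ^ 2 \<noteq> 0" for P :: "complex \<times> complex"
    using embed_denominator[of "fst P" "snd P"] by linarith
  then have N': "of_real (1 + norm (fst P) ^ 2 + norm (snd P) ^ 2) \<noteq> (0 :: complex)" for P :: "complex \<times> complex"
    by (simp only: of_real_eq_0_iff not_False_eq_True)
  show ?thesis
    unfolding embed_affine_def[abs_def] Let_def by (intro continuous_intros ballI N N')
qed

lemma norm_embed_affine: "norm (embed_affine P) ^ 2 = 1 / (1 + norm P ^ 2)"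
proof -
  let ?N = "1 + norm (fst P) ^ 2 + norm (snd P) ^ 2"
  have N: "?N > 0" by (rule embed_denominator)
  have "norm (embed_affine P) ^ 2 = (1 / ?N)^2 + ((norm (fst P) / ?N)^2 + (norm (snd P) / ?N)^2)"
    using N by (simp add: embed_affine_def Let_def norm_Pair real_sqrt_pow2 norm_divide del: of_real_add)
  also have "\<dots> = ?N / ?N ^ 2" by (simp add: power_divide add_divide_distrib)
  also have "\<dots> = 1 / ?N" using N by (simp add: power2_eq_square)
  also have "?N = 1 + norm P ^ 2" by (cases P) (simp add: norm_Pair)
  finally show ?thesis .
qed

lemma affine_curve_closed: "closed (affine_curve \<mu>)"
proof -
  have "affine_curve \<mu> = {P. snd P ^2 + (\<mu> 1 * fst P + \<mu> 3) * snd P = fst P ^3 + \<mu> 2 * fst P ^2 + \<mu> 4 * fst P + \<mu> 6}"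
    by (auto simp: affine_curve_def)
  then show ?thesis by (simp only:) (intro closed_Collect_eq continuous_intros)
qed

lemma continuous_map_embed_curve:
  assumes K: "\<And>P. P \<in> affine_curve \<mu> \<Longrightarrow> embed_affine P \<in> K" "0 \<in> K"
  shows "continuous_map (curve \<mu>) (top_of_set K) embed_curve"
proof -
  have top: "topspace (curve \<mu>) = insert None (Some ` affine_curve \<mu>)"
    by (simp add: curve_def topspace_Alexandroff_compactification)
  have "openin (curve \<mu>) {x \<in> topspace (curve \<mu>). embed_curve x \<in> W}" if W: "open W" for W
  proof (cases "0 \<in> W")
    case False
    have "{x \<in> topspace (curve \<mu>). embed_curve x \<in> W} = Some ` (affine_curve \<mu> \<inter> embed_affine -` W)"
      unfolding top using False by (auto simp: embed_curve_def)
    moreover have "openin (top_of_set (affine_curve \<mu>)) (affine_curve \<mu> \<inter> embed_affine -` W)"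
      using open_vimage[OF W continuous_embed_affine] by (rule openin_open_Int)
    ultimately show ?thesis unfolding curve_def openin_Alexandroff_compactification by blast
  next
    case True
    then obtain r where r: "r > 0" "ball 0 r \<subseteq> W" using W open_contains_ball by blast
    \<comment> \<open>The points not mapped into W. The embedding tends to 0 at infinity, so C is
      bounded and its complement is a neighbourhood of infinity in the compactification.\<close>
    define C where "C = affine_curve \<mu> - embed_affine -` W"
    have "closed C" unfolding C_def using affine_curve_closed open_vimage[OF W continuous_embed_affine] by blast
    moreover have "bounded C"
    proof (rule boundedI)
      fix P assume "P \<in> C"
      then have "norm (embed_affine P) \<ge> r" using r(2) unfolding C_def by (auto simp: subset_eq)
      then have "r ^ 2 \<le> 1 / (1 + norm P ^ 2)" unfolding norm_embed_affine[symmetric] using r(1) by (intro power_mono) auto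
      then have "r ^ 2 * (1 + norm P ^ 2) \<le> 1" by (subst (asm) pos_le_divide_eq) (auto intro: add_pos_nonneg)
      then have "r ^ 2 * norm P ^ 2 \<le> 1" using zero_le_power2[of r] unfolding distrib_left mult_1_right by linarith
      then have "norm P ^ 2 \<le> 1 / r ^ 2" using r(1) by (subst pos_le_divide_eq) (simp_all add: mult.commute)
      then show "norm P \<le> sqrt (1 / r ^ 2)" by (rule real_le_rsqrt)
    qed
    ultimately have "compact C" by (simp add: compact_eq_bounded_closed)
    then have "compactin (top_of_set (affine_curve \<mu>)) C" "closedin (top_of_set (affine_curve \<mu>)) C"
      using \<open>closed C\<close> by (auto simp: compactin_subtopology C_def intro: closed_subset)
    moreover have "{x \<in> topspace (curve \<mu>). embed_curve x \<in> W} = insert None (Some ` (affine_curve \<mu> - C))"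
      unfolding top C_def using True by (auto simp: embed_curve_def)
    ultimately show ?thesis unfolding curve_def openin_Alexandroff_compactification by auto
  qed
  then have "continuous_map (curve \<mu>) euclidean embed_curve" by (auto simp: continuous_map_def)
  moreover have "embed_curve \<in> topspace (curve \<mu>) \<rightarrow> K"
    unfolding top using K by (auto simp: embed_curve_def)
  ultimately show ?thesis by (simp add: continuous_map_in_subtopology image_subset_iff_funcset)
qed

text \<open>Used for the point at infinity: where x is bounded so is y, hence points near infinity
  have large x.\<close>

lemma affine_curve_snd_bounded:
  assumes "(x, y) \<in> affine_curve \<mu>" "norm x \<le> M" 
  shows "norm y \<le> 1 + norm (\<mu> 1) * M + norm (\<mu> 3) + (M ^ 3 + norm (\<mu> 2) * M ^ 2 + norm (\<mu> 4) * M + norm (\<mu> 6))"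
proof -
  have M: "0 \<le> M" using assms(2) norm_ge_zero[of x] by linarith
  define C where "C = M ^ 3 + norm (\<mu> 2) * M ^ 2 + norm (\<mu> 4) * M + norm (\<mu> 6)"
  have C: "0 \<le> C" unfolding C_def using M by simp
  have "norm (x^3 + \<mu> 2 * x^2 + \<mu> 4 * x + \<mu> 6) \<le> norm x ^ 3 + norm (\<mu> 2) * norm x ^ 2 + norm (\<mu> 4) * norm x + norm (\<mu> 6)"
    by (intro norm_triangle_le add_mono order_refl) (simp_all add: norm_mult norm_power)
  also have "\<dots> \<le> C"
    unfolding C_def using assms(2) M by (intro add_mono mult_left_mono power_mono order_refl) auto
  finally have r: "norm (x^3 + \<mu> 2 * x^2 + \<mu> 4 * x + \<mu> 6) \<le> C" .
  have l: "norm (\<mu> 1 * x + \<mu> 3) \<le> norm (\<mu> 1) * M + norm (\<mu> 3)"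
    using assms(2) by (intro norm_triangle_le add_mono) (simp_all add: norm_mult mult_left_mono)
  have "y^2 = (x^3 + \<mu> 2 * x^2 + \<mu> 4 * x + \<mu> 6) - (\<mu> 1 * x + \<mu> 3) * y"
    using assms(1) by (simp add: affine_curve_def algebra_simps)
  then have "norm y ^ 2 \<le> C + norm (\<mu> 1 * x + \<mu> 3) * norm y"
    using norm_triangle_ineq4[of "x^3 + \<mu> 2 * x^2 + \<mu> 4 * x + \<mu> 6" "(\<mu> 1 * x + \<mu> 3) * y"] r by (simp add: norm_mult flip: norm_power)
  also have "\<dots> \<le> C + (norm (\<mu> 1) * M + norm (\<mu> 3)) * norm y" using l by (intro add_left_mono mult_right_mono) auto
  finally have q: "norm y ^ 2 \<le> C + (norm (\<mu> 1) * M + norm (\<mu> 3)) * norm y" .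
  show ?thesis unfolding C_def[symmetric]
  proof (cases "norm y \<ge> 1")
    case True
    then have "C \<le> C * norm y" using mult_left_mono[OF True C] by simp
    with q have "norm y * norm y \<le> (norm (\<mu> 1) * M + norm (\<mu> 3) + C) * norm y" by (simp add: power2_eq_square distrib_right)
    then have "norm y \<le> norm (\<mu> 1) * M + norm (\<mu> 3) + C" by (rule mult_right_le_imp_le) (use True in linarith)
    then show "norm y \<le> 1 + norm (\<mu> 1) * M + norm (\<mu> 3) + C" by simp
  qed (use C M mult_nonneg_nonneg[OF norm_ge_zero[of "\<mu> 1"] M] norm_ge_zero[of "\<mu> 3"] in linarith)
qed

context complex_curve
begin

text \<open>\<open>\<eta>\<close> is \<sigma>^3 Y. The map \<open>p\<close> is the embedding of (X,
  Y) with numerators and denominators multiplied by |\<sigma>|^6, which extends it continuously to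
  the lattice.\<close>

definition \<eta> where "\<eta> u = (\<kappa> u - \<mu> 1 * \<nu> u * \<sigma> u - \<mu> 3 * \<sigma> u ^ 3) / 2"
definition den where "den u = norm (\<sigma> u) ^ 6 + norm (\<nu> u * \<sigma> u) ^ 2 + norm (\<eta> u) ^ 2"

definition p :: "complex \<Rightarrow> real \<times> complex \<times> complex" where
  "p u = (norm (\<sigma> u) ^ 6 / den u, \<nu> u * \<sigma> u * cnj (\<sigma> u) ^ 3 / of_real (den u), \<eta> u * cnj (\<sigma> u) ^ 3 / of_real (den u))"

lemma den_pos: "den u > 0"
proof (cases "u \<in> \<Lambda>")
  \<comment> \<open>At a lattice point only the term with \<eta> remains, and \<kappa>^2 = 4 \<nu>^3
    is not 0 there.\<close>
  case True
  then have s: "\<sigma> u = 0" "\<sigma>' u \<noteq> 0" using \<sigma>'_nonzero by (auto simp: \<Lambda>_def)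
  then have "\<kappa> u \<noteq> 0" using \<kappa>_square[of u] by (auto simp: \<nu>_eq)
  then show ?thesis by (simp add: den_def \<eta>_def s)
qed (simp add: den_def \<Lambda>_def add_pos_nonneg)

lemma continuous_p: "continuous_on UNIV p"
proof -
  have "den u \<noteq> 0" "of_real (den u) \<noteq> (0 :: complex)" for u using den_pos[of u] by (simp_all add: less_imp_neq[symmetric])
  moreover have "continuous_on UNIV den" unfolding den_def[abs_def] \<eta>_def by (intro continuous_intros) auto
  ultimately show ?thesis unfolding p_def[abs_def] \<eta>_def by (intro continuous_intros) auto
qed

lemma p_lattice: "u \<in> \<Lambda> \<Longrightarrow> p u = 0"
  by (simp add: p_def \<Lambda>_def zero_prod_def)

lemma p_affine: assumes "u \<notin> \<Lambda>" shows "p u = embed_affine (X u, Y u)"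
proof -
  have s: "\<sigma> u \<noteq> 0" using assms by (simp add: \<Lambda>_def)
  let ?N = "1 + norm (X u) ^ 2 + norm (Y u) ^ 2"
  have x: "\<nu> u * \<sigma> u = X u * \<sigma> u ^ 3" using s by (simp add: X_def power2_eq_square power3_eq_cube)
  have "\<kappa> u = X' u * \<sigma> u ^ 3" using s by (simp add: X'_def)
  then have y: "\<eta> u = Y u * \<sigma> u ^ 3" unfolding \<eta>_def mult.assoc x Y_def by (simp add: algebra_simps)
  have d: "den u = ?N * norm (\<sigma> u) ^ 6"
    unfolding den_def x y by (simp add: norm_mult norm_power power_mult_distrib algebra_simps flip: power_mult)
  have c: "\<sigma> u ^ 3 * cnj (\<sigma> u) ^ 3 = of_real (norm (\<sigma> u) ^ 6)"
  proof -
    have "\<sigma> u ^ 3 * cnj (\<sigma> u) ^ 3 = (\<sigma> u * cnj (\<sigma> u)) ^ 3" by (simp add: power_mult_distrib)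
    also have "\<dots> = of_real ((norm (\<sigma> u) ^ 2) ^ 3)" unfolding complex_norm_square[symmetric] by simp
    finally show ?thesis by (simp flip: power_mult)
  qed
  have "norm (\<sigma> u) ^ 6 / den u = 1 / ?N" using s unfolding d by simp
  moreover have "z * \<sigma> u ^ 3 * cnj (\<sigma> u) ^ 3 / of_real (den u) = z / of_real ?N" for z
    unfolding mult.assoc c d of_real_mult using s by simp
  ultimately show ?thesis unfolding p_def x y embed_affine_def Let_def by simp
qed

lemma p_eq_iff: "p u = p v \<longleftrightarrow> u - v \<in> \<Lambda>"
proof -
  consider "u \<in> \<Lambda>" "v \<in> \<Lambda>" | "u \<in> \<Lambda>" "v \<notin> \<Lambda>" | "u \<notin> \<Lambda>" "v \<in> \<Lambda>" | "u \<notin> \<Lambda>" "v \<notin> \<Lambda>" by blast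
  then show ?thesis
  proof cases
    case 1
    then show ?thesis using lattice_diff by (simp add: p_lattice)
  next
    case 2
    then have "v - u \<notin> \<Lambda>" using lattice_add[of u "v - u"] by auto
    then have "u - v \<notin> \<Lambda>" using lattice_minus_iff[of "u - v"] by simp
    moreover have "p v \<noteq> 0" using embed_affine_simps(1)[of "(X v, Y v)"] 2 by (auto simp: p_affine)
    ultimately show ?thesis using 2 by (simp add: p_lattice)
  next
    case 3
    then have "u - v \<notin> \<Lambda>" using lattice_add[of v "u - v"] by auto
    moreover have "p u \<noteq> 0" using embed_affine_simps(1)[of "(X u, Y u)"] 3 by (auto simp: p_affine)
    ultimately show ?thesis using 3 by (simp add: p_lattice)
  next
    case 4
    have "p u = p v \<longleftrightarrow> X u = X v \<and> Y u = Y v" using 4 by (simp add: p_affine embed_affine_inject)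
    also have "\<dots> \<longleftrightarrow> X u = X v \<and> X' u = X' v" by (auto simp: Y_def)
    finally show ?thesis using XX'_eq_iff[OF 4] by simp
  qed
qed

lemma reflect_ball: "w \<in> ball u e \<Longrightarrow> 2 * u - w \<in> ball u e" for u w :: complex
  by (simp add: dist_norm norm_minus_commute)

text \<open>X is open, so the x-coordinate of a nearby q is X w with w near u0, and v is congruent
  to w or to -w. If X' u0 is not 0, the values of X' stay in an open half-plane, which excludes the
  second case; otherwise 2 u0 is a period and the reflection of w in u0 takes the place of
  w.\<close>

lemma p_open_affine:
  assumes u0: "u0 \<notin> \<Lambda>" and e: "e > 0"
  shows "\<forall>\<^sub>F q in nhds (p u0). \<forall>v. p v = q \<longrightarrow> (\<exists>w\<in>ball u0 e. v - w \<in> \<Lambda>)"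
proof -
  let ?x = "\<lambda>q :: real \<times> complex \<times> complex. fst (snd q) / of_real (fst q)"
  let ?y = "\<lambda>q :: real \<times> complex \<times> complex. snd (snd q) / of_real (fst q)"
  let ?x' = "\<lambda>q. 2 * ?y q + \<mu> 1 * ?x q + \<mu> 3"
  have sel: "fst (p v) > 0" "?x (p v) = X v" "?y (p v) = Y v" if "v \<notin> \<Lambda>" for v
    using embed_affine_simps[of "(X v, Y v)"] that by (simp_all add: p_affine)
  have sel': "?x' (p v) = X' v" if "v \<notin> \<Lambda>" for v unfolding sel[OF that] by (rule partial_y_Y)
  have "isCont X' u0" by (rule DERIV_isCont[OF X'_deriv[OF u0]])
  then have lim: "(X' \<longlongrightarrow> X' u0) (nhds u0)" by (simp add: tendsto_at_iff_tendsto_nhds isCont_def)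
  have "\<forall>\<^sub>F w in nhds u0. w \<in> ball u0 e \<inter> - \<Lambda>"
    using u0 e by (intro eventually_nhds_in_open) (auto intro: open_complement)
  moreover have "\<forall>\<^sub>F w in nhds u0. X' u0 \<noteq> 0 \<longrightarrow> Re (X' w / X' u0) > 0"
  proof (cases "X' u0 = 0")
    case False
    have "((\<lambda>w. Re (X' w / X' u0)) \<longlongrightarrow> Re (X' u0 / X' u0)) (nhds u0)" by (intro tendsto_intros lim False)
    then have "\<forall>\<^sub>F w in nhds u0. Re (X' w / X' u0) > 0" by (rule order_tendstoD) (simp add: False)
    then show ?thesis by eventually_elim simp
  qed simp
  ultimately have "\<forall>\<^sub>F w in nhds u0. w \<in> ball u0 e \<inter> - \<Lambda> \<and> (X' u0 \<noteq> 0 \<longrightarrow> Re (X' w / X' u0) > 0)"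
    by (rule eventually_conj)
  then obtain d where d: "d > 0" "\<And>w. w \<in> ball u0 d \<Longrightarrow> w \<in> ball u0 e \<and> w \<notin> \<Lambda> \<and> (X' u0 \<noteq> 0 \<longrightarrow> Re (X' w / X' u0) > 0)"
    unfolding eventually_nhds_metric by (auto simp: dist_commute)
  have o: "open (X ` ball u0 d)" using d(2) by (intro X_open) auto
  have m: "?x (p u0) \<in> X ` ball u0 d" using d(1) sel(2)[OF u0] by auto
  have lx: "(?x \<longlongrightarrow> ?x (p u0)) (nhds (p u0))"
    using sel(1)[OF u0] by (intro tendsto_intros filterlim_ident) auto
  have 1: "\<forall>\<^sub>F q in nhds (p u0). ?x q \<in> X ` ball u0 d" by (rule topological_tendstoD[OF lx o m])
  have 2: "\<forall>\<^sub>F q in nhds (p u0). X' u0 \<noteq> 0 \<longrightarrow> Re (?x' q / X' u0) > 0"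
  proof (cases "X' u0 = 0")
    case False
    have "((\<lambda>q. Re (?x' q / X' u0)) \<longlongrightarrow> Re (?x' (p u0) / X' u0)) (nhds (p u0))"
      using sel(1)[OF u0] False by (intro tendsto_intros filterlim_ident) auto
    then have "\<forall>\<^sub>F q in nhds (p u0). Re (?x' q / X' u0) > 0" 
      by (rule order_tendstoD) (unfold sel'[OF u0], simp add: False)
    then show ?thesis by eventually_elim simp
  qed simp
  have 3: "\<forall>\<^sub>F q in nhds (p u0). fst q > 0"
    using order_tendstoD(1)[OF tendsto_fst[OF filterlim_ident] sel(1)[OF u0]] .
  from 1 2 3 show ?thesis
  proof eventually_elim
    case (elim q)
    show ?case
    proof (intro allI impI)
      fix v assume v: "p v = q"
      then have vL: "v \<notin> \<Lambda>" using elim(3) by (auto simp: p_lattice)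
      then obtain w where w: "w \<in> ball u0 d" "X v = X w" using elim(1) sel(2)[of v] v by (auto simp del: times_divide_eq_right times_divide_eq_left)
      have wL: "w \<notin> \<Lambda>" using d(2) w(1) by blast
      from X_eq_iff[OF vL wL] w(2) consider "v - w \<in> \<Lambda>" | "v + w \<in> \<Lambda>" by blast
      then show "\<exists>w\<in>ball u0 e. v - w \<in> \<Lambda>"
      proof cases
        case 2
        then have "X' v = - X' w" using X'_period[of "v + w" "- w"] by (simp add: X'_minus)
        have "X' u0 = 0"
        proof (rule ccontr)
          assume nz: "X' u0 \<noteq> 0"
          then have "Re (X' v / X' u0) > 0" using elim(2) sel'[OF vL] unfolding v by (simp only: simp_thms)
          moreover have "Re (X' w / X' u0) > 0" using d(2)[OF w(1)] nz by blast
          ultimately show False unfolding \<open>X' v = - X' w\<close> by simp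
        qed
        then have "2 * u0 \<in> \<Lambda>" using X'_zero_iff[OF u0] by simp
        then have "v - (2 * u0 - w) \<in> \<Lambda>" using lattice_diff[OF _ 2, of "2 * u0"] by (simp add: algebra_simps)
        moreover have "2 * u0 - w \<in> ball u0 e" using d(2)[OF w(1)] reflect_ball by blast
        ultimately show ?thesis by blast
      qed (use d(2)[OF w(1)] in blast)
    qed
  qed
qed

text \<open>Near a lattice point the open map 1/X = \<sigma>^2/\<nu> replaces X. Twice a lattice
  point is a period, so the sign ambiguity is again resolved by reflection in u0.\<close>

lemma p_open_infinity:
  assumes u0: "u0 \<in> \<Lambda>" and e: "e > 0"
  shows "\<forall>\<^sub>F q in nhds (p u0). \<forall>v. p v = q \<longrightarrow> (\<exists>w\<in>ball u0 e. v - w \<in> \<Lambda>)"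
proof -
  let ?h = "\<lambda>u. \<sigma> u ^ 2 / \<nu> u"
  have "isCont \<nu> u0" by (rule DERIV_isCont) (rule derivs(3)[OF DERIV_ident])
  then have "\<forall>\<^sub>F w in nhds u0. \<nu> w \<noteq> 0" 
    using tendsto_imp_eventually_ne[of \<nu> "\<nu> u0" "nhds u0" 0] \<nu>_nonzero[OF u0] by (simp add: tendsto_at_iff_tendsto_nhds isCont_def)
  moreover have "\<forall>\<^sub>F w in nhds u0. w \<in> ball u0 e" using e by (intro eventually_nhds_in_open) auto
  ultimately have "\<forall>\<^sub>F w in nhds u0. \<nu> w \<noteq> 0 \<and> w \<in> ball u0 e" by (rule eventually_conj)
  then obtain d where d: "d > 0" "\<And>w. w \<in> ball u0 d \<Longrightarrow> \<nu> w \<noteq> 0 \<and> w \<in> ball u0 e"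
    unfolding eventually_nhds_metric by (auto simp: dist_commute)
  have "open (?h ` ball u0 d)"
  proof (rule open_mapping_thm[where S = "ball u0 d"])
    show "?h holomorphic_on ball u0 d" using d(2) by (intro holomorphic_intros) auto
    show "\<not> ?h constant_on ball u0 d"
    proof
      assume "?h constant_on ball u0 d"
      then obtain c where c: "\<And>w. w \<in> ball u0 d \<Longrightarrow> ?h w = c" unfolding constant_on_def by blast
      have "c = 0" using c[of u0] d(1) u0 by (simp add: \<Lambda>_def)
      then have "ball u0 d \<subseteq> \<Lambda>" using c d(2) by (fastforce simp: \<Lambda>_def)
      then have "countable (ball u0 d)" using zeros_countable countable_subset by blast
      then show False using uncountable_ball[OF d(1)] by blast
    qed
  qed auto
  moreover have "0 \<in> ?h ` ball u0 d" using u0 d(1) by (auto simp: \<Lambda>_def intro!: image_eqI[of _ _ u0])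
  ultimately obtain r where r: "r > 0" "ball 0 r \<subseteq> ?h ` ball u0 d" using open_contains_ball by blast
  define M where "M = 1 / r"
  define M' where "M' = 1 + norm (\<mu> 1) * M + norm (\<mu> 3) + (M ^ 3 + norm (\<mu> 2) * M ^ 2 + norm (\<mu> 4) * M + norm (\<mu> 6))"
  have M: "M > 0" unfolding M_def using r(1) by simp
  \<comment> \<open>If X v has norm at most M, then Y v has norm at most M', and the squared norm of
    p v is at least \<rho>.\<close>
  define \<rho> where "\<rho> = 1 / (1 + M ^ 2 + M' ^ 2)"
  have \<rho>: "\<rho> > 0" unfolding \<rho>_def by (simp add: add_pos_nonneg)
  have "((\<lambda>q. norm q ^ 2) \<longlongrightarrow> norm (p u0) ^ 2) (nhds (p u0))" by (intro tendsto_intros filterlim_ident)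
  then have "\<forall>\<^sub>F q in nhds (p u0). norm q ^ 2 < \<rho>" by (rule order_tendstoD) (simp add: p_lattice[OF u0] \<rho>)
  then show ?thesis
  proof eventually_elim
    case (elim q)
    show ?case
    proof (intro allI impI)
      fix v assume v: "p v = q"
      show "\<exists>w\<in>ball u0 e. v - w \<in> \<Lambda>"
      proof (cases "v \<in> \<Lambda>")
        case True
        then show ?thesis using lattice_diff[OF u0] e by (intro bexI[of _ u0]) auto
      next
        case vL: False
        have "norm (X v) > M"
        proof (rule ccontr)
          assume "\<not> norm (X v) > M"
          then have x: "norm (X v) \<le> M" by simp
          have y: "norm (Y v) \<le> M'" unfolding M'_def by (rule affine_curve_snd_bounded[OF XY_in_curve[OF vL] x])
          have "1 + (norm (X v) ^ 2 + norm (Y v) ^ 2) \<le> 1 + M ^ 2 + M' ^ 2"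
            using power_mono[OF x norm_ge_zero, of 2] power_mono[OF y norm_ge_zero, of 2] by simp
          then have "\<rho> \<le> 1 / (1 + norm (X v, Y v) ^ 2)"
            unfolding \<rho>_def norm_Pair by (intro divide_left_mono) (auto intro!: mult_pos_pos add_pos_nonneg)
          then show False using elim unfolding v[symmetric] p_affine[OF vL] norm_embed_affine by simp
        qed
        then have "norm (X v) > 0" using M by linarith
        then have Xnz: "X v \<noteq> 0" by simp
        have "norm (1 / X v) < r"
          using \<open>norm (X v) > M\<close> \<open>norm (X v) > 0\<close> r(1) unfolding M_def norm_divide norm_one by (simp add: pos_divide_less_eq mult.commute)
        then have "1 / X v \<in> ?h ` ball u0 d" using r(2) by (auto simp: subset_eq)
        then obtain w where w: "w \<in> ball u0 d" "1 / X v = ?h w" by blast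
        then have wL: "w \<notin> \<Lambda>" using Xnz by (auto simp: \<Lambda>_def)
        have "X v = X w" using arg_cong[OF w(2), of inverse] by (simp add: X_def)
        with X_eq_iff[OF vL wL] consider "v - w \<in> \<Lambda>" | "v + w \<in> \<Lambda>" by blast
        then show ?thesis
        proof cases
          case 2
          have "2 * u0 \<in> \<Lambda>" using lattice_add[OF u0 u0] by simp
          then have "v - (2 * u0 - w) \<in> \<Lambda>" using lattice_diff[OF _ 2, of "2 * u0"] by (simp add: algebra_simps)
          moreover have "2 * u0 - w \<in> ball u0 e" using d(2)[OF w(1)] reflect_ball by blast
          ultimately show ?thesis by blast
        qed (use d(2)[OF w(1)] in blast)
      qed
    qed
  qed
qed

lemma p_open_map: assumes "open U" shows "openin (top_of_set (range p)) (p ` U)"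
proof (subst openin_subopen, intro ballI)
  fix q assume "q \<in> p ` U"
  then obtain u0 where u0: "u0 \<in> U" "q = p u0" by blast
  then obtain e where e: "e > 0" "ball u0 e \<subseteq> U" using assms open_contains_ball by blast
  have "\<forall>\<^sub>F q in nhds (p u0). \<forall>v. p v = q \<longrightarrow> (\<exists>w\<in>ball u0 e. v - w \<in> \<Lambda>)"
    using p_open_affine[OF _ e(1)] p_open_infinity[OF _ e(1)] by blast
  then obtain V where V: "open V" "p u0 \<in> V" "\<And>q v. q \<in> V \<Longrightarrow> p v = q \<Longrightarrow> (\<exists>w\<in>ball u0 e. v - w \<in> \<Lambda>)"
    unfolding eventually_nhds by blast
  have "range p \<inter> V \<subseteq> p ` U"
  proof
    fix q assume "q \<in> range p \<inter> V"
    then obtain v where "q = p v" "p v \<in> V" by blast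
    then obtain w where "w \<in> ball u0 e" "v - w \<in> \<Lambda>" using V(3) by blast
    then show "q \<in> p ` U" using \<open>q = p v\<close> e(2) p_eq_iff[of v w] by blast
  qed
  then show "\<exists>T. openin (top_of_set (range p)) T \<and> q \<in> T \<and> T \<subseteq> p ` U"
    using V u0 by (intro exI[of _ "range p \<inter> V"]) auto
qed

text \<open>Discs of radius \<delta>/2 about the translates of u0 are disjoint and mapped
  injectively, because no nonzero lattice point has norm below \<delta>.\<close>

theorem covering: "covering_space UNIV p (range p)"
proof
  obtain \<delta> where \<delta>: "\<delta> > 0" "\<And>l. l \<in> \<Lambda> \<Longrightarrow> norm l < \<delta> \<Longrightarrow> l = 0" using lattice_discrete by blast
  fix q assume "q \<in> range p"
  then obtain u0 where u0: "q = p u0" by blast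
  define B where "B l = ball (u0 + l) (\<delta> / 2)" for l
  let ?T = "p ` B 0"
  have inj: "x = y" if "x \<in> B l" "y \<in> B l" "x - y \<in> \<Lambda>" for x y l
  proof -
    have "dist x y < \<delta>" by (rule dist_triangle_half_r[of "u0 + l"]) (use that(1,2) in \<open>auto simp: B_def\<close>)
    then have "norm (x - y) < \<delta>" by (simp add: dist_norm)
    then show ?thesis using \<delta>(2)[OF that(3)] by simp
  qed
  have img: "p ` B l = ?T" if "l \<in> \<Lambda>" for l
  proof -
    have "B l = (+) l ` B 0" using ball_translation[of l u0 "\<delta> / 2"] by (simp add: B_def add.commute)
    moreover have "p (l + x) = p x" for x using p_eq_iff[of "l + x" x] that by simp
    ultimately show ?thesis by (simp add: image_image)
  qed
  show "\<exists>T. q \<in> T \<and> openin (top_of_set (range p)) T \<and> (\<exists>v. \<Union>v = UNIV \<inter> p -` T \<and> (\<forall>u\<in>v. openin (top_of_set UNIV) u) \<and> 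
      pairwise disjnt v \<and> (\<forall>u\<in>v. \<exists>q. homeomorphism u T p q))"
  proof (intro exI conjI)
    show "q \<in> ?T" using \<delta>(1) by (simp add: u0 B_def)
    show "openin (top_of_set (range p)) ?T" by (rule p_open_map) (simp add: B_def)
    show "\<Union>(B ` \<Lambda>) = UNIV \<inter> p -` ?T"
    proof (intro equalityI subsetI)
      fix x assume "x \<in> \<Union>(B ` \<Lambda>)"
      then show "x \<in> UNIV \<inter> p -` ?T" using img by blast
    next
      fix x assume "x \<in> UNIV \<inter> p -` ?T"
      then obtain y where y: "y \<in> B 0" "p x = p y" by blast
      then have "x - y \<in> \<Lambda>" by (simp add: p_eq_iff)
      moreover have "x \<in> B (x - y)" using y(1) by (simp add: B_def dist_norm algebra_simps)
      ultimately show "x \<in> \<Union>(B ` \<Lambda>)" by blast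
    qed
    show "\<forall>u\<in>B ` \<Lambda>. openin (top_of_set UNIV) u" by (simp add: B_def)
    show "pairwise disjnt (B ` \<Lambda>)"
    proof (rule pairwiseI, elim imageE, simp only:)
      fix l k assume l: "l \<in> \<Lambda>" "k \<in> \<Lambda>" "B l \<noteq> B k"
      show "disjnt (B l) (B k)"
      proof (rule ccontr)
        assume "\<not> disjnt (B l) (B k)"
        then obtain x where x: "x \<in> B l" "x \<in> B k" by (auto simp: disjnt_iff)
        then have "x - l \<in> B 0" "x - k \<in> B 0" by (simp_all add: B_def dist_norm algebra_simps)
        moreover have "(x - l) - (x - k) \<in> \<Lambda>" using lattice_diff[OF l(1,2)] by simp
        ultimately show False using inj[of "x - l" 0 "x - k"] l(3) by auto
      qed
    qed
    show "\<forall>u\<in>B ` \<Lambda>. \<exists>q. homeomorphism u ?T p q"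
    proof (intro ballI, elim imageE, simp only:)
      fix l assume l: "l \<in> \<Lambda>"
      have "inj_on p (B l)" using inj by (auto simp: inj_on_def p_eq_iff)
      moreover have "openin (top_of_set ?T) (p ` U)" if "openin (top_of_set (B l)) U" for U
      proof -
        have "open U" using that unfolding B_def by (simp add: openin_open_eq)
        moreover have "p ` U \<subseteq> ?T" using img[OF l] openin_imp_subset[OF that] by blast
        ultimately show ?thesis using openin_subset_trans[OF p_open_map] by blast
      qed
      ultimately obtain g where "homeomorphism (B l) ?T p g"
        using homeomorphism_injective_open_map[OF continuous_on_subset[OF continuous_p] img[OF l]] by auto
      then show "\<exists>g. homeomorphism (B l) ?T p g" by blast
    qed
  qed
qed (simp_all add: continuous_p)

end

subsection \<open>Periods\<close>

text \<open>F is locally invertible at f t, so near t the continuous function f is a holomorphic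
  inverse branch applied to F (f s).\<close>

lemma has_vector_derivative_lift:
  fixes f :: "real \<Rightarrow> complex"
  assumes F: "F holomorphic_on S" "open S" "f t \<in> S" "(F has_field_derivative D) (at (f t))" "D \<noteq> 0"
    and f: "isCont f t" and Ff: "((\<lambda>s. F (f s)) has_vector_derivative d) (at t)"
  shows "(f has_vector_derivative d / D) (at t)"
proof -
  have D: "deriv F (f t) = D" using F(4) by (rule DERIV_imp_deriv)
  then obtain r where r: "r > 0" "ball (f t) r \<subseteq> S" "inj_on F (ball (f t) r)"
    using has_complex_derivative_locally_injective[OF F(1,3,2)] F(5) by metis
  have hol: "F holomorphic_on ball (f t) r" by (rule holomorphic_on_subset[OF F(1) r(2)])
  then obtain G where G: "G holomorphic_on (F ` ball (f t) r)" "\<And>z. z \<in> ball (f t) r \<Longrightarrow> deriv F z * deriv G (F z) = 1"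
    "\<And>z. z \<in> ball (f t) r \<Longrightarrow> G (F z) = z"
    using holomorphic_has_inverse[OF _ open_ball r(3)] by metis
  have "open (F ` ball (f t) r)" by (rule open_mapping_thm3[OF hol open_ball r(3)])
  moreover have "F (f t) \<in> F ` ball (f t) r" using r(1) by simp
  ultimately have "(G has_field_derivative deriv G (F (f t))) (at (F (f t)))" using G(1) holomorphic_derivI by blast
  then have "(G \<circ> (\<lambda>s. F (f s)) has_vector_derivative d * deriv G (F (f t))) (at t)" using field_vector_diff_chain_at[OF Ff] by simp
  moreover have "d * deriv G (F (f t)) = d / D" using G(2)[of "f t"] r(1) F(5) unfolding D by (simp add: field_simps)
  moreover have "\<forall>\<^sub>F s in nhds t. f s \<in> ball (f t) r"
    using f r(1) unfolding isCont_def tendsto_at_iff_tendsto_nhds by (intro topological_tendstoD) auto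
  then have "\<forall>\<^sub>F s in nhds t. (G \<circ> (\<lambda>s. F (f s))) s = f s" by eventually_elim (simp add: G(3))
  then obtain V where "open V" "t \<in> V" "\<And>s. s \<in> V \<Longrightarrow> (G \<circ> (\<lambda>s. F (f s))) s = f s" unfolding eventually_nhds by blast
  ultimately show ?thesis using has_vector_derivative_transform_within_open by fastforce
qed

locale nonsingular_curve = complex_curve +
  assumes nonsingular: "nonsingular \<mu>"
begin

definition \<phi> where "\<phi> u = (X u, Y u)"

lemma \<phi>_eq_iff: "u \<notin> \<Lambda> \<Longrightarrow> v \<notin> \<Lambda> \<Longrightarrow> \<phi> u = \<phi> v \<longleftrightarrow> u - v \<in> \<Lambda>"
  by (metis p_affine p_eq_iff embed_affine_inject \<phi>_def)

lemma \<phi>_period: "l \<in> \<Lambda> \<Longrightarrow> \<phi> (u + l) = \<phi> u"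
  by (simp add: \<phi>_def Y_def X_period X'_period)

lemma \<phi>_surjective: "P \<in> affine_curve \<mu> \<Longrightarrow> \<exists>u. u \<notin> \<Lambda> \<and> \<phi> u = P"
  by (metis XY_surjective[OF nonsingular] \<phi>_def prod.exhaust)

lemma embed_affine_in_range: "P \<in> affine_curve \<mu> \<Longrightarrow> embed_affine P \<in> range p"
  using \<phi>_surjective p_affine unfolding \<phi>_def by (metis rangeI)

definition lifts :: "(real \<Rightarrow> complex \<times> complex) \<Rightarrow> (real \<Rightarrow> complex) \<Rightarrow> bool" where
  "lifts \<gamma> g \<longleftrightarrow> path g \<and> (\<forall>t\<in>{0..1}. g t \<notin> \<Lambda> \<and> \<phi> (g t) = \<gamma> t)"

lemma lifts_p: "lifts \<gamma> g \<Longrightarrow> t \<in> {0..1} \<Longrightarrow> p (g t) = embed_affine (\<gamma> t)"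
  unfolding lifts_def \<phi>_def by (metis p_affine)

text \<open>The path is lifted in the embedded complete curve; the lift avoids the lattice since the
  embedding of an affine point is not 0.\<close>

lemma exists_lift:
  assumes "path \<gamma>" "path_image \<gamma> \<subseteq> affine_curve \<mu>" "u \<notin> \<Lambda>" "\<phi> u = pathstart \<gamma>"
  obtains g where "lifts \<gamma> g" "g 0 = u"
proof -
  have "path (embed_affine \<circ> \<gamma>)"
    by (rule path_continuous_image[OF assms(1) continuous_on_subset[OF continuous_embed_affine]]) simp
  moreover have "path_image (embed_affine \<circ> \<gamma>) \<subseteq> range p"
    using assms(2) embed_affine_in_range unfolding path_image_compose by blast
  moreover have "pathstart (embed_affine \<circ> \<gamma>) = p u"
    unfolding pathstart_compose using assms(3,4) by (simp add: p_affine \<phi>_def)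
  ultimately obtain h where h: "path h" "pathstart h = u" "\<And>t. t \<in> {0..1} \<Longrightarrow> p (h t) = (embed_affine \<circ> \<gamma>) t"
    using covering_space_lift_path_strong[OF covering UNIV_I] by metis
  have "h t \<notin> \<Lambda> \<and> \<phi> (h t) = \<gamma> t" if t: "t \<in> {0..1}" for t
  proof -
    have "h t \<notin> \<Lambda>"
    proof
      assume "h t \<in> \<Lambda>"
      then have "embed_affine (\<gamma> t) = 0" using h(3)[OF t] by (simp add: p_lattice)
      then show False using embed_affine_simps(1)[of "\<gamma> t"] by simp
    qed
    then show ?thesis using h(3)[OF t] by (simp add: p_affine embed_affine_inject \<phi>_def)
  qed
  then show thesis using that[of h] h by (simp add: lifts_def pathstart_def)
qed

text \<open>Zeros of X' are the branch points of X. By nonsingularity Y is a local coordinate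
  there.\<close>

lemma Y_deriv: 
  assumes "u \<notin> \<Lambda>" "X' u = 0" 
  shows "(Y has_field_derivative - partial_x \<mu> (\<phi> u)) (at u)" "partial_x \<mu> (\<phi> u) \<noteq> 0"
proof -
  have "(Y has_field_derivative ((6 * X u ^ 2 + b2 \<mu> * X u + b4 \<mu>) - \<mu> 1 * X' u - 0) / 2) (at u)"
    unfolding Y_def[abs_def] 
    by (intro DERIV_cdivide DERIV_diff DERIV_cmult DERIV_const X_deriv X'_deriv assms(1))
  moreover have "- 2 * partial_x \<mu> (\<phi> u) = 6 * X u ^ 2 + b2 \<mu> * X u + b4 \<mu>"
    using assms(2) by (simp add: partial_x_def \<phi>_def Y_def b2_def b4_def field_simps power2_eq_square)
  ultimately have "(Y has_field_derivative (- 2 * partial_x \<mu> (\<phi> u) - 0 - 0) / 2) (at u)" using assms(2) by simp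
  then show "(Y has_field_derivative - partial_x \<mu> (\<phi> u)) (at u)" by simp
  have "partial_y \<mu> (\<phi> u) = 0" unfolding \<phi>_def partial_y_def using partial_y_Y[of u] assms(2) by simp
  then show "partial_x \<mu> (\<phi> u) \<noteq> 0"
    using nonsingular XY_in_curve[OF assms(1)] unfolding nonsingular_def \<phi>_def by blast
qed

text \<open>\<omega>_1 pulls back to du; the two cases of \<open>omega1\<close> correspond to X and
  Y as local coordinates.\<close>

lemma lift_derivative:
  assumes g: "lifts \<gamma> g" and t: "t \<in> {0<..<1}" and d: "(\<gamma> has_vector_derivative d) (at t)"
  shows "(g has_vector_derivative omega1 \<mu> (\<gamma> t) d) (at t)"
proof -
  have gt: "g t \<notin> \<Lambda>" "\<phi> (g t) = \<gamma> t" using g t by (auto simp: lifts_def)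
  have "isCont g t"
    using g t continuous_on_interior[of "{0..1}" g t] by (simp add: lifts_def path_def)
  have ev: "\<forall>s\<in>{0<..<1}. \<gamma> s = \<phi> (g s)" using g by (auto simp: lifts_def)
  have "((\<lambda>s. fst (\<gamma> s)) has_vector_derivative fst d) (at t)" "((\<lambda>s. snd (\<gamma> s)) has_vector_derivative snd d) (at t)"
    using bounded_linear.has_vector_derivative[OF bounded_linear_fst d] bounded_linear.has_vector_derivative[OF bounded_linear_snd d] by auto
  then have XY: "((\<lambda>s. X (g s)) has_vector_derivative fst d) (at t)" "((\<lambda>s. Y (g s)) has_vector_derivative snd d) (at t)"
    using ev t by (auto elim!: has_vector_derivative_transform_within_open[where S = "{0<..<1}"] simp: \<phi>_def)
  have py: "partial_y \<mu> (\<gamma> t) = X' (g t)" unfolding gt(2)[symmetric] \<phi>_def partial_y_def using partial_y_Y by simp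
  show ?thesis
  proof (cases "X' (g t) = 0")
    case False
    then show ?thesis
      using has_vector_derivative_lift[OF X_holomorphic open_complement _ X_deriv[OF gt(1)] _ \<open>isCont g t\<close> XY(1)] gt(1)
      by (simp add: omega1_def py case_prod_beta)
  next
    case True
    have "X' holomorphic_on - \<Lambda>"
      unfolding holomorphic_on_def field_differentiable_def using X'_deriv has_field_derivative_at_within by blast
    then have "Y holomorphic_on - \<Lambda>"
      unfolding Y_def[abs_def] by (intro holomorphic_intros X_holomorphic) auto
    from has_vector_derivative_lift[OF this open_complement _ Y_deriv(1)[OF gt(1) True] _ \<open>isCont g t\<close> XY(2)] gt Y_deriv(2)[OF gt(1) True]
    show ?thesis by (simp add: omega1_def py True case_prod_beta)
  qed
qed

text \<open>Along a lift g the two forms have the primitives g and \<zeta>(g), since \<eta>_1 pulls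
  back to -X du and \<zeta>' = -X.\<close>

lemma period_integrals:
  assumes "valid_path \<gamma>" and g: "lifts \<gamma> g"
  shows "form_integral (omega1 \<mu>) \<gamma> = g 1 - g 0" "form_integral (eta1 \<mu>) \<gamma> = \<zeta> (g 1) - \<zeta> (g 0)"
proof -
  obtain S where S: "finite S" "\<gamma> C1_differentiable_on ({0..1} - S)"
    using assms(1) unfolding valid_path_def piecewise_C1_differentiable_on_def by blast
  have d: "(g has_vector_derivative omega1 \<mu> (\<gamma> t) (vector_derivative \<gamma> (at t))) (at t)" if t: "t \<in> {0<..<1} - S" for t
  proof (rule lift_derivative[OF g])
    show "(\<gamma> has_vector_derivative vector_derivative \<gamma> (at t)) (at t)"
    proof -
      obtain D where "\<forall>x\<in>{0..1} - S. (\<gamma> has_vector_derivative D x) (at x)" using S(2) unfolding C1_differentiable_on_def by blast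
      then have "(\<gamma> has_vector_derivative D t) (at t)" using t by simp
      then show ?thesis using vector_derivative_at by metis
    qed
  qed (use t in auto)
  have cont: "continuous_on {0..1} g" using g by (simp add: lifts_def path_def)
  show "form_integral (omega1 \<mu>) \<gamma> = g 1 - g 0"
    unfolding form_integral_def by (intro integral_unique fundamental_theorem_of_calculus_interior_strong[OF S(1) _ d cont]) auto
  have "((\<lambda>t. eta1 \<mu> (\<gamma> t) (vector_derivative \<gamma> (at t))) has_integral (\<zeta> \<circ> g) 1 - (\<zeta> \<circ> g) 0) {0..1}"
  proof (rule fundamental_theorem_of_calculus_interior_strong[OF S(1)])
    fix t :: real assume t: "t \<in> {0<..<1} - S"
    have gt: "g t \<notin> \<Lambda>" "\<gamma> t = \<phi> (g t)" using g t by (auto simp: lifts_def)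
    show "(\<zeta> \<circ> g has_vector_derivative eta1 \<mu> (\<gamma> t) (vector_derivative \<gamma> (at t))) (at t)"
      using field_vector_diff_chain_at[OF d[OF t] \<zeta>_deriv[OF gt(1)]] by (simp add: eta1_def gt(2) \<phi>_def mult.commute)
  next
    have "continuous_on (- \<Lambda>) \<zeta>" using \<zeta>_deriv by (intro DERIV_continuous_on[of _ _ "\<lambda>u. - X u"]) (auto intro: has_field_derivative_at_within)
    moreover have "g ` {0..1} \<subseteq> - \<Lambda>" using g by (auto simp: lifts_def)
    ultimately show "continuous_on {0..1} (\<zeta> \<circ> g)"
      by (rule continuous_on_compose[OF cont continuous_on_subset])
  qed simp
  then show "form_integral (eta1 \<mu>) \<gamma> = \<zeta> (g 1) - \<zeta> (g 0)" unfolding form_integral_def by (simp add: integral_unique)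
qed

end

section \<open>Generation of the lattice by the two periods\<close>

locale curve_with_periods = nonsingular_curve +
  fixes \<alpha> \<beta> :: "real \<Rightarrow> complex \<times> complex"
  assumes basis: "period_basis \<mu> \<alpha> \<beta>"
begin

definition \<omega> where "\<omega> = form_integral (omega1 \<mu>) \<alpha>"
definition \<omega>' where "\<omega>' = form_integral (omega1 \<mu>) \<beta>"

lemma closed_paths: "valid_path \<alpha>" "path_image \<alpha> \<subseteq> affine_curve \<mu>" "pathfinish \<alpha> = pathstart \<alpha>"
    "valid_path \<beta>" "path_image \<beta> \<subseteq> affine_curve \<mu>" "pathfinish \<beta> = pathstart \<alpha>" "pathstart \<beta> = pathstart \<alpha>"
  using basis unfolding period_basis_def closed_curve_path_def generate_fundamental_group_def by auto

lemma basepoint: obtains u where "u \<notin> \<Lambda>" "\<phi> u = pathstart \<alpha>"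
  using \<phi>_surjective[of "pathstart \<alpha>"] closed_paths(2) pathstart_in_path_image[of \<alpha>] by blast

lemma lift_closed:
  assumes "valid_path \<gamma>" "path_image \<gamma> \<subseteq> affine_curve \<mu>" "pathfinish \<gamma> = pathstart \<gamma>" "u \<notin> \<Lambda>" "\<phi> u = pathstart \<gamma>"
  obtains g where "lifts \<gamma> g" "g 0 = u" "g 1 = u + form_integral (omega1 \<mu>) \<gamma>" "form_integral (omega1 \<mu>) \<gamma> \<in> \<Lambda>"
    "form_integral (eta1 \<mu>) \<gamma> = \<zeta> (u + form_integral (omega1 \<mu>) \<gamma>) - \<zeta> u"
proof -
  obtain g where g: "lifts \<gamma> g" "g 0 = u" using exists_lift[OF valid_path_imp_path[OF assms(1)] assms(2,4,5)] .
  note i = period_integrals[OF assms(1) g(1), unfolded g(2)]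
  have "\<phi> (g 1) = \<phi> u" "g 1 \<notin> \<Lambda>" using g(1) assms(3,5) by (auto simp: lifts_def pathstart_def pathfinish_def)
  then have "g 1 - u \<in> \<Lambda>" using \<phi>_eq_iff assms(4) by blast
  then show thesis using that[OF g] i by simp
qed

lemma periods: "\<omega> \<in> \<Lambda>" "\<omega>' \<in> \<Lambda>" "u \<notin> \<Lambda> \<Longrightarrow> \<phi> u = pathstart \<alpha> \<Longrightarrow> form_integral (eta1 \<mu>) \<alpha> = \<zeta> (u + \<omega>) - \<zeta> u"
proof -
  obtain u0 where u0: "u0 \<notin> \<Lambda>" "\<phi> u0 = pathstart \<alpha>" using basepoint .
  show "\<omega> \<in> \<Lambda>" using lift_closed[OF closed_paths(1,2,3) u0] unfolding \<omega>_def by blast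
  show "\<omega>' \<in> \<Lambda>" using lift_closed[OF closed_paths(4,5) _ u0(1)] closed_paths(6,7) u0(2) unfolding \<omega>'_def by metis
  show "form_integral (eta1 \<mu>) \<alpha> = \<zeta> (u + \<omega>) - \<zeta> u" if "u \<notin> \<Lambda>" "\<phi> u = pathstart \<alpha>"
    using lift_closed[OF closed_paths(1,2,3) that] unfolding \<omega>_def by blast
qed

lemma lifts_reversepath: "lifts \<gamma> g \<Longrightarrow> lifts (reversepath \<gamma>) (reversepath g)"
  by (auto simp: lifts_def reversepath_def path_reversepath[unfolded reversepath_def])

lemma lifts_translate:
  assumes "lifts \<gamma> g" "l \<in> \<Lambda>"
  shows "lifts \<gamma> (\<lambda>t. g t + l)"
  using assms by (auto simp: lifts_def path_def \<phi>_period lattice_add_iff intro!: continuous_intros)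

lemma lifts_joinpaths:
  assumes "lifts \<gamma> g" "lifts \<delta> h" "g 1 = h 0"
  shows "lifts (\<gamma> +++ \<delta>) (g +++ h)"
proof -
  have "path (g +++ h)" using assms by (intro path_join_imp) (auto simp: lifts_def pathstart_def pathfinish_def)
  moreover have "(g +++ h) t \<notin> \<Lambda> \<and> \<phi> ((g +++ h) t) = (\<gamma> +++ \<delta>) t" if t: "t \<in> {0..1}" for t
  proof (cases "t \<le> 1 / 2")
    case True
    then have "2 * t \<in> {0..1}" using t by simp
    then show ?thesis using assms(1) True by (simp add: lifts_def joinpaths_def)
  next
    case False
    then have "2 * t - 1 \<in> {0..1}" using t by simp
    then show ?thesis using assms(2) False by (simp add: lifts_def joinpaths_def)
  qed
  ultimately show ?thesis by (simp add: lifts_def)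
qed

text \<open>All points over the base point are allowed as start, because the lift of a joined loop
  continues at the end of the first lift.\<close>

lemma loop_words_lift:
  assumes "\<gamma> \<in> loop_words \<alpha> \<beta>"
  shows "\<forall>u. u \<notin> \<Lambda> \<and> \<phi> u = pathstart \<alpha> \<longrightarrow> (\<exists>g m n. lifts \<gamma> g \<and> g 0 = u \<and> g 1 = u + (of_int m * \<omega> + of_int n * \<omega>'))"
  using assms
proof induction
  case 1
  show ?case
  proof (intro allI impI)
    fix u assume "u \<notin> \<Lambda> \<and> \<phi> u = pathstart \<alpha>"
    then have "lifts (\<lambda>_. pathstart \<alpha>) (\<lambda>_. u)" by (simp add: lifts_def path_def)
    then show "\<exists>g m n. lifts (\<lambda>_. pathstart \<alpha>) g \<and> g 0 = u \<and> g 1 = u + (of_int m * \<omega> + of_int n * \<omega>')"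
      by (intro exI[of _ "\<lambda>_. u"] exI[of _ 0]) simp
  qed
next
  case 2
  show ?case
  proof (intro allI impI)
    fix u assume "u \<notin> \<Lambda> \<and> \<phi> u = pathstart \<alpha>"
    then obtain g where "lifts \<alpha> g" "g 0 = u" "g 1 = u + \<omega>" using lift_closed[OF closed_paths(1,2,3)] unfolding \<omega>_def by metis
    then show "\<exists>g m n. lifts \<alpha> g \<and> g 0 = u \<and> g 1 = u + (of_int m * \<omega> + of_int n * \<omega>')"
      by (intro exI[of _ g] exI[of _ 1] exI[of _ 0]) simp
  qed
next
  case 3
  show ?case
  proof (intro allI impI)
    fix u assume "u \<notin> \<Lambda> \<and> \<phi> u = pathstart \<alpha>"
    then obtain g where "lifts \<beta> g" "g 0 = u" "g 1 = u + \<omega>'" 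
      using lift_closed[OF closed_paths(4,5), of u] closed_paths(6,7) unfolding \<omega>'_def by metis
    then show "\<exists>g m n. lifts \<beta> g \<and> g 0 = u \<and> g 1 = u + (of_int m * \<omega> + of_int n * \<omega>')"
      by (intro exI[of _ g] exI[of _ 0] exI[of _ 1]) simp
  qed
next
  case (4 \<gamma>)
  show ?case
  proof (intro allI impI)
    fix u assume u: "u \<notin> \<Lambda> \<and> \<phi> u = pathstart \<alpha>"
    with 4 obtain g m n where g: "lifts \<gamma> g" "g 0 = u" "g 1 = u + (of_int m * \<omega> + of_int n * \<omega>')" by blast
    let ?l = "- (of_int m * \<omega> + of_int n * \<omega>')"
    have "?l \<in> \<Lambda>" unfolding lattice_minus_iff by (intro lattice_add lattice_of_int periods)
    \<comment> \<open>The reversed lift starts at the far end and is moved back to u by a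
      period.\<close>
    then have "lifts (reversepath \<gamma>) (\<lambda>t. reversepath g t + ?l)" by (intro lifts_translate lifts_reversepath g)
    then show "\<exists>h m n. lifts (reversepath \<gamma>) h \<and> h 0 = u \<and> h 1 = u + (of_int m * \<omega> + of_int n * \<omega>')"
      by (intro exI[of _ "\<lambda>t. reversepath g t + ?l"] exI[of _ "- m"] exI[of _ "- n"]) (auto simp: reversepath_def g algebra_simps)
  qed
next
  case (5 \<gamma> \<delta>)
  show ?case
  proof (intro allI impI)
    fix u assume u: "u \<notin> \<Lambda> \<and> \<phi> u = pathstart \<alpha>"
    with 5 obtain g m n where g: "lifts \<gamma> g" "g 0 = u" "g 1 = u + (of_int m * \<omega> + of_int n * \<omega>')" by blast
    have l: "of_int m * \<omega> + of_int n * \<omega>' \<in> \<Lambda>" by (intro lattice_add lattice_of_int periods)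
    then have "g 1 \<notin> \<Lambda> \<and> \<phi> (g 1) = pathstart \<alpha>" using u unfolding g(3) by (simp add: lattice_add_iff \<phi>_period)
    with 5 obtain h m' n' where h: "lifts \<delta> h" "h 0 = g 1" "h 1 = g 1 + (of_int m' * \<omega> + of_int n' * \<omega>')" by blast
    have "lifts (\<gamma> +++ \<delta>) (g +++ h)" using lifts_joinpaths[OF g(1) h(1)] h(2) by simp
    then show "\<exists>h m n. lifts (\<gamma> +++ \<delta>) h \<and> h 0 = u \<and> h 1 = u + (of_int m * \<omega> + of_int n * \<omega>')"
      by (intro exI[of _ "g +++ h"] exI[of _ "m + m'"] exI[of _ "n + n'"]) (auto simp: joinpaths_def g h(3) algebra_simps)
  qed
qed

text \<open>A path from u to u + l off the lattice projects to a loop in the affine curve. In the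
  complete curve it is homotopic to a word in \<alpha> and \<beta>, and by monodromy its lift ends
  where that of the word does. The homotopy may pass through infinity, so it is lifted along
  \<open>p\<close> and not along \<open>\<phi>\<close>.\<close>

lemma lattice_generated: assumes "l \<in> \<Lambda>" obtains m n :: int where "l = of_int m * \<omega> + of_int n * \<omega>'"
proof -
  obtain u where u: "u \<notin> \<Lambda>" "\<phi> u = pathstart \<alpha>" using basepoint .
  have "path_connected (- \<Lambda>)" by (intro path_connected_complement_countable zeros_countable) simp
  moreover have "u + l \<notin> \<Lambda>" using u assms by (simp add: lattice_add_iff)
  ultimately obtain h where h: "path h" "path_image h \<subseteq> - \<Lambda>" "pathstart h = u" "pathfinish h = u + l"
    using u(1) unfolding path_connected_def by (metis ComplI)
  have hL: "h t \<notin> \<Lambda>" if "t \<in> {0..1}" for t using h(2) that unfolding path_image_def by blast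
  define \<gamma> where "\<gamma> = Some \<circ> (\<lambda>t. \<phi> (h t))"
  have "continuous_on (- \<Lambda>) X" "continuous_on (- \<Lambda>) X'"
    using X_deriv X'_deriv by (auto intro!: DERIV_continuous_on intro: has_field_derivative_at_within)
  then have "continuous_on (- \<Lambda>) \<phi>" unfolding \<phi>_def[abs_def] Y_def by (intro continuous_intros) auto
  moreover have "h ` {0..1} \<subseteq> - \<Lambda>" using hL by blast
  moreover have "continuous_on {0..1} h" using h(1) by (simp add: path_def)
  ultimately have "continuous_on {0..1} (\<lambda>t. \<phi> (h t))"
    using continuous_on_compose2 by blast
  moreover have "\<phi> (h t) \<in> affine_curve \<mu>" if "t \<in> {0..1}" for t using XY_in_curve[OF hL[OF that]] by (simp add: \<phi>_def)
  ultimately have "continuous_map (top_of_set {0..1}) (top_of_set (affine_curve \<mu>)) (\<lambda>t. \<phi> (h t))"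
    by (auto simp: continuous_map_in_subtopology)
  then have "pathin (curve \<mu>) \<gamma>"
    unfolding pathin_def \<gamma>_def curve_def by (rule continuous_map_compose) (rule continuous_map_Some)
  moreover have ends: "\<gamma> 0 = Some (pathstart \<alpha>)" "\<gamma> 1 = Some (pathstart \<alpha>)"
    using h(3,4) u(2) assms by (auto simp: \<gamma>_def pathstart_def pathfinish_def \<phi>_period)
  ultimately obtain \<delta> where \<delta>: "\<delta> \<in> loop_words \<alpha> \<beta>" and
    hom: "homotopic_with (\<lambda>\<rho>. \<rho> 0 = Some (pathstart \<alpha>) \<and> \<rho> 1 = Some (pathstart \<alpha>)) (top_of_set {0..1}) (curve \<mu>) \<gamma> (Some \<circ> \<delta>)"
    using basis unfolding period_basis_def generate_fundamental_group_def by blast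
  from loop_words_lift[OF \<delta>] u obtain g m n where g: "lifts \<delta> g" "g 0 = u" "g 1 = u + (of_int m * \<omega> + of_int n * \<omega>')" by blast
  have "continuous_map (curve \<mu>) (top_of_set (range p)) embed_curve"
    using p_lattice[OF lattice_0] by (intro continuous_map_embed_curve embed_affine_in_range) (auto intro: range_eqI[of _ _ 0])
  from homotopic_with_compose_continuous_map_left[OF hom this, where q = "\<lambda>r. r 0 = embed_affine (pathstart \<alpha>) \<and> r 1 = embed_affine (pathstart \<alpha>)"]
  have hp: "homotopic_paths (range p) (embed_curve \<circ> \<gamma>) (embed_curve \<circ> (Some \<circ> \<delta>))"
    using ends by (simp add: homotopic_paths_def pathstart_def pathfinish_def embed_curve_def)
  have "pathfinish h = pathfinish g"
  proof (rule covering_space_monodromy[OF covering _ _ _ _ hp h(1) _ _ _ _ _ ])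
    show "path (embed_curve \<circ> \<gamma>)" "path (embed_curve \<circ> (Some \<circ> \<delta>))" using homotopic_paths_imp_path[OF hp] by auto
    show "path_image (embed_curve \<circ> \<gamma>) \<subseteq> range p" "path_image (embed_curve \<circ> (Some \<circ> \<delta>)) \<subseteq> range p"
      using homotopic_paths_imp_subset[OF hp] by auto
    show "p (h t) = (embed_curve \<circ> \<gamma>) t" if "t \<in> {0..1}" for t
      using p_affine[OF hL[OF that]] by (simp add: \<gamma>_def embed_curve_def \<phi>_def)
    show "p (g t) = (embed_curve \<circ> (Some \<circ> \<delta>)) t" if "t \<in> {0..1}" for t
      using lifts_p[OF g(1) that] by (simp add: embed_curve_def)
    show "path g" using g(1) by (simp add: lifts_def)
    show "pathstart h = pathstart g" using h(3) g(2) by (simp add: pathstart_def)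
  qed auto
  then have "u + l = u + (of_int m * \<omega> + of_int n * \<omega>')" using h(4) g(3) by (simp add: pathfinish_def)
  then show thesis using that by simp
qed

end

section \<open>Theta function and quasi-periodic entire functions\<close>

lemma summable_on_int:
  fixes f :: "int \<Rightarrow> real"
  assumes "\<And>n. 0 \<le> f n" "summable (\<lambda>n. f (int n))" "summable (\<lambda>n. f (- int (Suc n)))"
  shows "f summable_on UNIV"
proof -
  have "f summable_on range int"
    using summable_nonneg_imp_summable_on[OF assms(2,1)] by (subst summable_on_reindex) (simp_all add: o_def)
  moreover have "f summable_on range (\<lambda>n. - int (Suc n))"
    using summable_nonneg_imp_summable_on[OF assms(3,1)] by (subst summable_on_reindex) (simp_all add: o_def inj_def)
  moreover have "range int \<inter> range (\<lambda>n. - int (Suc n)) = {}" by auto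
  ultimately have "f summable_on (range int \<union> range (\<lambda>n. - int (Suc n)))" by (rule summable_on_Un_disjoint)
  also have "range int \<union> range (\<lambda>n. - int (Suc n)) = UNIV" using int_cases by (metis (no_types, lifting) UNIV_eq_I Un_iff rangeI)
  finally show ?thesis .
qed

definition theta_term :: "complex \<Rightarrow> int \<Rightarrow> complex \<Rightarrow> complex" where
  "theta_term \<tau> n z = exp (of_real pi * \<i> * \<tau> * (of_int n + 1/2)^2 + 2 * of_real pi * \<i> * (of_int n + 1/2) * (z + 1/2))"

definition theta :: "complex \<Rightarrow> complex \<Rightarrow> complex" where
  "theta \<tau> z = (\<Sum>\<^sub>\<infinity>n. theta_term \<tau> n z)"

text \<open>Completing the square with the linear coefficient 2 pi r + 1 in place of 2 pi r leaves
  the summable factor exp (-|n + 1/2|).\<close>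

definition theta_majorant :: "complex \<Rightarrow> real \<Rightarrow> int \<Rightarrow> real" where
  "theta_majorant \<tau> r n = exp ((2 * pi * r + 1)^2 / (4 * (pi * Im \<tau>))) * exp (- \<bar>of_int n + 1/2\<bar>)"

lemma quadratic_bound:
  fixes a b x :: real
  assumes "a > 0" shows "b * x - a * x ^ 2 \<le> b ^ 2 / (4 * a)"
proof -
  have "0 \<le> (2 * a * x - b) ^ 2 / (4 * a)" using assms by (intro divide_nonneg_pos) auto
  also have "\<dots> = a * x ^ 2 - b * x + b ^ 2 / (4 * a)" using assms by (simp add: field_simps power2_eq_square)
  finally show ?thesis by simp
qed

lemma entire_product_zero:
  assumes "f holomorphic_on UNIV" "g holomorphic_on UNIV" "\<And>z. f z * g z = 0" "g w \<noteq> 0"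
  shows "f z = (0 :: complex)"
proof -
  have "continuous_on UNIV g" using assms(2) by (rule holomorphic_on_imp_continuous_on)
  then have "open (g -` (- {0}))" by (intro open_vimage) auto
  then show ?thesis
    by (rule analytic_continuation_open[where s' = UNIV and g = "\<lambda>_. 0"]) (use assms in auto)
qed

text \<open>The zeros of g are simple and are zeros of f, so f / g extends continuously by f' / g'
  and the singularities are removable.\<close>

lemma entire_quotient:
  assumes f: "f holomorphic_on UNIV" and g: "g holomorphic_on UNIV"
    and zeros: "\<And>z. g z = 0 \<Longrightarrow> f z = 0 \<and> deriv g z \<noteq> 0"
  obtains W where "W holomorphic_on UNIV" "\<And>z. f z = W z * g z"
proof -
  define W where "W z = (if g z = 0 then deriv f z / deriv g z else f z / g z)" for z
  have D: "(f has_field_derivative deriv f z) (at z)" "(g has_field_derivative deriv g z) (at z)" for z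
    using f g holomorphic_derivI by blast+
  have off: "W holomorphic_on {z. g z \<noteq> 0}"
  proof -
    have "(\<lambda>z. f z / g z) holomorphic_on {z. g z \<noteq> 0}"
      using f g holomorphic_on_subset by (intro holomorphic_intros) auto
    then show ?thesis by (rule holomorphic_transform) (simp add: W_def)
  qed
  have op: "open {z. g z \<noteq> 0}"
    using holomorphic_on_imp_continuous_on[OF g] by (intro open_Collect_neq) auto
  have "W field_differentiable (at z)" for z
  proof (cases "g z = 0")
    case False
    then show ?thesis using holomorphic_on_imp_differentiable_at[OF off op] by simp
  next
    case True
    obtain r where r: "r > 0" "inj_on g (ball z r)"
      using has_complex_derivative_locally_injective[OF g UNIV_I open_UNIV] zeros[OF True] by metis
    have only: "g w \<noteq> 0" if "w \<in> ball z r - {z}" for w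
      using inj_onD[OF r(2), of w z] that r(1) True by auto
    have "W holomorphic_on ball z r"
    proof (rule no_isolated_singularity'[of "{z}"])
      show "W holomorphic_on ball z r - {z}" by (rule holomorphic_on_subset[OF off]) (use only in blast)
      show "(W \<longlongrightarrow> W w) (at w within ball z r)" if "w \<in> {z}" for w
      proof -
        have "((\<lambda>w. f w / g w) \<longlongrightarrow> W z) (at z)"
          by (rule lhopital_complex_simple[OF D]) (use zeros[OF True] True in \<open>auto simp: W_def\<close>)
        moreover have "\<forall>\<^sub>F w in at z. f w / g w = W w"
          using eventually_at_ball'[OF r(1), of z UNIV] by eventually_elim (use only in \<open>auto simp: W_def\<close>)
        ultimately have "(W \<longlongrightarrow> W z) (at z)" by (rule Lim_transform_eventually)
        then show ?thesis using that by (auto intro: tendsto_within_subset)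
      qed
    qed auto
    then show ?thesis using holomorphic_on_imp_differentiable_at[OF _ open_ball, of W z r z] r(1) by simp
  qed
  then have "W holomorphic_on UNIV" unfolding holomorphic_on_def by (blast intro: field_differentiable_at_within)
  moreover have "f z = W z * g z" for z using zeros[of z] by (auto simp: W_def)
  ultimately show thesis by (rule that)
qed

lemma periodic_multiple:
  fixes h :: "complex \<Rightarrow> complex"
  assumes "\<And>z. h (z + 1) = h z"
  shows "h (z + of_int n) = h z"
proof (induction n rule: int_induct[of _ 0])
  case (step1 n)
  then show ?case using assms[of "z + of_int n"] by (simp add: add_ac)
next
  case (step2 n)
  then show ?case using assms[of "z + of_int (n - 1)"] by (simp add: add_ac)
qed simp

context
  fixes \<tau> :: complex
  assumes tau: "Im \<tau> > 0"
begin

lemma theta_term_bound: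
  assumes "\<bar>Im z\<bar> \<le> r"
  shows "norm (theta_term \<tau> n z) \<le> theta_majorant \<tau> r n"
proof -
  let ?x = "of_int n + 1/2 :: real"
  have e: "theta_term \<tau> n z = exp (of_real pi * \<i> * \<tau> * of_real (?x ^ 2) + 2 * of_real pi * \<i> * of_real ?x * (z + 1/2))"
    by (simp add: theta_term_def)
  have "norm (theta_term \<tau> n z) = exp (- (pi * Im \<tau>) * ?x ^ 2 - 2 * pi * ?x * Im z)"
    unfolding e norm_exp_eq_Re by (simp add: algebra_simps)
  also have "\<dots> \<le> exp ((2 * pi * r + 1)^2 / (4 * (pi * Im \<tau>)) - \<bar>?x\<bar>)"
  proof -
    have "- (2 * pi * ?x * Im z) \<le> 2 * pi * r * \<bar>?x\<bar>"
    proof -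
      have "- (2 * pi * ?x * Im z) \<le> \<bar>2 * pi * ?x * Im z\<bar>" by linarith
      also have "\<dots> = 2 * pi * \<bar>?x\<bar> * \<bar>Im z\<bar>" by (simp add: abs_mult)
      also have "\<dots> \<le> 2 * pi * \<bar>?x\<bar> * r" using assms by (intro mult_left_mono) auto
      finally show ?thesis by (simp add: mult_ac)
    qed
    moreover have "(2 * pi * r + 1) * \<bar>?x\<bar> - (pi * Im \<tau>) * \<bar>?x\<bar> ^ 2 \<le> (2 * pi * r + 1)^2 / (4 * (pi * Im \<tau>))"
      by (rule quadratic_bound) (use tau in simp)
    ultimately show ?thesis by (simp add: algebra_simps)
  qed
  also have "\<dots> = theta_majorant \<tau> r n" by (simp only: theta_majorant_def diff_conv_add_uminus exp_add)
  finally show ?thesis .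
qed

lemma theta_majorant_summable: "theta_majorant \<tau> r summable_on UNIV"
proof (rule summable_on_int)
  have g: "summable (\<lambda>n. c * exp (- 1 :: real) ^ n)" for c by (intro summable_mult summable_geometric) simp
  have "exp (- \<bar>real n + 1/2\<bar>) = exp (- 1 / 2) * exp (- 1) ^ n" for n
    by (simp add: exp_of_nat_mult[symmetric] mult_exp_exp)
  then show "summable (\<lambda>n. theta_majorant \<tau> r (int n))"
    unfolding theta_majorant_def of_int_of_nat_eq by (simp only: mult.assoc[symmetric] g)
  have "\<bar>of_int (- int (Suc n)) + 1/2\<bar> = real n + 1/2" for n by simp
  then have "exp (- \<bar>of_int (- int (Suc n)) + 1/2\<bar>) = exp (- 1 / 2) * exp (- 1 :: real) ^ n" for n
    by (simp only:) (simp add: exp_of_nat_mult[symmetric] mult_exp_exp)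
  then show "summable (\<lambda>n. theta_majorant \<tau> r (- int (Suc n)))"
    unfolding theta_majorant_def by (simp only: mult.assoc[symmetric] g)
qed (simp add: theta_majorant_def)

lemma theta_uniform_limit:
  assumes "\<And>z. z \<in> S \<Longrightarrow> \<bar>Im z\<bar> \<le> r"
  shows "uniform_limit S (\<lambda>N z. \<Sum>n\<in>N. theta_term \<tau> n z) (theta \<tau>) (finite_subsets_at_top UNIV)"
  unfolding theta_def[abs_def]
  by (rule Weierstrass_m_test_general[OF theta_term_bound[OF assms] theta_majorant_summable])

lemma theta_holomorphic: "theta \<tau> holomorphic_on A"
proof -
  have "theta \<tau> holomorphic_on ball 0 r" for r
  proof (rule holomorphic_uniform_limit)
    show "uniform_limit (cball 0 r) (\<lambda>N z. \<Sum>n\<in>N. theta_term \<tau> n z) (theta \<tau>) (finite_subsets_at_top UNIV)"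
      by (rule theta_uniform_limit[of _ r]) (use abs_Im_le_cmod order_trans in auto)
    show "\<forall>\<^sub>F N in finite_subsets_at_top UNIV. continuous_on (cball 0 r) (\<lambda>z. \<Sum>n\<in>N. theta_term \<tau> n z) \<and> (\<lambda>z. \<Sum>n\<in>N. theta_term \<tau> n z) holomorphic_on ball 0 r"
      unfolding theta_term_def by (intro always_eventually allI conjI continuous_intros holomorphic_intros)
  qed auto
  then have "theta \<tau> field_differentiable (at z)" for z
    using holomorphic_on_imp_differentiable_at[OF _ open_ball, of "theta \<tau>" 0 "norm z + 1" z] by simp
  then show ?thesis unfolding holomorphic_on_def by (blast intro: field_differentiable_at_within)
qed

lemma theta_1: "theta \<tau> (z + 1) = - theta \<tau> z"
proof -
  have "theta_term \<tau> n (z + 1) = - 1 * theta_term \<tau> n z" for n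
  proof -
    have "theta_term \<tau> n (z + 1) = theta_term \<tau> n z * exp (2 * of_real pi * \<i> * of_int n + of_real pi * \<i>)"
      unfolding theta_term_def mult_exp_exp by (intro arg_cong[of _ _ exp]) (simp add: algebra_simps)
    also have "exp (2 * of_real pi * \<i> * of_int n + of_real pi * \<i>) = (- 1 :: complex)"
      unfolding exp_add by (simp add: exp_integer_2pi mult_ac)
    finally show ?thesis by simp
  qed
  then show ?thesis unfolding theta_def by (simp only: infsum_cmult_right') simp
qed

lemma theta_tau: "theta \<tau> (z + \<tau>) = - exp (- (of_real pi * \<i> * \<tau>) - 2 * of_real pi * \<i> * z) * theta \<tau> z"
proof -
  let ?c = "- exp (- (of_real pi * \<i> * \<tau>) - 2 * of_real pi * \<i> * z)"
  have "theta_term \<tau> n (z + \<tau>) = ?c * theta_term \<tau> (n + 1) z" for n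
  proof -
    have "theta_term \<tau> n (z + \<tau>) = theta_term \<tau> (n + 1) z * exp (- (of_real pi * \<i> * \<tau>) - 2 * of_real pi * \<i> * z - of_real pi * \<i>)"
      unfolding theta_term_def mult_exp_exp by (intro arg_cong[of _ _ exp]) (simp add: algebra_simps power2_eq_square)
    also have "exp (- (of_real pi * \<i> * \<tau>) - 2 * of_real pi * \<i> * z - of_real pi * \<i>) = ?c"
      by (subst exp_diff) simp
    finally show ?thesis by simp
  qed
  then have "theta \<tau> (z + \<tau>) = ?c * (\<Sum>\<^sub>\<infinity>n. theta_term \<tau> (n + 1) z)"
    unfolding theta_def by (simp only: infsum_cmult_right')
  also have "(\<Sum>\<^sub>\<infinity>n. theta_term \<tau> (n + 1) z) = theta \<tau> z"
    unfolding theta_def by (rule infsum_reindex_bij_betw) (rule bij_betwI[of _ _ _ "\<lambda>n. n - 1"], auto)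
  finally show ?thesis .
qed

lemma theta_minus: "theta \<tau> (- z) = - theta \<tau> z"
proof -
  have "theta_term \<tau> n (- z) = - 1 * theta_term \<tau> (- n - 1) z" for n
  proof -
    have "theta_term \<tau> n (- z) = theta_term \<tau> (- n - 1) z * exp (2 * of_real pi * \<i> * of_int n + of_real pi * \<i>)"
      unfolding theta_term_def mult_exp_exp by (intro arg_cong[of _ _ exp]) (simp add: algebra_simps power2_eq_square)
    also have "exp (2 * of_real pi * \<i> * of_int n + of_real pi * \<i>) = (- 1 :: complex)"
      unfolding exp_add by (simp add: exp_integer_2pi mult_ac)
    finally show ?thesis by simp
  qed
  then have "theta \<tau> (- z) = - 1 * (\<Sum>\<^sub>\<infinity>n. theta_term \<tau> (- n - 1) z)"
    unfolding theta_def by (simp only: infsum_cmult_right')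
  also have "(\<Sum>\<^sub>\<infinity>n. theta_term \<tau> (- n - 1) z) = theta \<tau> z"
    unfolding theta_def by (rule infsum_reindex_bij_betw) (rule bij_betwI[of _ _ _ "\<lambda>n. - n - 1"], auto)
  finally show ?thesis by simp
qed

text \<open>On the real line theta is exp(pi i x) times a Fourier series with coefficients a n. If
  it were 0, integration over a period would give a 0 = 0, but a 0 is a value of exp.\<close>

lemma theta_nonzero: "\<exists>z. theta \<tau> z \<noteq> 0"
proof (rule ccontr)
  assume "\<nexists>z. theta \<tau> z \<noteq> 0"
  then have zero: "theta \<tau> z = 0" for z by blast
  define a where "a n = exp (of_real pi * \<i> * \<tau> * (of_int n + 1/2)^2 + of_real pi * \<i> * (of_int n + 1/2))" for n
  define e where "e n x = exp (2 * of_real pi * \<i> * of_int n * of_real x)" for n :: int and x :: real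
  have t: "theta_term \<tau> n (of_real x) = a n * exp (of_real pi * \<i> * of_real x) * e n x" for n x
    unfolding theta_term_def a_def e_def mult_exp_exp by (intro arg_cong[of _ _ exp]) (simp add: algebra_simps)
  have bound: "norm (a n * e n x) \<le> theta_majorant \<tau> 0 n" for n x
  proof -
    have "norm (a n * e n x) = norm (theta_term \<tau> n (of_real x))" unfolding t norm_mult by (simp add: norm_exp_eq_Re)
    also have "\<dots> \<le> theta_majorant \<tau> 0 n" by (rule theta_term_bound) simp
    finally show ?thesis .
  qed
  have sum0: "(\<Sum>\<^sub>\<infinity>n. a n * e n x) = 0" for x
  proof -
    have "0 = exp (of_real pi * \<i> * of_real x) * (\<Sum>\<^sub>\<infinity>n. a n * e n x)"
      unfolding zero[of "of_real x", symmetric] theta_def t infsum_cmult_right'[symmetric] by (simp add: mult_ac)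
    then show ?thesis by simp
  qed
  have "uniform_limit {0..1} (\<lambda>N x. \<Sum>n\<in>N. a n * e n x) (\<lambda>x. \<Sum>\<^sub>\<infinity>n. a n * e n x) (finite_subsets_at_top UNIV)"
    by (rule Weierstrass_m_test_general[OF bound theta_majorant_summable])
  then have ul: "uniform_limit {0..1} (\<lambda>N x. \<Sum>n\<in>N. a n * e n x) (\<lambda>x. 0) (finite_subsets_at_top UNIV)"
    unfolding sum0 .
  have cont: "continuous_on {0..1} (\<lambda>x. \<Sum>n\<in>N. a n * e n x)" for N unfolding e_def by (intro continuous_intros)
  obtain I J where I: "\<And>N. ((\<lambda>x. \<Sum>n\<in>N. a n * e n x) has_integral I N) {0..1}" 
     "((\<lambda>x. 0 :: complex) has_integral J) {0..1::real}" "(I \<longlongrightarrow> J) (finite_subsets_at_top UNIV)"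
    by (rule uniform_limit_integral[OF ul cont finite_subsets_at_top_neq_bot]) (rule that)
  have J: "J = 0" using has_integral_unique[OF I(2) has_integral_0] .
  have ie: "(e n has_integral (if n = 0 then 1 else 0)) {0..1}" for n
  proof (cases "n = 0")
    case True
    have "((\<lambda>x::real. 1 :: complex) has_integral 1) {0..1}" using has_integral_const_real[of "1 :: complex" 0 1] by simp
    then show ?thesis using True by (simp add: e_def[abs_def])
  next
    case False
    let ?c = "2 * of_real pi * \<i> * of_int n :: complex"
    have c: "?c \<noteq> 0" using False by simp
    have "(e n has_integral exp (?c * of_real 1) / ?c - exp (?c * of_real 0) / ?c) {0..1}"
    proof (rule fundamental_theorem_of_calculus)
      fix x :: real
      have "((\<lambda>z. exp (?c * z) / ?c) has_field_derivative e n x) (at (of_real x))"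
        using c by (auto intro!: derivative_eq_intros simp: e_def)
      from has_vector_derivative_real_field[OF this] show "((\<lambda>x. exp (?c * of_real x) / ?c) has_vector_derivative e n x) (at x within {0..1})" by simp
    qed simp
    moreover have "exp ?c = 1" using exp_integer_2pi[of "of_int n"] by (simp add: mult_ac)
    ultimately show ?thesis using False by simp
  qed
  have "I N = (\<Sum>n\<in>N. a n * (if n = 0 then 1 else 0))" if "finite N" for N
    by (rule has_integral_unique[OF I(1)]) (intro has_integral_sum that has_integral_mult_right ie)
  then have "\<forall>\<^sub>F N in finite_subsets_at_top UNIV. I N = a 0"
    unfolding eventually_finite_subsets_at_top by (intro exI[of _ "{0}"]) (simp add: if_distrib cong: if_cong)
  then have "(I \<longlongrightarrow> a 0) (finite_subsets_at_top UNIV)" by (rule tendsto_eventually)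
  then have "a 0 = 0" using tendsto_unique[OF finite_subsets_at_top_neq_bot I(3)] J by metis
  then show False by (simp add: a_def)
qed

section \<open>Entire functions with exponential multipliers\<close>

lemma fundamental_cell:
  obtains m n :: int and w where "z = w + of_int m + of_int n * \<tau>" "norm w \<le> 1 + norm \<tau>" "\<bar>Im w\<bar> \<le> Im \<tau>"
proof -
  define y where "y = Im z / Im \<tau>"
  define x where "x = Re z - y * Re \<tau>"
  have z: "z = of_real x + of_real y * \<tau>" using tau by (simp add: complex_eq_iff x_def y_def)
  define w where "w = of_real (frac x) + of_real (frac y) * \<tau>"
  have "z = w + of_int \<lfloor>x\<rfloor> + of_int \<lfloor>y\<rfloor> * \<tau>"
    unfolding z w_def frac_def by (simp add: algebra_simps)
  moreover have "norm w \<le> 1 + norm \<tau>"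
    unfolding w_def using frac_lt_1[of x] frac_lt_1[of y] 
    by (intro norm_triangle_le add_mono) (auto simp: norm_mult mult_left_le_one_le)
  moreover have "\<bar>Im w\<bar> \<le> Im \<tau>"
    unfolding w_def using frac_lt_1[of y] tau by (simp add: abs_mult mult_left_le_one_le)
  ultimately show thesis by (rule that)
qed

text \<open>For n > 0 the multipliers are taken at z, z + \<tau>, ..., z + (n - 1) \<tau>, which
  accounts for n (n - 1) / 2; the same formula covers negative n.\<close>

lemma quasi_periodic_multiple:
  fixes h :: "complex \<Rightarrow> complex" and j :: real
  assumes "\<And>z. h (z + \<tau>) = exp (2 * of_real pi * \<i> * of_real j * z + d) * h z"
  shows "h (z + of_int n * \<tau>) = exp (2 * of_real pi * \<i> * of_real j * (of_int n * z + of_int n * (of_int n - 1) / 2 * \<tau>) + of_int n * d) * h z"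
proof (induction n rule: int_induct[of _ 0])
  case (step1 n)
  have "h (z + of_int (n + 1) * \<tau>) = exp (2 * of_real pi * \<i> * of_real j * (z + of_int n * \<tau>) + d) * h (z + of_int n * \<tau>)"
    using assms[of "z + of_int n * \<tau>"] by (simp add: algebra_simps)
  then show ?case unfolding step1.IH mult.assoc[symmetric] mult_exp_exp
    by (simp only:) (intro arg_cong2[of _ _ _ _ "(*)"] arg_cong[of _ _ exp] refl, simp add: field_simps)
next
  case (step2 n)
  let ?E = "2 * of_real pi * \<i> * of_real j * (z + of_int (n - 1) * \<tau>) + d"
  have "h (z + of_int n * \<tau>) = exp ?E * h (z + of_int (n - 1) * \<tau>)"
    using assms[of "z + of_int (n - 1) * \<tau>"] by (simp add: algebra_simps)
  moreover have "exp (- ?E) * exp ?E = 1" unfolding mult_exp_exp by simp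
  ultimately have "h (z + of_int (n - 1) * \<tau>) = exp (- ?E) * h (z + of_int n * \<tau>)" by (simp only: mult.assoc[symmetric] mult_1_left)
  then show ?case unfolding step2.IH mult.assoc[symmetric] mult_exp_exp
    by (simp only:) (intro arg_cong2[of _ _ _ _ "(*)"] arg_cong[of _ _ exp] refl, simp add: field_simps)
qed simp

text \<open>For j > 0 the modulus of the multiplier of the shift by n \<tau> has a logarithm
  quadratic in n with leading coefficient - pi j Im \<tau>, so these multipliers are bounded on the
  strip containing the cell; for j = 0 they have modulus 1. Hence h is bounded, and Liouville's
  theorem applies.\<close>

theorem quasi_periodic_constant:
  fixes h :: "complex \<Rightarrow> complex" and j :: int
  assumes hol: "h holomorphic_on UNIV" and 1: "\<And>z. h (z + 1) = h z"
    and tau': "\<And>z. h (z + \<tau>) = exp (2 * of_real pi * \<i> * of_int j * z + d) * h z"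
    and j: "j > 0 \<or> j = 0 \<and> exp d = 1"
  shows "\<exists>c. \<forall>z. h z = c" "j > 0 \<Longrightarrow> h z = 0"
proof -
  have "continuous_on (cball 0 (1 + norm \<tau>)) h"
    using hol by (intro holomorphic_on_imp_continuous_on) (auto intro: holomorphic_on_subset)
  then have "compact (h ` cball 0 (1 + norm \<tau>))" by (intro compact_continuous_image compact_cball)
  then obtain M where "\<And>y. y \<in> h ` cball 0 (1 + norm \<tau>) \<Longrightarrow> norm y \<le> M"
    using compact_imp_bounded bounded_iff by metis
  then have M: "norm (h w) \<le> M" if "norm w \<le> 1 + norm \<tau>" for w using that by simp
  have M0: "0 \<le> M" using M[of 0] norm_ge_zero[of "h 0"] by (smt (verit) norm_ge_zero norm_zero)
  have shift: "h (w + of_int m + of_int n * \<tau>) = exp (2 * of_real pi * \<i> * of_int j * (of_int n * w + of_int n * (of_int n - 1) / 2 * \<tau>) + of_int n * d) * h w" for w m n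
  proof -
    have "w + of_int m + of_int n * \<tau> = (w + of_int n * \<tau>) + of_int m" by simp
    then show ?thesis using periodic_multiple[of h "w + of_int n * \<tau>" m] 1 quasi_periodic_multiple[of h "of_int j" d w n] tau' 
      by (simp only: of_real_of_int_eq)
  qed
  obtain B where B: "\<And>w n. \<bar>Im w\<bar> \<le> Im \<tau> \<Longrightarrow> 
      norm (exp (2 * of_real pi * \<i> * of_int j * (of_int n * w + of_int n * (of_int n - 1) / 2 * \<tau>) + of_int n * d)) \<le> B"
  proof (cases "j = 0")
    case True
    then have "exp d = 1" using j by simp
    then have "Re d = 0" by (simp add: exp_eq_1)
    have "norm (exp (2 * of_real pi * \<i> * of_int j * (of_int n * w + of_int n * (of_int n - 1) / 2 * \<tau>) + of_int n * d)) \<le> 1" for w n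
      unfolding norm_exp_eq_Re by (simp add: True \<open>Re d = 0\<close>)
    then show thesis using that by blast
  next
    case False
    then have j0: "real_of_int j > 0" using j by simp
    let ?a = "pi * j * Im \<tau>"
    let ?b = "?a + 2 * pi * j * Im \<tau> + \<bar>Re d\<bar>"
    have "norm (exp (2 * of_real pi * \<i> * of_int j * (of_int n * w + of_int n * (of_int n - 1) / 2 * \<tau>) + of_int n * d)) \<le> exp (?b ^ 2 / (4 * ?a))"
      if w: "\<bar>Im w\<bar> \<le> Im \<tau>" for w n
    proof -
      let ?n = "real_of_int n"
      have e: "2 * of_real pi * \<i> * of_int j * (of_int n * w + of_int n * (of_int n - 1) / 2 * \<tau>) + of_int n * d =
         of_real (2 * pi * j * ?n) * (\<i> * w) + of_real (pi * j * (?n * (?n - 1))) * (\<i> * \<tau>) + of_real ?n * d"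
        by (simp add: field_simps)
      have "Re (2 * of_real pi * \<i> * of_int j * (of_int n * w + of_int n * (of_int n - 1) / 2 * \<tau>) + of_int n * d) =
          ?n * (?a - 2 * pi * j * Im w + Re d) - ?a * ?n ^ 2"
        unfolding e by (simp add: algebra_simps power2_eq_square)
      also have "\<dots> \<le> ?b * \<bar>?n\<bar> - ?a * \<bar>?n\<bar> ^ 2"
      proof -
        have "\<bar>2 * pi * j * Im w\<bar> \<le> 2 * pi * j * Im \<tau>" using w j0 by (simp add: abs_mult)
        then have "\<bar>?a - 2 * pi * j * Im w + Re d\<bar> \<le> ?b" using j0 tau by (intro order_trans[OF abs_triangle_ineq] add_mono order_trans[OF abs_triangle_ineq4]) auto
        then have "\<bar>?n\<bar> * \<bar>?a - 2 * pi * j * Im w + Re d\<bar> \<le> \<bar>?n\<bar> * ?b" by (intro mult_left_mono) auto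
        moreover have "?n * (?a - 2 * pi * j * Im w + Re d) \<le> \<bar>?n\<bar> * \<bar>?a - 2 * pi * j * Im w + Re d\<bar>"
          using abs_ge_self[of "?n * (?a - 2 * pi * j * Im w + Re d)"] unfolding abs_mult .
        ultimately show ?thesis by (simp add: mult.commute)
      qed
      also have "\<dots> \<le> ?b ^ 2 / (4 * ?a)" by (rule quadratic_bound) (use j0 tau in simp)
      finally show ?thesis unfolding norm_exp_eq_Re by simp
    qed
    then show thesis using that by blast
  qed
  have "bounded (range h)"
    unfolding bounded_iff
  proof (intro exI ballI)
    fix y assume "y \<in> range h"
    then obtain z where y: "y = h z" by blast
    obtain m n w where z: "z = w + of_int m + of_int n * \<tau>" "norm w \<le> 1 + norm \<tau>" "\<bar>Im w\<bar> \<le> Im \<tau>" using fundamental_cell .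
    show "norm y \<le> B * M" unfolding y z(1) shift norm_mult
      by (intro mult_mono' norm_ge_zero B[OF z(3)] M[OF z(2)])
  qed
  from Liouville_theorem[OF hol this] show c: "\<exists>c. \<forall>z. h z = c" unfolding constant_on_def by blast
  assume j0: "j > 0"
  from c obtain c where c: "\<And>z. h z = c" by blast
  have "c = 0"
  proof (rule ccontr)
    assume c0: "c \<noteq> 0"
    then have e: "exp (2 * of_real pi * \<i> * of_int j * z + d) = 1" for z using tau'[of z] c by simp
    \<comment> \<open>Between z = 0 and z = 1 / (2 j) the multiplier changes its sign, which a
      nonzero constant h does not permit.\<close>
    have "exp (2 * of_real pi * \<i> * of_int j * (1 / (2 * of_int j)) + d) = exp (of_real pi * \<i>) * exp d"
      using j0 by (simp add: exp_add)
    then show False using e[of "1 / (2 * of_int j)"] e[of 0] by simp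
  qed
  then show "h z = 0" using c by simp
qed

text \<open>
  Oddness forces the multiplier of \<open>F\<close> with respect to \<open>\<tau>\<close> to be that of theta: for any other
  multiplier either \<open>F\<close> or the quotient \<open>theta / F\<close> would vanish.
\<close>
theorem proportional_to_theta:
  fixes F :: "complex \<Rightarrow> complex"
  assumes hol: "F holomorphic_on UNIV" and odd: "\<And>z. F (- z) = - F z"
    and 1: "\<And>z. F (z + 1) = - F z" and tau': "\<And>z. F (z + \<tau>) = exp (c * z + d) * F z"
    and zeros: "\<And>z. F z = 0 \<Longrightarrow> deriv F z \<noteq> 0 \<and> (\<exists>m n :: int. z = of_int m + of_int n * \<tau>)"
  obtains w where "w \<noteq> 0" "\<And>z. theta \<tau> z = w * F z"
proof -
  obtain z0 where z0: "F z0 \<noteq> 0"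
  proof (rule ccontr)
    assume "\<not> thesis"
    then have "F = (\<lambda>_. 0)" using that by blast
    then show False using zeros[of 0] by simp
  qed
  have F0: "F 0 = 0" using odd[of 0] by simp
  \<comment> \<open>The translations by 1 and \<tau> commute, so exp c = 1.\<close>
  have "exp (c * (z0 + 1) + d) * - F z0 = - (exp (c * z0 + d) * F z0)"
    using tau'[of "z0 + 1"] 1[of "z0 + \<tau>"] 1[of z0] tau'[of z0] by (simp add: add_ac)
  then have "exp c = 1" using z0 by (simp add: exp_add distrib_left)
  then obtain k :: int where "c = of_real (of_int (2 * k) * pi) * \<i>" unfolding exp_eq_1 by (auto simp: complex_eq_iff)
  then have c: "c = 2 * of_real pi * \<i> * of_int k" by simp
  \<comment> \<open>Otherwise the square of F would be constant by
    \<open>quasi_periodic_constant\<close>, hence 0 as at the origin. For k = 0 the condition on d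
    comes from applying the multiplier at z0 and, by oddness, at - z0 - \<tau>.\<close>
  have k: "k < 0"
  proof (rule ccontr)
    assume "\<not> k < 0"
    have t: "F (z + \<tau>) ^ 2 = exp (2 * of_real pi * \<i> * of_int (2 * k) * z + 2 * d) * F z ^ 2" for z
      unfolding tau' c power_mult_distrib by (simp add: exp_double[symmetric] algebra_simps)
    have "2 * k > 0 \<or> 2 * k = 0 \<and> exp (2 * d) = 1"
    proof (cases "k = 0")
      case True
      have "F z0 = exp d * F (z0 + \<tau>)"
        using tau'[of "- z0 - \<tau>"] odd[of z0] odd[of "z0 + \<tau>"] by (simp add: c True)
      then have "F z0 = exp d * (exp d * F z0)" using tau'[of z0] by (simp add: c True)
      then have "exp d * exp d = 1" using z0 by simp
      then show ?thesis using True by (simp add: exp_double power2_eq_square)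
    qed (use \<open>\<not> k < 0\<close> in simp)
    from quasi_periodic_constant(1)[of "\<lambda>z. F z ^ 2", OF _ _ t this] obtain C where "\<And>z. F z ^ 2 = C"
      using hol 1 by (auto intro: holomorphic_intros)
    then have "F z0 ^ 2 = F 0 ^ 2" by simp
    then show False using z0 F0 by simp
  qed
  have th0: "theta \<tau> 0 = 0" using theta_minus[of 0] by simp
  have "theta \<tau> (of_int m + of_int n * \<tau>) = 0" for m n
  proof -
    have "theta \<tau> (z + 1) ^ 2 = theta \<tau> z ^ 2" for z by (simp add: theta_1)
    then have "theta \<tau> (of_int n * \<tau> + of_int m) ^ 2 = theta \<tau> (of_int n * \<tau>) ^ 2"
      by (rule periodic_multiple[of "\<lambda>z. theta \<tau> z ^ 2"])
    moreover have "theta \<tau> (0 + of_int n * \<tau>) = 0"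
    proof -
      have "theta \<tau> (z + \<tau>) = exp (2 * of_real pi * \<i> * of_real (- 1) * z + (of_real pi * \<i> - of_real pi * \<i> * \<tau>)) * theta \<tau> z" for z
        unfolding theta_tau by (simp add: exp_add exp_diff exp_minus field_simps)
      from quasi_periodic_multiple[OF this, of 0 n] show ?thesis by (simp add: th0)
    qed
    ultimately show ?thesis by (simp add: add.commute)
  qed
  then obtain W where W: "W holomorphic_on UNIV" "\<And>z. theta \<tau> z = W z * F z"
    using entire_quotient[OF theta_holomorphic hol] zeros by metis
  have cancel: "A z = B z" if "A holomorphic_on UNIV" "B holomorphic_on UNIV" "\<And>z. A z * F z = B z * F z" for A B z
  proof -
    have "A z - B z = 0" by (rule entire_product_zero[of _ F z0]) (use that hol z0 in \<open>auto intro: holomorphic_intros simp: left_diff_distrib\<close>)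
    then show ?thesis by simp
  qed
  have shift: "(\<lambda>z. W (z + a)) holomorphic_on UNIV" "(\<lambda>z. W (- z)) holomorphic_on UNIV" for a
  proof -
    have "(\<lambda>z. z + a) holomorphic_on UNIV" "uminus holomorphic_on (UNIV :: complex set)" by (intro holomorphic_intros)+
    then show "(\<lambda>z. W (z + a)) holomorphic_on UNIV" "(\<lambda>z. W (- z)) holomorphic_on UNIV"
      using holomorphic_on_compose_gen[of _ UNIV W UNIV] W(1) by (auto simp: o_def)
  qed
  have W1: "W (z + 1) = W z" for z
    by (rule cancel[OF shift(1) W(1)]) (use W(2) theta_1 1 in \<open>metis minus_mult_right minus_equation_iff\<close>)
  have Wm: "W (- z) = W z" for z
    by (rule cancel[OF shift(2) W(1)]) (use W(2) theta_minus odd in \<open>metis minus_mult_right minus_equation_iff\<close>)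
  define d' where "d' = of_real pi * \<i> - of_real pi * \<i> * \<tau> - d"
  have Wt: "W (z + \<tau>) = exp (2 * of_real pi * \<i> * of_int (- 1 - k) * z + d') * W z" for z
  proof (rule cancel[OF shift(1)])
    fix z
    have "W (z + \<tau>) * (exp (c * z + d) * F z) = - exp (- (of_real pi * \<i> * \<tau>) - 2 * of_real pi * \<i> * z) * (W z * F z)"
      using W(2)[of "z + \<tau>"] theta_tau[of z] unfolding tau' W(2)[of z] by simp
    also have "- exp (- (of_real pi * \<i> * \<tau>) - 2 * of_real pi * \<i> * z) = exp (c * z + d) * exp (2 * of_real pi * \<i> * of_int (- 1 - k) * z + d')"
    proof -
      have "exp (c * z + d) * exp (2 * of_real pi * \<i> * of_int (- 1 - k) * z + d') = exp ((- (of_real pi * \<i> * \<tau>) - 2 * of_real pi * \<i> * z) + of_real pi * \<i>)"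
        unfolding mult_exp_exp c d'_def by (intro arg_cong[of _ _ exp]) (simp add: algebra_simps)
      then show ?thesis by (subst (asm) (2) exp_add) simp
    qed
    finally show "W (z + \<tau>) * F z = exp (2 * of_real pi * \<i> * of_int (- 1 - k) * z + d') * W z * F z" by simp
  qed (intro holomorphic_intros W(1))
  \<comment> \<open>W has a multiplier with j = -1 - k. Were this positive, W and with it theta
    would vanish; together with k < 0 only k = -1 is left.\<close>
  have "\<not> - 1 - k > 0"
  proof
    assume *: "- 1 - k > 0"
    then have "W z = 0" for z using quasi_periodic_constant(2)[OF W(1) W1 Wt] by blast
    then show False using theta_nonzero W(2) by auto
  qed
  then have k1: "- 1 - k = 0" using k by simp
  have Wt': "W (z + \<tau>) = exp d' * W z" for z using Wt[of z] unfolding k1 by simp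
  obtain z1 where z1: "W z1 \<noteq> 0" using theta_nonzero W(2) by auto
  have "W z1 = exp d' * W (z1 + \<tau>)" using Wt'[of "- z1 - \<tau>"] Wm[of z1] Wm[of "z1 + \<tau>"] by simp
  then have "exp d' * exp d' = 1" using Wt'[of z1] z1 by simp
  then have e2: "exp (2 * d') = 1" by (simp add: exp_double power2_eq_square)
  have "W (z + \<tau>) ^ 2 = exp (2 * of_real pi * \<i> * of_int 0 * z + 2 * d') * W z ^ 2" for z
    unfolding Wt' power_mult_distrib by (simp add: exp_double)
  from quasi_periodic_constant(1)[of "\<lambda>z. W z ^ 2", OF _ _ this] obtain C where C: "\<And>z. W z ^ 2 = C"
    using W(1) W1 e2 by (auto intro: holomorphic_intros)
  \<comment> \<open>So far only the square of W is constant; but a continuous function with finitely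
    many values on the connected plane is constant.\<close>
  have "W z \<in> {W z1, - W z1}" for z using C[of z] C[of z1] power2_eq_iff[of "W z" "W z1"] by auto
  then have "range W \<subseteq> {W z1, - W z1}" by blast
  then have "finite (range W)" by (rule finite_subset) simp
  then have "W constant_on UNIV"
    using continuous_finite_range_constant[OF connected_UNIV holomorphic_on_imp_continuous_on[OF W(1)]] by blast
  then obtain w where "\<And>z. W z = w" unfolding constant_on_def by blast
  then show thesis using that[of w] W(2) z1 by metis
qed

end

section \<open>The sigma function as a theta series\<close>

text \<open>The difference \<zeta>(u + l) - \<zeta>(u) has derivative 0 on the connected complement
  of the lattice. With H for its value, \<sigma>(u + l) exp(-H u) / \<sigma>(u) has derivative 0
  too.\<close>

lemma (in complex_curve) \<sigma>_translate:
  assumes l: "l \<in> \<Lambda>" and u0: "u0 \<notin> \<Lambda>"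
  obtains C where "C \<noteq> 0" "\<And>u. \<sigma> (u + l) = C * exp ((\<zeta> (u0 + l) - \<zeta> u0) * u) * \<sigma> u"
proof -
  define H where "H = \<zeta> (u0 + l) - \<zeta> u0"
  have ul: "u + l \<notin> \<Lambda>" if "u \<notin> \<Lambda>" for u using that l by (simp add: lattice_add_iff)
  have "((\<lambda>u. \<zeta> (u + l) - \<zeta> u) has_field_derivative 0) (at u)" if u: "u \<notin> \<Lambda>" for u
  proof -
    have "((\<lambda>u. \<zeta> (u + l)) has_field_derivative - X (u + l) * 1) (at u)"
      by (rule DERIV_chain2[where f = \<zeta> and g = "\<lambda>u. u + l"], rule \<zeta>_deriv[OF ul[OF u]]) (auto intro!: derivative_eq_intros)
    from DERIV_diff[OF this \<zeta>_deriv[OF u]] show ?thesis by (simp add: X_period l)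
  qed
  note d = this
  then have cont: "continuous_on (- \<Lambda>) (\<lambda>u. \<zeta> (u + l) - \<zeta> u)" 
    by (intro DERIV_continuous_on[of _ _ "\<lambda>_. 0"]) (auto intro: has_field_derivative_at_within)
  obtain c where c: "\<And>u. u \<in> - \<Lambda> \<Longrightarrow> \<zeta> (u + l) - \<zeta> u = c"
    by (rule DERIV_zero_connected_constant[OF connected_complement open_complement finite.emptyI cont]) (use d that in auto)
  then have z: "\<zeta> (u + l) = \<zeta> u + H" if "u \<notin> \<Lambda>" for u 
    using c[of u] c[of u0] that u0 unfolding H_def by (simp add: algebra_simps)
  define q where "q u = \<sigma> (u + l) * exp (- (H * u)) / \<sigma> u" for u
  have dq: "(q has_field_derivative 0) (at u)" if u: "u \<notin> \<Lambda>" for u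
  proof -
    have s: "\<sigma> u \<noteq> 0" "\<sigma> (u + l) \<noteq> 0" using u ul[OF u] by (auto simp: \<Lambda>_def)
    have z': "\<sigma>' (u + l) = (\<zeta> u + H) * \<sigma> (u + l)" "\<sigma>' u = \<zeta> u * \<sigma> u" using s z[OF u] unfolding \<zeta>_def by (simp_all add: field_simps)
    have "(q has_field_derivative ((\<sigma>' (u + l) * 1 * exp (- (H * u)) + exp (- (H * u)) * (- H) * \<sigma> (u + l)) * \<sigma> u - \<sigma> (u + l) * exp (- (H * u)) * (\<sigma>' u * 1)) / (\<sigma> u * \<sigma> u)) (at u)"
      unfolding q_def[abs_def] using s by (intro derivative_eq_intros refl) auto
    also have "(\<sigma>' (u + l) * 1 * exp (- (H * u)) + exp (- (H * u)) * (- H) * \<sigma> (u + l)) * \<sigma> u - \<sigma> (u + l) * exp (- (H * u)) * (\<sigma>' u * 1) = 0"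
      unfolding z' by (simp add: algebra_simps)
    finally show ?thesis by simp
  qed
  then have cont_q: "continuous_on (- \<Lambda>) q" 
    by (intro DERIV_continuous_on[of _ _ "\<lambda>_. 0"]) (auto intro: has_field_derivative_at_within)
  obtain C where C: "\<And>u. u \<in> - \<Lambda> \<Longrightarrow> q u = C"
    by (rule DERIV_zero_connected_constant[OF connected_complement open_complement finite.emptyI cont_q]) (use dq that in auto)
  have eq: "\<sigma> (u + l) = C * exp (H * u) * \<sigma> u" for u
  proof (cases "u \<in> \<Lambda>")
    case True
    then show ?thesis using lattice_add[OF l True] by (simp add: \<Lambda>_def)
  next
    case False
    have "exp (H * u) * (q u * \<sigma> u) = \<sigma> (u + l) * (exp (- (H * u)) * exp (H * u))"
      using False by (simp add: q_def \<Lambda>_def)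
    also have "exp (- (H * u)) * exp (H * u) = 1" unfolding mult_exp_exp by simp
    finally show ?thesis using C[of u] False by (simp add: mult_ac)
  qed
  moreover have "C \<noteq> 0" using eq[of u0] ul[OF u0] by (auto simp: \<Lambda>_def)
  ultimately show thesis using that unfolding H_def by blast
qed

lemma (in complex_curve) \<sigma>_expansion: "fps_expansion \<sigma> 0 = weierstrass_coeffs.sig \<mu>"
  unfolding \<sigma>_def by (rule fps_expansion_eqI) (simp add: eval_fps_has_fps_expansion entire_sig)

text \<open>Since \<sigma>(z) - z is O(z^2), a factor k other than 1 would leave the term (k - 1) z,
  which is not O(z^2).\<close>

lemma (in complex_curve) \<sigma>_normalized: "(\<lambda>z. k * \<sigma> z - z) \<in> O[at 0](\<lambda>z. z^2) \<longleftrightarrow> k = 1"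
proof -
  define G where "G = fps_shift 2 (weierstrass_coeffs.sig \<mu>)"
  have G: "fps_conv_radius G = \<infinity>" by (simp add: G_def entire_sig)
  have "weierstrass_coeffs.sig \<mu> = fps_X + fps_X ^ 2 * G"
  proof (rule fps_ext)
    fix n
    consider "n = 0" | "n = Suc 0" | m where "n = m + 2" by (metis One_nat_def Suc_1 add.commute add_2_eq_Suc' not0_implies_Suc)
    then show "weierstrass_coeffs.sig \<mu> $ n = (fps_X + fps_X ^ 2 * G) $ n"
      by cases (simp_all add: G_def weierstrass_coeffs.sig_nu_0 fps_X_power_mult_nth)
  qed
  then have s: "\<sigma> z - z = z^2 * eval_fps G z" for z
    unfolding \<sigma>_def by (simp add: eval_fps_entire entire_closed G eval_fps_entire_power)
  have one: "(\<lambda>z. \<sigma> z - z) \<in> O[at 0](\<lambda>z. z^2)"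
  proof (rule bigoI_tendsto)
    have "isCont (eval_fps G) 0" using continuous_eval_fps[of 0 G UNIV] G by simp
    then have "(eval_fps G \<longlongrightarrow> eval_fps G 0) (at 0)" by (simp add: isCont_def)
    then show "((\<lambda>z. (\<sigma> z - z) / z^2) \<longlongrightarrow> eval_fps G 0) (at 0)"
      by (rule Lim_transform_eventually) (auto simp: s eventually_at_filter)
  qed (auto simp: eventually_at_filter)
  have "k = 1" if "(\<lambda>z. k * \<sigma> z - z) \<in> O[at 0](\<lambda>z. z^2)"
  proof -
    have "(\<lambda>z. (k * \<sigma> z - z) - k * (\<sigma> z - z)) \<in> O[at 0](\<lambda>z. z^2)"
    proof (rule sum_in_bigo(2)[OF that])
      show "(\<lambda>z. k * (\<sigma> z - z)) \<in> O[at 0](\<lambda>z. z^2)" using one by (cases "k = 0") auto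
    qed
    then have "(\<lambda>z. (k - 1) * z) \<in> O[at 0](\<lambda>z. z^2)" by (simp add: algebra_simps)
    also have "(\<lambda>z :: complex. z^2) \<in> o[at 0](\<lambda>z. z)"
    proof (rule smalloI_tendsto)
      have "((\<lambda>z::complex. z) \<longlongrightarrow> 0) (at 0)" by (rule tendsto_ident_at)
      then show "((\<lambda>z::complex. z^2 / z) \<longlongrightarrow> 0) (at 0)" by (simp add: power2_eq_square)
    qed (auto simp: eventually_at_filter)
    finally have "((\<lambda>z. (k - 1) * z / z) \<longlongrightarrow> 0) (at 0)" by (rule smalloD_tendsto)
    then have "((\<lambda>z::complex. k - 1) \<longlongrightarrow> 0) (at 0)"
      by (rule Lim_transform_eventually) (auto simp: eventually_at_filter)
    then show "k = 1" by (simp add: tendsto_const_iff)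
  qed
  then show ?thesis using one by auto
qed

context curve_with_periods
begin

definition \<tau> where "\<tau> = \<omega>' / \<omega>"

lemma period_ratio: "Im \<tau> > 0" "\<omega> \<noteq> 0"
proof -
  show "Im \<tau> > 0" using basis unfolding period_basis_def \<tau>_def \<omega>_def \<omega>'_def by blast
  then show "\<omega> \<noteq> 0" by (auto simp: \<tau>_def)
qed

text \<open>Makes \<sigma> nonzero at \<omega>/2, where the multiplier for \<omega> is computed
  below. The equation 1/2 = m + n \<tau> forces n = 0 by its imaginary part and then fails in its
  real part.\<close>

lemma half_period: "\<omega> / 2 \<notin> \<Lambda>"
proof
  assume "\<omega> / 2 \<in> \<Lambda>"
  then obtain m n :: int where "\<omega> / 2 = of_int m * \<omega> + of_int n * \<omega>'" by (rule lattice_generated)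
  then have e: "1 / 2 = of_int m + of_int n * \<tau>" using period_ratio(2) by (simp add: \<tau>_def field_simps)
  have "of_int n * Im \<tau> = 0" using arg_cong[OF e, of Im] by simp
  then have "n = 0" using period_ratio(1) by simp
  then have "1 / 2 = real_of_int m" using arg_cong[OF e, of Re] by simp
  then have "real_of_int (2 * m) = real_of_int 1" by simp
  then have "2 * m = 1" by (simp only: of_int_eq_iff)
  then show False by presburger
qed

text \<open>In the coordinate z = u / \<omega> a Gaussian factor removes the multiplier of \<sigma>
  for the first period except for its sign. This factor is inverse to the exponential in
  \<open>sigma_unnormalized\<close>, which is why the period of \<eta>_1 occurs there.\<close>

theorem sigma_unnormalized_proportional:
  obtains w where "w \<noteq> 0" "\<And>u. sigma_unnormalized \<omega> \<omega>' (form_integral (eta1 \<mu>) \<alpha>) u = w * \<sigma> u"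
proof -
  define H where "H = form_integral (eta1 \<mu>) \<alpha>"
  obtain u0 where u0: "u0 \<notin> \<Lambda>" "\<phi> u0 = pathstart \<alpha>" using basepoint .
  have H: "H = \<zeta> (u0 + \<omega>) - \<zeta> u0" unfolding H_def by (rule periods(3)[OF u0])
  obtain C where C: "C \<noteq> 0" "\<And>u. \<sigma> (u + \<omega>) = C * exp (H * u) * \<sigma> u" by (rule \<sigma>_translate[OF periods(1) u0(1), folded H]) (rule that)
  have s0: "\<sigma> (\<omega> / 2) \<noteq> 0" using half_period by (simp add: \<Lambda>_def)
  \<comment> \<open>The translation formula at u = -\<omega>/2 and oddness determine the constant
    C.\<close>
  have "\<sigma> (\<omega> / 2) = - (C * exp (- (H * \<omega> / 2))) * \<sigma> (\<omega> / 2)" using C(2)[of "- \<omega> / 2"] by (simp add: \<sigma>_minus)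
  then have "C * exp (- (H * \<omega> / 2)) = - 1" using s0 by (metis mult_cancel_right2 minus_equation_iff)
  then have C': "C = - exp (H * \<omega> / 2)" by (simp add: exp_minus field_simps)
  obtain C2 where C2: "C2 \<noteq> 0" "\<And>u. \<sigma> (u + \<omega>') = C2 * exp ((\<zeta> (u0 + \<omega>') - \<zeta> u0) * u) * \<sigma> u" by (rule \<sigma>_translate[OF periods(2) u0(1)]) (rule that)
  define H' where "H' = \<zeta> (u0 + \<omega>') - \<zeta> u0"
  obtain d where d: "C2 = exp d" using C2(1) exp_Ln by metis
  define F where "F z = \<sigma> (\<omega> * z) * exp (- (H * \<omega> / 2) * z^2)" for z
  have \<omega>t: "\<omega> * \<tau> = \<omega>'" using period_ratio(2) by (simp add: \<tau>_def)
  have dF: "(F has_field_derivative (\<sigma>' (\<omega> * z) * \<omega> + \<sigma> (\<omega> * z) * (- (H * \<omega>) * z)) * exp (- (H * \<omega> / 2) * z^2)) (at z)" for z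
    unfolding F_def[abs_def] by (auto intro!: derivative_eq_intros simp: algebra_simps)
  obtain w where w: "w \<noteq> 0" "\<And>z. theta \<tau> z = w * F z"
  proof (rule proportional_to_theta[OF period_ratio(1)])
    show "F holomorphic_on UNIV" unfolding F_def by (intro holomorphic_intros)
    show "F (- z) = - F z" for z by (simp add: F_def \<sigma>_minus)
    show "F (z + 1) = - F z" for z
    proof -
      have "F (z + 1) = - \<sigma> (\<omega> * z) * (exp (H * \<omega> / 2) * exp (H * (\<omega> * z)) * exp (- (H * \<omega> / 2) * (z + 1)^2))"
        unfolding F_def distrib_left using C(2)[of "\<omega> * z"] C' by simp
      also have "exp (H * \<omega> / 2) * exp (H * (\<omega> * z)) * exp (- (H * \<omega> / 2) * (z + 1)^2) = exp (- (H * \<omega> / 2) * z^2)"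
        unfolding mult_exp_exp by (intro arg_cong[of _ _ exp]) (simp add: power2_eq_square field_simps)
      finally show ?thesis by (simp add: F_def)
    qed
    \<comment> \<open>The coefficient of z stays undetermined here; oddness fixes it in
      \<open>proportional_to_theta\<close>.\<close>
    show "F (z + \<tau>) = exp ((H' * \<omega> - H * \<omega>') * z + (d - H * \<omega>' * \<tau> / 2)) * F z" for z
    proof -
      have "F (z + \<tau>) = \<sigma> (\<omega> * z) * (exp d * exp (H' * (\<omega> * z)) * exp (- (H * \<omega> / 2) * (z + \<tau>)^2))"
        unfolding F_def distrib_left \<omega>t using C2(2)[of "\<omega> * z"] d by (simp add: H'_def)
      also have "exp d * exp (H' * (\<omega> * z)) * exp (- (H * \<omega> / 2) * (z + \<tau>)^2) = exp ((H' * \<omega> - H * \<omega>') * z + (d - H * \<omega>' * \<tau> / 2)) * exp (- (H * \<omega> / 2) * z^2)"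
        unfolding mult_exp_exp \<omega>t[symmetric] by (intro arg_cong[of _ _ exp]) (simp add: power2_eq_square field_simps)
      finally show ?thesis by (simp add: F_def)
    qed
    show "deriv F z \<noteq> 0 \<and> (\<exists>m n :: int. z = of_int m + of_int n * \<tau>)" if "F z = 0" for z
    proof -
      have zL: "\<omega> * z \<in> \<Lambda>" using that by (simp add: F_def \<Lambda>_def)
      then obtain m n :: int where "\<omega> * z = of_int m * \<omega> + of_int n * \<omega>'" by (rule lattice_generated)
      then have "\<omega> * z = \<omega> * (of_int m + of_int n * \<tau>)" unfolding \<omega>t[symmetric] by (simp add: algebra_simps)
      then have "z = of_int m + of_int n * \<tau>" using period_ratio(2) by simp
      moreover have "deriv F z \<noteq> 0"
        unfolding DERIV_imp_deriv[OF dF] using \<sigma>'_nonzero[OF zL] zL period_ratio(2) by (simp add: \<Lambda>_def)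
      ultimately show ?thesis by blast
    qed
  qed blast
  have "sigma_unnormalized \<omega> \<omega>' H u = w * \<sigma> u" for u
  proof -
    have "sigma_unnormalized \<omega> \<omega>' H u = exp (u^2 * H / \<omega> / 2) * theta \<tau> (u / \<omega>)"
      by (simp add: sigma_unnormalized_def theta_def theta_term_def \<tau>_def)
    also have "\<dots> = w * \<sigma> u * (exp (u^2 * H / \<omega> / 2) * exp (- (H * \<omega> / 2) * (u / \<omega>)^2))"
      using period_ratio(2) by (simp add: w(2) F_def)
    also have "exp (u^2 * H / \<omega> / 2) * exp (- (H * \<omega> / 2) * (u / \<omega>)^2) = 1"
      unfolding mult_exp_exp using period_ratio(2) by (simp add: power2_eq_square field_simps)
    finally show ?thesis by simp
  qed
  then show thesis using that[OF w(1)] unfolding H_def by blast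
qed

theorem sigma_eq: "sigma \<mu> \<alpha> \<beta> = \<sigma>"
proof
  fix u
  obtain w where w: "w \<noteq> 0" "\<And>u. sigma_unnormalized \<omega> \<omega>' (form_integral (eta1 \<mu>) \<alpha>) u = w * \<sigma> u"
    by (rule sigma_unnormalized_proportional) (rule that)
  have "(THE c. c \<noteq> 0 \<and> (\<lambda>z. c * (w * \<sigma> z) - z) \<in> O[at 0](\<lambda>z. z^2)) = 1 / w"
  proof (rule the_equality)
    show "1 / w \<noteq> 0 \<and> (\<lambda>z. 1 / w * (w * \<sigma> z) - z) \<in> O[at 0](\<lambda>z. z^2)"
      using w(1) \<sigma>_normalized[of 1] by simp
    fix c assume "c \<noteq> 0 \<and> (\<lambda>z. c * (w * \<sigma> z) - z) \<in> O[at 0](\<lambda>z. z^2)"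
    then have "c * w = 1" using \<sigma>_normalized[of "c * w"] by (simp add: mult.assoc)
    then show "c = 1 / w" using w(1) by (simp add: field_simps)
  qed
  then show "sigma \<mu> \<alpha> \<beta> u = \<sigma> u"
    unfolding sigma_def Let_def \<omega>_def[symmetric] \<omega>'_def[symmetric] w(2) using w(1) by simp
qed

end

section \<open>Taylor series of the normalized theta quotient, and the formulas over the
  indeterminates\<close>

theorem sigma_expansion:
  assumes "nonsingular \<mu>" "period_basis \<mu> \<alpha> \<beta>"
  shows "fps_expansion (sigma \<mu> \<alpha> \<beta>) 0 = weierstrass_coeffs.sig \<mu>"
proof -
  interpret curve_with_periods \<mu> \<alpha> \<beta> by standard (use assms in auto)
  show ?thesis unfolding sigma_eq by (rule \<sigma>_expansion)
qed

theorem theorem3p17: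
  shows "let
      m = (\<lambda>j. fls_const (mu j));
      M = (\<lambda>j. const2 (mu j));
      t = fls_X;
      p12 = p_ser mu at1 at2;
      p21 = p_ser mu at2 at1;
      q = q_ser mu;
      r = r_ser mu
    in
      p12 - (1 + M 1 * t1 + M 2 * t2^2 + (M 2 + M 1 ^ 2) * t1^2) \<in> terms_from2 3
    \<and> p12 \<in> {1 + t1 * f + t2 * g |f g. f \<in> power_series2 Z_mu \<and> g \<in> power_series2 Z_mu}
    \<and> q - (1 - m 2 * t^2 - m 2 * m 1 * t^3 - (m 2 * m 1 ^ 2 + m 4) * t^4
            - (m 2 * m 1 ^ 3 + 2 * m 4 * m 1 + m 2 * m 3) * t^5) \<in> terms_from1 6
    \<and> q \<in> {1 + t * f |f. f \<in> power_series1 Z_mu}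
    \<and> r - (1 - (1/12 * M 1 * M 3 + 1/6 * M 4) * (t1 - t2)^4
            - (1/6 * M 1 ^ 2 * M 3 + 1/3 * M 4 * M 1) * (t1 - t2)^4 * (t1 + t2)
            + (- (1/30 * M 3 ^ 2 + (43/180 * M 1 ^ 3 + 11/90 * M 2 * M 1) * M 3
                   + 43/90 * M 4 * M 1 ^ 2 + 11/45 * M 2 * M 4 + 2/15 * M 6) * (t1^4 + t2^4)
               + (2/15 * M 3 ^ 2 + (11/90 * M 1 ^ 3 + 7/45 * M 2 * M 1) * M 3
                   + 11/45 * M 4 * M 1 ^ 2 + 14/45 * M 2 * M 4 + 8/15 * M 6) * t1 * t2 * (t1^2 + t2^2)
               + (- 1/5 * M 3 ^ 2 + (7/30 * M 1 ^ 3 - 1/15 * M 2 * M 1) * M 3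
                   + 7/15 * M 4 * M 1 ^ 2 - 2/15 * M 2 * M 4 + 1/5 * M 6) * t1^2 * t2^2)
              * (t1 - t2)^2) \<in> terms_from2 7
    \<and> r \<in> {1 + (t1 - t2)^2 * (t1^2 * f + t1 * t2 * g + t2^2 * h) |f g h.
              f \<in> power_series2 Q_mu \<and> g \<in> power_series2 Q_mu \<and> h \<in> power_series2 Q_mu}
    \<and> r \<in> hurwitz_series2 Z_mu
    \<and> fps_to_fls (t_ser mu) - t \<in> terms_from1 2
    \<and> fps_to_fls (t_ser mu) \<in> hurwitz_series1 Z_mu
    \<and> (\<exists>S. sigma_taylor_polys S \<and>
         (let \<sigma> = Abs_fps (\<lambda>n. to_fract (S n));
              U1 = at1 (fps_to_fls (u_ser mu));
              U2 = at2 (fps_to_fls (u_ser mu));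
              u = t1;
              v = t2
          in
            compose2 \<sigma> (U1 - U2) ^ 2 = (t2 - t1)^2 * at1 q * at2 q * p12 * p21 * r
          \<and> compose2 \<sigma> (u - v) ^ 2 \<in> {(u - v)^2 * (1 + u * f + v * g) |f g.
                f \<in> power_series2 Q_mu \<and> g \<in> power_series2 Q_mu}
          \<and> compose2 \<sigma> (u - v) ^ 2 \<in> hurwitz_series2 Z_mu))"
proof -
  interpret weierstrass_coeffs mu .
  \<comment> \<open>One family of polynomials gives \<open>sig\<close> over the indeterminates and,
    by evaluation, the Taylor coefficients on every complex curve.\<close>
  from sigma_polys_exist obtain S where S: "\<And>n. S n \<in> mupolys" "\<And>n. to_fract (S n) = sig $ n" 
    "\<And>n \<mu>. mupoly_eval \<mu> (S n) = weierstrass_coeffs.sig \<mu> $ n" by blast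
  have taylor: "sigma_taylor_polys S"
    unfolding sigma_taylor_polys_def using S sigma_expansion by (simp add: fps_eq_iff)
  have S': "Abs_fps (\<lambda>n. to_fract (S n)) = sig" by (simp add: S fps_eq_iff)
  note ring = is_subring_Z_mu mu_in_Z_mu
  note q_ring = is_subring_Q_mu mu_in_Q_mu divide_in_Q_mu
  let ?m = "\<lambda>j. fls_const (mu j)" and ?M = "\<lambda>j. const2 (mu j)"
  have "p_ser mu at1 at2 - (1 + ?M 1 * t1 + ?M 2 * t2^2 + (?M 2 + ?M 1 ^ 2) * t1^2) \<in> terms_from2 3"
    using P12_expansion unfolding p12_ser_eq const2_to_fls2 t1_to_fls2 t2_to_fls2 to_fls2_simps[symmetric] terms_from2_iff .
  moreover have "p_ser mu at1 at2 \<in> {1 + t1 * f + t2 * g |f g. f \<in> power_series2 Z_mu \<and> g \<in> power_series2 Z_mu}"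
  proof -
    from coeffs2_in_split[OF ring(1) P12_coeffs2_in[OF ring] P12_0] obtain f g where
      fg: "P12 = 1 + X1 * f + X2 * g" "f \<in> coeffs2_in Z_mu" "g \<in> coeffs2_in Z_mu" by blast
    then show ?thesis
      unfolding p12_ser_eq fg(1) t1_to_fls2 t2_to_fls2 to_fls2_simps using fg(2,3) by (fastforce simp: power_series2_iff)
  qed
  moreover have "q_ser mu - (1 - ?m 2 * fls_X^2 - ?m 2 * ?m 1 * fls_X^3 - (?m 2 * ?m 1 ^ 2 + ?m 4) * fls_X^4
            - (?m 2 * ?m 1 ^ 3 + 2 * ?m 4 * ?m 1 + ?m 2 * ?m 3) * fls_X^5) \<in> terms_from1 6" (is "?q \<in> _")
  proof -
    have "?q = fl (inverse a - (1 - m 2 * fps_X^2 - m 2 * m 1 * fps_X^3 - (m 2 * m 1 ^ 2 + m 4) * fps_X^4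
            - (m 2 * m 1 ^ 3 + 2 * m 4 * m 1 + m 2 * m 3) * fps_X^5))"
      by (simp only: q_ser_eq fl_simps fps_const_to_fls fps_X_to_fls)
    then show ?thesis using q_expansion by (simp only: terms_from1_iff) blast
  qed
  moreover have "q_ser mu \<in> {1 + fls_X * f |f. f \<in> power_series1 Z_mu}"
  proof -
    have "inverse a = 1 + fps_X * fps_shift 1 (inverse a)" by (rule fps_ext) (simp add: a_0 fps_X_mult_nth)
    then have "q_ser mu = fl (1 + fps_X * fps_shift 1 (inverse a))" unfolding q_ser_eq by simp
    also have "\<dots> = 1 + fls_X * fl (fps_shift 1 (inverse a))" by (simp only: fl_simps fps_X_to_fls)
    finally have q: "q_ser mu = 1 + fls_X * fl (fps_shift 1 (inverse a))" .
    have "fps_shift 1 (inverse a) \<in> coeffs_in Z_mu" using coeffs_in_all(2)[OF ring] by (simp add: coeffs_in_def)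
    then show ?thesis unfolding q by (auto simp: power_series1_iff)
  qed
  moreover note r_expansion
  moreover have "r_ser mu \<in> {1 + (t1 - t2)^2 * (t1^2 * f + t1 * t2 * g + t2^2 * h) |f g h.
      f \<in> power_series2 Q_mu \<and> g \<in> power_series2 Q_mu \<and> h \<in> power_series2 Q_mu}"
  proof -
    from r2_split[OF q_ring r2_vanishes] obtain f g h where 
      fgh: "r2 = 1 + (X1 - X2)^2 * (X1^2 * f + X1 * X2 * g + X2^2 * h)" "f \<in> coeffs2_in Q_mu" "g \<in> coeffs2_in Q_mu" "h \<in> coeffs2_in Q_mu"
      by blast
    have "r_ser mu = to_fls2 r2" by (simp add: r_ser_eq r2_def)
    then show ?thesis
      unfolding fgh(1) t1_to_fls2 t2_to_fls2 to_fls2_simps using fgh(2,3,4) by (fastforce simp: power_series2_iff)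
  qed
  moreover have "r_ser mu \<in> hurwitz_series2 Z_mu"
    using r_hurwitz[OF ring] by (simp add: r_ser_eq hurwitz_series2_iff)
  moreover have "fps_to_fls (t_ser mu) - fls_X \<in> terms_from1 2"
  proof -
    have "fps_to_fls (t_ser mu) - fls_X = fl (tau - fps_X)" by (simp only: t_ser_eq fl_simps fps_X_to_fls)
    moreover have "\<forall>n<2. (tau - fps_X) $ n = 0" using tau_low by (auto simp: less_2_cases_iff)
    ultimately show ?thesis by (simp only: terms_from1_iff)
  qed
  moreover have "fps_to_fls (t_ser mu) \<in> hurwitz_series1 Z_mu"
    unfolding hurwitz_series1_def series1_def
  proof (intro CollectI exI conjI allI)
    show "fl (t_ser mu) = fl (Abs_fps (\<lambda>n. tau $ n * fact n / fact n))" by (simp add: t_ser_eq fps_nth_inverse)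
    show "tau $ n * fact n \<in> Z_mu" for n by (rule tau_hurwitz[OF ring])
  qed
  moreover have "compose2 sig (at1 (fps_to_fls (u_ser mu)) - at2 (fps_to_fls (u_ser mu))) ^ 2 =
      (t2 - t1)^2 * at1 (q_ser mu) * at2 (q_ser mu) * p_ser mu at1 at2 * p_ser mu at2 at1 * r_ser mu"
    unfolding u_ser_eq q_ser_eq at1_fps_to_fls at2_fps_to_fls p12_ser_eq p21_ser_eq r_ser_eq t1_to_fls2 t2_to_fls2
      to_fls2_simps[symmetric] compose2_to_fls2[OF vanishes_U(4)] product_formula r2_def ..
  moreover have c: "compose2 sig (t1 - t2) ^ 2 = to_fls2 ((comp1 sig (X1 - X2))^2)"
    unfolding t1_to_fls2 t2_to_fls2 to_fls2_simps[symmetric] 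
    by (subst compose2_to_fls2) (simp_all add: vanishes_diff vanishes_X to_fls2_simps)
  moreover have "compose2 sig (t1 - t2) ^ 2 \<in> {(t1 - t2)^2 * (1 + t1 * f + t2 * g) |f g.
                f \<in> power_series2 Q_mu \<and> g \<in> power_series2 Q_mu}"
  proof -
    from sig_X12_split[OF q_ring] obtain f g where 
      fg: "(comp1 sig (X1 - X2))^2 = (X1 - X2)^2 * (1 + X1 * f + X2 * g)" "f \<in> coeffs2_in Q_mu" "g \<in> coeffs2_in Q_mu" by blast
    show ?thesis unfolding c fg(1) unfolding t1_to_fls2 t2_to_fls2 to_fls2_simps using fg(2,3) by (fastforce simp: power_series2_iff)
  qed
  moreover have "compose2 sig (t1 - t2) ^ 2 \<in> hurwitz_series2 Z_mu"
    unfolding c hurwitz_series2_iff by (rule sig_X12_hurwitz[OF ring])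
  ultimately show ?thesis
    unfolding Let_def using taylor S' by (intro conjI exI[of _ S]) simp_all
qed

end
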